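(* Let $(\Omega,\mathcal F,\mathbb P)$ be a probability space and let $\mathcal W=(\mathcal W_1,\mathcal W_2,\mathcal W_3)$ be a 3D white noise on $\mathbb T^2$ such that $\mathcal W_3$ has zero mean over $\mathbb T^2$. For $\varepsilon>0$ let $\mathcal W_k^\varepsilon=\rho_\varepsilon*\mathcal W_k$, $k=1,2,3$, where $\rho_\varepsilon$ is the standard mollifier. Let $\kappa\in(0,\tfrac12)$. Then for every $\delta>0$ there exist a number $\sigma_0>0$ and a set $\Omega_\delta\subset\Omega$ (depending also on $\kappa$) with $\mathbb P(\Omega_\delta)>1-\delta$ such that for every $\gamma=(\gamma_1,\gamma_2,\gamma_3)\in\mathbb R^3$ with $|\gamma|<\sigma_0$ and every $\varepsilon>0$, the system $$\begin{cases}\partial_{\bar z} r_1^\varepsilon = r_2^\varepsilon\overline{r_3^\varepsilon}-\overline{r_2^\varepsilon}\,r_3^\varepsilon+ i\gamma_1\mathcal W_1^\varepsilon,\\ \partial_{\bar z} r_2^\varepsilon=\overline{r_1^\varepsilon}\,r_3^\varepsilon-r_1^\varepsilon\overline{r_3^\varepsilon}+ i\gamma_2\mathcal W_2^\varepsilon,\\ \partial_{\bar z} r_3^\varepsilon=r_1^\varepsilon\overline{r_2^\varepsilon}-\overline{r_1^\varepsilon}\,r_2^\varepsilon+ i\gamma_3\mathcal W_3^\varepsilon,\end{cases}$$ considered for $\omega\in\Omega_\delta$, has a (classical) solution $r^\varepsilon=(r_1^\varepsilon,r_2^\varepsilon,r_3^\varepsilon)\in C^\infty(\mathbb T^2,\mathbb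 C^3)$ such that the limit $r:=\lim_{\varepsilon\to0}r^\varepsilon$ exists in $C^{-\kappa}(\mathbb T^2)$ for every $\omega\in\Omega_\delta$. Moreover, there is a constant $C>0$, independent of $\varepsilon$ and of $\omega\in\Omega_\delta$, such that $$\|r^\varepsilon-r\|_{C^{-\kappa}(\mathbb T^2)}\le C\,\varepsilon^{\kappa/8}\qquad\text{for all }\omega\in\Omega_\delta.$$
   Context: $\mathbb T^2=[-\pi,\pi]^2$ with opposite faces identified; $\partial_{\bar z}=\frac12(\partial_x+i\partial_y)$. White noise: a 3D white noise on $\mathbb T^2$ is a Gaussian random field $\mathcal W=(\mathcal W_1,\mathcal W_2,\mathcal W_3)$ with $\mathcal W_j=\eta_j+\mathrm{Re}\big[\sum_{k\in\mathbb Z^2\setminus\{0\}}\eta_{kj}e^{i(k,x)}\big]$, $j=1,2,3$, the series converging in $\mathcal D'(\mathbb T^2)$, where $\eta_j$ are standard i.i.d. real Gaussian random variables and $\eta_{kj}$ are standard i.i.d. complex Gaussian random variables. "$\mathcal W_j$ has zero mean over $\mathbb T^2$" means that in this representation $\eta_j=0$ (the constant term is absent). Mollifier: $\rho_\varepsilon(x)=\varepsilon^{-2}\rho(x/\varepsilon)$ with $\rho$ the standard mollifier; $*$ is convolution on $\mathbb T^2$. Space $C^{-\kappa}(\mathbb T^2)$, $\kappa\in(0,\frac12)$ (applied componentwise for $\mathbb C^3$-valued distributions): distributions $f\in\mathcal D'(\mathbb T^2)$ with finite norm $\sup\{\lambda^{\kappa}|f(\varphi^\lambda_x)|:\ x\in\mathbb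 T^2,\ \lambda\in(0,1],\ \varphi\in C_c^\infty(B_1(0)),\ \|\partial^k\varphi\|_\infty\le1 \text{ for } |k|\le1\}$, where $B_1(0)\subset\mathbb R^2$ is the open unit ball and $\varphi_x^\lambda(y)=\lambda^{-2}\varphi((y-x)/\lambda)$, extended $2\pi$-periodically. *)

theory Defs
  imports "HOL-Probability.Probability"
begin

text \<open>Functions on the torus are functions on the plane which are \<open>2\<pi>\<close>-periodic in both
  coordinates; integrals over the torus are Lebesgue integrals over the fundamental cell.\<close>

type_synonym plane = "real \<times> real"

definition cell :: "plane set" where
  "cell = cbox (- pi, - pi) (pi, pi)"

definition lattice_pt :: "int \<times> int \<Rightarrow> plane" where
  "lattice_pt m = (of_int (fst m), of_int (snd m))"

definition periodic :: "(plane \<Rightarrow> 'b) \<Rightarrow> bool" where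
  "periodic f \<longleftrightarrow> (\<forall>m x. f (x + (2 * pi) *\<^sub>R lattice_pt m) = f x)"

text \<open>Only applied to functions of bounded support, for which the sum has finitely many
  nonzero terms.\<close>

definition periodize :: "(plane \<Rightarrow> complex) \<Rightarrow> plane \<Rightarrow> complex" where
  "periodize f x = (\<Sum>\<^sub>\<infinity>m\<in>UNIV. f (x + (2 * pi) *\<^sub>R lattice_pt m))"

definition pderiv1 :: "(plane \<Rightarrow> 'b::real_normed_vector) \<Rightarrow> plane \<Rightarrow> 'b" where
  "pderiv1 f x = frechet_derivative f (at x) (1, 0)"

definition pderiv2 :: "(plane \<Rightarrow> 'b::real_normed_vector) \<Rightarrow> plane \<Rightarrow> 'b" where
  "pderiv2 f x = frechet_derivative f (at x) (0, 1)"

definition dbar :: "(plane \<Rightarrow> complex) \<Rightarrow> plane \<Rightarrow> complex" where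
  "dbar f x = (1 / 2) * (pderiv1 f x + \<i> * pderiv2 f x)"

primrec Ck :: "nat \<Rightarrow> (plane \<Rightarrow> 'b::real_normed_vector) \<Rightarrow> bool" where
  "Ck 0 f \<longleftrightarrow> continuous_on UNIV f"
| "Ck (Suc n) f \<longleftrightarrow> f differentiable_on UNIV \<and> Ck n (pderiv1 f) \<and> Ck n (pderiv2 f)"

definition smooth :: "(plane \<Rightarrow> 'b::real_normed_vector) \<Rightarrow> bool" where
  "smooth f \<longleftrightarrow> (\<forall>n. Ck n f)"

definition smooth_torus :: "(plane \<Rightarrow> 'b::real_normed_vector) set" where
  "smooth_torus = {f. smooth f \<and> periodic f}"

text \<open>A distribution on the torus is represented by a functional of which only the values on
  smooth periodic functions matter; continuity is expressed by the usual seminorm estimate.\<close>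

type_synonym functional = "(plane \<Rightarrow> complex) \<Rightarrow> complex"

definition distribution :: "functional \<Rightarrow> bool" where
  "distribution u \<longleftrightarrow>
     (\<forall>\<phi>\<in>smooth_torus. \<forall>\<psi>\<in>smooth_torus. u (\<lambda>x. \<phi> x + \<psi> x) = u \<phi> + u \<psi>) \<and>
     (\<forall>c. \<forall>\<phi>\<in>smooth_torus. u (\<lambda>x. c * \<phi> x) = c * u \<phi>) \<and>
     (\<exists>C N. \<forall>\<phi>\<in>smooth_torus. \<forall>B.
        (\<forall>m n x. m + n \<le> N \<longrightarrow> cmod ((pderiv1 ^^ m) ((pderiv2 ^^ n) \<phi>) x) \<le> B)
          \<longrightarrow> cmod (u \<phi>) \<le> C * B)"

definition of_fun :: "(plane \<Rightarrow> complex) \<Rightarrow> functional" where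
  "of_fun f \<phi> = (LINT x:cell|lborel. f x * \<phi> x)"

definition bump :: "plane \<Rightarrow> real" where
  "bump x = (if norm x < 1 then exp (- 1 / (1 - (norm x)\<^sup>2)) else 0)"

definition std_mollifier :: "plane \<Rightarrow> real" where
  "std_mollifier x = bump x / (LINT y|lborel. bump y)"

text \<open>The convolution on the torus of a distribution with the periodization of
  \<open>\<rho>\<^sub>\<epsilon>(y) = \<epsilon>\<^sup>-\<^sup>2 \<rho>(y/\<epsilon>)\<close>.\<close>

definition mollify :: "real \<Rightarrow> functional \<Rightarrow> plane \<Rightarrow> complex" where
  "mollify \<epsilon> u x =
     u (periodize (\<lambda>y. complex_of_real (std_mollifier ((1 / \<epsilon>) *\<^sub>R (x - y)) / \<epsilon>\<^sup>2)))"

definition unit_tests :: "(plane \<Rightarrow> complex) set" where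
  "unit_tests = {\<phi>. smooth \<phi> \<and> closure {x. \<phi> x \<noteq> 0} \<subseteq> ball 0 1 \<and>
     (\<forall>x. cmod (\<phi> x) \<le> 1 \<and> cmod (pderiv1 \<phi> x) \<le> 1 \<and> cmod (pderiv2 \<phi> x) \<le> 1)}"

definition rescale :: "real \<Rightarrow> plane \<Rightarrow> (plane \<Rightarrow> complex) \<Rightarrow> plane \<Rightarrow> complex" where
  "rescale l x \<phi> y = \<phi> ((1 / l) *\<^sub>R (y - x)) / complex_of_real (l\<^sup>2)"

text \<open>The norm of \<open>C\<^sup>-\<^sup>\<kappa>\<close>, with value \<open>\<infinity>\<close> where the supremum is infinite.\<close>

definition neg_norm :: "real \<Rightarrow> functional \<Rightarrow> ennreal" where
  "neg_norm \<kappa> u = Sup {ennreal (l powr \<kappa> * cmod (u (periodize (rescale l x \<phi>)))) | x l \<phi>.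
     x \<in> cell \<and> 0 < l \<and> l \<le> 1 \<and> \<phi> \<in> unit_tests}"

definition neg_norm3 :: "real \<Rightarrow> (3 \<Rightarrow> functional) \<Rightarrow> ennreal" where
  "neg_norm3 \<kappa> u = (SUP j. neg_norm \<kappa> (u j))"

definition neg_space3 :: "real \<Rightarrow> (3 \<Rightarrow> functional) set" where
  "neg_space3 \<kappa> = {u. (\<forall>j. distribution (u j)) \<and> neg_norm3 \<kappa> u < \<infinity>}"

definition diff3 :: "(plane \<Rightarrow> complex ^ 3) \<Rightarrow> (3 \<Rightarrow> functional) \<Rightarrow> 3 \<Rightarrow> functional" where
  "diff3 f u j \<phi> = of_fun (\<lambda>x. f x $ j) \<phi> - u j \<phi>"

text \<open>Circularly symmetric, normalised by \<open>E |X|\<^sup>2 = 1\<close>.\<close>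

definition std_complex_gaussian :: "'a measure \<Rightarrow> ('a \<Rightarrow> complex) \<Rightarrow> bool" where
  "std_complex_gaussian M X \<longleftrightarrow>
     distributed M lborel (\<lambda>\<omega>. Re (X \<omega>)) (normal_density 0 (sqrt (1 / 2))) \<and>
     distributed M lborel (\<lambda>\<omega>. Im (X \<omega>)) (normal_density 0 (sqrt (1 / 2))) \<and>
     prob_space.indep_var M borel (\<lambda>\<omega>. Re (X \<omega>)) borel (\<lambda>\<omega>. Im (X \<omega>))"

text \<open>\<open>white_noise M Z W\<close>: \<open>W\<close> is a 3D white noise whose components with index in \<open>Z\<close> have
  zero mean over the torus. The coefficients \<open>c j\<close> (\<open>j \<notin> Z\<close>) and \<open>\<eta> k j\<close> (\<open>k \<noteq> 0\<close>) are
  independent as one family, in which \<open>c j\<close> occupies the index \<open>(0, j)\<close>. The series converges in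
  the (weak) topology of distributions, i.e. when tested against each test function.\<close>

definition white_noise :: "'a measure \<Rightarrow> 3 set \<Rightarrow> (3 \<Rightarrow> 'a \<Rightarrow> functional) \<Rightarrow> bool" where
  "white_noise M Z W \<longleftrightarrow> (\<exists>(c :: 3 \<Rightarrow> 'a \<Rightarrow> real) (\<eta> :: int \<times> int \<Rightarrow> 3 \<Rightarrow> 'a \<Rightarrow> complex).
     (\<forall>j. j \<notin> Z \<longrightarrow> distributed M lborel (c j) std_normal_density) \<and>
     (\<forall>j\<in>Z. \<forall>\<omega>. c j \<omega> = 0) \<and>
     (\<forall>k j. k \<noteq> 0 \<longrightarrow> std_complex_gaussian M (\<eta> k j)) \<and>
     prob_space.indep_vars M (\<lambda>_. borel)
       (\<lambda>(k, j) \<omega>. if k = 0 then complex_of_real (c j \<omega>) else \<eta> k j \<omega>)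
       {(k, j). k = 0 \<longrightarrow> j \<notin> Z} \<and>
     (AE \<omega> in M. \<forall>j. distribution (W j \<omega>) \<and>
       (\<forall>\<phi>\<in>smooth_torus.
          ((\<lambda>k. of_fun (\<lambda>x. complex_of_real (Re (\<eta> k j \<omega> * exp (\<i> * (lattice_pt k \<bullet> x))))) \<phi>)
             has_sum (W j \<omega> \<phi> - of_fun (\<lambda>x. complex_of_real (c j \<omega>)) \<phi>)) (UNIV - {0}))))"

definition solves_system ::
  "real ^ 3 \<Rightarrow> (3 \<Rightarrow> plane \<Rightarrow> complex) \<Rightarrow> (plane \<Rightarrow> complex ^ 3) \<Rightarrow> bool" where
  "solves_system \<gamma> F r \<longleftrightarrow> (\<forall>x.
     dbar (\<lambda>y. r y $ 1) x = r x $ 2 * cnj (r x $ 3) - cnj (r x $ 2) * r x $ 3 + \<i> * \<gamma> $ 1 * F 1 x \<and>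
     dbar (\<lambda>y. r y $ 2) x = cnj (r x $ 1) * r x $ 3 - r x $ 1 * cnj (r x $ 3) + \<i> * \<gamma> $ 2 * F 2 x \<and>
     dbar (\<lambda>y. r y $ 3) x = r x $ 1 * cnj (r x $ 2) - cnj (r x $ 1) * r x $ 2 + \<i> * \<gamma> $ 3 * F 3 x)"

end

theory Submission
  imports Defs
begin

text \<open>Write \<open>r\<^sub>j = c\<^sub>j + \<partial>\<^sub>2\<psi>\<^sub>j + \<i> \<partial>\<^sub>1\<psi>\<^sub>j\<close> with real stream functions \<open>\<psi>\<^sub>j\<close> and constants \<open>c\<^sub>j\<close>, so that
  \<open>dbar r\<^sub>j = (\<i>/2) \<Delta>\<psi>\<^sub>j\<close>. The cross product of \<open>Re c\<close> and \<open>Im c\<close> absorbs the mean of the noise, which is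
  possible because \<open>W\<^sub>3\<close> has mean zero, and the system becomes
  \<open>\<Delta>\<psi>\<^sub>j = 2 \<gamma>\<^sub>j W\<^sub>j - 4 (\<partial>\<^sub>2\<psi>\<^sub>k \<partial>\<^sub>1\<psi>\<^sub>l - \<partial>\<^sub>1\<psi>\<^sub>k \<partial>\<^sub>2\<psi>\<^sub>l + first order terms)\<close> for cyclic \<open>(j, k, l)\<close>.

  The solution \<open>\<Psi>\<close> of the linear equation just fails to be Lipschitz, but the quadratic term is a
  Jacobian, and this null structure gains the missing regularity: \<open>\<psi> = \<Psi> + \<theta>\<close> with \<open>\<theta>\<close> in the
  Sobolev space \<open>H\<^sup>2\<^sup>-\<^sup>s\<close> is found by a contraction, for small \<open>\<gamma>\<close>, uniformly in the mollification and
  with Lipschitz dependence on \<open>\<Psi>\<close>. Almost surely the dyadic blocks of \<open>\<Psi>\<close> are bounded by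
  multiples of \<open>2\<^sup>n\<^sup>(\<^sup>a\<^sup>-\<^sup>1\<^sup>)\<close> (exponential moments on a grid), the mollification error costs a factor
  \<open>\<epsilon>\<^sup>\<theta>\<close>, and pairing such blocks with a test function at scale \<open>l\<close> costs \<open>l\<^sup>-\<^sup>\<kappa>\<close>. With
  \<open>a = \<theta> = \<kappa>/8\<close> and \<open>s = 3\<kappa>/4 < \<kappa>\<close> this yields the rate.\<close>

section \<open>Calculus on the torus\<close>

text \<open>The obstacle is that a product of two gradients of regularity slightly below zero has no
  meaning in general, so no equation is solved for the limit itself. The sum \<open>jac\<close> is
  only formed for sequences with square summable gradients, which mollified data have, while every
  estimate uses the bounds \<open>besov\<close> and \<open>sobolev (2 - s)\<close> that survive
  \<epsilon> \<rightarrow> 0. Hence a quantitative hypothesis often runs beside a bare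
  \<open>sobolev 1 f D\<close>; in \<open>decomp\<close> and in the fixed point lemmas this
  \<open>D\<close> guarantees convergence and enters no bound. The limit then comes from a Cauchy
  estimate in \<epsilon>. The exponents are forced as follows. The gradient blocks of the linear
  solution grow like \<open>2 ^ n\<close> to the power a > 0, and measuring the mollification error
  costs \<theta>, so b = a + \<theta>. Two rough factors need 2 * b < s, two remainders need s <
  1/2, and pairing with test functions needs s < \<kappa>. Randomness enters only through one
  integer bounding the noise, fixed before \<gamma> and \<epsilon>; from there on the argument is
  deterministic.\<close>

definition kx :: "int \<times> int \<Rightarrow> real" where "kx k = of_int (fst k)"
definition ky :: "int \<times> int \<Rightarrow> real" where "ky k = of_int (snd k)"

type_synonym coeffs = "int \<times> int \<Rightarrow> complex"

definition fexp :: "int \<times> int \<Rightarrow> plane \<Rightarrow> complex" where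
  "fexp k x = exp (\<i> * complex_of_real (lattice_pt k \<bullet> x))"

lemma cell_measurable [measurable]: "cell \<in> sets borel"
  by (simp add: cell_def)

lemma measure_cell: "measure lborel cell = 4 * pi\<^sup>2"
proof -
  have "measure lborel cell = (\<Prod>b\<in>Basis. ((pi, pi) - (- pi, - pi)) \<bullet> b)"
    unfolding cell_def by (subst measure_lborel_cbox) (auto simp: Basis_prod_def)
  also have "\<dots> = 4 * pi\<^sup>2"
    by (simp add: Basis_prod_def power2_eq_square)
  finally show ?thesis .
qed

lemma emeasure_cell_finite: "emeasure lborel cell < \<infinity>"
  unfolding cell_def by (rule emeasure_lborel_cbox_finite)

lemma set_integrable_cell:
  fixes f :: "plane \<Rightarrow> 'b::{banach, second_countable_topology}"
  assumes "continuous_on UNIV f"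
  shows "set_integrable lborel cell f"
  unfolding set_integrable_def cell_def
  by (rule borel_integrable_compact) (auto intro: continuous_on_subset[OF assms])

lemma cell_integral_iterated:
  fixes f :: "plane \<Rightarrow> complex"
  assumes "continuous_on UNIV f"
  shows "(LINT x:cell|lborel. f x) = integral {-pi..pi} (\<lambda>x. integral {-pi..pi} (\<lambda>y. f (x, y)))"
    and "(LINT x:cell|lborel. f x) = integral {-pi..pi} (\<lambda>y. integral {-pi..pi} (\<lambda>x. f (x, y)))"
proof -
  have c: "continuous_on S f" for S using assms continuous_on_subset by blast
  have 1: "(LINT x:cell|lborel. f x) = integral cell f"
    by (rule set_borel_integral_eq_integral(2)[OF set_integrable_cell[OF assms]])
  also have "\<dots> = integral {-pi..pi} (\<lambda>x. integral {-pi..pi} (\<lambda>y. f (x, y)))"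
    unfolding cell_def using integral_prod_continuous[OF c, of "-pi" "-pi" pi pi] by simp
  finally show 2: "(LINT x:cell|lborel. f x) = integral {-pi..pi} (\<lambda>x. integral {-pi..pi} (\<lambda>y. f (x, y)))" .
  show "(LINT x:cell|lborel. f x) = integral {-pi..pi} (\<lambda>y. integral {-pi..pi} (\<lambda>x. f (x, y)))"
    unfolding 2 using integral_swap_continuous[where f="\<lambda>x y. f (x, y)" and a="-pi" and b=pi and c="-pi" and d=pi] c
    by (simp add: case_prod_beta')
qed

lemma periodic_x: "periodic f \<Longrightarrow> f (pi, y) = f (- pi, y)"
  unfolding periodic_def lattice_pt_def
  by (drule spec[of _ "(1, 0)"], drule spec[of _ "(- pi, y)"]) simp

lemma periodic_y: "periodic f \<Longrightarrow> f (x, pi) = f (x, - pi)"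
  unfolding periodic_def lattice_pt_def
  by (drule spec[of _ "(0, 1)"], drule spec[of _ "(x, - pi)"]) simp

lemma pderiv_has_derivative:
  fixes f :: "plane \<Rightarrow> 'b::real_normed_vector"
  assumes "f differentiable (at x)"
  shows "(f has_derivative (\<lambda>h. fst h *\<^sub>R pderiv1 f x + snd h *\<^sub>R pderiv2 f x)) (at x)"
proof -
  let ?D = "frechet_derivative f (at x)"
  have d: "(f has_derivative ?D) (at x)" using assms frechet_derivative_works by blast
  then have l: "linear ?D" using has_derivative_linear by blast
  have "?D h = fst h *\<^sub>R pderiv1 f x + snd h *\<^sub>R pderiv2 f x" for h
  proof -
    have "h = fst h *\<^sub>R (1, 0) + snd h *\<^sub>R (0, 1)" by (simp add: prod_eq_iff)
    then have "?D h = ?D (fst h *\<^sub>R (1, 0) + snd h *\<^sub>R (0, 1))" by simp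
    also have "\<dots> = fst h *\<^sub>R ?D (1, 0) + snd h *\<^sub>R ?D (0, 1)"
      by (simp only: linear_add[OF l] linear_scale[OF l])
    finally show ?thesis unfolding pderiv1_def pderiv2_def .
  qed
  then have "?D = (\<lambda>h. fst h *\<^sub>R pderiv1 f x + snd h *\<^sub>R pderiv2 f x)" by blast
  with d show ?thesis by metis
qed

lemma pderiv_eqI:
  fixes f :: "plane \<Rightarrow> 'b::real_normed_vector"
  assumes "(f has_derivative D) (at x)"
  shows "pderiv1 f x = D (1, 0)" "pderiv2 f x = D (0, 1)"
  using frechet_derivative_at[OF assms] by (simp_all add: pderiv1_def pderiv2_def)

text \<open>Integrate first in the direction of the derivative: by the fundamental theorem only the
  values on opposite faces remain, and periodicity cancels them.\<close>

lemma cell_integral_pderiv: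
  fixes f :: "plane \<Rightarrow> complex"
  assumes d: "f differentiable_on UNIV" and p: "periodic f"
  shows "continuous_on UNIV (pderiv1 f) \<Longrightarrow> (LINT x:cell|lborel. pderiv1 f x) = 0"
    and "continuous_on UNIV (pderiv2 f) \<Longrightarrow> (LINT x:cell|lborel. pderiv2 f x) = 0"
proof -
  have df: "(f has_derivative (\<lambda>h. fst h *\<^sub>R pderiv1 f x + snd h *\<^sub>R pderiv2 f x)) (at x)" for x
    using d by (intro pderiv_has_derivative) (metis UNIV_I differentiable_on_def)
  have v1: "((\<lambda>t. f (t, y)) has_vector_derivative pderiv1 f (t, y)) (at t within S)" for t y S
  proof -
    have "((\<lambda>t. f (t, y)) has_derivative (\<lambda>h. h *\<^sub>R pderiv1 f (t, y))) (at t)"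
      by (rule has_derivative_eq_rhs, rule has_derivative_compose[where f="\<lambda>t. (t, y)", OF _ df])
         (auto intro!: derivative_eq_intros)
    then show ?thesis unfolding has_vector_derivative_def by (rule has_derivative_at_withinI)
  qed
  have v2: "((\<lambda>t. f (y, t)) has_vector_derivative pderiv2 f (y, t)) (at t within S)" for t y S
  proof -
    have "((\<lambda>t. f (y, t)) has_derivative (\<lambda>h. h *\<^sub>R pderiv2 f (y, t))) (at t)"
      by (rule has_derivative_eq_rhs, rule has_derivative_compose[where f="\<lambda>t. (y, t)", OF _ df])
         (auto intro!: derivative_eq_intros)
    then show ?thesis unfolding has_vector_derivative_def by (rule has_derivative_at_withinI)
  qed
  show "(LINT x:cell|lborel. pderiv1 f x) = 0" if "continuous_on UNIV (pderiv1 f)"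
  proof -
    have "integral {-pi..pi} (\<lambda>x. pderiv1 f (x, y)) = 0" for y
      using fundamental_theorem_of_calculus[of "-pi" pi "\<lambda>t. f (t, y)", OF _ v1] periodic_x[OF p, of y]
      by (intro integral_unique) auto
    then show ?thesis by (simp add: cell_integral_iterated(2)[OF that])
  qed
  show "(LINT x:cell|lborel. pderiv2 f x) = 0" if "continuous_on UNIV (pderiv2 f)"
  proof -
    have "integral {-pi..pi} (\<lambda>y. pderiv2 f (x, y)) = 0" for x
      using fundamental_theorem_of_calculus[of "-pi" pi "\<lambda>t. f (x, t)", OF _ v2] periodic_y[OF p, of x]
      by (intro integral_unique) auto
    then show ?thesis by (simp add: cell_integral_iterated(1)[OF that])
  qed
qed

lemma pderiv_mult:
  fixes f g :: "plane \<Rightarrow> complex"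
  assumes "f differentiable (at x)" "g differentiable (at x)"
  shows "pderiv1 (\<lambda>x. f x * g x) x = pderiv1 f x * g x + f x * pderiv1 g x"
    and "pderiv2 (\<lambda>x. f x * g x) x = pderiv2 f x * g x + f x * pderiv2 g x"
proof -
  note d = has_derivative_mult[OF pderiv_has_derivative[OF assms(1)] pderiv_has_derivative[OF assms(2)]]
  show "pderiv1 (\<lambda>x. f x * g x) x = pderiv1 f x * g x + f x * pderiv1 g x"
    "pderiv2 (\<lambda>x. f x * g x) x = pderiv2 f x * g x + f x * pderiv2 g x"
    using pderiv_eqI[OF d] by simp_all
qed

lemma Ck_Suc_continuous:
  fixes f :: "plane \<Rightarrow> 'b::real_normed_vector"
  assumes "Ck (Suc 0) f"
  shows "continuous_on UNIV f" "f differentiable (at x)" "f differentiable_on UNIV"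
    "continuous_on UNIV (pderiv1 f)" "continuous_on UNIV (pderiv2 f)"
  using assms by (simp_all add: differentiable_imp_continuous_on) (metis UNIV_I differentiable_on_def)

lemma periodic_mult: "periodic f \<Longrightarrow> periodic g \<Longrightarrow> periodic (\<lambda>x. f x * g x)"
  by (simp add: periodic_def)

lemma cell_integral_by_parts:
  fixes f g :: "plane \<Rightarrow> complex"
  assumes f: "Ck (Suc 0) f" "periodic f" and g: "Ck (Suc 0) g" "periodic g"
  shows "(LINT x:cell|lborel. pderiv1 f x * g x) = - (LINT x:cell|lborel. f x * pderiv1 g x)"
    and "(LINT x:cell|lborel. pderiv2 f x * g x) = - (LINT x:cell|lborel. f x * pderiv2 g x)"
proof -
  note f' = Ck_Suc_continuous[OF f(1)] and g' = Ck_Suc_continuous[OF g(1)]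
  let ?p = "\<lambda>x. f x * g x"
  have d: "?p differentiable_on UNIV"
    using f' g' by (auto simp: differentiable_on_def intro!: differentiable_mult)
  have e1: "pderiv1 ?p = (\<lambda>x. pderiv1 f x * g x + f x * pderiv1 g x)"
    and e2: "pderiv2 ?p = (\<lambda>x. pderiv2 f x * g x + f x * pderiv2 g x)"
    using pderiv_mult[OF f'(2) g'(2)] by auto
  have "0 = (LINT x:cell|lborel. pderiv1 ?p x)"
    by (rule cell_integral_pderiv(1)[OF d periodic_mult[OF f(2) g(2)], symmetric])
       (auto simp: e1 intro!: continuous_intros f' g')
  also have "\<dots> = (LINT x:cell|lborel. pderiv1 f x * g x) + (LINT x:cell|lborel. f x * pderiv1 g x)"
    unfolding e1 by (intro set_integral_add set_integrable_cell continuous_intros f' g')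
  finally show "(LINT x:cell|lborel. pderiv1 f x * g x) = - (LINT x:cell|lborel. f x * pderiv1 g x)"
    by (simp add: eq_neg_iff_add_eq_0)
  have "0 = (LINT x:cell|lborel. pderiv2 ?p x)"
    by (rule cell_integral_pderiv(2)[OF d periodic_mult[OF f(2) g(2)], symmetric])
       (auto simp: e2 intro!: continuous_intros f' g')
  also have "\<dots> = (LINT x:cell|lborel. pderiv2 f x * g x) + (LINT x:cell|lborel. f x * pderiv2 g x)"
    unfolding e2 by (intro set_integral_add set_integrable_cell continuous_intros f' g')
  finally show "(LINT x:cell|lborel. pderiv2 f x * g x) = - (LINT x:cell|lborel. f x * pderiv2 g x)"
    by (simp add: eq_neg_iff_add_eq_0)
qed

section \<open>The Fourier modes\<close>

lemma inner_lattice: "lattice_pt k \<bullet> x = kx k * fst x + ky k * snd x"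
  by (simp add: lattice_pt_def kx_def ky_def inner_prod_def)

lemma fexp_has_derivative:
  "(fexp k has_derivative (\<lambda>h. \<i> * of_real (kx k * fst h + ky k * snd h) * fexp k x)) (at x)"
proof -
  have 1: "((\<lambda>x. \<i> * complex_of_real (kx k * fst x + ky k * snd x)) has_derivative
      (\<lambda>h. \<i> * of_real (kx k * fst h + ky k * snd h))) (at x)"
    by (intro bounded_linear_imp_has_derivative bounded_linear_const_mult
        bounded_linear_compose[OF bounded_linear_of_real] bounded_linear_add
        bounded_linear_fst bounded_linear_snd)
  have "(exp has_derivative (\<lambda>h. exp z * h)) (at z)" for z :: complex
    using DERIV_exp[of z] by (simp add: has_field_derivative_def)
  from has_derivative_compose[OF 1 this]
  show ?thesis unfolding fexp_def inner_lattice by (simp add: mult.commute)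
qed

lemma pderiv_fexp:
  "pderiv1 (fexp k) x = \<i> * of_real (kx k) * fexp k x"
  "pderiv2 (fexp k) x = \<i> * of_real (ky k) * fexp k x"
  using pderiv_eqI[OF fexp_has_derivative] by simp_all

lemma fexp_differentiable: "fexp k differentiable (at x)"
  using fexp_has_derivative differentiableI by blast

lemma continuous_on_fexp [continuous_intros]: "continuous_on S (fexp k)"
  unfolding fexp_def by (intro continuous_intros)

lemma norm_fexp [simp]: "cmod (fexp k x) = 1"
  by (simp add: fexp_def norm_exp_eq_Re)

lemma fexp_0 [simp]: "fexp 0 x = 1" "fexp (0, 0) x = 1"
  by (simp_all add: fexp_def lattice_pt_def zero_prod_def[symmetric])

lemma lattice_pt_add: "lattice_pt (k + l) = lattice_pt k + lattice_pt l"
  and lattice_pt_uminus: "lattice_pt (- k) = - lattice_pt k"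
  by (simp_all add: lattice_pt_def)

lemma fexp_add: "fexp (k + l) x = fexp k x * fexp l x"
  by (simp add: fexp_def lattice_pt_add inner_add_left exp_add ring_distribs)

lemma fexp_uminus: "fexp (- k) x = cnj (fexp k x)"
  by (simp add: fexp_def lattice_pt_uminus exp_cnj)

lemma fexp_plus: "fexp k (x + y) = fexp k x * fexp k y"
  by (simp add: fexp_def inner_add_right exp_add ring_distribs)

lemma fexp_period: "fexp k ((2 * pi) *\<^sub>R lattice_pt m) = 1"
proof -
  have "complex_of_real (lattice_pt k \<bullet> ((2 * pi) *\<^sub>R lattice_pt m)) =
    2 * of_int (fst k * fst m + snd k * snd m) * pi"
    by (simp add: inner_lattice kx_def ky_def lattice_pt_def algebra_simps)
  then have "fexp k ((2 * pi) *\<^sub>R lattice_pt m) = exp (2 * of_int (fst k * fst m + snd k * snd m) * pi * \<i>)"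
    unfolding fexp_def by (simp only: mult.commute)
  also have "\<dots> = 1" by (rule exp_integer_2pi) simp
  finally show ?thesis .
qed

lemma periodic_fexp: "periodic (fexp k)"
  by (simp add: periodic_def fexp_plus fexp_period)

lemma set_integral_cell_const:
  fixes c :: complex
  shows "(LINT x:cell|lborel. c) = 4 * pi\<^sup>2 * c"
proof -
  have "(LINT x:cell|lborel. c) = measure lborel cell *\<^sub>R c"
    using emeasure_cell_finite by (simp add: set_lebesgue_integral_def less_top)
  then show ?thesis by (simp add: measure_cell scaleR_conv_of_real)
qed

text \<open>For k \<noteq> 0 one of the two partial derivatives of the mode is a nonzero multiple of
  the mode, and derivatives of periodic functions integrate to zero.\<close>

lemma cell_integral_fexp:
  "(LINT x:cell|lborel. fexp k x) = (if k = 0 then complex_of_real (4 * pi\<^sup>2) else 0)"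
proof (cases "k = 0")
  case True then show ?thesis using set_integral_cell_const[of 1] by simp
next
  case False
  have d: "fexp k differentiable_on UNIV"
    by (auto simp: differentiable_on_def intro: fexp_differentiable)
  have p: "pderiv1 (fexp k) = (\<lambda>x. \<i> * of_real (kx k) * fexp k x)"
    "pderiv2 (fexp k) = (\<lambda>x. \<i> * of_real (ky k) * fexp k x)"
    by (intro ext pderiv_fexp)+
  have c: "continuous_on UNIV (pderiv1 (fexp k))" "continuous_on UNIV (pderiv2 (fexp k))"
    unfolding p by (intro continuous_intros)+
  have "\<i> * of_real (kx k) * (LINT x:cell|lborel. fexp k x) = 0"
    "\<i> * of_real (ky k) * (LINT x:cell|lborel. fexp k x) = 0"
    using cell_integral_pderiv(1)[OF d periodic_fexp c(1)] cell_integral_pderiv(2)[OF d periodic_fexp c(2)]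
    unfolding p by (simp_all only: set_integral_mult_right)
  moreover have "kx k \<noteq> 0 \<or> ky k \<noteq> 0" using False by (auto simp: kx_def ky_def prod_eq_iff)
  ultimately show ?thesis using False by auto
qed

section \<open>Weighted square summable sequences and dyadic shells\<close>

text \<open>The maximum norm, so that its dyadic shells are differences of squares, cut off below at
  1, so that every weight \<open>sz k powr t\<close> is positive and increasing in t.\<close>

definition sz :: "int \<times> int \<Rightarrow> real" where "sz k = max 1 (max \<bar>kx k\<bar> \<bar>ky k\<bar>)"

lemma sz_ge1: "1 \<le> sz k" and sz_pos: "0 < sz k" and sz_nonneg: "0 \<le> sz k"
  by (auto simp: sz_def)

lemma kx_le_sz: "\<bar>kx k\<bar> \<le> sz k" and ky_le_sz: "\<bar>ky k\<bar> \<le> sz k"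
  by (auto simp: sz_def)

lemma kx_add [simp]: "kx (k + l) = kx k + kx l" and ky_add [simp]: "ky (k + l) = ky k + ky l"
  and kx_diff [simp]: "kx (k - l) = kx k - kx l" and ky_diff [simp]: "ky (k - l) = ky k - ky l"
  and kx_uminus [simp]: "kx (- k) = - kx k" and ky_uminus [simp]: "ky (- k) = - ky k"
  and kx_0 [simp]: "kx 0 = 0" and ky_0 [simp]: "ky 0 = 0"
  by (simp_all add: kx_def ky_def)

lemma sz_uminus [simp]: "sz (- k) = sz k"
  by (simp add: sz_def)

lemma sz_add: "sz (k + l) \<le> sz k + sz l"
  unfolding sz_def kx_add ky_add by linarith

text \<open>The ball of radius R in the space H^t of Fourier coefficients. As a predicate over
  finite sets it needs no summability side condition and passes to coefficientwise limits.\<close>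

definition sobolev :: "real \<Rightarrow> coeffs \<Rightarrow> real \<Rightarrow> bool" where
  "sobolev t f R \<longleftrightarrow> (\<forall>F. finite F \<longrightarrow> L2_set (\<lambda>k. sz k powr t * cmod (f k)) F \<le> R)"

lemma sobolevD: "sobolev t f R \<Longrightarrow> finite F \<Longrightarrow> L2_set (\<lambda>k. sz k powr t * cmod (f k)) F \<le> R"
  by (simp add: sobolev_def)

lemma sobolev_nonneg: "sobolev t f R \<Longrightarrow> 0 \<le> R"
  using sobolevD[of t f R "{}"] by simp

lemma sobolev_mono: "sobolev t f R \<Longrightarrow> R \<le> R' \<Longrightarrow> sobolev t f R'"
  by (force simp: sobolev_def)

lemma sobolev_coord: "sobolev t f R \<Longrightarrow> sz k powr t * cmod (f k) \<le> R"
  using sobolevD[of t f R "{k}"] by simp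

lemma sobolev_0: "0 \<le> R \<Longrightarrow> sobolev t (\<lambda>_. 0) R"
  by (simp add: sobolev_def L2_set_def)

lemma sobolev_dom:
  assumes "sobolev t' g R" "0 \<le> c" "\<And>k. sz k powr t * cmod (f k) \<le> c * (sz k powr t' * cmod (g k))"
  shows "sobolev t f (c * R)"
  unfolding sobolev_def
proof (intro allI impI)
  fix F :: "(int \<times> int) set" assume F: "finite F"
  have "L2_set (\<lambda>k. sz k powr t * cmod (f k)) F \<le> L2_set (\<lambda>k. c * (sz k powr t' * cmod (g k))) F"
    by (rule L2_set_mono) (use assms(3) in auto)
  also have "\<dots> = c * L2_set (\<lambda>k. sz k powr t' * cmod (g k)) F"
    by (rule L2_set_right_distrib[symmetric]) fact
  also have "\<dots> \<le> c * R" using assms(1,2) F by (intro mult_left_mono sobolevD)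
  finally show "L2_set (\<lambda>k. sz k powr t * cmod (f k)) F \<le> c * R" .
qed

lemma sobolev_dom1:
  assumes "sobolev t' g R" "\<And>k. sz k powr t * cmod (f k) \<le> sz k powr t' * cmod (g k)"
  shows "sobolev t f R"
  using sobolev_dom[OF assms(1), of 1 t f] assms(2) by simp

lemma sobolev_exp_mono:
  assumes "sobolev t' f R" "t \<le> t'"
  shows "sobolev t f R"
  by (rule sobolev_dom1[OF assms(1)]) (intro mult_right_mono powr_mono assms(2) sz_ge1 norm_ge_zero)

lemma sobolev_add:
  assumes "sobolev t f A" "sobolev t g B"
  shows "sobolev t (\<lambda>k. f k + g k) (A + B)"
  unfolding sobolev_def
proof (intro allI impI)
  fix F :: "(int \<times> int) set" assume F: "finite F"
  have "L2_set (\<lambda>k. sz k powr t * cmod (f k + g k)) F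
     \<le> L2_set (\<lambda>k. sz k powr t * cmod (f k) + sz k powr t * cmod (g k)) F"
    by (rule L2_set_mono) (auto simp: distrib_left[symmetric] norm_triangle_ineq intro!: mult_left_mono)
  also have "\<dots> \<le> L2_set (\<lambda>k. sz k powr t * cmod (f k)) F + L2_set (\<lambda>k. sz k powr t * cmod (g k)) F"
    by (rule L2_set_triangle_ineq)
  also have "\<dots> \<le> A + B" using assms F by (intro add_mono sobolevD)
  finally show "L2_set (\<lambda>k. sz k powr t * cmod (f k + g k)) F \<le> A + B" .
qed

lemma sobolev_cmult: "sobolev t f A \<Longrightarrow> sobolev t (\<lambda>k. c * f k) (cmod c * A)"
  by (rule sobolev_dom) (auto simp: norm_mult)

lemma sobolev_uminus: "sobolev t f A \<Longrightarrow> sobolev t (\<lambda>k. - f k) A"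
  by (simp add: sobolev_def)

lemma sobolev_diff: "sobolev t f A \<Longrightarrow> sobolev t g B \<Longrightarrow> sobolev t (\<lambda>k. f k - g k) (A + B)"
  using sobolev_add[OF _ sobolev_uminus, of t f A g B] by simp

lemma sobolev_sum:
  assumes "\<And>i. i \<in> I \<Longrightarrow> sobolev t (f i) (A i)"
  shows "sobolev t (\<lambda>k. \<Sum>i\<in>I. f i k) (\<Sum>i\<in>I. A i)"
proof (cases "finite I")
  case True
  then show ?thesis using assms
    by (induction I) (auto intro!: sobolev_0 sobolev_add)
qed (simp add: sobolev_0)

text \<open>Each bound involves finitely many coefficients only, so it is closed under
  coefficientwise convergence: Fatou's lemma in this setting.\<close>

lemma sobolev_lim:
  assumes "\<And>k. ((\<lambda>n. f n k) \<longlongrightarrow> g k) F" "\<forall>\<^sub>F n in F. sobolev t (f n) (R n)" "F \<noteq> bot" "(R \<longlongrightarrow> r) F"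
  shows "sobolev t g r"
  unfolding sobolev_def
proof (intro allI impI)
  fix S :: "(int \<times> int) set" assume S: "finite S"
  have 1: "((\<lambda>n. L2_set (\<lambda>k. sz k powr t * cmod (f n k)) S) \<longlongrightarrow> L2_set (\<lambda>k. sz k powr t * cmod (g k)) S) F"
    unfolding L2_set_def by (intro tendsto_intros assms(1))
  show "L2_set (\<lambda>k. sz k powr t * cmod (g k)) S \<le> r"
    by (rule tendsto_le[OF assms(3,4) 1]) (use assms(2) in eventually_elim, auto dest: sobolevD[OF _ S])
qed

lemma sobolev_lim_const:
  assumes "\<And>k. (\<lambda>n. f n k) \<longlonglongrightarrow> g k" "\<And>n. sobolev t (f n) R"
  shows "sobolev t g R"
  by (rule sobolev_lim[where R="\<lambda>_. R", OF assms(1)]) (simp_all add: assms(2))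

section \<open>Parseval's identity and multiplication by bounded trigonometric polynomials\<close>

lemma cnj_mult_fexp: "fexp m x * cnj (fexp n x) = fexp (m - n) x"
  by (metis add_uminus_conv_diff fexp_add fexp_uminus)

lemma cell_integral_sum:
  fixes f :: "'i \<Rightarrow> plane \<Rightarrow> complex"
  assumes "\<And>i. i \<in> I \<Longrightarrow> continuous_on UNIV (f i)"
  shows "(LINT x:cell|lborel. (\<Sum>i\<in>I. f i x)) = (\<Sum>i\<in>I. LINT x:cell|lborel. f i x)"
  unfolding set_lebesgue_integral_def scaleR_sum_right
  by (rule Bochner_Integration.integral_sum)
     (use assms set_integrable_cell in \<open>auto simp: set_integrable_def\<close>)

lemma parseval_trig:
  assumes "finite H"
  shows "(LINT x:cell|lborel. complex_of_real ((cmod (\<Sum>m\<in>H. a m * fexp m x))\<^sup>2))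
    = complex_of_real (4 * pi\<^sup>2 * (\<Sum>m\<in>H. (cmod (a m))\<^sup>2))"
proof -
  have *: "complex_of_real ((cmod (\<Sum>m\<in>H. a m * fexp m x))\<^sup>2)
     = (\<Sum>m\<in>H. \<Sum>n\<in>H. a m * cnj (a n) * fexp (m - n) x)" for x
    unfolding complex_norm_square
    by (simp add: sum_distrib_left sum_distrib_right cnj_mult_fexp[symmetric] ac_simps)
       (rule sum.swap)
  have "(LINT x:cell|lborel. (\<Sum>m\<in>H. \<Sum>n\<in>H. a m * cnj (a n) * fexp (m - n) x))
      = (\<Sum>m\<in>H. \<Sum>n\<in>H. (LINT x:cell|lborel. a m * cnj (a n) * fexp (m - n) x))"
    by (subst cell_integral_sum, intro continuous_intros, intro sum.cong refl cell_integral_sum continuous_intros)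
  also have "\<dots> = (\<Sum>m\<in>H. \<Sum>n\<in>H. if m = n then complex_of_real (4 * pi\<^sup>2) * complex_of_real ((cmod (a m))\<^sup>2) else 0)"
    unfolding complex_norm_square by (intro sum.cong refl) (simp add: cell_integral_fexp)
  also have "\<dots> = complex_of_real (4 * pi\<^sup>2 * (\<Sum>m\<in>H. (cmod (a m))\<^sup>2))"
    using assms by (simp add: sum_distrib_left)
  finally show ?thesis unfolding * .
qed

lemma parseval_real:
  assumes "finite H"
  shows "(LINT x:cell|lborel. (cmod (\<Sum>m\<in>H. a m * fexp m x))\<^sup>2) = 4 * pi\<^sup>2 * (\<Sum>m\<in>H. (cmod (a m))\<^sup>2)"
proof -
  have "complex_of_real (LINT x:cell|lborel. (cmod (\<Sum>m\<in>H. a m * fexp m x))\<^sup>2)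
    = (LINT x:cell|lborel. complex_of_real ((cmod (\<Sum>m\<in>H. a m * fexp m x))\<^sup>2))"
    by (rule set_integral_complex_of_real[symmetric])
  then show ?thesis unfolding parseval_trig[OF assms] of_real_eq_iff .
qed

text \<open>Multiplication by a function bounded by B enlarges the L2 norm at most by the factor B;
  Parseval's identity is used before and after the pointwise estimate.\<close>

lemma sobolev_convolution_trig:
  assumes F: "finite F" and B: "\<And>x. cmod (\<Sum>k\<in>F. p k * fexp k x) \<le> B" and v: "sobolev 0 v D"
  shows "sobolev 0 (\<lambda>m. \<Sum>k\<in>F. p k * v (m - k)) (B * D)"
  unfolding sobolev_def
proof (intro allI impI)
  fix H :: "(int \<times> int) set" assume H: "finite H"
  have B0: "0 \<le> B" using B[of 0] norm_ge_zero order_trans by blast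
  have D0: "0 \<le> D" using sobolev_nonneg[OF v] .
  \<comment> \<open>\<open>G\<close> collects the frequencies of v that can reach \<open>H\<close>.
    Cutting v down to \<open>G\<close> leaves the coefficients on \<open>H\<close> unchanged and
    makes the product a trigonometric polynomial with frequencies in \<open>H'\<close>.\<close>
  define G where "G = (\<lambda>(m, k). m - k) ` (H \<times> F)"
  define H' where "H' = (\<lambda>(l, k). l + k) ` (G \<times> F)"
  have fin: "finite G" "finite H'" using F H by (auto simp: G_def H'_def)
  define v' where "v' l = (if l \<in> G then v l else 0)" for l
  define a where "a m = (\<Sum>k\<in>F. p k * v' (m - k))" for m
  have HF: "(\<Sum>k\<in>F. p k * v (m - k)) = a m" if "m \<in> H" for m
    unfolding a_def v'_def by (intro sum.cong refl) (use that in \<open>force simp: G_def\<close>)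
  have a0: "a m = 0" if "m \<notin> H'" for m
    unfolding a_def
  proof (intro sum.neutral ballI)
    fix k assume k: "k \<in> F"
    have "m = (m - k) + k" by simp
    then have "m - k \<notin> G" using that k unfolding H'_def by (metis (mono_tags, lifting) SigmaI case_prod_conv image_eqI)
    then show "p k * v' (m - k) = 0" by (simp add: v'_def)
  qed
  have prod: "(\<Sum>k\<in>F. p k * fexp k x) * (\<Sum>l\<in>G. v l * fexp l x) = (\<Sum>m\<in>H'. a m * fexp m x)" for x
  proof -
    have "(\<Sum>m\<in>H'. a m * fexp m x) = (\<Sum>k\<in>F. \<Sum>m\<in>H'. p k * v' (m - k) * fexp m x)"
      unfolding a_def sum_distrib_right by (rule sum.swap)
    also have "\<dots> = (\<Sum>k\<in>F. \<Sum>l\<in>G. p k * v l * fexp (l + k) x)"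
    proof (rule sum.cong[OF refl])
      fix k assume k: "k \<in> F"
      have "(\<Sum>m\<in>H'. p k * v' (m - k) * fexp m x) = (\<Sum>m\<in>(\<lambda>l. l + k) ` G. p k * v' (m - k) * fexp m x)"
        proof (rule sum.mono_neutral_right)
          show "\<forall>m\<in>H' - (\<lambda>l. l + k) ` G. p k * v' (m - k) * fexp m x = 0"
          proof
            fix m assume "m \<in> H' - (\<lambda>l. l + k) ` G"
            then have "m - k \<notin> G" by (metis DiffD2 diff_add_cancel imageI)
            then show "p k * v' (m - k) * fexp m x = 0" by (simp add: v'_def)
          qed
        qed (use fin k in \<open>auto simp: H'_def\<close>)
      also have "\<dots> = (\<Sum>l\<in>G. p k * v l * fexp (l + k) x)"
        by (subst sum.reindex) (auto simp: inj_on_def v'_def)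
      finally show "(\<Sum>m\<in>H'. p k * v' (m - k) * fexp m x) = (\<Sum>l\<in>G. p k * v l * fexp (l + k) x)" .
    qed
    finally show ?thesis
      by (simp add: sum_product fexp_add ac_simps)
  qed
  have "4 * pi\<^sup>2 * (\<Sum>m\<in>H'. (cmod (a m))\<^sup>2) = (LINT x:cell|lborel. (cmod (\<Sum>m\<in>H'. a m * fexp m x))\<^sup>2)"
    by (rule parseval_real[symmetric]) fact
  also have "\<dots> \<le> (LINT x:cell|lborel. B\<^sup>2 * (cmod (\<Sum>l\<in>G. v l * fexp l x))\<^sup>2)"
  proof (rule set_integral_mono)
    fix x
    show "(cmod (\<Sum>m\<in>H'. a m * fexp m x))\<^sup>2 \<le> B\<^sup>2 * (cmod (\<Sum>l\<in>G. v l * fexp l x))\<^sup>2"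
      unfolding prod[symmetric] norm_mult power_mult_distrib
      by (intro mult_right_mono power_mono B) auto
  qed (intro set_integrable_cell continuous_intros)+
  also have "\<dots> = B\<^sup>2 * (4 * pi\<^sup>2 * (\<Sum>l\<in>G. (cmod (v l))\<^sup>2))"
    unfolding set_integral_mult_right parseval_real[OF fin(1)] by simp
  finally have 1: "(\<Sum>m\<in>H'. (cmod (a m))\<^sup>2) \<le> B\<^sup>2 * (\<Sum>l\<in>G. (cmod (v l))\<^sup>2)"
    by (simp add: ac_simps)
  have "L2_set (\<lambda>l. cmod (v l)) G \<le> D"
    using sobolevD[OF v fin(1)] sz_pos by (simp add: less_imp_neq[THEN not_sym])
  then have "(\<Sum>l\<in>G. (cmod (v l))\<^sup>2) \<le> D\<^sup>2"
    unfolding L2_set_def using D0 by (metis real_sqrt_le_iff real_sqrt_abs abs_of_nonneg)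
  with 1 have 2: "(\<Sum>m\<in>H'. (cmod (a m))\<^sup>2) \<le> (B * D)\<^sup>2"
    unfolding power_mult_distrib by (meson mult_left_mono order_trans zero_le_power2)
  have "(\<Sum>m\<in>H. (cmod (a m))\<^sup>2) = (\<Sum>m\<in>H \<inter> H'. (cmod (a m))\<^sup>2)"
    using H a0 by (intro sum.mono_neutral_right) auto
  also have "\<dots> \<le> (\<Sum>m\<in>H'. (cmod (a m))\<^sup>2)" using fin by (intro sum_mono2) auto
  finally have "(\<Sum>m\<in>H. (cmod (a m))\<^sup>2) \<le> (B * D)\<^sup>2" using 2 by simp
  then have "L2_set (\<lambda>m. cmod (a m)) H \<le> B * D"
    unfolding L2_set_def using B0 D0 by (intro real_le_lsqrt) (auto intro: sum_nonneg)
  moreover have "L2_set (\<lambda>m. sz m powr 0 * cmod (\<Sum>k\<in>F. p k * v (m - k))) H = L2_set (\<lambda>m. cmod (a m)) H"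
    using HF sz_pos by (intro L2_set_cong) (auto simp: less_imp_neq[THEN not_sym])
  ultimately show "L2_set (\<lambda>m. sz m powr 0 * cmod (\<Sum>k\<in>F. p k * v (m - k))) H \<le> B * D" by simp
qed

text \<open>The convolution bound applied to the unit sequence at frequency 0, which reproduces p:
  the L2 norm for the normalised measure is at most the supremum.\<close>

lemma sobolev_trig_coeff:
  assumes F: "finite F" and B: "\<And>x. cmod (\<Sum>k\<in>F. p k * fexp k x) \<le> B"
  shows "sobolev 0 (\<lambda>k. if k \<in> F then p k else 0) B"
proof -
  have d: "sobolev 0 (\<lambda>k. if k = 0 then 1 else 0) 1"
    unfolding sobolev_def L2_set_def
    by (auto simp: if_distrib[of "\<lambda>x. x ^ 2"] sz_pos[THEN less_imp_neq, THEN not_sym] power2_eq_square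
        if_distrib[of cmod] if_distrib[of "\<lambda>x. _ * x"] if_distrib[of "\<lambda>x. x * _"] cong: if_cong)
  have "sobolev 0 (\<lambda>m. \<Sum>k\<in>F. p k * (if m - k = 0 then 1 else 0)) (B * 1)"
    by (rule sobolev_convolution_trig[OF F B d])
  moreover have "(\<lambda>m. \<Sum>k\<in>F. p k * (if m - k = 0 then 1 else 0)) = (\<lambda>m. if m \<in> F then p m else 0)"
    using F by (auto simp: fun_eq_iff if_distrib[of "\<lambda>x. _ * x"] cong: if_cong)
  ultimately show ?thesis by simp
qed

section \<open>Dyadic shells and lattice sums\<close>

definition shell :: "nat \<Rightarrow> (int \<times> int) set" where
  "shell n = {k. 2 ^ n \<le> max \<bar>fst k\<bar> \<bar>snd k\<bar> \<and> max \<bar>fst k\<bar> \<bar>snd k\<bar> < 2 ^ Suc n}"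

definition square :: "nat \<Rightarrow> (int \<times> int) set" where
  "square n = {k. max \<bar>fst k\<bar> \<bar>snd k\<bar> < 2 ^ n}"

lemma square_0: "square 0 = {0}"
  by (auto simp: square_def prod_eq_iff)

lemma square_Suc: "square (Suc n) = square n \<union> shell n"
  by (auto simp: square_def shell_def)

lemma square_shell_disjoint: "square n \<inter> shell n = {}"
  by (auto simp: square_def shell_def)

lemma square_subset: "square n \<subseteq> {- (2 ^ n)<..<2 ^ n} \<times> {- (2 ^ n)<..<2 ^ n}"
  by (auto simp: square_def abs_less_iff)

lemma finite_square [simp]: "finite (square n)"
  by (rule finite_subset[OF square_subset]) auto

lemma finite_shell [simp]: "finite (shell n)"
  using finite_square[of "Suc n"] by (simp add: square_Suc)

lemma zero_in_square [simp]: "0 \<in> square n" and zero_notin_shell [simp]: "0 \<notin> shell n"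
  by (auto simp: square_def shell_def not_le)

lemma uminus_in_shell [simp]: "- k \<in> shell n \<longleftrightarrow> k \<in> shell n"
  by (simp add: shell_def)

lemma card_shell: "real (card (shell n)) \<le> 16 * 4 ^ n"
proof -
  have "card (shell n) \<le> card (square (Suc n))" by (intro card_mono) (auto simp: square_Suc)
  also have "\<dots> \<le> card ({- (2 ^ Suc n)<..<2 ^ Suc n :: int} \<times> {- (2 ^ Suc n)<..<2 ^ Suc n :: int})"
    by (intro card_mono square_subset) auto
  also have "\<dots> \<le> (4 * 2 ^ n) ^ 2"
    unfolding card_cartesian_product power2_eq_square
    by (intro mult_mono) (auto simp: nat_le_iff)
  finally have "real (card (shell n)) \<le> real ((4 * 2 ^ n) ^ 2)" by (rule of_nat_mono)
  also have "\<dots> = 16 * 4 ^ n" by (simp add: power_mult_distrib flip: power_mult) (simp add: power_mult mult.commute[of n])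
  finally show ?thesis .
qed

lemma sz_of_int: "k \<noteq> 0 \<Longrightarrow> sz k = of_int (max \<bar>fst k\<bar> \<bar>snd k\<bar>)"
proof -
  assume "k \<noteq> 0"
  then have "1 \<le> max \<bar>fst k\<bar> \<bar>snd k\<bar>" by (auto simp: prod_eq_iff)
  then have "(1::real) \<le> of_int (max \<bar>fst k\<bar> \<bar>snd k\<bar>)" by linarith
  then show ?thesis by (simp add: sz_def kx_def ky_def of_int_max)
qed

lemma sz_shell: "k \<in> shell n \<Longrightarrow> 2 ^ n \<le> sz k" "k \<in> shell n \<Longrightarrow> sz k \<le> 2 * 2 ^ n"
proof -
  assume k: "k \<in> shell n"
  then have "k \<noteq> 0" by auto
  then have s: "sz k = of_int (max \<bar>fst k\<bar> \<bar>snd k\<bar>)" by (rule sz_of_int)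
  have "(2::int) ^ n \<le> max \<bar>fst k\<bar> \<bar>snd k\<bar>" "max \<bar>fst k\<bar> \<bar>snd k\<bar> \<le> 2 * 2 ^ n"
    using k by (auto simp: shell_def)
  from this[folded of_int_le_iff[where ?'a=real]] show "2 ^ n \<le> sz k" "sz k \<le> 2 * 2 ^ n"
    unfolding s by simp_all
qed

lemma sz_sq_le:
  assumes "k \<noteq> 0"
  shows "(sz k)\<^sup>2 \<le> (kx k)\<^sup>2 + (ky k)\<^sup>2"
proof -
  have "sz k = \<bar>kx k\<bar> \<or> sz k = \<bar>ky k\<bar>"
    unfolding sz_of_int[OF assms] kx_def ky_def of_int_max of_int_abs by linarith
  then show ?thesis by (metis power2_abs le_add_same_cancel1 le_add_same_cancel2 zero_le_power2)
qed

lemma eventually_in_square: "finite X \<Longrightarrow> \<forall>\<^sub>F n in sequentially. X \<subseteq> square n"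
proof -
  assume X: "finite X"
  have "\<forall>\<^sub>F n in sequentially. k \<in> square n" for k
  proof -
    obtain N where N: "nat (max \<bar>fst k\<bar> \<bar>snd k\<bar>) < 2 ^ N" using less_exp by blast
    have "k \<in> square n" if "N \<le> n" for n
    proof -
      have "nat (max \<bar>fst k\<bar> \<bar>snd k\<bar>) < 2 ^ n"
        using N power_increasing[OF that, of "2::nat"] by linarith
      then have "max \<bar>fst k\<bar> \<bar>snd k\<bar> < int (2 ^ n)" by linarith
      then show ?thesis by (simp add: square_def)
    qed
    then show ?thesis by (auto simp: eventually_sequentially)
  qed
  then have "\<forall>\<^sub>F n in sequentially. \<forall>k\<in>X. k \<in> square n" using X by (intro eventually_ball_finite) auto
  then show ?thesis unfolding subset_eq .
qed

lemma filterlim_exhaust: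
  assumes "\<And>n. finite (F n)" "\<And>X. finite X \<Longrightarrow> \<forall>\<^sub>F n in sequentially. X \<subseteq> F n"
  shows "filterlim F (finite_subsets_at_top UNIV) sequentially"
  unfolding filterlim_finite_subsets_at_top using assms by auto

lemma filterlim_square: "filterlim square (finite_subsets_at_top UNIV) sequentially"
  by (rule filterlim_exhaust[OF finite_square eventually_in_square])

text \<open>Unconditional summability allows any exhausting sequence of finite sets, not just
  squares; the Jacobian with both factors truncated needs this freedom.\<close>

lemma tendsto_exhaust:
  fixes h :: "int \<times> int \<Rightarrow> 'b::{comm_monoid_add, topological_space, t2_space}"
  assumes "h summable_on UNIV" "filterlim F (finite_subsets_at_top UNIV) sequentially"
  shows "(\<lambda>n. \<Sum>k\<in>F n. h k) \<longlonglongrightarrow> infsum h UNIV"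
  using filterlim_compose[OF _ assms(2)] infsum_tendsto[OF assms(1)] by blast

lemma sum_square: "(\<Sum>k\<in>square n. f k) = f 0 + (\<Sum>i<n. \<Sum>k\<in>shell i. f k)"
  by (induction n) (simp_all add: square_0 square_Suc sum.union_disjoint square_shell_disjoint add.assoc)

definition geo :: "real \<Rightarrow> real" where "geo c = 1 / (1 - 2 powr (- c))"

lemma geo_pos: "0 < c \<Longrightarrow> 0 < geo c"
  by (simp add: geo_def powr_less_one)

lemma pow2_powr: "(2 ^ n) powr c = (2 powr c) ^ n"
  for c :: real
proof -
  have "((2::real) ^ n) powr c = (2 powr real n) powr c" by (simp add: powr_realpow)
  also have "\<dots> = (2 powr c) powr real n" by (simp add: powr_powr mult.commute)
  also have "\<dots> = (2 powr c) ^ n" by (rule powr_realpow) simp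
  finally show ?thesis .
qed

lemma sum_geo: "0 < c \<Longrightarrow> (\<Sum>i<n. (2 ^ i) powr (- c)) \<le> geo c"
proof -
  assume c: "0 < c"
  have "(\<Sum>i<n. (2 powr (- c)) ^ i) \<le> (\<Sum>i. (2 powr (- c)) ^ i)"
    using c by (intro sum_le_suminf summable_geometric) (auto simp: powr_less_one)
  also have "\<dots> = geo c" using c unfolding geo_def by (intro suminf_geometric) (auto simp: powr_less_one)
  finally show ?thesis by (simp add: pow2_powr)
qed

text \<open>Shell i has at most \<open>16 * 4 ^ i\<close> points and contributes a multiple of
  \<open>(2 ^ i) powr (2 - t)\<close>, a convergent geometric series as t > 2; the 1 is the zero
  frequency.\<close>

lemma sum_sz_bound:
  assumes t: "2 < t" and F: "finite F"
  shows "(\<Sum>k\<in>F. sz k powr (- t)) \<le> 1 + 16 * geo (t - 2)"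
proof -
  obtain n where n: "F \<subseteq> square n"
    using eventually_in_square[OF F] by (auto simp: eventually_sequentially)
  have "(\<Sum>k\<in>F. sz k powr (- t)) \<le> (\<Sum>k\<in>square n. sz k powr (- t))"
    using n by (intro sum_mono2) auto
  also have "\<dots> = 1 + (\<Sum>i<n. \<Sum>k\<in>shell i. sz k powr (- t))"
    unfolding sum_square by (simp add: sz_def)
  also have "\<dots> \<le> 1 + (\<Sum>i<n. 16 * (2 ^ i) powr (- (t - 2)))"
  proof (intro add_left_mono sum_mono)
    fix i
    have "(\<Sum>k\<in>shell i. sz k powr (- t)) \<le> (\<Sum>k\<in>shell i. (2 ^ i) powr (- t))"
      using t by (intro sum_mono powr_mono2' sz_shell) auto
    also have "\<dots> \<le> (16 * 4 ^ i) * (2 ^ i) powr (- t)"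
      using card_shell[of i] by (auto intro!: mult_right_mono)
    also have "(4::real) ^ i = (2 ^ i) powr 2" by (simp add: power2_eq_square power_mult_distrib[symmetric])
    also have "16 * (2 ^ i) powr 2 * (2 ^ i) powr (- t) = 16 * ((2::real) ^ i) powr (- (t - 2))"
      unfolding mult.assoc powr_add[symmetric] by simp
    finally show "(\<Sum>k\<in>shell i. sz k powr (- t)) \<le> 16 * (2 ^ i) powr (- (t - 2))" .
  qed
  also have "\<dots> \<le> 1 + 16 * geo (t - 2)"
    unfolding sum_distrib_left[symmetric] using t by (intro add_left_mono mult_left_mono sum_geo) auto
  finally show ?thesis .
qed

section \<open>The Jacobian on the Fourier side\<close>

definition wedge :: "int \<times> int \<Rightarrow> int \<times> int \<Rightarrow> real" where
  "wedge k l = kx k * ky l - ky k * kx l"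

text \<open>Since the square of \<i> is -1, these are the Fourier coefficients of
  \<open>\<partial>\<^sub>2 f \<partial>\<^sub>1 g - \<partial>\<^sub>1 f \<partial>\<^sub>2
  g\<close>, with f and g read as functions; \<open>fourier_jac\<close> proves this for rapidly
  decreasing sequences.\<close>

definition jac :: "coeffs \<Rightarrow> coeffs \<Rightarrow> coeffs" where
  "jac f g m = (\<Sum>\<^sub>\<infinity>k. of_real (wedge k (m - k)) * f k * g (m - k))"

lemma wedge_le: "\<bar>wedge k l\<bar> \<le> 2 * (sz k * sz l)"
proof -
  have "\<bar>kx k * ky l\<bar> \<le> sz k * sz l" "\<bar>ky k * kx l\<bar> \<le> sz k * sz l"
    unfolding abs_mult by (intro mult_mono kx_le_sz ky_le_sz sz_nonneg abs_ge_zero)+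
  then show ?thesis unfolding wedge_def by linarith
qed

lemma jac_term_le:
  "cmod (of_real (wedge k l) * f k * g l) \<le> 2 * ((sz k powr 1 * cmod (f k)) * (sz l powr 1 * cmod (g l)))"
proof -
  have "cmod (of_real (wedge k l) * f k * g l) = \<bar>wedge k l\<bar> * (cmod (f k) * cmod (g l))"
    by (simp add: norm_mult)
  also have "\<dots> \<le> (2 * (sz k * sz l)) * (cmod (f k) * cmod (g l))"
    by (intro mult_right_mono wedge_le) auto
  also have "\<dots> = 2 * ((sz k powr 1 * cmod (f k)) * (sz l powr 1 * cmod (g l)))"
    by (simp only: powr_one[OF sz_nonneg] ac_simps)
  finally show ?thesis .
qed

lemma L2_set_reindex: "inj_on h A \<Longrightarrow> L2_set f (h ` A) = L2_set (f \<circ> h) A"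
  by (simp add: L2_set_def sum.reindex)

text \<open>The source of the \<open>sobolev 1\<close> hypotheses in the sequel: they make the
  defining sum absolutely convergent, by Cauchy-Schwarz with one power of \<open>sz\<close> on each
  factor.\<close>

lemma jac_summable:
  assumes f: "sobolev 1 f D" and g: "sobolev 1 g E"
  shows "(\<lambda>k. of_real (wedge k (m - k)) * f k * g (m - k)) summable_on UNIV"
proof (rule abs_summable_summable, unfold abs_summable_iff_bdd_above, rule bdd_aboveI2)
  fix F :: "(int \<times> int) set" assume "F \<in> {F. F \<subseteq> UNIV \<and> finite F}"
  then have F: "finite F" by simp
  have "(\<Sum>k\<in>F. cmod (of_real (wedge k (m - k)) * f k * g (m - k)))
     \<le> 2 * (\<Sum>k\<in>F. \<bar>sz k powr 1 * cmod (f k)\<bar> * \<bar>sz (m - k) powr 1 * cmod (g (m - k))\<bar>)"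
    unfolding sum_distrib_left by (intro sum_mono order_trans[OF jac_term_le]) simp
  also have "\<dots> \<le> 2 * (L2_set (\<lambda>k. sz k powr 1 * cmod (f k)) F * L2_set (\<lambda>k. sz (m - k) powr 1 * cmod (g (m - k))) F)"
    by (intro mult_left_mono L2_set_mult_ineq) auto
  also have "L2_set (\<lambda>k. sz (m - k) powr 1 * cmod (g (m - k))) F
     = L2_set (\<lambda>k. sz k powr 1 * cmod (g k)) ((\<lambda>k. m - k) ` F)"
    by (subst L2_set_reindex) (auto simp: inj_on_def o_def)
  also have "2 * (L2_set (\<lambda>k. sz k powr 1 * cmod (f k)) F * L2_set (\<lambda>k. sz k powr 1 * cmod (g k)) ((\<lambda>k. m - k) ` F)) \<le> 2 * (D * E)"
    using F by (intro mult_left_mono mult_mono sobolevD[OF f] sobolevD[OF g] sobolev_nonneg[OF f]) auto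
  finally show "(\<Sum>k\<in>F. cmod (of_real (wedge k (m - k)) * f k * g (m - k))) \<le> 2 * (D * E)" .
qed

lemma jac_add_left:
  assumes "sobolev 1 f D" "sobolev 1 f' D'" "sobolev 1 g E"
  shows "jac (\<lambda>k. f k + f' k) g m = jac f g m + jac f' g m"
  unfolding jac_def
  by (subst infsum_add[symmetric, OF jac_summable[OF assms(1,3)] jac_summable[OF assms(2,3)]])
     (simp add: algebra_simps)

lemma jac_antisym: "jac g f m = - jac f g m"
proof -
  have "jac g f m = (\<Sum>\<^sub>\<infinity>k. - (of_real (wedge k (m - k)) * f k * g (m - k)))"
    unfolding jac_def
    by (rule infsum_reindex_bij_witness[of _ "\<lambda>k. m - k" "\<lambda>k. m - k"])
       (auto simp: wedge_def algebra_simps)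
  then show ?thesis by (simp add: infsum_uminus jac_def)
qed

lemma jac_add_right:
  assumes "sobolev 1 f D" "sobolev 1 g E" "sobolev 1 g' E'"
  shows "jac f (\<lambda>k. g k + g' k) m = jac f g m + jac f g' m"
  using jac_add_left[OF assms(2,3,1)] jac_antisym[of f] by simp

lemma jac_cmult_left: "jac (\<lambda>k. c * f k) g m = c * jac f g m"
  unfolding jac_def by (subst infsum_cmult_right'[symmetric]) (simp add: ac_simps)

lemma jac_uminus_left: "jac (\<lambda>k. - f k) g m = - jac f g m"
  using jac_cmult_left[of "-1"] by simp

lemma jac_diff_left:
  assumes "sobolev 1 f D" "sobolev 1 f' D'" "sobolev 1 g E"
  shows "jac (\<lambda>k. f k - f' k) g m = jac f g m - jac f' g m"
  using jac_add_left[OF assms(1) sobolev_uminus[OF assms(2)] assms(3)] by (simp add: jac_uminus_left)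

lemma jac_diff_right:
  assumes "sobolev 1 f D" "sobolev 1 g E" "sobolev 1 g' E'"
  shows "jac f (\<lambda>k. g k - g' k) m = jac f g m - jac f g' m"
  using jac_diff_left[OF assms(2,3,1)] jac_antisym[of f] by simp

definition trunc :: "(int \<times> int) set \<Rightarrow> coeffs \<Rightarrow> coeffs" where
  "trunc F f k = (if k \<in> F then f k else 0)"

lemma trunc_sobolev: "sobolev t f D \<Longrightarrow> sobolev t (trunc F f) D"
  by (erule sobolev_dom1) (simp add: trunc_def)

lemma jac_trunc: 
  assumes "finite F"
  shows "jac (trunc F f) g m = (\<Sum>k\<in>F. of_real (wedge k (m - k)) * f k * g (m - k))"
proof -
  have "jac (trunc F f) g m = (\<Sum>\<^sub>\<infinity>k\<in>F. of_real (wedge k (m - k)) * f k * g (m - k))"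
    unfolding jac_def by (rule infsum_cong_neutral) (auto simp: trunc_def)
  with assms show ?thesis by simp
qed

text \<open>Estimates are proved for truncated factors, block by block, and carried to the full
  Jacobian through these limits and \<open>sobolev_lim_const\<close>.\<close>

lemma jac_trunc_tendsto:
  assumes f: "sobolev 1 f D" and g: "sobolev 1 g E"
  shows "(\<lambda>n. jac (trunc (square n) f) g m) \<longlonglongrightarrow> jac f g m"
    and "(\<lambda>n. jac (trunc (square n) f) (trunc (square n) g) m) \<longlonglongrightarrow> jac f g m"
proof -
  let ?h = "\<lambda>k. of_real (wedge k (m - k)) * f k * g (m - k)"
  note s = jac_summable[OF f g, of m]
  show "(\<lambda>n. jac (trunc (square n) f) g m) \<longlonglongrightarrow> jac f g m"
    unfolding jac_trunc[OF finite_square] unfolding jac_def by (rule tendsto_exhaust[OF s filterlim_square])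
  \<comment> \<open>Truncating both factors keeps those k for which k and m - k lie in the square;
    these sets again exhaust the lattice.\<close>
  define G where "G n = square n \<inter> (\<lambda>k. m - k) ` square n" for n
  have fl: "filterlim G (finite_subsets_at_top UNIV) sequentially"
  proof (rule filterlim_exhaust)
    fix X :: "(int \<times> int) set" assume X: "finite X"
    have "\<forall>\<^sub>F n in sequentially. X \<subseteq> square n \<and> (\<lambda>k. m - k) ` X \<subseteq> square n"
      using X by (intro eventually_conj eventually_in_square) auto
    then show "\<forall>\<^sub>F n in sequentially. X \<subseteq> G n"
    proof eventually_elim
      case (elim n)
      show ?case
      proof
        fix k assume "k \<in> X"
        then have "k \<in> square n" "m - k \<in> square n" using elim by auto
        moreover have "k = m - (m - k)" by simp
        ultimately show "k \<in> G n" unfolding G_def by blast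
      qed
    qed
  qed (auto simp: G_def)
  have "jac (trunc (square n) f) (trunc (square n) g) m = (\<Sum>k\<in>G n. ?h k)" for n
  proof -
    have "m - k \<in> square n \<longleftrightarrow> k \<in> (\<lambda>k. m - k) ` square n" for k
      by (force simp: image_iff)
    then show ?thesis
      unfolding jac_trunc[OF finite_square] by (intro sum.mono_neutral_cong_right) (auto simp: G_def trunc_def)
  qed
  then show "(\<lambda>n. jac (trunc (square n) f) (trunc (square n) g) m) \<longlonglongrightarrow> jac f g m"
    using tendsto_exhaust[OF s fl] by (simp add: jac_def)
qed

text \<open>Regularity 1 - b on the Hoelder-Besov scale, with sharp frequency cut-offs. Bounds for
  the derivatives of a block are part of the definition, which avoids Bernstein's inequality;
  \<open>f 0 = 0\<close> is demanded because no shell contains the zero frequency.\<close>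

definition besov :: "real \<Rightarrow> real \<Rightarrow> coeffs \<Rightarrow> bool" where
  "besov b K f \<longleftrightarrow> f 0 = 0 \<and> (\<forall>n x.
     cmod (\<Sum>k\<in>shell n. f k * fexp k x) \<le> K * (2 ^ n) powr (b - 1) \<and>
     cmod (\<Sum>k\<in>shell n. of_real (kx k) * f k * fexp k x) \<le> K * (2 ^ n) powr b \<and>
     cmod (\<Sum>k\<in>shell n. of_real (ky k) * f k * fexp k x) \<le> K * (2 ^ n) powr b)"

lemma besovD:
  assumes "besov b K f"
  shows "f 0 = 0"
    "cmod (\<Sum>k\<in>shell n. f k * fexp k x) \<le> K * (2 ^ n) powr (b - 1)"
    "cmod (\<Sum>k\<in>shell n. of_real (kx k) * f k * fexp k x) \<le> K * (2 ^ n) powr b"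
    "cmod (\<Sum>k\<in>shell n. of_real (ky k) * f k * fexp k x) \<le> K * (2 ^ n) powr b"
  using assms unfolding besov_def by blast+

text \<open>Frequencies above N are estimated by the L2 bound, those below N by the bound in H^(-1).
  N stays free so that it can be put at the scale of a block.\<close>

lemma sobolev_interp:
  assumes J: "sobolev 0 f P" "sobolev (- 1) f Q" and N: "1 \<le> N" and s: "0 \<le> s" "s \<le> 1"
  shows "sobolev (- s) f (N powr (- s) * P + N powr (1 - s) * Q)"
  unfolding sobolev_def
proof (intro allI impI)
  fix F :: "(int \<times> int) set" assume F: "finite F"
  have p: "sz k powr (- s) \<le> N powr (- s) * sz k powr 0 + N powr (1 - s) * sz k powr (- 1)" for k
  proof (cases "N \<le> sz k")
    case True
    then have "sz k powr (- s) \<le> N powr (- s)" using N s by (intro powr_mono2') auto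
    also have "\<dots> \<le> N powr (- s) * sz k powr 0 + N powr (1 - s) * sz k powr (- 1)"
      using sz_pos[of k] by simp
    finally show ?thesis .
  next
    case False
    have "sz k powr (- s) = sz k powr (1 - s) * sz k powr (- 1)" unfolding powr_add[symmetric] by simp
    also have "\<dots> \<le> N powr (1 - s) * sz k powr (- 1)"
      using False s sz_pos[of k] by (intro mult_right_mono powr_mono2) auto
    also have "\<dots> \<le> N powr (- s) * sz k powr 0 + N powr (1 - s) * sz k powr (- 1)" by simp
    finally show ?thesis .
  qed
  have "L2_set (\<lambda>k. sz k powr (- s) * cmod (f k)) F
    \<le> L2_set (\<lambda>k. N powr (- s) * (sz k powr 0 * cmod (f k)) + N powr (1 - s) * (sz k powr (- 1) * cmod (f k))) F"
  proof (rule L2_set_mono)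
    fix k
    show "sz k powr (- s) * cmod (f k) \<le> N powr (- s) * (sz k powr 0 * cmod (f k)) + N powr (1 - s) * (sz k powr (- 1) * cmod (f k))"
      using mult_right_mono[OF p[of k], of "cmod (f k)"] by (simp add: distrib_right mult.assoc)
  qed simp
  also have "\<dots> \<le> L2_set (\<lambda>k. N powr (- s) * (sz k powr 0 * cmod (f k))) F + L2_set (\<lambda>k. N powr (1 - s) * (sz k powr (- 1) * cmod (f k))) F"
    by (rule L2_set_triangle_ineq)
  also have "\<dots> = N powr (- s) * L2_set (\<lambda>k. sz k powr 0 * cmod (f k)) F + N powr (1 - s) * L2_set (\<lambda>k. sz k powr (- 1) * cmod (f k)) F"
    by (simp add: L2_set_right_distrib)
  also have "\<dots> \<le> N powr (- s) * P + N powr (1 - s) * Q"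
    using F by (intro add_mono mult_left_mono sobolevD[OF J(1)] sobolevD[OF J(2)]) auto
  finally show "L2_set (\<lambda>k. sz k powr (- s) * cmod (f k)) F \<le> N powr (- s) * P + N powr (1 - s) * Q" .
qed

lemma sobolev_kx: "sobolev 1 g D \<Longrightarrow> sobolev 0 (\<lambda>k. of_real (kx k) * g k) D"
  and sobolev_ky: "sobolev 1 g D \<Longrightarrow> sobolev 0 (\<lambda>k. of_real (ky k) * g k) D"
  using sz_pos sz_nonneg kx_le_sz ky_le_sz
  by (auto elim!: sobolev_dom1 simp: norm_mult less_imp_neq[THEN not_sym] intro!: mult_right_mono)

lemma sobolev_kx': "sobolev 0 g D \<Longrightarrow> sobolev (- 1) (\<lambda>k. of_real (kx k) * g k) D"
  and sobolev_ky': "sobolev 0 g D \<Longrightarrow> sobolev (- 1) (\<lambda>k. of_real (ky k) * g k) D"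
proof -
  have "sz k powr (- 1) * cmod (of_real a * g k) \<le> sz k powr 0 * cmod (g k)" if "\<bar>a\<bar> \<le> sz k" for a k
  proof -
    have "sz k powr (- 1) * \<bar>a\<bar> \<le> 1"
      using that sz_pos[of k] by (simp add: powr_minus powr_one divide_simps split: if_splits)
    from mult_right_mono[OF this, of "cmod (g k)"] show ?thesis
      using sz_pos[of k] by (simp add: norm_mult mult.assoc)
  qed
  then show "sobolev 0 g D \<Longrightarrow> sobolev (- 1) (\<lambda>k. of_real (kx k) * g k) D"
    "sobolev 0 g D \<Longrightarrow> sobolev (- 1) (\<lambda>k. of_real (ky k) * g k) D"
    using kx_le_sz ky_le_sz by (blast intro: sobolev_dom1)+
qed

text \<open>The null structure: since \<open>k \<and> l = k \<and> m = m \<and> l\<close> for \<open>k + l = m\<close>, one derivative may be moved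
  to the output frequency \<open>m\<close>, which is what makes the high-high-to-low interactions summable.\<close>

lemma jac_block:
  assumes B0: "\<And>x. cmod (\<Sum>k\<in>shell n. f k * fexp k x) \<le> K * (2 ^ n) powr (b - 1)"
    and B1: "\<And>x. cmod (\<Sum>k\<in>shell n. of_real (kx k) * f k * fexp k x) \<le> K * (2 ^ n) powr b"
      "\<And>x. cmod (\<Sum>k\<in>shell n. of_real (ky k) * f k * fexp k x) \<le> K * (2 ^ n) powr b"
    and g: "sobolev 1 g D" and s: "0 \<le> s" "s \<le> 1"
  shows "sobolev (- s) (jac (trunc (shell n) f) g) (4 * K * D * (2 ^ n) powr (b - s))"
proof -
  let ?J = "jac (trunc (shell n) f) g"
  let ?C = "\<lambda>p v m. \<Sum>k\<in>shell n. p k * v (m - k)"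
  note conv = sobolev_convolution_trig[OF finite_shell]
  \<comment> \<open>L2 bound: both derivatives stay on the factors, and the differentiated block of
    f has size \<open>(2 ^ n) powr b\<close>.\<close>
  have 0: "sobolev 0 ?J (K * (2 ^ n) powr b * D + K * (2 ^ n) powr b * D)"
  proof -
    have "sobolev 0 (\<lambda>m. ?C (\<lambda>k. of_real (kx k) * f k) (\<lambda>k. of_real (ky k) * g k) m
        - ?C (\<lambda>k. of_real (ky k) * f k) (\<lambda>k. of_real (kx k) * g k) m) (K * (2 ^ n) powr b * D + K * (2 ^ n) powr b * D)"
      by (intro sobolev_diff conv B1 sobolev_kx sobolev_ky g)
    also have "(\<lambda>m. ?C (\<lambda>k. of_real (kx k) * f k) (\<lambda>k. of_real (ky k) * g k) m
        - ?C (\<lambda>k. of_real (ky k) * f k) (\<lambda>k. of_real (kx k) * g k) m) = ?J"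
      unfolding fun_eq_iff jac_trunc[OF finite_shell] sum_subtractf[symmetric]
      by (intro allI sum.cong refl) (simp add: wedge_def algebra_simps)
    finally show ?thesis .
  qed
  \<comment> \<open>Bound in H^(-1): the derivative leaves the block of f, which becomes smaller by
    the factor \<open>2 ^ n\<close>, and falls on the output frequency m.\<close>
  have 1: "sobolev (- 1) ?J (K * (2 ^ n) powr (b - 1) * D + K * (2 ^ n) powr (b - 1) * D)"
  proof -
    have "sobolev (- 1) (\<lambda>m. of_real (kx m) * ?C f (\<lambda>k. of_real (ky k) * g k) m
        - of_real (ky m) * ?C f (\<lambda>k. of_real (kx k) * g k) m) (K * (2 ^ n) powr (b - 1) * D + K * (2 ^ n) powr (b - 1) * D)"
      by (intro sobolev_diff sobolev_kx' sobolev_ky' conv B0 sobolev_kx sobolev_ky g)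
    also have "(\<lambda>m. of_real (kx m) * ?C f (\<lambda>k. of_real (ky k) * g k) m
        - of_real (ky m) * ?C f (\<lambda>k. of_real (kx k) * g k) m) = ?J"
      unfolding fun_eq_iff jac_trunc[OF finite_shell] sum_subtractf[symmetric] sum_distrib_left
      by (intro allI sum.cong refl) (simp add: wedge_def algebra_simps)
    finally show ?thesis .
  qed
  \<comment> \<open>Splitting at N = 2 ^ n makes both contributions of the same order
    \<open>(2 ^ n) powr (b - s)\<close>.\<close>
  have "sobolev (- s) ?J ((2 ^ n) powr (- s) * (K * (2 ^ n) powr b * D + K * (2 ^ n) powr b * D)
      + (2 ^ n) powr (1 - s) * (K * (2 ^ n) powr (b - 1) * D + K * (2 ^ n) powr (b - 1) * D))"
    by (rule sobolev_interp[OF 0 1 _ s]) simp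
  also have "(2 ^ n) powr (- s) * (K * (2 ^ n) powr b * D + K * (2 ^ n) powr b * D)
      + (2 ^ n) powr (1 - s) * (K * (2 ^ n) powr (b - 1) * D + K * (2 ^ n) powr (b - 1) * D)
      = 2 * K * D * ((2 ^ n) powr (- s) * (2 ^ n) powr b) + 2 * K * D * ((2 ^ n) powr (1 - s) * (2 ^ n) powr (b - 1))"
    by (simp add: algebra_simps)
  also have "\<dots> = 4 * K * D * (2 ^ n) powr (b - s)"
    unfolding powr_add[symmetric] by (simp add: algebra_simps)
  finally show ?thesis .
qed

lemma trunc_square_Suc:
  "trunc (square (Suc n)) f = (\<lambda>k. trunc (square n) f k + trunc (shell n) f k)"
  using square_shell_disjoint[of n] by (auto simp: trunc_def square_Suc fun_eq_iff)

lemma sobolev_trunc_shell: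
  assumes f: "besov b K f"
  shows "sobolev 1 (trunc (shell n) f) (2 * K * (2 ^ n) powr b)"
proof -
  have 1: "sobolev 0 (\<lambda>k. of_real (kx k) * trunc (shell n) f k) (K * (2 ^ n) powr b)"
    "sobolev 0 (\<lambda>k. of_real (ky k) * trunc (shell n) f k) (K * (2 ^ n) powr b)"
  proof -
    have "sobolev 0 (\<lambda>k. if k \<in> shell n then of_real (kx k) * f k else 0) (K * (2 ^ n) powr b)"
      "sobolev 0 (\<lambda>k. if k \<in> shell n then of_real (ky k) * f k else 0) (K * (2 ^ n) powr b)"
      by (intro sobolev_trig_coeff finite_shell besovD[OF f])+
    moreover have "(\<lambda>k. of_real (c k) * trunc (shell n) f k) = (\<lambda>k. if k \<in> shell n then of_real (c k) * f k else 0)" for c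
      by (auto simp: trunc_def)
    ultimately show "sobolev 0 (\<lambda>k. of_real (kx k) * trunc (shell n) f k) (K * (2 ^ n) powr b)"
      "sobolev 0 (\<lambda>k. of_real (ky k) * trunc (shell n) f k) (K * (2 ^ n) powr b)" by simp_all
  qed
  \<comment> \<open>\<open>sobolev\<close> sees moduli only. Replacing both sequences by their
    moduli allows adding them, and |kx| + |ky| dominates \<open>sz\<close> away from 0.\<close>
  have abs: "sobolev 0 (\<lambda>k. of_real (cmod (h k))) R" if "sobolev 0 h R" for h R
    using that by (simp add: sobolev_def)
  have "sobolev 0 (\<lambda>k. of_real (cmod (of_real (kx k) * trunc (shell n) f k)) + of_real (cmod (of_real (ky k) * trunc (shell n) f k)))
      (K * (2 ^ n) powr b + K * (2 ^ n) powr b)"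
    by (intro sobolev_add abs 1)
  moreover have "sz k powr 1 * cmod (trunc (shell n) f k) \<le> sz k powr 0 *
    cmod (of_real (cmod (of_real (kx k) * trunc (shell n) f k)) + of_real (cmod (of_real (ky k) * trunc (shell n) f k)))" for k
  proof (cases "k \<in> shell n")
    case True
    then have "k \<noteq> 0" by auto
    then have "sz k \<le> \<bar>kx k\<bar> + \<bar>ky k\<bar>" unfolding sz_of_int[OF \<open>k \<noteq> 0\<close>] kx_def ky_def of_int_max of_int_abs by linarith
    from mult_right_mono[OF this, of "cmod (f k)"] True sz_pos[of k]
    show ?thesis by (simp add: trunc_def norm_mult of_real_add[symmetric] distrib_right del: of_real_add of_real_mult)
  qed (simp add: trunc_def)
  ultimately have "sobolev 1 (trunc (shell n) f) (K * (2 ^ n) powr b + K * (2 ^ n) powr b)"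
    by (rule sobolev_dom1)
  then show ?thesis by (simp add: mult.assoc)
qed

lemma besov_nonneg: "besov b K f \<Longrightarrow> 0 \<le> K"
proof -
  assume "besov b K f"
  then have "cmod (\<Sum>k\<in>shell 0. f k * fexp k 0) \<le> K * (2 ^ 0) powr (b - 1)" unfolding besov_def by blast
  then have "cmod (\<Sum>k\<in>shell 0. f k * fexp k 0) \<le> K" by simp
  then show ?thesis using norm_ge_zero order_trans by blast
qed

lemma sum_geo_up:
  fixes b :: real
  assumes "0 < b"
  shows "(\<Sum>i<n. (2 ^ i) powr b) \<le> (2 ^ n) powr b / (2 powr b - 1)"
proof -
  have b: "1 < (2::real) powr b" using assms by simp
  have "(\<Sum>i<n. (2 ^ i) powr b) = (\<Sum>i<n. (2 powr b) ^ i)" by (simp only: pow2_powr)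
  also have "\<dots> = ((2 powr b) ^ n - 1) / (2 powr b - 1)" using b by (subst geometric_sum) auto
  also have "\<dots> \<le> (2 powr b) ^ n / (2 powr b - 1)" using b by (intro divide_right_mono) auto
  finally show ?thesis by (simp only: pow2_powr)
qed

text \<open>For b > 0 the bounds on the shells grow geometrically, so the last shell dominates the
  H^1 norm of the low frequencies.\<close>

lemma sobolev_trunc_square:
  assumes f: "besov b K f" and b: "0 < b"
  shows "sobolev 1 (trunc (square n) f) (2 * K / (2 powr b - 1) * (2 ^ n) powr b)"
proof -
  have K: "0 \<le> K" using besov_nonneg[OF f] .
  have "sobolev 1 (trunc (square n) f) (\<Sum>i<n. 2 * K * (2 ^ i) powr b)"
  proof (induction n)
    case 0
    have "trunc (square 0) f = (\<lambda>_. 0)" using f by (auto simp: trunc_def square_0 besov_def)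
    then show ?case by (simp add: sobolev_0)
  next
    case (Suc n)
    show ?case unfolding trunc_square_Suc using sobolev_add[OF Suc sobolev_trunc_shell[OF f, of n]] by simp
  qed
  moreover have "(\<Sum>i<n. 2 * K * (2 ^ i) powr b) \<le> 2 * K / (2 powr b - 1) * (2 ^ n) powr b"
    unfolding sum_distrib_left[symmetric]
    using mult_left_mono[OF sum_geo_up[OF b, of n], of "2 * K"] K by simp
  ultimately show ?thesis by (rule sobolev_mono)
qed

text \<open>The blocks of f contribute terms of order \<open>(2 ^ i) powr (b - s)\<close> against
  the fixed H^1 norm of g, a summable series for b < s.\<close>

lemma sobolev_jac_besov:
  assumes f: "besov b K f" "sobolev 1 f D'" and g: "sobolev 1 g D" and s: "0 \<le> s" "s \<le> 1" "b < s"
  shows "sobolev (- s) (jac f g) (4 * K * D * geo (s - b))"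
proof (rule sobolev_lim_const)
  fix n
  have "sobolev (- s) (jac (trunc (square n) f) g) (\<Sum>i<n. 4 * K * D * (2 ^ i) powr (b - s))"
  proof (induction n)
    case 0
    have "trunc (square 0) f = (\<lambda>_. 0)" using f by (auto simp: trunc_def square_0 besov_def)
    then show ?case by (simp add: sobolev_0 jac_def)
  next
    case (Suc n)
    have "sobolev (- s) (\<lambda>m. jac (trunc (square n) f) g m + jac (trunc (shell n) f) g m)
      ((\<Sum>i<n. 4 * K * D * (2 ^ i) powr (b - s)) + 4 * K * D * (2 ^ n) powr (b - s))"
      by (intro sobolev_add Suc jac_block g s) (use f in \<open>auto simp: besov_def\<close>)
    also have "(\<lambda>m. jac (trunc (square n) f) g m + jac (trunc (shell n) f) g m) = jac (trunc (square (Suc n)) f) g"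
      unfolding trunc_square_Suc fun_eq_iff
      using jac_add_left[OF trunc_sobolev[OF f(2)] trunc_sobolev[OF f(2)] g] by simp
    finally show ?case by simp
  qed
  moreover have "(\<Sum>i<n. 4 * K * D * (2 ^ i) powr (b - s)) \<le> 4 * K * D * geo (s - b)"
    unfolding sum_distrib_left[symmetric] using sum_geo[of "s - b" n] s besov_nonneg[OF f(1)] sobolev_nonneg[OF g]
    by (intro mult_left_mono) auto
  ultimately show "sobolev (- s) (jac (trunc (square n) f) g) (4 * K * D * geo (s - b))" by (rule sobolev_mono)
qed (rule jac_trunc_tendsto[OF f(2) g])

text \<open>Expanding f alone would bring in the H^1 norm of g, which the block bounds do not
  control. Enlarging both squares simultaneously pairs each new block with a factor truncated at the
  same scale, whose H^1 norm is of order \<open>(2 ^ n) powr b\<close>; this leaves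
  \<open>(2 ^ n) powr (2 * b - s)\<close>.\<close>

lemma sobolev_jac_besov_besov:
  assumes f: "besov b K f" "sobolev 1 f D" and g: "besov b K' g" "sobolev 1 g D'"
    and s: "s \<le> 1" "0 < b" "2 * b < s"
  shows "sobolev (- s) (jac f g) (16 * 2 powr b / (2 powr b - 1) * geo (s - 2 * b) * K * K')"
proof (rule sobolev_lim_const)
  fix n
  have K: "0 \<le> K" "0 \<le> K'" using besov_nonneg f g by blast+
  have b1: "1 < 2 powr b" using s by simp
  \<comment> \<open>The increment with the block of f carries \<open>2 powr b\<close>, as the other
    factor is truncated one level higher; the one with the block of g carries 1.\<close>
  define c where "c = 8 * K * K' * (1 + 2 powr b) / (2 powr b - 1)"
  have "sobolev (- s) (jac (trunc (square n) f) (trunc (square n) g)) (\<Sum>i<n. c * (2 ^ i) powr (2 * b - s))"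
  proof (induction n)
    case 0
    have "trunc (square 0) f = (\<lambda>_. 0)" using f by (auto simp: trunc_def square_0 besov_def)
    then show ?case by (simp add: sobolev_0 jac_def)
  next
    case (Suc n)
    let ?f = "trunc (square n) f" and ?g = "trunc (square n) g" and ?g' = "trunc (square (Suc n)) g"
    have 1: "sobolev (- s) (jac (trunc (shell n) f) ?g') (4 * K * (2 * K' / (2 powr b - 1) * (2 ^ Suc n) powr b) * (2 ^ n) powr (b - s))"
      by (intro jac_block sobolev_trunc_square g(1)) (use s f in \<open>auto simp: besov_def\<close>)
    have 2: "sobolev (- s) (jac (trunc (shell n) g) ?f) (4 * K' * (2 * K / (2 powr b - 1) * (2 ^ n) powr b) * (2 ^ n) powr (b - s))"
      by (intro jac_block sobolev_trunc_square f(1)) (use s g in \<open>auto simp: besov_def\<close>)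
    \<comment> \<open>Telescoping, with antisymmetry used to bring the block of g into the first
      slot, where \<open>jac_block\<close> applies.\<close>
    have eq: "jac (trunc (square (Suc n)) f) ?g' m = jac ?f ?g m + (jac (trunc (shell n) f) ?g' m - jac (trunc (shell n) g) ?f m)" for m
    proof -
      have "jac (trunc (square (Suc n)) f) ?g' m = jac ?f ?g' m + jac (trunc (shell n) f) ?g' m"
        unfolding trunc_square_Suc[of n f] by (rule jac_add_left[OF trunc_sobolev[OF f(2)] trunc_sobolev[OF f(2)] trunc_sobolev[OF g(2)]])
      also have "jac ?f ?g' m = jac ?f ?g m + jac ?f (trunc (shell n) g) m"
        unfolding trunc_square_Suc[of n g] by (rule jac_add_right[OF trunc_sobolev[OF f(2)] trunc_sobolev[OF g(2)] trunc_sobolev[OF g(2)]])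
      finally show ?thesis using jac_antisym[of "trunc (shell n) g" ?f m] by simp
    qed
    have "sobolev (- s) (\<lambda>m. jac ?f ?g m + (jac (trunc (shell n) f) ?g' m - jac (trunc (shell n) g) ?f m))
      ((\<Sum>i<n. c * (2 ^ i) powr (2 * b - s)) + (4 * K * (2 * K' / (2 powr b - 1) * (2 ^ Suc n) powr b) * (2 ^ n) powr (b - s)
         + 4 * K' * (2 * K / (2 powr b - 1) * (2 ^ n) powr b) * (2 ^ n) powr (b - s)))"
      by (intro sobolev_add sobolev_diff Suc 1 2)
    moreover have "4 * K * (2 * K' / (2 powr b - 1) * (2 ^ Suc n) powr b) * (2 ^ n) powr (b - s)
         + 4 * K' * (2 * K / (2 powr b - 1) * (2 ^ n) powr b) * (2 ^ n) powr (b - s) = c * (2 ^ n) powr (2 * b - s)"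
    proof -
      have p: "(2 ^ Suc n) powr b = 2 powr b * (2 ^ n) powr b" by (simp add: powr_mult)
      have q: "(2 ^ n) powr (2 * b - s) = (2 ^ n) powr b * (2 ^ n) powr (b - s)" by (simp add: powr_add[symmetric])
      show ?thesis unfolding p q c_def using b1 by (simp add: add_divide_distrib[symmetric] algebra_simps)
    qed
    ultimately show ?case unfolding eq[abs_def] by simp
  qed
  moreover have "(\<Sum>i<n. c * (2 ^ i) powr (2 * b - s)) \<le> 16 * 2 powr b / (2 powr b - 1) * geo (s - 2 * b) * K * K'"
  proof -
    have c: "0 \<le> c" "c \<le> 16 * 2 powr b / (2 powr b - 1) * K * K'"
    proof -
      show "0 \<le> c" unfolding c_def using K b1 by simp
      have "8 * (1 + 2 powr b) / (2 powr b - 1) \<le> 16 * 2 powr b / (2 powr b - 1)"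
        using b1 by (intro divide_right_mono) auto
      from mult_right_mono[OF this, of "K * K'"] K
      show "c \<le> 16 * 2 powr b / (2 powr b - 1) * K * K'" by (simp add: c_def ac_simps)
    qed
    have "(\<Sum>i<n. c * (2 ^ i) powr (2 * b - s)) \<le> c * geo (s - 2 * b)"
      unfolding sum_distrib_left[symmetric] using sum_geo[of "s - 2 * b" n] s c by (intro mult_left_mono) auto
    also have "\<dots> \<le> 16 * 2 powr b / (2 powr b - 1) * K * K' * geo (s - 2 * b)"
      using c s geo_pos[of "s - 2 * b"] by (intro mult_right_mono) auto
    finally show ?thesis by (simp add: ac_simps)
  qed
  ultimately show "sobolev (- s) (jac (trunc (square n) f) (trunc (square n) g)) (16 * 2 powr b / (2 powr b - 1) * geo (s - 2 * b) * K * K')"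
    by (rule sobolev_mono)
qed (rule jac_trunc_tendsto[OF f(2) g(2)])

section \<open>Products of Sobolev sequences\<close>

lemma young_summable:
  assumes h: "\<And>F. finite F \<Longrightarrow> (\<Sum>k\<in>F. cmod (h k)) \<le> H" and u: "sobolev 0 u E"
  shows "(\<lambda>k. h k * u (m - k)) summable_on UNIV"
proof (rule abs_summable_summable, unfold abs_summable_iff_bdd_above, rule bdd_aboveI2)
  fix F :: "(int \<times> int) set" assume "F \<in> {F. F \<subseteq> UNIV \<and> finite F}"
  then have F: "finite F" by simp
  have "cmod (u k) \<le> E" for k using sobolev_coord[OF u, of k] sz_pos[of k] by simp
  then have "(\<Sum>k\<in>F. cmod (h k * u (m - k))) \<le> (\<Sum>k\<in>F. cmod (h k)) * E"
    unfolding sum_distrib_right by (intro sum_mono) (simp add: norm_mult mult_left_mono)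
  also have "\<dots> \<le> H * E" by (intro mult_right_mono h F sobolev_nonneg[OF u])
  finally show "(\<Sum>k\<in>F. cmod (h k * u (m - k))) \<le> H * E" .
qed

lemma sobolev_shift: "sobolev 0 u E \<Longrightarrow> sobolev 0 (\<lambda>m. u (m - k)) E"
  unfolding sobolev_def
proof (intro allI impI)
  fix F :: "(int \<times> int) set" assume u: "\<forall>F. finite F \<longrightarrow> L2_set (\<lambda>k. sz k powr 0 * cmod (u k)) F \<le> E" and F: "finite F"
  have "L2_set (\<lambda>m. sz m powr 0 * cmod (u (m - k))) F = L2_set (\<lambda>k. sz k powr 0 * cmod (u k)) ((\<lambda>m. m - k) ` F)"
    using sz_pos by (subst L2_set_reindex) (auto simp: inj_on_def o_def less_imp_neq[THEN not_sym])
  also have "\<dots> \<le> E" using u F by blast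
  finally show "L2_set (\<lambda>m. sz m powr 0 * cmod (u (m - k))) F \<le> E" .
qed

text \<open>Young's inequality for h in l1 and u in l2: a finite combination of shifts, each of
  which preserves the l2 bound, followed by a limit.\<close>

lemma young:
  assumes h: "\<And>F. finite F \<Longrightarrow> (\<Sum>k\<in>F. cmod (h k)) \<le> H" and u: "sobolev 0 u E"
  shows "sobolev 0 (\<lambda>m. \<Sum>\<^sub>\<infinity>k. h k * u (m - k)) (H * E)"
proof (rule sobolev_lim[where F="finite_subsets_at_top UNIV" and R="\<lambda>_. H * E"])
  show "((\<lambda>F. \<Sum>k\<in>F. h k * u (m - k)) \<longlongrightarrow> (\<Sum>\<^sub>\<infinity>k. h k * u (m - k))) (finite_subsets_at_top UNIV)" for m
    by (rule infsum_tendsto[OF young_summable[OF h u]])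
  show "\<forall>\<^sub>F F in finite_subsets_at_top UNIV. sobolev 0 (\<lambda>m. \<Sum>k\<in>F. h k * u (m - k)) (H * E)"
  proof (rule eventually_finite_subsets_at_top_weakI)
    fix F :: "(int \<times> int) set" assume F: "finite F"
    have "sobolev 0 (\<lambda>m. \<Sum>k\<in>F. h k * u (m - k)) (\<Sum>k\<in>F. cmod (h k) * E)"
      by (intro sobolev_sum sobolev_cmult sobolev_shift u)
    then show "sobolev 0 (\<lambda>m. \<Sum>k\<in>F. h k * u (m - k)) (H * E)"
      by (rule sobolev_mono) (auto simp: sum_distrib_right[symmetric] intro!: mult_right_mono h F sobolev_nonneg[OF u])
  qed
qed auto

definition szsum :: "real \<Rightarrow> real" where "szsum t = 1 + 16 * geo (t - 2)"

text \<open>Cauchy-Schwarz against \<open>sz k powr (- (t - r))\<close>, which is square summable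
  over the two-dimensional lattice because t - r > 1.\<close>

lemma l1_bound:
  assumes f: "sobolev t f D" and t: "1 < t - r" and F: "finite F"
  shows "(\<Sum>k\<in>F. sz k powr r * cmod (f k)) \<le> sqrt (szsum (2 * (t - r))) * D"
proof -
  have "(\<Sum>k\<in>F. sz k powr r * cmod (f k)) = (\<Sum>k\<in>F. \<bar>sz k powr (- (t - r))\<bar> * \<bar>sz k powr t * cmod (f k)\<bar>)"
    by (intro sum.cong refl) (simp add: mult.assoc[symmetric] powr_add[symmetric])
  also have "\<dots> \<le> L2_set (\<lambda>k. sz k powr (- (t - r))) F * L2_set (\<lambda>k. sz k powr t * cmod (f k)) F"
    by (rule L2_set_mult_ineq)
  also have "\<dots> \<le> sqrt (szsum (2 * (t - r))) * D"
  proof (intro mult_mono sobolevD[OF f F])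
    have "(\<Sum>k\<in>F. (sz k powr (- (t - r)))\<^sup>2) = (\<Sum>k\<in>F. sz k powr (- (2 * (t - r))))"
    proof (intro sum.cong refl)
      fix k show "(sz k powr (- (t - r)))\<^sup>2 = sz k powr (- (2 * (t - r)))"
        unfolding power2_eq_square powr_add[symmetric] by simp
    qed
    also have "\<dots> \<le> szsum (2 * (t - r))" unfolding szsum_def using t F by (intro sum_sz_bound) auto
    finally show "L2_set (\<lambda>k. sz k powr (- (t - r))) F \<le> sqrt (szsum (2 * (t - r)))"
      unfolding L2_set_def by (rule real_sqrt_le_mono)
    show "0 \<le> sqrt (szsum (2 * (t - r)))" using t geo_pos[of "2 * (t - r) - 2"] by (simp add: szsum_def)
  qed auto
  finally show ?thesis .
qed

text \<open>The output frequency is at most twice the larger input frequency l, so l can carry the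
  whole weight \<tau> - \<sigma>, and in addition \<sigma> powers handed over from k.\<close>

lemma jac_term_low_high:
  assumes s: "0 \<le> \<sigma>" "\<sigma> \<le> \<tau>" and le: "sz k \<le> sz l"
    and that: "0 \<le> F" "0 \<le> G"
  shows "sz (k + l) powr (\<tau> - \<sigma>) * (sz k * F) * (sz l * G) \<le> 
    2 powr (\<tau> - \<sigma>) * ((sz k powr (1 - \<sigma>) * F) * (sz l powr (1 + \<tau>) * G))"
proof -
  have "sz (k + l) \<le> 2 * sz l" using sz_add[of k l] le by simp
  then have "sz (k + l) powr (\<tau> - \<sigma>) \<le> (2 * sz l) powr (\<tau> - \<sigma>)"
    using s sz_pos[of "k + l"] by (intro powr_mono2) auto
  also have "\<dots> = 2 powr (\<tau> - \<sigma>) * (sz l powr (\<tau> - \<sigma>))" using sz_pos[of l] by (simp add: powr_mult)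
  finally have 1: "sz (k + l) powr (\<tau> - \<sigma>) \<le> 2 powr (\<tau> - \<sigma>) * (sz l powr (\<tau> - \<sigma>))" .
  have "sz k powr \<sigma> \<le> sz l powr \<sigma>" using le s sz_pos[of k] by (intro powr_mono2) auto
  have 2: "sz k = sz k powr (1 - \<sigma>) * sz k powr \<sigma>" using sz_pos[of k] by (simp add: powr_add[symmetric])
  have 3: "sz l powr (1 + \<tau>) = sz l powr (\<tau> - \<sigma>) * sz l powr \<sigma> * sz l"
    using sz_pos[of l] by (simp add: powr_add[symmetric] powr_mult_base mult.commute)
  have "sz (k + l) powr (\<tau> - \<sigma>) * (sz k * F) * (sz l * G) = sz (k + l) powr (\<tau> - \<sigma>) * (sz k powr \<sigma> * (sz k powr (1 - \<sigma>) * F * (sz l * G)))"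
    by (subst 2) (simp add: ac_simps)
  also have "\<dots> \<le> (2 powr (\<tau> - \<sigma>) * (sz l powr (\<tau> - \<sigma>))) * (sz l powr \<sigma> * (sz k powr (1 - \<sigma>) * F * (sz l * G)))"
    using that sz_pos[of l] by (intro mult_mono 1 mult_right_mono \<open>sz k powr \<sigma> \<le> sz l powr \<sigma>\<close>) auto
  also have "\<dots> = 2 powr (\<tau> - \<sigma>) * ((sz k powr (1 - \<sigma>) * F) * (sz l powr (1 + \<tau>) * G))"
    unfolding 3 by (simp add: ac_simps)
  finally show ?thesis .
qed

text \<open>A tame estimate: the high norms, of exponent 1 + \<tau>, enter linearly, multiplied by
  low norms of exponent 1 + \<sigma>, so that regularity can be bootstrapped. The low factor, with
  weight 1 - \<sigma>, is in l1 because 2 * \<sigma> > 1, and Young's inequality applies.\<close>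

lemma sobolev_jac_sobolev:
  assumes f: "sobolev (1 + \<sigma>) f D1" "sobolev (1 + \<tau>) f D2" and g: "sobolev (1 + \<sigma>) g E1" "sobolev (1 + \<tau>) g E2"
    and s: "1 / 2 < \<sigma>" "\<sigma> \<le> \<tau>"
  shows "sobolev (\<tau> - \<sigma>) (jac f g) (2 * 2 powr (\<tau> - \<sigma>) * sqrt (szsum (4 * \<sigma>)) * (D1 * E2 + D2 * E1))"
proof -
  define H where "H = sqrt (szsum (4 * \<sigma>))"
  have f1: "sobolev 1 f D1" and g1: "sobolev 1 g E1" using sobolev_exp_mono[OF f(1)] sobolev_exp_mono[OF g(1)] s by auto
  define lo where "lo f k = complex_of_real (sz k powr (1 - \<sigma>) * cmod (f k))" for f k
  define hi where "hi f k = complex_of_real (sz k powr (1 + \<tau>) * cmod (f k))" for f k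
  have lo: "(\<Sum>k\<in>F. cmod (lo f k)) \<le> H * D" if "sobolev (1 + \<sigma>) f D" "finite F" for f D F
    using l1_bound[OF that(1) _ that(2), of "1 - \<sigma>"] s unfolding lo_def H_def by (simp add: mult.commute norm_mult)
  have hi: "sobolev 0 (hi f) D" if "sobolev (1 + \<tau>) f D" for f D
    using that sz_pos by (simp add: sobolev_def hi_def norm_mult less_imp_neq[THEN not_sym])
  let ?c1 = "\<lambda>m. \<Sum>\<^sub>\<infinity>k. lo f k * hi g (m - k)" and ?c2 = "\<lambda>m. \<Sum>\<^sub>\<infinity>k. lo g k * hi f (m - k)"
  have c: "sobolev 0 (\<lambda>m. ?c1 m + ?c2 m) (H * D1 * E2 + H * E1 * D2)"
    by (intro sobolev_add young lo hi f g)
  let ?t = "\<lambda>m k. of_real (wedge k (m - k)) * f k * g (m - k)"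
  \<comment> \<open>\<open>r\<close> majorises the Jacobian term: its first summand serves the case
    in which k is the lower frequency, its second the case in which m - k is.\<close>
  define r where "r m k = (sz k powr (1 - \<sigma>) * cmod (f k)) * (sz (m - k) powr (1 + \<tau>) * cmod (g (m - k)))
      + (sz (m - k) powr (1 - \<sigma>) * cmod (g (m - k))) * (sz k powr (1 + \<tau>) * cmod (f k))" for m k
  have t: "sz m powr (\<tau> - \<sigma>) * cmod (?t m k) \<le> 2 * 2 powr (\<tau> - \<sigma>) * r m k" for m k
  proof -
    have "sz m powr (\<tau> - \<sigma>) * cmod (?t m k) \<le> sz m powr (\<tau> - \<sigma>) * (2 * ((sz k * cmod (f k)) * (sz (m - k) * cmod (g (m - k)))))"
      using jac_term_le[of k "m - k" f g] sz_nonneg by (intro mult_left_mono) auto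
    also have "\<dots> = 2 * (sz m powr (\<tau> - \<sigma>) * (sz k * cmod (f k)) * (sz (m - k) * cmod (g (m - k))))"
      by (simp add: ac_simps)
    also have "\<dots> \<le> 2 * (2 powr (\<tau> - \<sigma>) * r m k)"
    proof (intro mult_left_mono)
      show "sz m powr (\<tau> - \<sigma>) * (sz k * cmod (f k)) * (sz (m - k) * cmod (g (m - k))) \<le> 2 powr (\<tau> - \<sigma>) * r m k"
      proof (cases "sz k \<le> sz (m - k)")
        case True
        then show ?thesis
          using jac_term_low_high[of \<sigma> \<tau> k "m - k" "cmod (f k)" "cmod (g (m - k))"] s
          unfolding r_def distrib_left by (auto simp: add_increasing2)
      next
        case False
        then show ?thesis
          using jac_term_low_high[of \<sigma> \<tau> "m - k" k "cmod (g (m - k))" "cmod (f k)"] s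
          unfolding r_def distrib_left by (auto simp: add_increasing ac_simps)
      qed
    qed simp
    finally show ?thesis by simp
  qed
  have sr: "((\<lambda>k. complex_of_real (r m k)) has_sum (?c1 m + ?c2 m)) UNIV" for m
  proof -
    have 1: "((\<lambda>k. lo f k * hi g (m - k)) has_sum ?c1 m) UNIV"
      by (intro has_sum_infsum young_summable[OF lo[OF f(1)] hi[OF g(2)]])
    have "((\<lambda>k. lo g k * hi f (m - k)) has_sum ?c2 m) UNIV"
      by (intro has_sum_infsum young_summable[OF lo[OF g(1)] hi[OF f(2)]])
    then have 2: "((\<lambda>k. lo g (m - k) * hi f k) has_sum ?c2 m) UNIV"
      by (subst has_sum_reindex_bij_witness[of _ "\<lambda>k. m - k" "\<lambda>k. m - k"]) auto
    show ?thesis using has_sum_add[OF 1 2] by (simp add: r_def lo_def hi_def)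
  qed
  have r0: "0 \<le> r m k" for m k by (simp add: r_def)
  have key: "sz m powr (\<tau> - \<sigma>) * cmod (jac f g m) \<le> (2 * 2 powr (\<tau> - \<sigma>)) * (sz m powr 0 * cmod (?c1 m + ?c2 m))" for m
  proof -
    have "(r m has_sum Re (?c1 m + ?c2 m)) UNIV" using has_sum_Re[OF sr] by simp
    then have rs: "(r m has_sum cmod (?c1 m + ?c2 m)) UNIV"
    proof -
      assume a: "(r m has_sum Re (?c1 m + ?c2 m)) UNIV"
      then have "0 \<le> Re (?c1 m + ?c2 m)" by (rule has_sum_nonneg) (rule r0)
      moreover have "((\<lambda>k::int \<times> int. 0::real) has_sum Im (?c1 m + ?c2 m)) UNIV" using has_sum_Im[OF sr[of m]] by simp
      then have "Im (?c1 m + ?c2 m) = 0" using has_sum_0_simp has_sum_unique by blast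
      ultimately have "cmod (?c1 m + ?c2 m) = Re (?c1 m + ?c2 m)" by (simp add: cmod_def)
      with a show ?thesis by simp
    qed
    have a: "sz m powr (\<tau> - \<sigma>) * cmod (jac f g m) = cmod (\<Sum>\<^sub>\<infinity>k. of_real (sz m powr (\<tau> - \<sigma>)) * ?t m k)"
      unfolding jac_def by (subst infsum_cmult_right') (simp add: norm_mult)
    have "((\<lambda>k. of_real (sz m powr (\<tau> - \<sigma>)) * ?t m k) has_sum (\<Sum>\<^sub>\<infinity>k. of_real (sz m powr (\<tau> - \<sigma>)) * ?t m k)) UNIV"
      by (intro has_sum_infsum summable_on_cmult_right jac_summable[OF f1 g1])
    moreover have "((\<lambda>k. (2 * 2 powr (\<tau> - \<sigma>)) * r m k) has_sum ((2 * 2 powr (\<tau> - \<sigma>)) * cmod (?c1 m + ?c2 m))) UNIV"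
      by (intro has_sum_cmult_right rs)
    ultimately have "cmod (\<Sum>\<^sub>\<infinity>k. of_real (sz m powr (\<tau> - \<sigma>)) * ?t m k) \<le> (2 * 2 powr (\<tau> - \<sigma>)) * cmod (?c1 m + ?c2 m)"
      by (rule norm_infsum_le) (use t[of m] in \<open>simp add: norm_mult\<close>)
    then show ?thesis unfolding a using sz_pos[of m] by simp
  qed
  have "sobolev (\<tau> - \<sigma>) (jac f g) ((2 * 2 powr (\<tau> - \<sigma>)) * (H * D1 * E2 + H * E1 * D2))"
    by (rule sobolev_dom[OF c _ key]) simp
  then show ?thesis unfolding H_def by (simp add: algebra_simps)
qed

text \<open>Supremum bounds control the L2 norms of blocks, by \<open>sobolev_trunc_shell\<close>;
  any loss s > b makes these summable.\<close>

lemma besov_sobolev: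
  assumes f: "besov b K f" and s: "0 \<le> s" "b < s"
  shows "sobolev (1 - s) f (2 * K * geo (s - b))"
proof (rule sobolev_lim_const)
  show "(\<lambda>n. trunc (square n) f k) \<longlonglongrightarrow> f k" for k
  proof (rule tendsto_eventually)
    have "\<forall>\<^sub>F n in sequentially. {k} \<subseteq> square n" by (rule eventually_in_square) simp
    then show "\<forall>\<^sub>F n in sequentially. trunc (square n) f k = f k"
      by eventually_elim (simp add: trunc_def)
  qed
  fix n
  have shell: "sobolev (1 - s) (trunc (shell n) f) (2 * K * (2 ^ n) powr (b - s))" for n
  proof -
    have "sobolev (1 - s) (trunc (shell n) f) ((2 ^ n) powr (- s) * (2 * K * (2 ^ n) powr b))"
    proof (rule sobolev_dom[OF sobolev_trunc_shell[OF f]])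
      fix k
      show "sz k powr (1 - s) * cmod (trunc (shell n) f k) \<le> (2 ^ n) powr (- s) * (sz k powr 1 * cmod (trunc (shell n) f k))"
      proof (cases "k \<in> shell n")
        case True
        have "sz k powr (1 - s) = sz k powr (- s) * sz k powr 1" unfolding powr_add[symmetric] by simp
        also have "\<dots> \<le> (2 ^ n) powr (- s) * sz k powr 1"
          using sz_shell(1)[OF True] s by (intro mult_right_mono powr_mono2') auto
        finally show ?thesis by (simp add: mult_right_mono mult.assoc[symmetric])
      qed (simp add: trunc_def)
    qed simp
    also have "(2 ^ n) powr (- s) * (2 * K * (2 ^ n) powr b) = 2 * K * ((2 ^ n) powr (- s) * (2 ^ n) powr b)"
      by (simp add: ac_simps)
    also have "\<dots> = 2 * K * (2 ^ n) powr (b - s)"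
      unfolding powr_add[symmetric] by (simp add: algebra_simps)
    finally show ?thesis .
  qed
  have "sobolev (1 - s) (trunc (square n) f) (\<Sum>i<n. 2 * K * (2 ^ i) powr (b - s))"
  proof (induction n)
    case 0
    have "trunc (square 0) f = (\<lambda>_. 0)" using besovD(1)[OF f] by (auto simp: trunc_def square_0)
    then show ?case by (simp add: sobolev_0)
  next
    case (Suc n)
    show ?case unfolding trunc_square_Suc using sobolev_add[OF Suc shell[of n]] by simp
  qed
  moreover have "(\<Sum>i<n. 2 * K * (2 ^ i) powr (b - s)) \<le> 2 * K * geo (s - b)"
    unfolding sum_distrib_left[symmetric] using sum_geo[of "s - b" n] s besov_nonneg[OF f]
    by (intro mult_left_mono) auto
  ultimately show "sobolev (1 - s) (trunc (square n) f) (2 * K * geo (s - b))" by (rule sobolev_mono)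
qed

text \<open>A rough part p with block bounds plus a smoother remainder t, both of size S. The
  existentially bound D only guarantees that the Jacobians converge.\<close>

definition decomp :: "real \<Rightarrow> real \<Rightarrow> real \<Rightarrow> coeffs \<Rightarrow> bool" where
  "decomp b s S f \<longleftrightarrow> (\<exists>p t D. f = (\<lambda>k. p k + t k) \<and> besov b S p \<and> sobolev 1 p D \<and> sobolev (2 - s) t S)"

lemma besov_0: "0 \<le> K \<Longrightarrow> besov b K (\<lambda>_. 0)"
  by (simp add: besov_def)

lemma besov_mono: "besov b K f \<Longrightarrow> K \<le> K' \<Longrightarrow> besov b K' f"
  unfolding besov_def by (meson mult_right_mono order_trans powr_ge_zero)

lemma decomp_sobolev1: "decomp b s S f \<Longrightarrow> s \<le> 1 \<Longrightarrow> \<exists>D. sobolev 1 f D"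
proof -
  assume "decomp b s S f" "s \<le> 1"
  then obtain p t D where p: "f = (\<lambda>k. p k + t k)" "besov b S p" "sobolev 1 p D" "sobolev (2 - s) t S" unfolding decomp_def by auto
  have "sobolev 1 t S" using sobolev_exp_mono[OF p(4)] \<open>s \<le> 1\<close> by auto
  then show ?thesis unfolding p(1) using sobolev_add[OF p(3)] by blast
qed

lemma decomp_nonneg: "decomp b s S f \<Longrightarrow> 0 \<le> S"
  unfolding decomp_def using besov_nonneg by blast

text \<open>One summand for each type of interaction: rough with rough, rough with remainder in both
  orders, remainder with remainder.\<close>

definition jconst :: "real \<Rightarrow> real \<Rightarrow> real" where
  "jconst b s = 16 * 2 powr b / (2 powr b - 1) * geo (s - 2 * b) + 8 * geo (s - b) + 4 * sqrt (szsum (4 * (1 - s)))"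

text \<open>The conditions on s have separate origins: 2 * b < s comes from rough with rough, and s
  < 1/2 from remainder with remainder, where \<open>sobolev_jac_sobolev\<close> is used with
  \<sigma> = \<tau> = 1 - s.\<close>

lemma decomp_jac:
  assumes b: "0 < b" "2 * b < s" and s: "s < 1 / 2" and f: "decomp b s S f" and g: "decomp b s S' g"
  shows "sobolev (- s) (jac f g) (jconst b s * (S * S'))"
proof -
  obtain p t D where p: "f = (\<lambda>k. p k + t k)" "besov b S p" "sobolev 1 p D" "sobolev (2 - s) t S" using f unfolding decomp_def by auto
  obtain q u E where q: "g = (\<lambda>k. q k + u k)" "besov b S' q" "sobolev 1 q E" "sobolev (2 - s) u S'" using g unfolding decomp_def by auto
  have t1: "sobolev 1 t S" "sobolev 1 u S'" using sobolev_exp_mono[OF p(4)] sobolev_exp_mono[OF q(4)] s by auto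
  have 1: "sobolev (- s) (jac p q) (16 * 2 powr b / (2 powr b - 1) * geo (s - 2 * b) * S * S')"
    using sobolev_jac_besov_besov[OF p(2,3) q(2,3)] b s by simp
  have 2: "sobolev (- s) (jac p u) (4 * S * S' * geo (s - b))"
    using sobolev_jac_besov[OF p(2,3) t1(2)] b s by simp
  have 3: "sobolev (- s) (jac q t) (4 * S' * S * geo (s - b))"
    using sobolev_jac_besov[OF q(2,3) t1(1)] b s by simp
  have "sobolev 0 (jac t u) (2 * sqrt (szsum (4 * (1 - s))) * (S * S' + S * S'))"
    using sobolev_jac_sobolev[of "1 - s" t S "1 - s" S u S' S'] p(4) q(4) s by simp
  then have 4: "sobolev (- s) (jac t u) (2 * sqrt (szsum (4 * (1 - s))) * (S * S' + S * S'))"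
    using b by (elim sobolev_exp_mono) auto
  have eq: "jac f g = (\<lambda>m. (jac p q m + jac p u m) + (- jac q t m + jac t u m))"
  proof
    fix m
    have "jac f g m = jac p g m + jac t g m"
      unfolding p(1) using jac_add_left[OF p(3) t1(1) sobolev_add[OF q(3) t1(2)]] q(1) by simp
    also have "jac p g m = jac p q m + jac p u m"
      unfolding q(1) by (rule jac_add_right[OF p(3) q(3) t1(2)])
    also have "jac t g m = jac t q m + jac t u m"
      unfolding q(1) by (rule jac_add_right[OF t1(1) q(3) t1(2)])
    finally show "jac f g m = (jac p q m + jac p u m) + (- jac q t m + jac t u m)"
      using jac_antisym[of q t m] by simp
  qed
  show ?thesis unfolding eq
    using sobolev_add[OF sobolev_add[OF 1 2] sobolev_add[OF sobolev_uminus[OF 3] 4]]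
    by (rule sobolev_mono) (simp add: jconst_def algebra_simps)
qed

text \<open>After one derivative this is the regularity -s of the Jacobian, so the first order terms
  fit into the same fixed point equation.\<close>

lemma decomp_linear:
  assumes b: "0 < b" "b < s" and f: "decomp b s S f"
  shows "sobolev (1 - s) f ((2 * geo (s - b) + 1) * S)"
proof -
  obtain p t D where p: "f = (\<lambda>k. p k + t k)" "besov b S p" "sobolev 1 p D" "sobolev (2 - s) t S" using f unfolding decomp_def by auto
  have "sobolev (1 - s) p (2 * S * geo (s - b))" using besov_sobolev[OF p(2)] b by simp
  moreover have "sobolev (1 - s) t S" using sobolev_exp_mono[OF p(4)] by simp
  ultimately have "sobolev (1 - s) f (2 * S * geo (s - b) + S)" unfolding p(1) by (rule sobolev_add)
  then show ?thesis by (simp add: algebra_simps)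
qed

section \<open>The fixed point equation\<close>

definition nsq :: "int \<times> int \<Rightarrow> real" where "nsq k = (kx k)\<^sup>2 + (ky k)\<^sup>2"

lemma nsq_ge: "k \<noteq> 0 \<Longrightarrow> (sz k)\<^sup>2 \<le> nsq k"
  unfolding nsq_def by (rule sz_sq_le)

lemma nsq_0 [simp]: "nsq 0 = 0" and nsq_uminus [simp]: "nsq (- k) = nsq k"
  by (simp_all add: nsq_def)

lemma nsq_pos: "k \<noteq> 0 \<Longrightarrow> 0 < nsq k"
  using nsq_ge[of k] sz_pos[of k] by (meson less_le_trans zero_less_power)

text \<open>Inverting the Laplacian gains two derivatives. At k = 0 the factor is 0, since division
  by zero yields 0, so the zero mode is dropped instead of being singular.\<close>

lemma sobolev_laplace:
  assumes "sobolev r h R"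
  shows "sobolev (r + 2) (\<lambda>k. of_real (4 / nsq k) * h k) (4 * R)"
proof (rule sobolev_dom[OF assms])
  fix k
  show "sz k powr (r + 2) * cmod (of_real (4 / nsq k) * h k) \<le> 4 * (sz k powr r * cmod (h k))"
  proof (cases "k = 0")
    case False
    have "(sz k)\<^sup>2 / nsq k \<le> 1" using nsq_ge[OF False] nsq_pos[OF False] by simp
    then have "4 * (sz k powr r * cmod (h k)) * ((sz k)\<^sup>2 / nsq k) \<le> 4 * (sz k powr r * cmod (h k)) * 1"
      by (intro mult_left_mono) auto
    moreover have "sz k powr (r + 2) * cmod (of_real (4 / nsq k) * h k) = 4 * (sz k powr r * cmod (h k)) * ((sz k)\<^sup>2 / nsq k)"
      using nsq_pos[OF False] sz_pos[of k] by (simp add: powr_add norm_mult norm_divide)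
    ultimately show ?thesis by simp
  qed simp
qed simp

text \<open>The j-th component of the cross product of A and f: addition in the index type 3 is
  cyclic, so j + 1 and j + 2 are the other two indices in cyclic order.\<close>

definition cross_lin :: "(3 \<Rightarrow> real) \<Rightarrow> (3 \<Rightarrow> coeffs) \<Rightarrow> 3 \<Rightarrow> coeffs" where
  "cross_lin A f j k = of_real (A (j + 1)) * f (j + 2) k - of_real (A (j + 2)) * f (j + 1) k"

text \<open>The Jacobian of the two other stream functions, plus the first order terms produced by
  the constants c = A + \<i> B: A is paired with \<open>\<partial>\<^sub>1\<close>, B with
  \<open>\<partial>\<^sub>2\<close>.\<close>

definition nonlin0 :: "(3 \<Rightarrow> real) \<Rightarrow> (3 \<Rightarrow> real) \<Rightarrow> (3 \<Rightarrow> coeffs) \<Rightarrow> 3 \<Rightarrow> coeffs" where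
  "nonlin0 A B f j k = jac (f (j + 1)) (f (j + 2)) k
     + (\<i> * of_real (kx k) * cross_lin A f j k - \<i> * of_real (ky k) * cross_lin B f j k)"

definition nonlin :: "(3 \<Rightarrow> real) \<Rightarrow> (3 \<Rightarrow> real) \<Rightarrow> (3 \<Rightarrow> coeffs) \<Rightarrow> 3 \<Rightarrow> coeffs" where
  "nonlin A B f j k = of_real (4 / nsq k) * nonlin0 A B f j k"

lemma sobolev_deriv:
  assumes f: "sobolev (r + 1) f R"
  shows "sobolev r (\<lambda>k. \<i> * of_real (kx k) * f k) R" "sobolev r (\<lambda>k. \<i> * of_real (ky k) * f k) R"
proof -
  have "sz k powr r * cmod (\<i> * of_real a * f k) \<le> sz k powr (r + 1) * cmod (f k)" if "\<bar>a\<bar> \<le> sz k" for a k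
  proof -
    have "sz k powr r * cmod (\<i> * of_real a * f k) = \<bar>a\<bar> * (sz k powr r * cmod (f k))"
      by (simp add: norm_mult)
    also have "\<dots> \<le> sz k * (sz k powr r * cmod (f k))" using that by (intro mult_right_mono) auto
    finally show ?thesis using sz_pos[of k] by (simp add: powr_add ac_simps)
  qed
  then show "sobolev r (\<lambda>k. \<i> * of_real (kx k) * f k) R" "sobolev r (\<lambda>k. \<i> * of_real (ky k) * f k) R"
    using kx_le_sz ky_le_sz by (blast intro: sobolev_dom1[OF f])+
qed

lemma sobolev_cross_lin:
  assumes f: "\<And>j. sobolev r (f j) R" and A: "\<And>j. \<bar>A j\<bar> \<le> \<eta>"
  shows "sobolev r (cross_lin A f j) (2 * \<eta> * R)"
proof -
  have "sobolev r (cross_lin A f j) (cmod (of_real (A (j + 1))) * R + cmod (of_real (A (j + 2))) * R)"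
    unfolding cross_lin_def by (intro sobolev_diff sobolev_cmult f)
  then show ?thesis
  proof (rule sobolev_mono)
    have "\<bar>A (j + 1)\<bar> * R + \<bar>A (j + 2)\<bar> * R \<le> \<eta> * R + \<eta> * R"
      using sobolev_nonneg[OF f] A by (intro add_mono mult_right_mono) auto
    then show "cmod (complex_of_real (A (j + 1))) * R + cmod (complex_of_real (A (j + 2))) * R \<le> 2 * \<eta> * R" unfolding norm_of_real mult.assoc mult_2[of "\<eta> * R"] .
  qed
qed

text \<open>The outer 4 is that of \<open>sobolev_laplace\<close>; the inner 4 comes from two cross
  products with two terms each, and its bracket from \<open>decomp_linear\<close>.\<close>

definition nconst :: "real \<Rightarrow> real \<Rightarrow> real" where
  "nconst b s = 4 * (jconst b s + 4 * (2 * geo (s - b) + 1))"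

lemma szsum_pos: "2 < t \<Longrightarrow> 0 < szsum t"
  using geo_pos[of "t - 2"] by (simp add: szsum_def add_pos_pos)

lemma jconst_pos:
  assumes "0 < b" "2 * b < s" "s < 1 / 2"
  shows "0 < jconst b s"
proof -
  have "1 < 2 powr b" using assms by simp
  then show ?thesis unfolding jconst_def
    using assms geo_pos[of "s - b"] geo_pos[of "s - 2 * b"] szsum_pos[of "4 * (1 - s)"]
    by (intro add_pos_pos) auto
qed

lemma nconst_pos:
  assumes "0 < b" "2 * b < s" "s < 1 / 2"
  shows "0 < nconst b s"
  using jconst_pos[OF assms] geo_pos[of "s - b"] assms by (simp add: nconst_def add_pos_pos)

text \<open>Bilinearity: the difference of two Jacobians splits into one with f - g in the first
  slot and one with f - g in the second. The Lipschitz constant is therefore proportional to the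
  sizes of f, g and the constants, and becomes small with \<gamma>.\<close>

lemma nonlin_diff:
  assumes b: "0 < b" "2 * b < s" and s: "s < 1 / 2"
    and f: "\<And>j. decomp b s S (f j)" and g: "\<And>j. decomp b s S' (g j)" and d: "\<And>j. decomp b s d (\<lambda>k. f j k - g j k)"
    and A: "\<And>j. \<bar>A j\<bar> \<le> \<eta>" and B: "\<And>j. \<bar>B j\<bar> \<le> \<eta>"
  shows "sobolev (2 - s) (\<lambda>k. nonlin A B f j k - nonlin A B g j k) (nconst b s * (S + S' + \<eta>) * d)"
proof -
  have s1: "s \<le> 1" using s by simp
  obtain Df Dg where D: "\<And>j. sobolev 1 (f j) (Df j)" "\<And>j. sobolev 1 (g j) (Dg j)"
    using decomp_sobolev1[OF f s1] decomp_sobolev1[OF g s1] by metis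
  have eq: "nonlin0 A B f j k - nonlin0 A B g j k =
     (jac (\<lambda>k. f (j + 1) k - g (j + 1) k) (f (j + 2)) k + jac (g (j + 1)) (\<lambda>k. f (j + 2) k - g (j + 2) k) k)
     + (\<i> * of_real (kx k) * cross_lin A (\<lambda>j k. f j k - g j k) j k - \<i> * of_real (ky k) * cross_lin B (\<lambda>j k. f j k - g j k) j k)" for k
    unfolding nonlin0_def jac_diff_left[OF D(1) D(2) D(1)] jac_diff_right[OF D(2) D(1) D(2)]
    by (simp add: cross_lin_def algebra_simps)
  let ?c = "2 * geo (s - b) + 1"
  have l: "sobolev (- s + 1) (\<lambda>k. f j k - g j k) (?c * d)" for j
    using decomp_linear[OF b(1) _ d] b by simp
  have "sobolev (- s) (\<lambda>k. nonlin0 A B f j k - nonlin0 A B g j k)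
     ((jconst b s * (d * S) + jconst b s * (S' * d)) + (2 * \<eta> * (?c * d) + 2 * \<eta> * (?c * d)))"
    unfolding eq
    by (intro sobolev_add sobolev_diff decomp_jac b s f g d sobolev_deriv sobolev_cross_lin l A B)
  then have "sobolev (- s) (\<lambda>k. nonlin0 A B f j k - nonlin0 A B g j k) ((jconst b s + 4 * ?c) * (S + S' + \<eta>) * d)"
  proof (rule sobolev_mono)
    have 0: "0 \<le> d" "0 \<le> S" "0 \<le> S'" "0 \<le> \<eta>" "0 \<le> jconst b s" "0 \<le> geo (s - b)"
      using decomp_nonneg[OF d] decomp_nonneg[OF f] decomp_nonneg[OF g] A[of j] jconst_pos[OF b s] geo_pos[of "s - b"] b by auto
    \<comment> \<open>Exactly the terms by which the product form of the bound exceeds the sum of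
      the estimates.\<close>
    then have "0 \<le> d * (jconst b s * \<eta> + 4 * ?c * (S + S'))" by auto
    then show "(jconst b s * (d * S) + jconst b s * (S' * d)) + (2 * \<eta> * (?c * d) + 2 * \<eta> * (?c * d))
      \<le> (jconst b s + 4 * ?c) * (S + S' + \<eta>) * d"
      by (simp add: algebra_simps)
  qed
  from sobolev_laplace[OF this] show ?thesis
    unfolding nonlin_def nconst_def right_diff_distrib by (simp only: mult.assoc add.commute[of "- s"] diff_conv_add_uminus)
qed

section \<open>The contraction argument\<close>

lemma sobolev_limit_bound:
  assumes "\<And>n. sobolev t f (R n)" "R \<longlonglongrightarrow> r"
  shows "sobolev t f r"
  by (rule sobolev_lim[where f="\<lambda>_. f" and R=R]) (use assms in auto)

text \<open>Banach's iteration carried out coefficientwise: as t \<ge> 0, all weights are at least 1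
  and a bound on a difference controls each coefficient, while the ball is closed under
  coefficientwise limits.\<close>

lemma sobolev_fixpoint:
  fixes \<Phi> :: "('j \<Rightarrow> coeffs) \<Rightarrow> 'j \<Rightarrow> coeffs"
  assumes R: "0 \<le> R" and t: "0 \<le> t"
    and self: "\<And>f. (\<And>j. sobolev t (f j) R) \<Longrightarrow> (\<And>j. sobolev t (\<Phi> f j) R)"
    and contr: "\<And>f g d. (\<And>j. sobolev t (f j) R) \<Longrightarrow> (\<And>j. sobolev t (g j) R) \<Longrightarrow> (\<And>j. sobolev t (\<lambda>k. f j k - g j k) d) \<Longrightarrow>
      (\<And>j. sobolev t (\<lambda>k. \<Phi> f j k - \<Phi> g j k) (d / 2))"
  obtains f where "\<And>j. sobolev t (f j) R" "\<Phi> f = f"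
proof -
  define u where "u n = (\<Phi> ^^ n) (\<lambda>_ _. 0)" for n
  have u_Suc: "u (Suc n) = \<Phi> (u n)" for n by (simp add: u_def)
  have u: "sobolev t (u n j) R" for n j
  proof (induction n arbitrary: j)
    case 0 then show ?case using R by (simp add: u_def sobolev_0)
  next
    case (Suc n) show ?case unfolding u_Suc by (rule self[OF Suc])
  qed
  have step: "sobolev t (\<lambda>k. u (Suc n) j k - u n j k) (2 * R / 2 ^ n)" for n j
  proof (induction n arbitrary: j)
    case 0 show ?case using sobolev_diff[OF u u] by simp
  next
    case (Suc n)
    have "sobolev t (\<lambda>k. \<Phi> (u (Suc n)) j k - \<Phi> (u n) j k) (2 * R / 2 ^ n / 2)" by (rule contr[OF u u Suc])
    then show ?case unfolding u_Suc[symmetric] by (simp add: ac_simps)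
  qed
  \<comment> \<open>Keeping the negative remainder of the geometric sum is what lets the induction
    on m close.\<close>
  have tail: "sobolev t (\<lambda>k. u (n + m) j k - u n j k) (4 * R / 2 ^ n - 4 * R / 2 ^ (n + m))" for n m j
  proof (induction m)
    case 0 show ?case by (simp add: sobolev_0)
  next
    case (Suc m)
    show ?case using sobolev_add[OF step[of "n + m" j] Suc] by (simp add: field_simps)
  qed
  have tail': "sobolev t (\<lambda>k. u (n + m) j k - u n j k) (4 * R / 2 ^ n)" for n m j
    using tail by (rule sobolev_mono) (use R in simp)
  have coord: "cmod (h k) \<le> D" if "sobolev t h D" for h D k
  proof -
    have "1 * cmod (h k) \<le> sz k powr t * cmod (h k)"
      using ge_one_powr_ge_zero[OF sz_ge1 t] by (intro mult_right_mono) auto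
    then show ?thesis using sobolev_coord[OF that, of k] by simp
  qed
  have conv: "convergent (\<lambda>n. u n j k)" for j k
  proof (rule Cauchy_convergent, rule CauchyI')
    fix e :: real assume e: "0 < e"
    have "(\<lambda>n. 4 * R * (1 / 2) ^ n) \<longlonglongrightarrow> 4 * R * 0"
      by (intro tendsto_mult_left LIMSEQ_power_zero) auto
    then have "\<forall>\<^sub>F n in sequentially. 4 * R * (1 / 2) ^ n < e"
      using e by (intro order_tendstoD) auto
    then obtain N where N: "4 * R * (1 / 2) ^ N < e / 1" "\<forall>n\<ge>N. 4 * R * (1 / 2) ^ n < e"
      by (auto simp: eventually_sequentially)
    have "dist (u m j k) (u n j k) < e" if "N \<le> m" "m < n" for m n
    proof -
      have "cmod (u (m + (n - m)) j k - u m j k) \<le> 4 * R / 2 ^ m" by (rule coord[OF tail'])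
      also have "\<dots> < e" using N(2) that by (simp add: power_divide)
      finally show ?thesis using that by (simp add: dist_norm norm_minus_commute)
    qed
    then show "\<exists>M. \<forall>m\<ge>M. \<forall>n>m. dist (u m j k) (u n j k) < e" by blast
  qed
  define f where "f j k = lim (\<lambda>n. u n j k)" for j k
  have lim: "(\<lambda>n. u n j k) \<longlonglongrightarrow> f j k" for j k
    unfolding f_def using conv convergent_LIMSEQ_iff by blast
  have f: "sobolev t (f j) R" for j by (rule sobolev_lim_const[OF lim u])
  have fu: "sobolev t (\<lambda>k. f j k - u n j k) (4 * R / 2 ^ n)" for j n
  proof (rule sobolev_lim_const[OF _ tail'])
    show "(\<lambda>m. u (n + m) j k - u n j k) \<longlonglongrightarrow> f j k - u n j k" for k
      using LIMSEQ_ignore_initial_segment[OF lim, of n] by (intro tendsto_intros) (simp add: add.commute)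
  qed
  have "\<Phi> f j k = f j k" for j k
  proof -
    have z: "(\<lambda>n. 4 * R / 2 ^ n / 2) \<longlonglongrightarrow> 0"
      using tendsto_mult_left[OF LIMSEQ_power_zero[of "1/2::real"], of "2 * R"] by (simp add: power_divide)
    have "(\<lambda>n. \<Phi> f j k - u (Suc n) j k) \<longlonglongrightarrow> 0"
    proof (rule Lim_null_comparison[OF always_eventually z], intro allI)
      fix n
      show "cmod (\<Phi> f j k - u (Suc n) j k) \<le> 4 * R / 2 ^ n / 2"
        unfolding u_Suc by (intro coord contr f u fu)
    qed
    moreover have "(\<lambda>n. \<Phi> f j k - u (Suc n) j k) \<longlonglongrightarrow> \<Phi> f j k - f j k"
      by (intro tendsto_intros LIMSEQ_Suc lim)
    ultimately have "\<Phi> f j k - f j k = 0" using LIMSEQ_unique by blast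
    then show ?thesis by simp
  qed
  then show ?thesis using that f by blast
qed

text \<open>The ball of radius R belongs to the definition: uniqueness and the Lipschitz estimate
  are proved for solutions inside it.\<close>

definition solves_fp :: "real \<Rightarrow> (3 \<Rightarrow> real) \<Rightarrow> (3 \<Rightarrow> real) \<Rightarrow> real \<Rightarrow> (3 \<Rightarrow> coeffs) \<Rightarrow> (3 \<Rightarrow> coeffs) \<Rightarrow> bool" where
  "solves_fp s A B R \<Psi> \<theta> \<longleftrightarrow> (\<forall>j. sobolev (2 - s) (\<theta> j) R) \<and> \<theta> = nonlin A B (\<lambda>j k. \<Psi> j k + \<theta> j k)"

lemma decompI: "besov b S p \<Longrightarrow> sobolev 1 p D \<Longrightarrow> sobolev (2 - s) t S \<Longrightarrow> decomp b s S (\<lambda>k. p k + t k)"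
  unfolding decomp_def by blast

lemma jac_0: "jac (\<lambda>_. 0) g m = 0"
  by (simp add: jac_def)

lemma nonlin_0: "nonlin A B (\<lambda>_ _. 0) = (\<lambda>_ _. 0)"
  by (simp add: nonlin_def nonlin0_def jac_0 cross_lin_def fun_eq_iff)

context
  fixes b s R \<eta> :: real and A B :: "3 \<Rightarrow> real"
  assumes b: "0 < b" "2 * b < s" and s: "s < 1 / 2"
    and A: "\<And>j. \<bar>A j\<bar> \<le> \<eta>" and B: "\<And>j. \<bar>B j\<bar> \<le> \<eta>"
    and small: "nconst b s * (2 * R + \<eta>) \<le> 1 / 2"
begin

text \<open>The same R bounds the rough part and the remainder, so two candidates give S + S' +
  \<eta> = 2 * R + \<eta> in \<open>nonlin_diff\<close>, and \<open>small\<close> turns the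
  Lipschitz constant into at most 1/2.\<close>

lemma ex_solves_fp:
  assumes \<Psi>: "\<And>j. besov b R (\<Psi> j)" "\<And>j. sobolev 1 (\<Psi> j) D"
  shows "\<exists>\<theta>. solves_fp s A B R \<Psi> \<theta>"
proof -
  let ?\<Phi> = "\<lambda>\<theta>. nonlin A B (\<lambda>j k. \<Psi> j k + \<theta> j k)"
  have R: "0 \<le> R" using besov_nonneg[OF \<Psi>(1)] .
  have contr: "sobolev (2 - s) (\<lambda>k. ?\<Phi> f j k - ?\<Phi> g j k) (d / 2)"
    if f: "\<And>j. sobolev (2 - s) (f j) R" and g: "\<And>j. sobolev (2 - s) (g j) R" and d: "\<And>j. sobolev (2 - s) (\<lambda>k. f j k - g j k) d" for f g d j
  proof -
    have d0: "0 \<le> d" using sobolev_nonneg[OF d] .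
    have "decomp b s d (\<lambda>k. 0 + (f j k - g j k))" for j by (rule decompI[OF besov_0[OF d0] sobolev_0[OF d0] d])
    then have "decomp b s d (\<lambda>k. (\<Psi> j k + f j k) - (\<Psi> j k + g j k))" for j by simp
    from nonlin_diff[OF b s decompI[OF \<Psi> f] decompI[OF \<Psi> g] this A B]
    have "sobolev (2 - s) (\<lambda>k. ?\<Phi> f j k - ?\<Phi> g j k) (nconst b s * (R + R + \<eta>) * d)" .
    then show ?thesis by (rule sobolev_mono) (use mult_right_mono[OF small d0] in simp)
  qed
  have self: "sobolev (2 - s) (?\<Phi> f j) R" if f: "\<And>j. sobolev (2 - s) (f j) R" for f j
  proof -
    have z: "decomp b s 0 (\<lambda>k. 0 + 0)" by (rule decompI[OF besov_0 sobolev_0 sobolev_0]) auto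
    \<comment> \<open>Self-mapping is the Lipschitz bound against the zero sequence, which is mapped
      to itself.\<close>
    have "sobolev (2 - s) (\<lambda>k. ?\<Phi> f j k - nonlin A B (\<lambda>_ _. 0) j k) (nconst b s * (R + 0 + \<eta>) * R)"
    proof (rule nonlin_diff[OF b s _ _ _ A B])
      show "decomp b s R (\<lambda>k. \<Psi> j k + f j k)" for j by (rule decompI[OF \<Psi> f])
      then show "decomp b s R (\<lambda>k. (\<Psi> j k + f j k) - 0)" for j by simp
      show "decomp b s 0 (\<lambda>k. 0)" for j :: 3 using z by simp
    qed
    then have "sobolev (2 - s) (?\<Phi> f j) (nconst b s * (R + \<eta>) * R)" unfolding nonlin_0 by simp
    then show ?thesis
    proof (rule sobolev_mono)
      have "nconst b s * (R + \<eta>) \<le> nconst b s * (2 * R + \<eta>)"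
        using nconst_pos[OF b s] R by (intro mult_left_mono) auto
      also have "\<dots> \<le> 1" using small by simp
      finally have "nconst b s * (R + \<eta>) * R \<le> 1 * R" using R by (rule mult_right_mono)
      then show "nconst b s * (R + \<eta>) * R \<le> R" by simp
    qed
  qed
  show ?thesis
  proof (rule sobolev_fixpoint[of R "2 - s" ?\<Phi>])
    fix \<theta> assume "\<And>j. sobolev (2 - s) (\<theta> j) R" "?\<Phi> \<theta> = \<theta>"
    then show ?thesis unfolding solves_fp_def by (intro exI[of _ \<theta>]) auto
  qed (use R s in simp, use s in simp, rule self, assumption, rule contr)
qed

text \<open>Absorbing the remainder into the left-hand side would need the norm of the difference
  itself. With upper bounds only, the improvement from d to \<open>max e d / 2\<close> is iterated
  instead, starting from 2 * R, and leaves e in the limit.\<close>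

lemma solves_fp_diff:
  assumes \<Psi>: "\<And>j. besov b R (\<Psi> j)" "\<And>j. sobolev 1 (\<Psi> j) D" and \<Psi>': "\<And>j. besov b R (\<Psi>' j)" "\<And>j. sobolev 1 (\<Psi>' j) D'"
    and e: "\<And>j. besov b e (\<lambda>k. \<Psi> j k - \<Psi>' j k)"
    and \<theta>: "solves_fp s A B R \<Psi> \<theta>" and \<theta>': "solves_fp s A B R \<Psi>' \<theta>'"
  shows "sobolev (2 - s) (\<lambda>k. \<theta> j k - \<theta>' j k) e"
proof -
  have R: "0 \<le> R" using besov_nonneg[OF \<Psi>(1)] .
  have e0: "0 \<le> e" using besov_nonneg[OF e] .
  have w: "sobolev (2 - s) (\<theta> j) R" "sobolev (2 - s) (\<theta>' j) R" for j using \<theta> \<theta>' by (auto simp: solves_fp_def)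
  have eq: "\<theta> j = nonlin A B (\<lambda>j k. \<Psi> j k + \<theta> j k) j" "\<theta>' j = nonlin A B (\<lambda>j k. \<Psi>' j k + \<theta>' j k) j" for j
    using \<theta> \<theta>' unfolding solves_fp_def by metis+
  have step: "sobolev (2 - s) (\<lambda>k. \<theta> j k - \<theta>' j k) (max e d / 2)" if d: "\<And>j. sobolev (2 - s) (\<lambda>k. \<theta> j k - \<theta>' j k) d" for d j
  proof -
    have "decomp b s (max e d) (\<lambda>k. (\<Psi> j k - \<Psi>' j k) + (\<theta> j k - \<theta>' j k))" for j
      by (rule decompI[OF besov_mono[OF e] sobolev_diff[OF \<Psi>(2) \<Psi>'(2)] sobolev_mono[OF d]]) auto
    then have "decomp b s (max e d) (\<lambda>k. (\<Psi> j k + \<theta> j k) - (\<Psi>' j k + \<theta>' j k))" for j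
      by (simp add: algebra_simps)
    from nonlin_diff[where f="\<lambda>j k. \<Psi> j k + \<theta> j k" and g="\<lambda>j k. \<Psi>' j k + \<theta>' j k" and A=A and B=B and j=j,
        OF b s decompI[OF \<Psi> w(1)] decompI[OF \<Psi>' w(2)] this A B]
    have "sobolev (2 - s) (\<lambda>k. nonlin A B (\<lambda>j k. \<Psi> j k + \<theta> j k) j k - nonlin A B (\<lambda>j k. \<Psi>' j k + \<theta>' j k) j k)
        (nconst b s * (R + R + \<eta>) * max e d)" .
    then have "sobolev (2 - s) (\<lambda>k. \<theta> j k - \<theta>' j k) (nconst b s * (R + R + \<eta>) * max e d)"
      unfolding eq[symmetric] .
    then show ?thesis
    proof (rule sobolev_mono)
      show "nconst b s * (R + R + \<eta>) * max e d \<le> max e d / 2"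
        using mult_right_mono[OF small, of "max e d"] e0 by simp
    qed
  qed
  have it: "sobolev (2 - s) (\<lambda>k. \<theta> j k - \<theta>' j k) (max e (2 * R * (1 / 2) ^ n))" for n j
  proof (induction n arbitrary: j)
    case 0 show ?case using sobolev_diff[OF w] by (rule sobolev_mono) simp
  next
    case (Suc n)
    show ?case using step[OF Suc] by (rule sobolev_mono) (use e0 R in \<open>auto simp: max_def\<close>)
  qed
  have "(\<lambda>n. max e (2 * R * (1 / 2) ^ n)) \<longlonglongrightarrow> max e (2 * R * 0)"
    by (intro tendsto_intros LIMSEQ_power_zero) auto
  from sobolev_limit_bound[OF it this] show ?thesis using e0 by simp
qed

end

section \<open>Fourier series with rapidly decreasing coefficients\<close>

definition rapid :: "coeffs \<Rightarrow> bool" where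
  "rapid c \<longleftrightarrow> (\<forall>t. \<exists>R. sobolev t c R)"

definition fourier :: "coeffs \<Rightarrow> plane \<Rightarrow> complex" where
  "fourier c x = (\<Sum>\<^sub>\<infinity>k. c k * fexp k x)"

lemma rapidD: "rapid c \<Longrightarrow> \<exists>R. sobolev t c R"
  by (simp add: rapid_def)

lemma rapid_add: "rapid c \<Longrightarrow> rapid d \<Longrightarrow> rapid (\<lambda>k. c k + d k)"
  unfolding rapid_def using sobolev_add by blast

lemma rapid_cmult: "rapid c \<Longrightarrow> rapid (\<lambda>k. a * c k)"
  unfolding rapid_def using sobolev_cmult by blast

lemma rapid_uminus: "rapid c \<Longrightarrow> rapid (\<lambda>k. - c k)"
  unfolding rapid_def using sobolev_uminus by blast

lemma rapid_diff: "rapid c \<Longrightarrow> rapid d \<Longrightarrow> rapid (\<lambda>k. c k - d k)"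
  unfolding rapid_def using sobolev_diff by blast

lemma rapid_deriv:
  assumes "rapid c"
  shows "rapid (\<lambda>k. \<i> * of_real (kx k) * c k)" "rapid (\<lambda>k. \<i> * of_real (ky k) * c k)"
  using assms sobolev_deriv unfolding rapid_def by blast+

lemma rapid_single: "rapid (\<lambda>k. if k = 0 then a else 0)"
  unfolding rapid_def
proof
  fix t
  have "sobolev t (\<lambda>k. if k = 0 then a else 0) (cmod a)"
    unfolding sobolev_def L2_set_def
  proof (intro allI impI)
    fix F :: "(int \<times> int) set" assume "finite F"
    have "(\<Sum>k\<in>F. (sz k powr t * cmod (if k = 0 then a else 0))\<^sup>2) = (\<Sum>k\<in>F. if k = 0 then (cmod a)\<^sup>2 else 0)"
      by (intro sum.cong) (auto simp: sz_def)
    also have "\<dots> \<le> (cmod a)\<^sup>2" using \<open>finite F\<close> by simp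
    finally have "(\<Sum>k\<in>F. (sz k powr t * cmod (if k = 0 then a else 0))\<^sup>2) \<le> (cmod a)\<^sup>2" .
    then show "sqrt (\<Sum>k\<in>F. (sz k powr t * cmod (if k = 0 then a else 0))\<^sup>2) \<le> cmod a"
      by (intro real_le_lsqrt) (auto intro: sum_nonneg)
  qed
  then show "\<exists>R. sobolev t (\<lambda>k. if k = 0 then a else 0) R" by blast
qed

lemma rapid_l1: "rapid c \<Longrightarrow> \<exists>H. \<forall>F. finite F \<longrightarrow> (\<Sum>k\<in>F. sz k powr r * cmod (c k)) \<le> H"
proof -
  assume "rapid c"
  then obtain R where "sobolev (r + 2) c R" using rapidD by blast
  then have "finite F \<Longrightarrow> (\<Sum>k\<in>F. sz k powr r * cmod (c k)) \<le> sqrt (szsum (2 * (r + 2 - r))) * R" for F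
    by (intro l1_bound) auto
  then show ?thesis by blast
qed

lemma rapid_summable_sz: "rapid c \<Longrightarrow> (\<lambda>k. sz k powr r * cmod (c k)) summable_on UNIV"
  using rapid_l1[of c r]
  by (intro nonneg_bdd_above_summable_on) (auto simp: bdd_above_def)

lemma rapid_abs_summable: "rapid c \<Longrightarrow> (\<lambda>k. cmod (c k)) summable_on UNIV"
  using rapid_summable_sz[of c 0] sz_pos by (simp add: less_imp_neq[THEN not_sym])

lemma rapid_fourier_abs: "rapid c \<Longrightarrow> (\<lambda>k. cmod (c k * fexp k x)) summable_on UNIV"
  using rapid_abs_summable[of c] by (simp add: norm_mult)

lemma rapid_fourier_summable: "rapid c \<Longrightarrow> (\<lambda>k. c k * fexp k x) summable_on UNIV"
  by (rule abs_summable_summable[OF rapid_fourier_abs])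

lemma fourier_add: "rapid c \<Longrightarrow> rapid d \<Longrightarrow> fourier (\<lambda>k. c k + d k) x = fourier c x + fourier d x"
  unfolding fourier_def distrib_right by (intro infsum_add rapid_fourier_summable)

lemma fourier_cmult: "fourier (\<lambda>k. a * c k) x = a * fourier c x"
  unfolding fourier_def mult.assoc by (rule infsum_cmult_right')

lemma fourier_uminus: "fourier (\<lambda>k. - c k) x = - fourier c x"
  using fourier_cmult[of "- 1"] by simp

lemma fourier_diff: "rapid c \<Longrightarrow> rapid d \<Longrightarrow> fourier (\<lambda>k. c k - d k) x = fourier c x - fourier d x"
  using fourier_add[OF _ rapid_uminus, of c d x] by (simp add: fourier_uminus)

lemma fourier_single: "fourier (\<lambda>k. if k = 0 then a else 0) x = a"
proof -
  have "fourier (\<lambda>k. if k = 0 then a else 0) x = (\<Sum>\<^sub>\<infinity>k\<in>{0::int \<times> int}. a)"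
    unfolding fourier_def by (rule infsum_cong_neutral) auto
  then show ?thesis by simp
qed

lemma fourier_real:
  assumes "\<And>k. c (- k) = cnj (c k)"
  shows "cnj (fourier c x) = fourier c x"
proof -
  have "cnj (fourier c x) = (\<Sum>\<^sub>\<infinity>k. cnj (c k * fexp k x))" by (simp add: fourier_def flip: infsum_cnj)
  also have "\<dots> = fourier c x"
    unfolding fourier_def by (rule infsum_reindex_bij_witness[of _ uminus uminus]) (auto simp: assms fexp_uminus)
  finally show ?thesis .
qed

lemma fourier_periodic: "periodic (fourier c)"
  using periodic_fexp by (simp add: fourier_def periodic_def)

lemma fourier_tail:
  assumes a: "(\<lambda>k. cmod (a k)) summable_on (UNIV :: (int \<times> int) set)" and F: "finite F"
  shows "cmod (sum a F - infsum a UNIV) \<le> infsum (\<lambda>k. cmod (a k)) UNIV - (\<Sum>k\<in>F. cmod (a k))"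
proof -
  have s: "a summable_on A" "(\<lambda>k. cmod (a k)) summable_on A" for A
    using abs_summable_summable[OF a] a by (auto intro: summable_on_subset_banach)
  have 1: "infsum a UNIV = sum a F + infsum a (- F)" 
    using infsum_Un_disjoint[OF s(1)[of F] s(1)[of "- F"]] F by (simp add: Compl_partition)
  have 2: "infsum (\<lambda>k. cmod (a k)) UNIV = (\<Sum>k\<in>F. cmod (a k)) + infsum (\<lambda>k. cmod (a k)) (- F)"
    using infsum_Un_disjoint[OF s(2)[of F] s(2)[of "- F"]] F by (simp add: Compl_partition)
  show ?thesis unfolding 1 2 using norm_infsum_bound[OF s(2)[of "- F"]] by simp
qed

lemma fourier_partial: "rapid c \<Longrightarrow> (\<lambda>n. \<Sum>k\<in>square n. c k * fexp k x) \<longlonglongrightarrow> fourier c x"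
  unfolding fourier_def by (rule tendsto_exhaust[OF rapid_fourier_summable filterlim_square])

text \<open>Termwise differentiation: the derivatives of the partial sums over squares converge
  uniformly, with error at most the tail of the summable majorant \<open>b\<close>.\<close>

lemma fourier_has_derivative:
  assumes c: "rapid c"
  shows "(fourier c has_derivative (\<lambda>h. fst h *\<^sub>R fourier (\<lambda>k. \<i> * of_real (kx k) * c k) x
    + snd h *\<^sub>R fourier (\<lambda>k. \<i> * of_real (ky k) * c k) x)) (at x)"
proof -
  define D where "D x h = fst h *\<^sub>R fourier (\<lambda>k. \<i> * of_real (kx k) * c k) x
    + snd h *\<^sub>R fourier (\<lambda>k. \<i> * of_real (ky k) * c k) x" for x h
  define f where "f n x = (\<Sum>k\<in>square n. c k * fexp k x)" for n x
  define f' where "f' n x h = (\<Sum>k\<in>square n. c k * (\<i> * of_real (kx k * fst h + ky k * snd h) * fexp k x))" for n x h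
  define b where "b k = 2 * (sz k powr 1 * cmod (c k))" for k
  have bs: "b summable_on UNIV" unfolding b_def by (intro summable_on_cmult_right rapid_summable_sz c)
  have trm: "cmod (c k * (\<i> * of_real (kx k * fst h + ky k * snd h) * fexp k x)) \<le> b k * norm h" for k h x
  proof -
    have "\<bar>kx k * fst h + ky k * snd h\<bar> \<le> \<bar>kx k\<bar> * \<bar>fst h\<bar> + \<bar>ky k\<bar> * \<bar>snd h\<bar>"
      by (metis abs_mult abs_triangle_ineq)
    also have "\<dots> \<le> sz k * norm h + sz k * norm h"
      using norm_fst_le[of "fst h" "snd h"] norm_snd_le[of "snd h" "fst h"] sz_nonneg kx_le_sz ky_le_sz
      by (intro add_mono mult_mono) auto
    finally have "cmod (c k) * \<bar>kx k * fst h + ky k * snd h\<bar> \<le> cmod (c k) * (sz k * norm h + sz k * norm h)"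
      by (rule mult_left_mono) simp
    also have "\<dots> = b k * norm h" using sz_pos[of k] by (simp add: b_def)
    finally show ?thesis by (simp add: norm_mult flip: of_real_mult of_real_add)
  qed
  have D_eq: "D x h = (\<Sum>\<^sub>\<infinity>k. c k * (\<i> * of_real (kx k * fst h + ky k * snd h) * fexp k x))" for x h
  proof -
    have "D x h = fourier (\<lambda>k. of_real (fst h) * (\<i> * of_real (kx k) * c k) + of_real (snd h) * (\<i> * of_real (ky k) * c k)) x"
      unfolding D_def by (subst fourier_add) (auto intro!: rapid_cmult rapid_deriv c simp: fourier_cmult scaleR_conv_of_real)
    then show ?thesis by (simp add: fourier_def algebra_simps)
  qed
  have "\<exists>g. \<forall>x\<in>UNIV. (\<lambda>n. f n x) \<longlonglongrightarrow> g x \<and> (g has_derivative D x) (at x within UNIV)"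
  proof (rule has_derivative_sequence[where f'=f'])
    show "(f n has_derivative f' n x) (at x within UNIV)" for n x
      unfolding f_def f'_def by (intro has_derivative_sum has_derivative_mult_right fexp_has_derivative)
    show "\<forall>\<^sub>F n in sequentially. \<forall>x\<in>UNIV. \<forall>h. cmod (f' n x h - D x h) \<le> e * norm h" if e: "e > 0" for e
    proof -
      have "(\<lambda>n. \<Sum>k\<in>square n. b k) \<longlonglongrightarrow> infsum b UNIV" by (rule tendsto_exhaust[OF bs filterlim_square])
      then have "\<forall>\<^sub>F n in sequentially. infsum b UNIV - e < (\<Sum>k\<in>square n. b k)"
        using e by (intro order_tendstoD) auto
      then show ?thesis
      proof eventually_elim
        case (elim n)
        show ?case
        proof (intro ballI allI)
          fix x h
          let ?a = "\<lambda>k. c k * (\<i> * of_real (kx k * fst h + ky k * snd h) * fexp k x)"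
          have bh: "(\<lambda>k. b k * norm h) summable_on UNIV" by (intro summable_on_cmult_left bs)
          have a: "(\<lambda>k. cmod (?a k)) summable_on UNIV"
            by (rule Infinite_Sum.abs_summable_on_comparison_test'[OF bh]) (rule trm)
          have a': "(\<lambda>k. cmod (?a k)) summable_on (- square n)" by (rule summable_on_subset_banach[OF a]) simp
          have bh': "(\<lambda>k. b k * norm h) summable_on (- square n)" by (rule summable_on_subset_banach[OF bh]) simp
          have "cmod (f' n x h - D x h) = cmod (infsum ?a (- square n))"
            using infsum_Un_disjoint[of ?a "square n" "- square n"] abs_summable_summable[OF a']
            by (simp add: f'_def D_eq Compl_partition)
          also have "\<dots> \<le> infsum (\<lambda>k. b k * norm h) (- square n)"
            using norm_infsum_bound[OF a'] infsum_mono[OF a' bh' trm] by linarith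
          also have "\<dots> = infsum b (- square n) * norm h" by (rule infsum_cmult_left')
          also have "infsum b (- square n) = infsum b UNIV - (\<Sum>k\<in>square n. b k)"
            using infsum_Un_disjoint[of b "square n" "- square n"] summable_on_subset_banach[OF bs, of "- square n"]
            by (simp add: Compl_partition)
          also have "(infsum b UNIV - (\<Sum>k\<in>square n. b k)) * norm h \<le> e * norm h"
            using elim by (intro mult_right_mono) auto
          finally show "cmod (f' n x h - D x h) \<le> e * norm h" .
        qed
      qed
    qed
    show "(\<lambda>n. f n 0) \<longlonglongrightarrow> fourier c 0" unfolding f_def by (rule fourier_partial[OF c])
  qed auto
  then obtain g where g: "\<And>x. (\<lambda>n. f n x) \<longlonglongrightarrow> g x" "\<And>x. (g has_derivative D x) (at x)" by auto
  have "g = fourier c"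
    using LIMSEQ_unique[OF g(1) fourier_partial[OF c, folded f_def]] by blast
  then show ?thesis using g(2)[of x] unfolding D_def by simp
qed

lemma pderiv_fourier:
  assumes "rapid c"
  shows "pderiv1 (fourier c) = fourier (\<lambda>k. \<i> * of_real (kx k) * c k)" "pderiv2 (fourier c) = fourier (\<lambda>k. \<i> * of_real (ky k) * c k)"
  using pderiv_eqI[OF fourier_has_derivative[OF assms]] by (auto simp: fun_eq_iff)

lemma fourier_differentiable: "rapid c \<Longrightarrow> fourier c differentiable_on UNIV"
  using fourier_has_derivative by (meson differentiable_at_imp_differentiable_on differentiableI)

lemma fourier_Ck: "rapid c \<Longrightarrow> Ck n (fourier c)"
proof (induction n arbitrary: c)
  case 0 then show ?case using differentiable_imp_continuous_on[OF fourier_differentiable] by simp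
next
  case (Suc n) then show ?case by (simp add: fourier_differentiable pderiv_fourier rapid_deriv)
qed

text \<open>The double series converges absolutely, so it may be summed along the lines k + l =
  m.\<close>

lemma fourier_mult:
  assumes c: "rapid c" and d: "rapid d"
  shows "fourier c x * fourier d x = fourier (\<lambda>m. \<Sum>\<^sub>\<infinity>k. c k * d (m - k)) x"
    and "((\<lambda>m. (\<Sum>\<^sub>\<infinity>k. c k * d (m - k)) * fexp m x) has_sum fourier c x * fourier d x) UNIV"
proof -
  define a where "a k = c k * fexp k x" for k
  define b where "b k = d k * fexp k x" for k
  have as: "(\<lambda>k. cmod (a k)) summable_on UNIV" "(\<lambda>k. cmod (b k)) summable_on UNIV"
    unfolding a_def b_def by (intro rapid_fourier_abs c d)+
  have "(\<lambda>z. cmod ((\<lambda>(k, l). a k * b l) z)) summable_on UNIV \<times> UNIV"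
    unfolding Infinite_Sum.abs_summable_on_Sigma_iff
  proof (intro conjI ballI)
    show "(\<lambda>y. cmod (case (x, y) of (k, l) \<Rightarrow> a k * b l)) summable_on UNIV" for x
      using as(2) by (simp add: norm_mult summable_on_cmult_right)
    have "(\<lambda>x. cmod (a x) * (\<Sum>\<^sub>\<infinity>y. cmod (b y))) summable_on UNIV"
      by (intro summable_on_cmult_left as)
    moreover have "0 \<le> (\<Sum>\<^sub>\<infinity>y. cmod (b y))" by (rule infsum_nonneg) simp
    ultimately show "(\<lambda>x. norm (\<Sum>\<^sub>\<infinity>y. cmod (case (x, y) of (k, l) \<Rightarrow> a k * b l))) summable_on UNIV"
      by (simp add: norm_mult infsum_cmult_right' abs_mult)
  qed
  then have s: "(\<lambda>(k, l). a k * b l) summable_on UNIV \<times> UNIV" by (rule abs_summable_summable)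
  have 1: "infsum (\<lambda>(k, l). a k * b l) (UNIV \<times> UNIV) = fourier c x * fourier d x"
    using infsum_Sigma_banach[OF s] by (simp add: infsum_cmult_right' infsum_cmult_left' fourier_def a_def b_def)
  have hs: "((\<lambda>(k, l). a k * b l) has_sum fourier c x * fourier d x) (UNIV \<times> UNIV)"
    using s 1 by (simp add: has_sum_iff)
  have "((\<lambda>(m, k). a k * b (m - k)) has_sum fourier c x * fourier d x) (UNIV \<times> UNIV)"
    using hs by (subst has_sum_reindex_bij_witness[of _ "\<lambda>(k, l). (k + l, k)" "\<lambda>(m, k). (k, m - k)"]) auto
  then have hs2: "((\<lambda>(m, k). a k * b (m - k)) has_sum fourier c x * fourier d x) (Sigma UNIV (\<lambda>_. UNIV))" by simp
  have conv: "a k * b (m - k) = c k * d (m - k) * fexp m x" for k m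
  proof -
    have "fexp m x = fexp k x * fexp (m - k) x" by (simp add: fexp_add[symmetric])
    then show ?thesis by (simp add: a_def b_def)
  qed
  have s2: "(\<lambda>(m, k). a k * b (m - k)) summable_on Sigma UNIV (\<lambda>_. UNIV)"
    using hs2 by (rule has_sum_imp_summable)
  have inner: "((\<lambda>k. a k * b (m - k)) has_sum (\<Sum>\<^sub>\<infinity>k. c k * d (m - k)) * fexp m x) UNIV" for m
  proof -
    have "(\<lambda>k. a k * b (m - k)) summable_on UNIV"
      using summable_on_SigmaD1[of "\<lambda>m k. a k * b (m - k)" UNIV "\<lambda>_. UNIV" m] s2 by simp
    then have "((\<lambda>k. a k * b (m - k)) has_sum (\<Sum>\<^sub>\<infinity>k. a k * b (m - k))) UNIV" by simp
    then show ?thesis unfolding conv infsum_cmult_left' .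
  qed
  show "((\<lambda>m. (\<Sum>\<^sub>\<infinity>k. c k * d (m - k)) * fexp m x) has_sum fourier c x * fourier d x) UNIV"
    by (rule has_sum_SigmaD[OF hs2]) (use inner in auto)
  then show "fourier c x * fourier d x = fourier (\<lambda>m. \<Sum>\<^sub>\<infinity>k. c k * d (m - k)) x"
    unfolding fourier_def by (simp add: has_sum_iff)
qed

lemma has_sum_diff:
  fixes f g :: "'i \<Rightarrow> complex"
  assumes "(f has_sum a) A" "(g has_sum b) A"
  shows "((\<lambda>k. f k - g k) has_sum (a - b)) A"
  using has_sum_add[OF assms(1), of "\<lambda>k. - g k" "- b"] assms(2) by (simp add: has_sum_uminus)

lemma infsum_diff:
  fixes f g :: "'i \<Rightarrow> complex"
  assumes "f summable_on A" "g summable_on A"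
  shows "(\<Sum>\<^sub>\<infinity>k\<in>A. f k - g k) = infsum f A - infsum g A"
  using infsum_add[OF assms(1), of "\<lambda>k. - g k"] assms(2) by (simp add: summable_on_uminus infsum_uminus)

lemma conv_summable:
  assumes c: "rapid c" and d: "rapid d"
  shows "(\<lambda>k. c k * d (m - k)) summable_on UNIV"
proof -
  obtain H where H: "\<And>F. finite F \<Longrightarrow> (\<Sum>k\<in>F. cmod (c k)) \<le> H"
    using rapid_l1[OF c, of 0] sz_pos by (auto simp: less_imp_neq[THEN not_sym])
  obtain E where "sobolev 0 d E" using rapidD[OF d] by blast
  from young_summable[OF H this] show ?thesis .
qed

lemma fourier_jac:
  assumes f: "rapid f" and g: "rapid g"
  shows "fourier (jac f g) x = pderiv2 (fourier f) x * pderiv1 (fourier g) x - pderiv1 (fourier f) x * pderiv2 (fourier g) x"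
    and "(\<lambda>m. jac f g m * fexp m x) summable_on UNIV"
proof -
  let ?fx = "\<lambda>k. \<i> * of_real (kx k) * f k" and ?fy = "\<lambda>k. \<i> * of_real (ky k) * f k"
  let ?gx = "\<lambda>k. \<i> * of_real (kx k) * g k" and ?gy = "\<lambda>k. \<i> * of_real (ky k) * g k"
  note r = rapid_deriv[OF f] rapid_deriv[OF g]
  have j: "jac f g m = (\<Sum>\<^sub>\<infinity>k. ?fy k * ?gx (m - k)) - (\<Sum>\<^sub>\<infinity>k. ?fx k * ?gy (m - k))" for m
  proof -
    have "(\<Sum>\<^sub>\<infinity>k. ?fy k * ?gx (m - k)) - (\<Sum>\<^sub>\<infinity>k. ?fx k * ?gy (m - k)) = (\<Sum>\<^sub>\<infinity>k. ?fy k * ?gx (m - k) - ?fx k * ?gy (m - k))"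
      by (intro infsum_diff[symmetric] conv_summable r)
    also have "\<dots> = jac f g m"
      unfolding jac_def wedge_def by (intro infsum_cong) (simp add: algebra_simps)
    finally show ?thesis by simp
  qed
  have "((\<lambda>m. jac f g m * fexp m x) has_sum fourier ?fy x * fourier ?gx x - fourier ?fx x * fourier ?gy x) UNIV"
    unfolding j left_diff_distrib by (intro has_sum_diff fourier_mult(2) r)
  then show "fourier (jac f g) x = pderiv2 (fourier f) x * pderiv1 (fourier g) x - pderiv1 (fourier f) x * pderiv2 (fourier g) x"
    "(\<lambda>m. jac f g m * fexp m x) summable_on UNIV"
    by (simp_all add: fourier_def has_sum_iff pderiv_fourier f g)
qed

text \<open>A bootstrap in which each round gains s derivatives: from exponent 2 - s + n s the tame
  estimate puts the Jacobian into exponent n s, and the inverse Laplacian adds 2.\<close>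

lemma rapid_of_fixpoint:
  assumes s: "0 < s" "s < 1 / 2" and \<Psi>: "\<And>j. rapid (\<Psi> j)" and w: "\<And>j. \<exists>R. sobolev (2 - s) (f j) R"
    and eq: "\<And>j k. f j k = \<Psi> j k + nonlin A B f j k"
  shows "rapid (f j)"
proof -
  have it: "\<exists>R. sobolev (2 - s + real n * s) (f j) R" for n j
  proof (induction n arbitrary: j)
    case 0 then show ?case using w by simp
  next
    case (Suc n)
    obtain R1 where R1: "\<And>j. sobolev (2 - s) (f j) (R1 j)" using w by metis
    obtain R2 where R2: "\<And>j. sobolev (2 - s + real n * s) (f j) (R2 j)" using Suc by metis
    define \<eta> where "\<eta> = Max (range (\<lambda>j. \<bar>A j\<bar> + \<bar>B j\<bar>))"
    have \<eta>: "\<bar>A j\<bar> \<le> \<eta>" "\<bar>B j\<bar> \<le> \<eta>" for j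
      using Max_ge[of "range (\<lambda>j. \<bar>A j\<bar> + \<bar>B j\<bar>)" "\<bar>A j\<bar> + \<bar>B j\<bar>", folded \<eta>_def] by force+
    define R where "R = Max (range R2)"
    have "sobolev (real n * s + 1) (f j) (R2 j)" for j using sobolev_exp_mono[OF R2] s by auto
    then have R: "sobolev (real n * s + 1) (f j) R" for j
      by (rule sobolev_mono) (simp add: R_def)
    \<comment> \<open>With \<sigma> = 1 - s and \<tau> = 1 - s + n s the exponent \<tau> - \<sigma>
      of the Jacobian is exactly n s.\<close>
    have e: "1 + (1 - s + real n * s) = 2 - s + real n * s" "1 + (1 - s) = 2 - s" by auto
    have "\<exists>Q. sobolev (real n * s) (jac (f (j + 1)) (f (j + 2))) Q"
      using sobolev_jac_sobolev[of "1 - s" "f (j + 1)" "R1 (j + 1)" "1 - s + real n * s" "R2 (j + 1)" "f (j + 2)" "R1 (j + 2)" "R2 (j + 2)"]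
        R1 R2 s unfolding e by auto
    then obtain Q where Q: "sobolev (real n * s) (jac (f (j + 1)) (f (j + 2))) Q" ..
    have "sobolev (real n * s) (nonlin0 A B f j) (Q + (2 * \<eta> * R + 2 * \<eta> * R))"
      unfolding nonlin0_def by (intro sobolev_add sobolev_diff sobolev_deriv sobolev_cross_lin Q R \<eta>)
    from sobolev_laplace[OF this] have "sobolev (real n * s + 2) (nonlin A B f j) (4 * (Q + (2 * \<eta> * R + 2 * \<eta> * R)))"
      unfolding nonlin_def .
    moreover obtain P where "sobolev (real n * s + 2) (\<Psi> j) P" using rapidD[OF \<Psi>] by blast
    ultimately have "sobolev (real n * s + 2) (\<lambda>k. \<Psi> j k + nonlin A B f j k) (P + 4 * (Q + (2 * \<eta> * R + 2 * \<eta> * R)))"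
      using sobolev_add by blast
    also have "(\<lambda>k. \<Psi> j k + nonlin A B f j k) = f j" using eq by auto
    also have "real n * s + 2 = 2 - s + real (Suc n) * s" by (simp add: algebra_simps)
    finally show ?case by blast
  qed
  show ?thesis unfolding rapid_def
  proof
    fix t
    obtain n :: nat where "t / s \<le> real n" using real_arch_simple by blast
    then have "t \<le> 2 - s + real n * s" using s by (simp add: field_simps)
    then show "\<exists>R. sobolev t (f j) R" using it[of n j] sobolev_exp_mono by blast
  qed
qed

section \<open>Reality of the solution\<close>

lemma sobolev_refl: "sobolev t f R \<Longrightarrow> sobolev t (\<lambda>k. cnj (f (- k))) R"
  unfolding sobolev_def
proof (intro allI impI)
  fix F :: "(int \<times> int) set" assume u: "\<forall>F. finite F \<longrightarrow> L2_set (\<lambda>k. sz k powr t * cmod (f k)) F \<le> R" and F: "finite F"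
  have "L2_set (\<lambda>m. sz m powr t * cmod (cnj (f (- m)))) F = L2_set (\<lambda>k. sz k powr t * cmod (f k)) (uminus ` F)"
    by (subst L2_set_reindex) (auto simp: o_def)
  also have "\<dots> \<le> R" using u F by blast
  finally show "L2_set (\<lambda>m. sz m powr t * cmod (cnj (f (- m)))) F \<le> R" .
qed

lemma jac_refl: "jac (\<lambda>k. cnj (f (- k))) (\<lambda>k. cnj (g (- k))) m = cnj (jac f g (- m))"
proof -
  have "cnj (jac f g (- m)) = (\<Sum>\<^sub>\<infinity>k. cnj (of_real (wedge k (- m - k)) * f k * g (- m - k)))"
    by (simp add: jac_def flip: infsum_cnj)
  also have "\<dots> = jac (\<lambda>k. cnj (f (- k))) (\<lambda>k. cnj (g (- k))) m"
    unfolding jac_def by (rule infsum_reindex_bij_witness[of _ uminus uminus]) (simp_all add: wedge_def minus_diff_commute, simp add: algebra_simps)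
  finally show ?thesis by simp
qed

lemma nonlin_refl: "nonlin A B (\<lambda>j k. cnj (f j (- k))) j k = cnj (nonlin A B f j (- k))"
  by (simp add: nonlin_def nonlin0_def jac_refl cross_lin_def)

text \<open>The reflected conjugate of a solution solves the same equation in the same ball, so
  uniqueness (\<open>solves_fp_diff\<close> with e = 0) identifies the two. That the stream
  functions are real is what \<open>rsol_solves\<close> rests on.\<close>

lemma solves_fp_real:
  assumes b: "0 < b" "2 * b < s" "s < 1 / 2"
    and A: "\<And>j. \<bar>A j\<bar> \<le> \<eta>" "\<And>j. \<bar>B j\<bar> \<le> \<eta>" and small: "nconst b s * (2 * R + \<eta>) \<le> 1 / 2"
    and \<Psi>: "\<And>j. besov b R (\<Psi> j)" "\<And>j. sobolev 1 (\<Psi> j) D" and re: "\<And>j k. \<Psi> j (- k) = cnj (\<Psi> j k)"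
    and \<theta>: "solves_fp s A B R \<Psi> \<theta>"
  shows "\<theta> j (- k) = cnj (\<theta> j k)"
proof -
  define \<theta>' where "\<theta>' j k = cnj (\<theta> j (- k))" for j k
  have "solves_fp s A B R \<Psi> \<theta>'"
    unfolding solves_fp_def
  proof
    show "\<forall>j. sobolev (2 - s) (\<theta>' j) R" using \<theta> sobolev_refl unfolding solves_fp_def \<theta>'_def by blast
    have "nonlin A B (\<lambda>j k. \<Psi> j k + \<theta>' j k) j k = \<theta>' j k" for j k
    proof -
      have "nonlin A B (\<lambda>j k. \<Psi> j k + \<theta>' j k) j k = nonlin A B (\<lambda>j k. cnj (\<Psi> j (- k) + \<theta> j (- k))) j k"
        by (simp add: re \<theta>'_def)
      also have "\<dots> = cnj (nonlin A B (\<lambda>j k. \<Psi> j k + \<theta> j k) j (- k))" by (rule nonlin_refl)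
      also have "\<dots> = \<theta>' j k" using \<theta> unfolding solves_fp_def \<theta>'_def by metis
      finally show ?thesis .
    qed
    then show "\<theta>' = nonlin A B (\<lambda>j k. \<Psi> j k + \<theta>' j k)" by (simp add: fun_eq_iff)
  qed
  from solves_fp_diff[OF b A small \<Psi> \<Psi> _ \<theta> this, of 0]
  have "sobolev (2 - s) (\<lambda>k. \<theta> j k - \<theta>' j k) 0" by (simp add: besov_0)
  from sobolev_coord[OF this, of "- k"] show ?thesis using sz_pos[of "- k"] by (simp add: \<theta>'_def mult_le_0_iff)
qed

section \<open>Suprema and pairings of Fourier series\<close>

lemma besov_exp_mono:
  assumes f: "besov b K f" and bs: "b \<le> s"
  shows "besov s K f"
proof -
  have K: "0 \<le> K" by (rule besov_nonneg[OF f])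
  have "K * (2 ^ n) powr (b - 1) \<le> K * (2 ^ n) powr (s - 1)" "K * (2 ^ n) powr b \<le> K * (2 ^ n) powr s" for n
    using bs by (intro mult_left_mono powr_mono K; simp)+
  then show ?thesis unfolding besov_def using besovD[OF f] order_trans by blast
qed

lemma besov_add:
  assumes f: "besov b K f" and g: "besov b K' g"
  shows "besov b (K + K') (\<lambda>k. f k + g k)"
  unfolding besov_def
  using norm_triangle_mono[OF besovD(2)[OF f] besovD(2)[OF g]] norm_triangle_mono[OF besovD(3)[OF f] besovD(3)[OF g]]
    norm_triangle_mono[OF besovD(4)[OF f] besovD(4)[OF g]] besovD(1)[OF f] besovD(1)[OF g]
  by (simp add: distrib_right distrib_left sum.distrib)

lemma besov_cmult:
  assumes f: "besov b K f"
  shows "besov b (cmod a * K) (\<lambda>k. a * f k)"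
proof -
  have e: "(\<Sum>k\<in>shell n. of_real (c k) * (a * f k) * fexp k x) = a * (\<Sum>k\<in>shell n. of_real (c k) * f k * fexp k x)" for c n x
    by (simp add: sum_distrib_left ac_simps)
  have e': "(\<Sum>k\<in>shell n. (a * f k) * fexp k x) = a * (\<Sum>k\<in>shell n. f k * fexp k x)" for n x
    by (simp add: sum_distrib_left ac_simps)
  show ?thesis unfolding besov_def e e' norm_mult mult.assoc[of "cmod a" K]
    by (intro conjI allI mult_left_mono besovD[OF f] norm_ge_zero) (simp add: besovD(1)[OF f])
qed

text \<open>Cauchy-Schwarz over the at most \<open>16 * 4 ^ n\<close> points of the shell; the
  square root of their number is the factor \<open>4 * 2 ^ n\<close>.\<close>

lemma sobolev_block_sum:
  assumes t: "sobolev r f R" and c: "\<And>k. k \<in> shell n \<Longrightarrow> cmod (c k) \<le> Q" and Q: "0 \<le> Q" and r: "0 \<le> r"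
  shows "cmod (\<Sum>k\<in>shell n. c k * f k * fexp k x) \<le> 4 * Q * R * (2 ^ n) powr (1 - r)"
proof -
  have R: "0 \<le> R" by (rule sobolev_nonneg[OF t])
  have "cmod (\<Sum>k\<in>shell n. c k * f k * fexp k x) \<le> (\<Sum>k\<in>shell n. cmod (c k * f k * fexp k x))" by (rule norm_sum)
  also have "\<dots> \<le> (\<Sum>k\<in>shell n. \<bar>Q * (2 ^ n) powr (- r)\<bar> * \<bar>sz k powr r * cmod (f k)\<bar>)"
  proof (rule sum_mono)
    fix k assume k: "k \<in> shell n"
    have "1 \<le> (2 ^ n) powr (- r) * sz k powr r"
      using powr_mono2[OF r _ sz_shell(1)[OF k]] by (simp add: powr_minus field_simps)
    then have "cmod (c k) * cmod (f k) * 1 \<le> Q * cmod (f k) * ((2 ^ n) powr (- r) * sz k powr r)"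
      by (intro mult_mono c[OF k] mult_nonneg_nonneg Q mult_right_mono) auto
    then show "cmod (c k * f k * fexp k x) \<le> \<bar>Q * (2 ^ n) powr (- r)\<bar> * \<bar>sz k powr r * cmod (f k)\<bar>"
      using Q by (simp add: norm_mult abs_mult ac_simps)
  qed
  also have "\<dots> \<le> L2_set (\<lambda>k. Q * (2 ^ n) powr (- r)) (shell n) * L2_set (\<lambda>k. sz k powr r * cmod (f k)) (shell n)"
    by (rule L2_set_mult_ineq)
  also have "\<dots> \<le> (4 * 2 ^ n * (Q * (2 ^ n) powr (- r))) * R"
  proof (intro mult_mono sobolevD[OF t])
    have "sqrt (real (card (shell n))) \<le> sqrt (16 * 4 ^ n)" using card_shell by (rule real_sqrt_le_mono)
    also have "\<dots> = 4 * 2 ^ n"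
    proof -
      have "(16::real) * 4 ^ n = (4 * 2 ^ n)\<^sup>2" by (simp add: power_mult_distrib power_mult[symmetric] mult.commute[of n]) (simp add: power_mult)
      then show ?thesis by (simp only: real_sqrt_abs) simp
    qed
    finally show "L2_set (\<lambda>k. Q * (2 ^ n) powr (- r)) (shell n) \<le> 4 * 2 ^ n * (Q * (2 ^ n) powr (- r))"
      unfolding L2_set_constant using Q by (intro mult_mono) (auto simp: abs_mult)
  qed (use R Q in auto)
  also have "\<dots> = 4 * Q * R * ((2 ^ n) powr 1 * (2 ^ n) powr (- r))" by simp
  also have "\<dots> = 4 * Q * R * (2 ^ n) powr (1 - r)" unfolding powr_add[symmetric] by simp
  finally show ?thesis .
qed

text \<open>Sobolev embedding in dimension two: one derivative is lost in passing from L2 to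
  suprema. The 8 is the 4 of \<open>sobolev_block_sum\<close> times the 2 in |kx| \<le> 2 * 2 ^
  n.\<close>

lemma sobolev_imp_besov:
  assumes t: "sobolev (2 - s) f R" "f 0 = 0" and s: "s \<le> 2"
  shows "besov s (8 * R) f"
  unfolding besov_def
proof (intro conjI allI)
  have R: "0 \<le> R" by (rule sobolev_nonneg[OF t(1)])
  fix n x
  have "cmod (\<Sum>k\<in>shell n. 1 * f k * fexp k x) \<le> 4 * 1 * R * (2 ^ n) powr (1 - (2 - s))"
    using s by (intro sobolev_block_sum t) auto
  also have "\<dots> \<le> 8 * R * (2 ^ n) powr (s - 1)" using R by (intro mult_mono powr_mono) auto
  finally show "cmod (\<Sum>k\<in>shell n. f k * fexp k x) \<le> 8 * R * (2 ^ n) powr (s - 1)" by simp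
  have e: "4 * (2 * 2 ^ n) * R * (2 ^ n) powr (1 - (2 - s)) = 8 * R * (2 ^ n) powr s"
  proof -
    have "(2 ^ n) powr s = (2 ^ n) powr 1 * (2 ^ n) powr (s - 1)" unfolding powr_add[symmetric] by simp
    then show ?thesis by simp
  qed
  have "cmod (\<Sum>k\<in>shell n. of_real (kx k) * f k * fexp k x) \<le> 4 * (2 * 2 ^ n) * R * (2 ^ n) powr (1 - (2 - s))"
    using s order_trans[OF kx_le_sz sz_shell(2)] by (intro sobolev_block_sum t) auto
  then show "cmod (\<Sum>k\<in>shell n. of_real (kx k) * f k * fexp k x) \<le> 8 * R * (2 ^ n) powr s" unfolding e .
  have "cmod (\<Sum>k\<in>shell n. of_real (ky k) * f k * fexp k x) \<le> 4 * (2 * 2 ^ n) * R * (2 ^ n) powr (1 - (2 - s))"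
    using s order_trans[OF ky_le_sz sz_shell(2)] by (intro sobolev_block_sum t) auto
  then show "cmod (\<Sum>k\<in>shell n. of_real (ky k) * f k * fexp k x) \<le> 8 * R * (2 ^ n) powr s" unfolding e .
qed (fact t(2))

lemma fourier_sup:
  assumes c: "rapid c" and a: "besov s K c" and s: "s < 1"
  shows "cmod (fourier c x) \<le> K * geo (1 - s)"
proof (rule tendsto_upperbound[OF tendsto_norm[OF fourier_partial[OF c]]])
  show "\<forall>\<^sub>F n in sequentially. cmod (\<Sum>k\<in>square n. c k * fexp k x) \<le> K * geo (1 - s)"
  proof (intro always_eventually allI)
    fix n
    have "cmod (\<Sum>k\<in>square n. c k * fexp k x) \<le> (\<Sum>i<n. cmod (\<Sum>k\<in>shell i. c k * fexp k x))"
      unfolding sum_square using besovD(1)[OF a] by (simp add: norm_sum)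
    also have "\<dots> \<le> (\<Sum>i<n. K * (2 ^ i) powr (- (1 - s)))"
      using besovD(2)[OF a] by (intro sum_mono) simp
    also have "\<dots> \<le> K * geo (1 - s)"
      unfolding sum_distrib_left[symmetric] using s by (intro mult_left_mono sum_geo besov_nonneg[OF a]) auto
    finally show "cmod (\<Sum>k\<in>square n. c k * fexp k x) \<le> K * geo (1 - s)" .
  qed
qed simp

lemma cell_integral_bound:
  fixes f :: "plane \<Rightarrow> complex"
  assumes f: "continuous_on UNIV f" and g: "continuous_on UNIV g" and le: "\<And>x. cmod (f x) \<le> M"
  shows "cmod (LINT x:cell|lborel. f x * g x) \<le> M * (LINT x:cell|lborel. cmod (g x))"
proof -
  have "cmod (LINT x:cell|lborel. f x * g x) \<le> (LINT x:cell|lborel. cmod (f x * g x))"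
    by (intro set_integral_norm_bound set_integrable_cell continuous_intros f g)
  also have "\<dots> \<le> (LINT x:cell|lborel. M * cmod (g x))"
    by (intro set_integral_mono set_integrable_cell continuous_intros f g)
       (auto simp: norm_mult intro!: mult_right_mono le)
  finally show ?thesis by simp
qed

lemma fourier_continuous: "rapid c \<Longrightarrow> continuous_on UNIV (fourier c)"
  using fourier_Ck[of c 0] by simp

lemma fourier_integral_tendsto:
  assumes c: "rapid c" and g: "continuous_on UNIV g"
  shows "(\<lambda>n. LINT x:cell|lborel. (\<Sum>k\<in>square n. c k * fexp k x) * g x) \<longlonglongrightarrow> (LINT x:cell|lborel. fourier c x * g x)"
proof -
  let ?I = "\<lambda>n. LINT x:cell|lborel. (\<Sum>k\<in>square n. c k * fexp k x) * g x" and ?G = "LINT x:cell|lborel. cmod (g x)"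
  let ?e = "\<lambda>n. (infsum (\<lambda>k. cmod (c k)) UNIV - (\<Sum>k\<in>square n. cmod (c k))) * ?G"
  have cs: "(\<lambda>k. cmod (c k)) summable_on UNIV" by (rule rapid_abs_summable[OF c])
  have "?e \<longlonglongrightarrow> (infsum (\<lambda>k. cmod (c k)) UNIV - infsum (\<lambda>k. cmod (c k)) UNIV) * ?G"
    by (intro tendsto_intros tendsto_exhaust[OF cs filterlim_square])
  then have e: "?e \<longlonglongrightarrow> 0" by simp
  have cont: "continuous_on UNIV (\<lambda>x. (\<Sum>k\<in>square n. c k * fexp k x))" for n by (intro continuous_intros)
  have "cmod (?I n - (LINT x:cell|lborel. fourier c x * g x)) \<le> ?e n" for n
  proof -
    have "?I n - (LINT x:cell|lborel. fourier c x * g x) = (LINT x:cell|lborel. ((\<Sum>k\<in>square n. c k * fexp k x) - fourier c x) * g x)"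
      unfolding left_diff_distrib
      by (intro set_integral_diff(2)[symmetric] set_integrable_cell continuous_intros fourier_continuous c g)
    also have "cmod \<dots> \<le> ?e n"
    proof (intro cell_integral_bound continuous_intros fourier_continuous c g)
      fix x
      have "cmod (sum (\<lambda>k. c k * fexp k x) (square n) - infsum (\<lambda>k. c k * fexp k x) UNIV)
        \<le> infsum (\<lambda>k. cmod (c k * fexp k x)) UNIV - (\<Sum>k\<in>square n. cmod (c k * fexp k x))"
        by (rule fourier_tail[OF rapid_fourier_abs[OF c]]) simp
      then show "cmod ((\<Sum>k\<in>square n. c k * fexp k x) - fourier c x) \<le> infsum (\<lambda>k. cmod (c k)) UNIV - (\<Sum>k\<in>square n. cmod (c k))"
        by (simp add: fourier_def norm_mult)
    qed
    finally show ?thesis .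
  qed
  then have "(\<lambda>n. ?I n - (LINT x:cell|lborel. fourier c x * g x)) \<longlonglongrightarrow> 0"
    by (intro Lim_null_comparison[OF always_eventually e]) auto
  then show ?thesis by (simp add: LIM_zero_iff)
qed

lemma rapid_trunc: "rapid c \<Longrightarrow> rapid (trunc F c)"
  unfolding rapid_def using trunc_sobolev by blast

lemma fourier_trunc: "finite F \<Longrightarrow> fourier (trunc F c) x = (\<Sum>k\<in>F. c k * fexp k x)"
proof -
  assume "finite F"
  have "fourier (trunc F c) x = (\<Sum>\<^sub>\<infinity>k\<in>F. c k * fexp k x)"
    unfolding fourier_def by (rule infsum_cong_neutral) (auto simp: trunc_def)
  with \<open>finite F\<close> show ?thesis by simp
qed

text \<open>On each dyadic block the derivative is left on \<open>\<psi>\<close> or moved to the test function, whichever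
  is cheaper.\<close>

lemma fourier_pairing:
  assumes c: "rapid c" and a: "besov s K c" and s: "s < \<kappa>" "0 \<le> \<kappa>" "\<kappa> \<le> 1"
    and g: "Ck (Suc 0) g" "periodic g" and l: "0 < l"
    and P: "(LINT x:cell|lborel. cmod (g x)) \<le> P" and Q: "(LINT x:cell|lborel. cmod (pderiv1 g x)) \<le> P / l"
      "(LINT x:cell|lborel. cmod (pderiv2 g x)) \<le> P / l"
  shows "cmod (LINT x:cell|lborel. pderiv1 (fourier c) x * g x) \<le> K * P * geo (\<kappa> - s) * l powr (- \<kappa>)"
    and "cmod (LINT x:cell|lborel. pderiv2 (fourier c) x * g x) \<le> K * P * geo (\<kappa> - s) * l powr (- \<kappa>)"
proof -
  have K: "0 \<le> K" by (rule besov_nonneg[OF a])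
  have "0 \<le> (LINT x:cell|lborel. cmod (g x))" by (auto simp: set_lebesgue_integral_def)
  then have P0: "0 \<le> P" using P by simp
  note g' = Ck_Suc_continuous[OF g(1)]
  \<comment> \<open>Covers both partial derivatives: d is the Fourier symbol of the derivative and
    g1 the same derivative of the test function.\<close>
  have main: "cmod (LINT x:cell|lborel. fourier (\<lambda>k. d k * c k) x * g x) \<le> K * P * geo (\<kappa> - s) * l powr (- \<kappa>)"
    if d0: "d 0 = 0" and dr: "\<And>c. rapid c \<Longrightarrow> rapid (\<lambda>k. d k * c k)"
      and b1: "\<And>n x. cmod (\<Sum>k\<in>shell n. d k * c k * fexp k x) \<le> K * (2 ^ n) powr s"
      and parts: "\<And>c. rapid c \<Longrightarrow> (LINT x:cell|lborel. fourier (\<lambda>k. d k * c k) x * g x) = - (LINT x:cell|lborel. fourier c x * g1 x)"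
      and g1: "continuous_on UNIV g1" "(LINT x:cell|lborel. cmod (g1 x)) \<le> P / l" for d g1
  proof -
    define T where "T n = (LINT x:cell|lborel. (\<Sum>k\<in>shell n. d k * c k * fexp k x) * g x)" for n
    have T1: "cmod (T n) \<le> K * (2 ^ n) powr s * P" for n
    proof -
      have "cmod (T n) \<le> K * (2 ^ n) powr s * (LINT x:cell|lborel. cmod (g x))"
        unfolding T_def by (intro cell_integral_bound continuous_intros g' b1)
      also have "\<dots> \<le> K * (2 ^ n) powr s * P" using P K by (intro mult_left_mono) auto
      finally show ?thesis .
    qed
    have T2: "cmod (T n) \<le> K * (2 ^ n) powr (s - 1) * (P / l)" for n
    proof -
      have "(\<lambda>k. d k * trunc (shell n) c k) = trunc (shell n) (\<lambda>k. d k * c k)" by (auto simp: trunc_def)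
      then have "T n = (LINT x:cell|lborel. fourier (\<lambda>k. d k * trunc (shell n) c k) x * g x)"
        unfolding T_def by (simp add: fourier_trunc)
      also have "\<dots> = - (LINT x:cell|lborel. (\<Sum>k\<in>shell n. c k * fexp k x) * g1 x)"
        by (simp only: parts[OF rapid_trunc[OF c]] fourier_trunc[OF finite_shell])
      also have "cmod \<dots> \<le> K * (2 ^ n) powr (s - 1) * (LINT x:cell|lborel. cmod (g1 x))"
        unfolding norm_minus_cancel by (intro cell_integral_bound continuous_intros g1 besovD(2)[OF a])
      also have "\<dots> \<le> K * (2 ^ n) powr (s - 1) * (P / l)" using g1(2) K by (intro mult_left_mono) auto
      finally show ?thesis .
    qed
    \<comment> \<open>Blocks coarser than l keep the derivative, finer ones move it to the test
      function, which multiplies the bound by 1 / (2 ^ n * l). In the respective ranges both 1 and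
      this factor are at most \<open>(2 ^ n * l) powr (- \<kappa>)\<close>, as 0 \<le> \<kappa>
      \<le> 1.\<close>
    have T: "cmod (T n) \<le> K * P * l powr (- \<kappa>) * (2 ^ n) powr (- (\<kappa> - s))" for n
    proof (cases "2 ^ n * l \<le> 1")
      case True
      have "1 \<le> (2 ^ n * l) powr (- \<kappa>)"
        using powr_mono2'[of "- \<kappa>" "2 ^ n * l" 1] True l s by simp
      then have "K * P * (2 ^ n) powr s * 1 \<le> K * P * (2 ^ n) powr s * (2 ^ n * l) powr (- \<kappa>)"
        using K P0 by (intro mult_left_mono) auto
      also have "\<dots> = K * P * l powr (- \<kappa>) * ((2 ^ n) powr s * (2 ^ n) powr (- \<kappa>))"
        using l by (simp add: powr_mult)
      also have "(2 ^ n) powr s * (2 ^ n) powr (- \<kappa>) = (2 ^ n) powr (- (\<kappa> - s))"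
        unfolding powr_add[symmetric] by simp
      finally show ?thesis using T1[of n] by (simp add: ac_simps)
    next
      case False
      have "(2 ^ n * l) powr (- 1) \<le> (2 ^ n * l) powr (- \<kappa>)"
        using False s by (intro powr_mono) auto
      then have "K * P * (2 ^ n) powr s * (2 ^ n * l) powr (- 1) \<le> K * P * (2 ^ n) powr s * (2 ^ n * l) powr (- \<kappa>)"
        using K P0 by (intro mult_left_mono) auto
      also have "\<dots> = K * P * l powr (- \<kappa>) * ((2 ^ n) powr s * (2 ^ n) powr (- \<kappa>))"
        using l by (simp add: powr_mult)
      also have "(2 ^ n) powr s * (2 ^ n) powr (- \<kappa>) = (2 ^ n) powr (- (\<kappa> - s))"
        unfolding powr_add[symmetric] by simp
      finally have "K * P * (2 ^ n) powr s * (2 ^ n * l) powr (- 1) \<le> K * P * l powr (- \<kappa>) * (2 ^ n) powr (- (\<kappa> - s))" .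
      moreover have "K * P * (2 ^ n) powr s * (2 ^ n * l) powr (- 1) = K * (2 ^ n) powr (s - 1) * (P / l)"
      proof -
        have "(2 ^ n * l) powr (- 1) = (2 ^ n) powr (- 1) / l" using l by (simp add: powr_minus divide_simps)
        moreover have "(2 ^ n) powr (s - 1) = (2 ^ n) powr s * (2 ^ n) powr (- 1)" unfolding powr_add[symmetric] by simp
        ultimately show ?thesis by simp
      qed
      ultimately show ?thesis using T2[of n] by simp
    qed
    have lim: "(\<lambda>n. LINT x:cell|lborel. (\<Sum>k\<in>square n. d k * c k * fexp k x) * g x) \<longlonglongrightarrow> (LINT x:cell|lborel. fourier (\<lambda>k. d k * c k) x * g x)"
      by (rule fourier_integral_tendsto[OF dr[OF c] g'(1)])
    show ?thesis
    proof (rule tendsto_upperbound[OF tendsto_norm[OF lim]], intro always_eventually allI)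
      fix n
      have "(LINT x:cell|lborel. (\<Sum>k\<in>square n. d k * c k * fexp k x) * g x) = (\<Sum>i<n. T i)"
        unfolding T_def sum_square
        by (subst cell_integral_sum[symmetric]) (auto simp: d0 sum_distrib_right intro!: continuous_intros g')
      then have "cmod (LINT x:cell|lborel. (\<Sum>k\<in>square n. d k * c k * fexp k x) * g x) \<le> (\<Sum>i<n. cmod (T i))"
        by (simp add: norm_sum)
      also have "\<dots> \<le> (\<Sum>i<n. K * P * l powr (- \<kappa>) * (2 ^ i) powr (- (\<kappa> - s)))" by (intro sum_mono T)
      also have "\<dots> \<le> K * P * l powr (- \<kappa>) * geo (\<kappa> - s)"
        unfolding sum_distrib_left[symmetric] using K P0 s by (intro mult_left_mono sum_geo) auto
      finally show "cmod (LINT x:cell|lborel. (\<Sum>k\<in>square n. d k * c k * fexp k x) * g x) \<le> K * P * geo (\<kappa> - s) * l powr (- \<kappa>)"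
        by (simp add: ac_simps)
    qed simp
  qed
  have n: "(\<Sum>k\<in>shell n. \<i> * of_real (m k) * c k * fexp k x) = \<i> * (\<Sum>k\<in>shell n. of_real (m k) * c k * fexp k x)" for n m x
    by (simp add: sum_distrib_left ac_simps)
  show "cmod (LINT x:cell|lborel. pderiv1 (fourier c) x * g x) \<le> K * P * geo (\<kappa> - s) * l powr (- \<kappa>)"
    unfolding pderiv_fourier[OF c]
  proof (rule main[OF _ _ _ _ _ Q(1)])
    show "cmod (\<Sum>k\<in>shell n. \<i> * of_real (kx k) * c k * fexp k x) \<le> K * (2 ^ n) powr s" for n x
      unfolding n using besovD(3)[OF a, where n=n and x=x] by (simp add: norm_mult)
    show "(LINT x:cell|lborel. fourier (\<lambda>k. \<i> * of_real (kx k) * c k) x * g x) = - (LINT x:cell|lborel. fourier c x * pderiv1 g x)" if "rapid c" for c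
      using cell_integral_by_parts(1)[OF fourier_Ck[OF that] fourier_periodic g] pderiv_fourier[OF that] by simp
  qed (auto simp: rapid_deriv g')
  show "cmod (LINT x:cell|lborel. pderiv2 (fourier c) x * g x) \<le> K * P * geo (\<kappa> - s) * l powr (- \<kappa>)"
    unfolding pderiv_fourier[OF c]
  proof (rule main[OF _ _ _ _ _ Q(2)])
    show "cmod (\<Sum>k\<in>shell n. \<i> * of_real (ky k) * c k * fexp k x) \<le> K * (2 ^ n) powr s" for n x
      unfolding n using besovD(4)[OF a, where n=n and x=x] by (simp add: norm_mult)
    show "(LINT x:cell|lborel. fourier (\<lambda>k. \<i> * of_real (ky k) * c k) x * g x) = - (LINT x:cell|lborel. fourier c x * pderiv2 g x)" if "rapid c" for c
      using cell_integral_by_parts(2)[OF fourier_Ck[OF that] fourier_periodic g] pderiv_fourier[OF that] by simp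
  qed (auto simp: rapid_deriv g')
qed

section \<open>Periodization and the mollifier\<close>

definition supp_le :: "real \<Rightarrow> (plane \<Rightarrow> 'b::zero) \<Rightarrow> bool" where
  "supp_le R f \<longleftrightarrow> (\<forall>x. R < norm x \<longrightarrow> f x = 0)"

lemma norm_lattice_pt: "m \<notin> square n \<Longrightarrow> 2 ^ n \<le> norm (lattice_pt m)"
proof -
  assume "m \<notin> square n"
  then have "(2::int) ^ n \<le> \<bar>fst m\<bar> \<or> 2 ^ n \<le> \<bar>snd m\<bar>" by (auto simp: square_def)
  then have "(2::real) ^ n \<le> \<bar>of_int (fst m)\<bar> \<or> (2::real) ^ n \<le> \<bar>of_int (snd m)\<bar>"
  proof (elim disj_forward)
    have "(2::real) ^ n \<le> \<bar>of_int i\<bar>" if "(2::int) ^ n \<le> \<bar>i\<bar>" for i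
      using that[folded of_int_le_iff[where ?'a=real]] by simp
    then show "(2::int) ^ n \<le> \<bar>fst m\<bar> \<Longrightarrow> (2::real) ^ n \<le> \<bar>of_int (fst m)\<bar>"
      "(2::int) ^ n \<le> \<bar>snd m\<bar> \<Longrightarrow> (2::real) ^ n \<le> \<bar>of_int (snd m)\<bar>" by blast+
  qed
  moreover have "\<bar>of_int (fst m)\<bar> \<le> norm (lattice_pt m)" "\<bar>of_int (snd m)\<bar> \<le> norm (lattice_pt m)"
    using norm_fst_le[of "of_int (fst m) :: real" "of_int (snd m) :: real"]
      norm_snd_le[of "of_int (snd m) :: real" "of_int (fst m) :: real"]
    by (simp_all add: lattice_pt_def)
  ultimately show ?thesis by linarith
qed

lemma supp_leD: "supp_le R f \<Longrightarrow> R < norm x \<Longrightarrow> f x = 0"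
  by (simp only: supp_le_def)

lemma periodicD: "periodic f \<Longrightarrow> f (x + (2 * pi) *\<^sub>R lattice_pt m) = f x"
  by (simp only: periodic_def)

text \<open>n depends only on the support radius and on r, so near a point one finite index set
  serves the periodization of f and of its derivatives simultaneously.\<close>

lemma periodize_supp_le:
  "\<exists>n. \<forall>(f :: plane \<Rightarrow> complex) x. supp_le R f \<longrightarrow> norm x \<le> r \<longrightarrow>
     periodize f x = (\<Sum>m\<in>square n. f (x + (2 * pi) *\<^sub>R lattice_pt m)) \<and>
     (\<forall>m. m \<notin> square n \<longrightarrow> f (x + (2 * pi) *\<^sub>R lattice_pt m) = 0)"
proof -
  obtain n :: nat where n: "\<bar>R\<bar> + \<bar>r\<bar> < 2 ^ n" using real_arch_pow[of 2 "\<bar>R\<bar> + \<bar>r\<bar>"] by auto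
  have z: "f (x + (2 * pi) *\<^sub>R lattice_pt m) = 0" if f: "supp_le R f" and x: "norm x \<le> r" and m: "m \<notin> square n" for f :: "plane \<Rightarrow> complex" and x m
  proof -
    have "2 ^ n * 1 \<le> norm (lattice_pt m) * (2 * pi)"
      using norm_lattice_pt[OF m] pi_gt3 by (intro mult_mono) auto
    then have "2 ^ n \<le> norm ((2 * pi) *\<^sub>R lattice_pt m)" by (simp add: ac_simps)
    also have "\<dots> \<le> norm (x + (2 * pi) *\<^sub>R lattice_pt m) + norm x"
      using norm_triangle_ineq4[of "x + (2 * pi) *\<^sub>R lattice_pt m" x] by simp
    finally have "R < norm (x + (2 * pi) *\<^sub>R lattice_pt m)" using n x by linarith
    then show ?thesis by (rule supp_leD[OF f])
  qed
  have "periodize f x = (\<Sum>m\<in>square n. f (x + (2 * pi) *\<^sub>R lattice_pt m))" if "supp_le R f" "norm x \<le> r"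
    for f :: "plane \<Rightarrow> complex" and x
  proof -
    have "periodize f x = (\<Sum>\<^sub>\<infinity>m\<in>square n. f (x + (2 * pi) *\<^sub>R lattice_pt m))"
      unfolding periodize_def by (rule infsum_cong_neutral) (use z[OF that] in auto)
    then show ?thesis by simp
  qed
  with z show ?thesis by (intro exI[of _ n] allI impI conjI)
qed

lemma periodic_periodize: "periodic (periodize f)"
  unfolding periodic_def
proof (intro allI)
  fix m x
  show "periodize f (x + (2 * pi) *\<^sub>R lattice_pt m) = periodize f x"
    unfolding periodize_def
    by (rule infsum_reindex_bij_witness[of _ "\<lambda>k. k - m" "\<lambda>k. k + m"])
       (auto simp: lattice_pt_add scaleR_add_right add_ac)
qed

lemma periodize_mult:
  assumes "periodic g"
  shows "g x * periodize f x = periodize (\<lambda>y. g y * f y) x"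
proof -
  have "g x * periodize f x = (\<Sum>\<^sub>\<infinity>m. g x * f (x + (2 * pi) *\<^sub>R lattice_pt m))"
    unfolding periodize_def by (rule infsum_cmult_right'[symmetric])
  also have "\<dots> = (\<Sum>\<^sub>\<infinity>m. g (x + (2 * pi) *\<^sub>R lattice_pt m) * f (x + (2 * pi) *\<^sub>R lattice_pt m))"
    by (intro infsum_cong arg_cong2[where f="(*)"] periodicD[OF assms, symmetric] refl)
  finally show ?thesis unfolding periodize_def .
qed

lemma supp_le_pderiv:
  fixes f :: "plane \<Rightarrow> 'b::real_normed_vector"
  assumes "supp_le R f"
  shows "supp_le R (pderiv1 f)" "supp_le R (pderiv2 f)"
proof -
  have "(f has_derivative (\<lambda>_. 0)) (at x)" if "R < norm x" for x
  proof -
    have o: "open {x :: plane. R < norm x}" by (intro open_Collect_less continuous_intros)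
    have "((\<lambda>_. 0 :: 'b) has_derivative (\<lambda>_. 0)) (at x)" by (rule has_derivative_const)
    then show ?thesis
      by (rule has_derivative_transform_within_open[OF _ o]) (use assms that in \<open>auto simp: supp_le_def\<close>)
  qed
  then show "supp_le R (pderiv1 f)" "supp_le R (pderiv2 f)"
    using pderiv_eqI unfolding supp_le_def by metis+
qed

lemma periodize_has_derivative:
  fixes f :: "plane \<Rightarrow> complex"
  assumes f: "f differentiable_on UNIV" "supp_le R f"
  shows "(periodize f has_derivative (\<lambda>h. fst h *\<^sub>R periodize (pderiv1 f) x + snd h *\<^sub>R periodize (pderiv2 f) x)) (at x)"
proof -
  obtain n where n': "\<forall>(f :: plane \<Rightarrow> complex) x'. supp_le R f \<longrightarrow> norm x' \<le> norm x + 1 \<longrightarrow>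
       periodize f x' = (\<Sum>m\<in>square n. f (x' + (2 * pi) *\<^sub>R lattice_pt m)) \<and>
       (\<forall>m. m \<notin> square n \<longrightarrow> f (x' + (2 * pi) *\<^sub>R lattice_pt m) = 0)"
      using periodize_supp_le[of R "norm x + 1"] ..
    note n = conjunct1[OF n'[rule_format]] conjunct2[OF n'[rule_format], rule_format]
  have per: "periodize h y = (\<Sum>m\<in>square n. h (y + (2 * pi) *\<^sub>R lattice_pt m))" if "supp_le R h" "y \<in> ball x 1" for h y
  proof (rule n(1)[OF that(1)])
    have "norm y \<le> norm x + dist x y" using norm_triangle_sub[of y x] by (simp add: dist_norm norm_minus_commute)
    then show "norm y \<le> norm x + 1" using that(2) by simp
  qed
  have d: "(f has_derivative (\<lambda>h. fst h *\<^sub>R pderiv1 f y + snd h *\<^sub>R pderiv2 f y)) (at y)" for y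
    using f(1) by (intro pderiv_has_derivative) (metis UNIV_I differentiable_on_def)
  have "((\<lambda>y. \<Sum>m\<in>square n. f (y + (2 * pi) *\<^sub>R lattice_pt m)) has_derivative
     (\<lambda>h. \<Sum>m\<in>square n. fst h *\<^sub>R pderiv1 f (x + (2 * pi) *\<^sub>R lattice_pt m) + snd h *\<^sub>R pderiv2 f (x + (2 * pi) *\<^sub>R lattice_pt m))) (at x)"
  proof (rule has_derivative_sum)
    fix m
    have "((\<lambda>y. y + (2 * pi) *\<^sub>R lattice_pt m) has_derivative (\<lambda>h. h)) (at x)"
      by (auto intro!: derivative_eq_intros)
    from has_derivative_compose[OF this d]
    show "((\<lambda>y. f (y + (2 * pi) *\<^sub>R lattice_pt m)) has_derivative
      (\<lambda>h. fst h *\<^sub>R pderiv1 f (x + (2 * pi) *\<^sub>R lattice_pt m) + snd h *\<^sub>R pderiv2 f (x + (2 * pi) *\<^sub>R lattice_pt m))) (at x)" .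
  qed
  then have "(periodize f has_derivative
     (\<lambda>h. \<Sum>m\<in>square n. fst h *\<^sub>R pderiv1 f (x + (2 * pi) *\<^sub>R lattice_pt m) + snd h *\<^sub>R pderiv2 f (x + (2 * pi) *\<^sub>R lattice_pt m))) (at x)"
    by (rule has_derivative_transform_within_open[where s="ball x 1"]) (auto simp: per[OF f(2)])
  then have "(periodize f has_derivative
     (\<lambda>h. fst h *\<^sub>R (\<Sum>m\<in>square n. pderiv1 f (x + (2 * pi) *\<^sub>R lattice_pt m)) + snd h *\<^sub>R (\<Sum>m\<in>square n. pderiv2 f (x + (2 * pi) *\<^sub>R lattice_pt m)))) (at x)"
    by (simp only: sum.distrib scaleR_sum_right)
  moreover have x: "x \<in> ball x 1" by simp
  ultimately show ?thesis
    by (simp only: per[OF supp_le_pderiv(1)[OF f(2)] x] per[OF supp_le_pderiv(2)[OF f(2)] x])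
qed

lemma pderiv_periodize:
  fixes f :: "plane \<Rightarrow> complex"
  assumes f: "f differentiable_on UNIV" "supp_le R f"
  shows "pderiv1 (periodize f) = periodize (pderiv1 f)" "pderiv2 (periodize f) = periodize (pderiv2 f)"
proof -
  have "pderiv1 (periodize f) x = fst (1::real, 0::real) *\<^sub>R periodize (pderiv1 f) x + snd (1::real, 0::real) *\<^sub>R periodize (pderiv2 f) x" for x
    by (rule pderiv_eqI(1)[OF periodize_has_derivative[OF f]])
  moreover have "pderiv2 (periodize f) x = fst (0::real, 1::real) *\<^sub>R periodize (pderiv1 f) x + snd (0::real, 1::real) *\<^sub>R periodize (pderiv2 f) x" for x
    by (rule pderiv_eqI(2)[OF periodize_has_derivative[OF f]])
  ultimately show "pderiv1 (periodize f) = periodize (pderiv1 f)" "pderiv2 (periodize f) = periodize (pderiv2 f)"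
    unfolding fst_conv snd_conv scaleR_one scaleR_zero_left add_0_left add_0_right by blast+
qed

lemma Ck_continuous: "Ck n f \<Longrightarrow> continuous_on UNIV f"
  by (cases n) (simp_all add: differentiable_imp_continuous_on)

lemma periodize_continuous:
  fixes f :: "plane \<Rightarrow> complex"
  assumes f: "continuous_on UNIV f" "supp_le R f"
  shows "continuous_on UNIV (periodize f)"
proof -
  have "continuous (at x) (periodize f)" for x
  proof -
    obtain n where n': "\<forall>(f :: plane \<Rightarrow> complex) x'. supp_le R f \<longrightarrow> norm x' \<le> norm x + 1 \<longrightarrow>
       periodize f x' = (\<Sum>m\<in>square n. f (x' + (2 * pi) *\<^sub>R lattice_pt m)) \<and>
       (\<forall>m. m \<notin> square n \<longrightarrow> f (x' + (2 * pi) *\<^sub>R lattice_pt m) = 0)"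
      using periodize_supp_le[of R "norm x + 1"] ..
    note n = conjunct1[OF n'[rule_format]] conjunct2[OF n'[rule_format], rule_format]
    have per: "periodize f y = (\<Sum>m\<in>square n. f (y + (2 * pi) *\<^sub>R lattice_pt m))" if "y \<in> ball x 1" for y
    proof (rule n(1)[OF f(2)])
      have "norm y \<le> norm x + dist x y" using norm_triangle_sub[of y x] by (simp add: dist_norm norm_minus_commute)
      then show "norm y \<le> norm x + 1" using that by simp
    qed
    have "continuous_on (ball x 1) (\<lambda>y. \<Sum>m\<in>square n. f (y + (2 * pi) *\<^sub>R lattice_pt m))"
      by (intro continuous_intros continuous_on_compose2[OF f(1)]) auto
    then have "continuous_on (ball x 1) (periodize f)"
      by (rule continuous_on_eq) (simp add: per)
    then show ?thesis by (simp add: continuous_on_eq_continuous_at)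
  qed
  then show ?thesis by (simp add: continuous_on_eq_continuous_at)
qed

lemma Ck_periodize:
  fixes f :: "plane \<Rightarrow> complex"
  assumes "Ck n f" "supp_le R f"
  shows "Ck n (periodize f)"
  using assms
proof (induction n arbitrary: f)
  case 0 then show ?case by (simp add: periodize_continuous)
next
  case (Suc n)
  then have f: "f differentiable_on UNIV" "supp_le R f" by auto
  have "periodize f differentiable_on UNIV"
    using periodize_has_derivative[OF f] by (meson differentiable_at_imp_differentiable_on differentiableI)
  moreover have "Ck n (periodize (pderiv1 f))" "Ck n (periodize (pderiv2 f))"
    using Suc.prems by (auto intro!: Suc.IH supp_le_pderiv[OF f(2)])
  ultimately show ?case by (simp add: pderiv_periodize[OF f])
qed

lemma periodize_smooth_torus:
  fixes f :: "plane \<Rightarrow> complex"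
  shows "smooth f \<Longrightarrow> supp_le R f \<Longrightarrow> periodize f \<in> smooth_torus"
  unfolding smooth_torus_def smooth_def using Ck_periodize periodic_periodize by blast

text \<open>Half-open, so that its lattice translates partition the plane exactly; it differs from
  \<open>cell\<close> by a null set.\<close>

definition hcell :: "plane set" where "hcell = {-pi..<pi} \<times> {-pi..<pi}"

lemma hcell_measurable [measurable]: "hcell \<in> sets borel"
  unfolding hcell_def by (intro borel_Times) auto

lemma AE_hcell: "AE x in lborel. x \<in> cell \<longleftrightarrow> x \<in> hcell"
proof -
  let ?b = "box (- pi, - pi) (pi, pi) :: plane set"
  have "emeasure lborel cell = emeasure lborel ?b"
    unfolding cell_def emeasure_lborel_cbox_eq emeasure_lborel_box_eq by simp
  then have "emeasure lborel (cell - ?b) = 0"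
    using emeasure_cell_finite unfolding cell_def
    by (subst emeasure_Diff) (auto simp: box_subset_cbox less_top)
  then have ae: "AE x in lborel. x \<notin> cell - ?b"
    by (intro AE_not_in) (auto simp: null_sets_def)
  have sub: "?b \<subseteq> hcell" "hcell \<subseteq> cell"
    by (auto simp: hcell_def cell_def mem_box Basis_prod_def inner_prod_def)
  from ae show ?thesis by eventually_elim (use sub in blast)
qed

lemma hcell_unique: "\<exists>!m. y - (2 * pi) *\<^sub>R lattice_pt m \<in> hcell"
proof -
  have "y - (2 * pi) *\<^sub>R lattice_pt m \<in> hcell \<longleftrightarrow> fst m = \<lfloor>(fst y + pi) / (2 * pi)\<rfloor> \<and> snd m = \<lfloor>(snd y + pi) / (2 * pi)\<rfloor>" for m
  proof -
    have *: "- pi \<le> t - 2 * pi * of_int i \<and> t - 2 * pi * of_int i < pi \<longleftrightarrow> i = \<lfloor>(t + pi) / (2 * pi)\<rfloor>" for t i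
    proof -
      have "i = \<lfloor>(t + pi) / (2 * pi)\<rfloor> \<longleftrightarrow> of_int i \<le> (t + pi) / (2 * pi) \<and> (t + pi) / (2 * pi) < of_int i + 1"
        using floor_eq_iff[of "(t + pi) / (2 * pi)" i] by (simp only: eq_commute[of i])
      also have "\<dots> \<longleftrightarrow> of_int i * (2 * pi) \<le> t + pi \<and> t + pi < (of_int i + 1) * (2 * pi)"
        by (simp add: pos_le_divide_eq pos_divide_less_eq)
      also have "\<dots> \<longleftrightarrow> - pi \<le> t - 2 * pi * of_int i \<and> t - 2 * pi * of_int i < pi"
        by (auto simp: algebra_simps)
      finally show ?thesis by simp
    qed
    show ?thesis unfolding *[symmetric] by (auto simp: hcell_def lattice_pt_def mem_Times_iff)
  qed
  then show ?thesis by (intro ex1I[of _ "(\<lfloor>(fst y + pi) / (2 * pi)\<rfloor>, \<lfloor>(snd y + pi) / (2 * pi)\<rfloor>)"]) (auto simp: prod_eq_iff)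
qed

lemma lborel_integral_affine:
  fixes g :: "'a::euclidean_space \<Rightarrow> 'b::{banach, second_countable_topology}"
  assumes [measurable]: "g \<in> borel_measurable borel" and c: "c \<noteq> 0"
  shows "integral\<^sup>L lborel g = \<bar>c\<bar> ^ DIM('a) *\<^sub>R (LINT x|lborel. g (t + c *\<^sub>R x))"
proof -
  have "integral\<^sup>L lborel g = integral\<^sup>L (density (distr lborel borel (\<lambda>x. t + c *\<^sub>R x)) (\<lambda>_. \<bar>c\<bar>^DIM('a))) g"
    by (subst lborel_affine[OF c, of t]) simp
  also have "\<dots> = (\<integral>x. (\<bar>c\<bar>^DIM('a)) *\<^sub>R g x \<partial>(distr lborel borel (\<lambda>x. t + c *\<^sub>R x)))"
    using integral_density[of g "distr lborel borel (\<lambda>x. t + c *\<^sub>R x)" "\<lambda>_. \<bar>c\<bar>^DIM('a)"] by (simp add: ennreal_power)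
  also have "\<dots> = (\<integral>x. (\<bar>c\<bar>^DIM('a)) *\<^sub>R g (t + c *\<^sub>R x) \<partial>lborel)"
    by (subst integral_distr) auto
  finally show ?thesis by simp
qed

lemma integrable_supp_le:
  fixes f :: "plane \<Rightarrow> 'b::{banach, second_countable_topology}"
  assumes f: "continuous_on UNIV f" "supp_le R f"
  shows "integrable lborel f"
proof -
  have "integrable lborel (\<lambda>x. indicator (cball 0 R) x *\<^sub>R f x)"
    by (rule borel_integrable_compact) (auto intro: continuous_on_subset[OF f(1)])
  also have "(\<lambda>x. indicator (cball 0 R) x *\<^sub>R f x) = f"
    using f(2) by (auto simp: supp_le_def fun_eq_iff indicator_def not_le split: prod.splits)
  finally show ?thesis .
qed

text \<open>Unfolding: shifting each term of the periodization moves the cell to one of its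
  translates, and these tile the plane.\<close>

lemma cell_integral_periodize:
  fixes f :: "plane \<Rightarrow> complex"
  assumes f: "continuous_on UNIV f" "supp_le R f"
  shows "(LINT x:cell|lborel. periodize f x) = (LINT x|lborel. f x)"
proof -
  have fm [measurable]: "f \<in> borel_measurable borel" using f(1) by (rule borel_measurable_continuous_onI)
  have pm [measurable]: "periodize f \<in> borel_measurable borel"
    using periodize_continuous[OF f] by (rule borel_measurable_continuous_onI)
  obtain r where r: "\<And>x. x \<in> hcell \<Longrightarrow> norm x \<le> r"
  proof -
    have "bounded hcell" 
      by (rule bounded_subset[of cell]) (auto simp: cell_def hcell_def mem_box Basis_prod_def inner_prod_def)
    then show ?thesis using that unfolding bounded_iff by blast
  qed
  obtain n where n': "\<forall>(f :: plane \<Rightarrow> complex) x'. supp_le R f \<longrightarrow> norm x' \<le> r \<longrightarrow>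
       periodize f x' = (\<Sum>m\<in>square n. f (x' + (2 * pi) *\<^sub>R lattice_pt m)) \<and>
       (\<forall>m. m \<notin> square n \<longrightarrow> f (x' + (2 * pi) *\<^sub>R lattice_pt m) = 0)"
      using periodize_supp_le[of R r] ..
    note n = conjunct1[OF n'[rule_format]] conjunct2[OF n'[rule_format], rule_format]
  have fi: "integrable lborel f" by (rule integrable_supp_le[OF f])
  have hi: "integrable lborel (\<lambda>y. indicator hcell (y - (2 * pi) *\<^sub>R lattice_pt m) *\<^sub>R f y)" for m
    by (rule Bochner_Integration.integrable_bound[OF fi]) (auto split: split_indicator)
  have hi': "integrable lborel (\<lambda>x. indicator hcell x *\<^sub>R f (x + (2 * pi) *\<^sub>R lattice_pt m))" for m
  proof -
    have "supp_le (R + norm ((2 * pi) *\<^sub>R lattice_pt m)) (\<lambda>x. f (x + (2 * pi) *\<^sub>R lattice_pt m))"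
      unfolding supp_le_def
    proof (intro allI impI)
      fix x :: plane assume "R + norm ((2 * pi) *\<^sub>R lattice_pt m) < norm x"
      moreover have "norm x \<le> norm (x + (2 * pi) *\<^sub>R lattice_pt m) + norm ((2 * pi) *\<^sub>R lattice_pt m)"
        by (metis add_diff_cancel_right' norm_triangle_ineq4)
      ultimately have "R < norm (x + (2 * pi) *\<^sub>R lattice_pt m)" by simp
      then show "f (x + (2 * pi) *\<^sub>R lattice_pt m) = 0" by (rule supp_leD[OF f(2)])
    qed
    then have "integrable lborel (\<lambda>x. f (x + (2 * pi) *\<^sub>R lattice_pt m))"
      by (rule integrable_supp_le[rotated]) (intro continuous_on_compose2[OF f(1)] continuous_intros, auto)
    then show ?thesis
      by (rule Bochner_Integration.integrable_bound) (auto split: split_indicator)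
  qed
  have "(LINT x:cell|lborel. periodize f x) = (LINT x|lborel. indicator hcell x *\<^sub>R periodize f x)"
    unfolding set_lebesgue_integral_def
    by (rule integral_cong_AE, measurable) (use AE_hcell in \<open>auto split: split_indicator\<close>)
  also have "\<dots> = (LINT x|lborel. (\<Sum>m\<in>square n. indicator hcell x *\<^sub>R f (x + (2 * pi) *\<^sub>R lattice_pt m)))"
    by (intro Bochner_Integration.integral_cong refl)
       (auto split: split_indicator simp: n(1)[OF f(2) r])
  also have "\<dots> = (\<Sum>m\<in>square n. LINT x|lborel. indicator hcell x *\<^sub>R f (x + (2 * pi) *\<^sub>R lattice_pt m))"
    by (intro Bochner_Integration.integral_sum hi')
  also have "\<dots> = (\<Sum>m\<in>square n. LINT y|lborel. indicator hcell (y - (2 * pi) *\<^sub>R lattice_pt m) *\<^sub>R f y)"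
  proof (intro sum.cong refl)
    fix m
    show "(LINT x|lborel. indicator hcell x *\<^sub>R f (x + (2 * pi) *\<^sub>R lattice_pt m)) = (LINT y|lborel. indicator hcell (y - (2 * pi) *\<^sub>R lattice_pt m) *\<^sub>R f y)"
      using lborel_integral_affine[of "\<lambda>y. indicator hcell (y - (2 * pi) *\<^sub>R lattice_pt m) *\<^sub>R f y" 1 "(2 * pi) *\<^sub>R lattice_pt m"]
      by (simp add: add.commute)
  qed
  also have "\<dots> = (LINT y|lborel. (\<Sum>m\<in>square n. indicator hcell (y - (2 * pi) *\<^sub>R lattice_pt m) *\<^sub>R f y))"
    by (intro Bochner_Integration.integral_sum[symmetric] hi)
  also have "\<dots> = (LINT y|lborel. f y)"
  proof (intro Bochner_Integration.integral_cong refl)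
    fix y :: plane
    define P where "P m \<longleftrightarrow> y - (2 * pi) *\<^sub>R lattice_pt m \<in> hcell" for m
    have ex1: "\<exists>!m. P m" unfolding P_def by (rule hcell_unique)
    define m where "m = (THE m. P m)"
    have m: "P m" unfolding m_def by (rule theI'[OF ex1])
    have m': "m' = m" if "P m'" for m'
      unfolding m_def by (rule the1_equality[OF ex1 that, symmetric])
    have i: "indicator hcell (y - (2 * pi) *\<^sub>R lattice_pt m') *\<^sub>R f y = (if m' = m then f y else 0)" for m'
    proof (cases "P m'")
      case True
      then have "m' = m" by (rule m')
      with True show ?thesis by (simp add: P_def)
    next
      case False
      then have "m' \<noteq> m" using m by metis
      with False show ?thesis by (simp add: P_def)
    qed
    \<comment> \<open>If the unique translate containing y is missing from the finite sum, f
      vanishes at y, so nothing is lost.\<close>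
    have "f y = 0" if "m \<notin> square n"
      using n(2)[OF f(2) r[OF m[unfolded P_def]] that] by simp
    then show "(\<Sum>m\<in>square n. indicator hcell (y - (2 * pi) *\<^sub>R lattice_pt m) *\<^sub>R f y) = f y"
      unfolding i by auto
  qed
  finally show ?thesis .
qed

text \<open>The triangle inequality inside the periodization, then unfolding applied to the modulus
  of f.\<close>

lemma cell_integral_norm_periodize:
  fixes f :: "plane \<Rightarrow> complex"
  assumes f: "continuous_on UNIV f" "supp_le R f"
  shows "(LINT x:cell|lborel. cmod (periodize f x)) \<le> (LINT x|lborel. cmod (f x))"
proof -
  let ?g = "\<lambda>x. complex_of_real (cmod (f x))"
  have g: "continuous_on UNIV ?g" "supp_le R ?g"
    using f by (auto intro!: continuous_intros simp: supp_le_def)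
  have pt: "complex_of_real (cmod (periodize f x)) = of_real (cmod (periodize f x)) \<and> cmod (periodize f x) \<le> Re (periodize ?g x)" for x
  proof -
    obtain n where n': "\<forall>(f :: plane \<Rightarrow> complex) x'. supp_le R f \<longrightarrow> norm x' \<le> norm x \<longrightarrow>
       periodize f x' = (\<Sum>m\<in>square n. f (x' + (2 * pi) *\<^sub>R lattice_pt m)) \<and>
       (\<forall>m. m \<notin> square n \<longrightarrow> f (x' + (2 * pi) *\<^sub>R lattice_pt m) = 0)"
      using periodize_supp_le[of R "norm x"] ..
    note n = conjunct1[OF n'[rule_format]] conjunct2[OF n'[rule_format], rule_format]
    show ?thesis unfolding n(1)[OF f(2) order_refl] n(1)[OF g(2) order_refl]
      by (simp add: norm_sum)
  qed
  have "(LINT x:cell|lborel. cmod (periodize f x)) \<le> (LINT x:cell|lborel. Re (periodize ?g x))"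
    using pt by (intro set_integral_mono set_integrable_cell continuous_intros periodize_continuous[OF f] periodize_continuous[OF g]) auto
  also have "\<dots> = Re (LINT x:cell|lborel. periodize ?g x)"
    using set_integrable_cell[OF periodize_continuous[OF g]]
    unfolding set_lebesgue_integral_def set_integrable_def by (subst integral_Re[symmetric]) auto
  also have "\<dots> = (LINT x|lborel. cmod (f x))"
    unfolding cell_integral_periodize[OF g] by simp
  finally show ?thesis .
qed

section \<open>Smoothness of the bump function\<close>

lemma Ck_Suc_Ck: "Ck (Suc n) f \<Longrightarrow> Ck n f"
proof (induction n arbitrary: f)
  case 0
  then show ?case by (simp add: differentiable_imp_continuous_on)
next
  case (Suc n)
  from Suc.prems have "f differentiable_on UNIV" and p: "Ck (Suc n) (pderiv1 f)" "Ck (Suc n) (pderiv2 f)"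
    by simp_all
  with Suc.IH[OF p(1)] Suc.IH[OF p(2)] show ?case by simp
qed

lemma pderiv_add:
  fixes f g :: "plane \<Rightarrow> 'b::real_normed_vector"
  assumes "f differentiable (at x)" "g differentiable (at x)"
  shows "pderiv1 (\<lambda>x. f x + g x) x = pderiv1 f x + pderiv1 g x"
    and "pderiv2 (\<lambda>x. f x + g x) x = pderiv2 f x + pderiv2 g x"
  using pderiv_eqI[OF has_derivative_add[OF pderiv_has_derivative[OF assms(1)] pderiv_has_derivative[OF assms(2)]]]
  by simp_all

lemma differentiable_on_UNIV_at: "f differentiable_on UNIV \<Longrightarrow> f differentiable (at x)"
  by (simp only: differentiable_on_def UNIV_I ball_UNIV)

lemma Ck_add: "Ck n f \<Longrightarrow> Ck n g \<Longrightarrow> Ck n (\<lambda>x. f x + g x)"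
proof (induction n arbitrary: f g)
  case 0 then show ?case by (simp add: continuous_on_add)
next
  case (Suc n)
  then have d: "f differentiable (at x)" "g differentiable (at x)" for x by (auto intro: differentiable_on_UNIV_at)
  have e: "pderiv1 (\<lambda>x. f x + g x) = (\<lambda>x. pderiv1 f x + pderiv1 g x)"
    "pderiv2 (\<lambda>x. f x + g x) = (\<lambda>x. pderiv2 f x + pderiv2 g x)"
    using pderiv_add[OF d] by blast+
  have "(\<lambda>x. f x + g x) differentiable_on UNIV"
    using d by (simp add: differentiable_on_def)
  moreover have p: "Ck n (pderiv1 f)" "Ck n (pderiv2 f)" "Ck n (pderiv1 g)" "Ck n (pderiv2 g)"
    using Suc.prems by simp_all
  ultimately show ?case unfolding Ck.simps e using Suc.IH[OF p(1,3)] Suc.IH[OF p(2,4)] by simp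
qed

lemma Ck_mult:
  fixes f g :: "plane \<Rightarrow> complex"
  shows "Ck n f \<Longrightarrow> Ck n g \<Longrightarrow> Ck n (\<lambda>x. f x * g x)"
proof (induction n arbitrary: f g)
  case 0 then show ?case by (simp add: continuous_on_mult)
next
  case (Suc n)
  then have d: "f differentiable (at x)" "g differentiable (at x)" for x by (auto intro: differentiable_on_UNIV_at)
  have e: "pderiv1 (\<lambda>x. f x * g x) = (\<lambda>x. pderiv1 f x * g x + f x * pderiv1 g x)"
    "pderiv2 (\<lambda>x. f x * g x) = (\<lambda>x. pderiv2 f x * g x + f x * pderiv2 g x)"
    using pderiv_mult[OF d] by blast+
  have "(\<lambda>x. f x * g x) differentiable_on UNIV"
    using d by (simp add: differentiable_on_def)
  moreover have fg: "Ck n f" "Ck n g" by (rule Ck_Suc_Ck[OF Suc.prems(1)], rule Ck_Suc_Ck[OF Suc.prems(2)])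
  have p: "Ck n (pderiv1 f)" "Ck n (pderiv2 f)" "Ck n (pderiv1 g)" "Ck n (pderiv2 g)"
    using Suc.prems by simp_all
  have "Ck n (\<lambda>x. pderiv1 f x * g x + f x * pderiv1 g x)" "Ck n (\<lambda>x. pderiv2 f x * g x + f x * pderiv2 g x)"
    by (rule Ck_add[OF Suc.IH[OF p(1) fg(2)] Suc.IH[OF fg(1) p(3)]], rule Ck_add[OF Suc.IH[OF p(2) fg(2)] Suc.IH[OF fg(1) p(4)]])
  ultimately show ?case unfolding Ck.simps e by simp
qed

lemma Ck_const: "Ck n (\<lambda>_. c :: complex)"
proof (induction n arbitrary: c)
  case (Suc n)
  have e: "pderiv1 (\<lambda>_. c) = (\<lambda>_. 0)" "pderiv2 (\<lambda>_. c) = (\<lambda>_. 0)"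
    by (rule ext, rule pderiv_eqI[where D="\<lambda>_. 0", OF has_derivative_const])+
  show ?case unfolding Ck.simps e using Suc by simp
qed simp

lemma Ck_linear:
  assumes "bounded_linear (l :: plane \<Rightarrow> complex)"
  shows "Ck n l"
proof (cases n)
  case 0 then show ?thesis using assms by (simp add: linear_continuous_on)
next
  case (Suc m)
  have "pderiv1 l = (\<lambda>_. l (1, 0))" "pderiv2 l = (\<lambda>_. l (0, 1))"
    by (rule ext, rule pderiv_eqI[OF bounded_linear_imp_has_derivative[OF assms]])+
  moreover have "l differentiable_on UNIV"
    using bounded_linear_imp_differentiable_on[OF assms] .
  ultimately show ?thesis using Suc Ck_const by simp
qed

lemma Ck_affine:
  fixes f :: "plane \<Rightarrow> complex"
  shows "Ck n f \<Longrightarrow> Ck n (\<lambda>y. f (t + c *\<^sub>R y))"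
proof (induction n arbitrary: f)
  case 0 then show ?case by (auto intro!: continuous_on_compose2[of UNIV f] continuous_intros)
next
  case (Suc n)
  have d: "((\<lambda>y. f (t + c *\<^sub>R y)) has_derivative (\<lambda>h. fst (c *\<^sub>R h) *\<^sub>R pderiv1 f (t + c *\<^sub>R y) + snd (c *\<^sub>R h) *\<^sub>R pderiv2 f (t + c *\<^sub>R y))) (at y)" for y
  proof (rule has_derivative_compose[where f="\<lambda>y. t + c *\<^sub>R y"])
    show "((\<lambda>y. t + c *\<^sub>R y) has_derivative (\<lambda>h. c *\<^sub>R h)) (at y)" by (auto intro!: derivative_eq_intros)
    show "(f has_derivative (\<lambda>h. fst h *\<^sub>R pderiv1 f (t + c *\<^sub>R y) + snd h *\<^sub>R pderiv2 f (t + c *\<^sub>R y))) (at (t + c *\<^sub>R y))"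
      using Suc.prems by (intro pderiv_has_derivative differentiable_on_UNIV_at) simp
  qed
  have e: "pderiv1 (\<lambda>y. f (t + c *\<^sub>R y)) = (\<lambda>y. complex_of_real c * pderiv1 f (t + c *\<^sub>R y))"
    "pderiv2 (\<lambda>y. f (t + c *\<^sub>R y)) = (\<lambda>y. complex_of_real c * pderiv2 f (t + c *\<^sub>R y))"
    by (rule ext, simp add: pderiv_eqI[OF d] scaleR_conv_of_real)+
  have d': "(\<lambda>y. f (t + c *\<^sub>R y)) differentiable_on UNIV"
    using d by (meson differentiable_at_imp_differentiable_on differentiableI)
  have p: "Ck n (pderiv1 f)" "Ck n (pderiv2 f)" using Suc.prems by simp_all
  have "Ck n (\<lambda>y. complex_of_real c * pderiv1 f (t + c *\<^sub>R y))" "Ck n (\<lambda>y. complex_of_real c * pderiv2 f (t + c *\<^sub>R y))"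
    by (rule Ck_mult[OF Ck_const Suc.IH[OF p(1)]], rule Ck_mult[OF Ck_const Suc.IH[OF p(2)]])
  with d' show ?case unfolding Ck.simps e by (intro conjI)
qed

text \<open>Derivatives of \<open>t \<mapsto> exp (- 1 / t)\<close> are linear combinations of these functions.\<close>

definition flat :: "nat \<Rightarrow> real \<Rightarrow> real" where
  "flat m t = (if 0 < t then exp (- 1 / t) / t ^ m else 0)"

text \<open>A single term of the exponential series suffices:
  \<open>(1 / t) ^ Suc m / fact (Suc m)\<close> is at most \<open>exp (1 / t)\<close>.\<close>

lemma flat_bound: "\<bar>flat m t\<bar> \<le> fact (Suc m) * \<bar>t\<bar>"
proof (cases "0 < t")
  case True
  have "(1 / t) ^ Suc m /\<^sub>R fact (Suc m) \<le> (\<Sum>n. (1 / t) ^ n /\<^sub>R fact n)"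
  proof -
    have "(\<Sum>n\<in>{Suc m}. (1 / t) ^ n /\<^sub>R fact n) \<le> (\<Sum>n. (1 / t) ^ n /\<^sub>R fact n)"
      using True by (intro sum_le_suminf summable_exp_generic) auto
    then show ?thesis by simp
  qed
  then have "(1 / t) ^ Suc m / fact (Suc m) \<le> exp (1 / t)"
    by (simp only: exp_def real_scaleR_def divide_inverse mult.commute)
  then have "(1 / t) ^ Suc m \<le> exp (1 / t) * fact (Suc m)" by (simp only: pos_divide_le_eq fact_gt_zero)
  then have "t ^ Suc m * (1 / t) ^ Suc m \<le> t ^ Suc m * (exp (1 / t) * fact (Suc m))"
    using True by (intro mult_left_mono) auto
  moreover have "t ^ Suc m * (1 / t) ^ Suc m = 1"
    using True unfolding power_mult_distrib[symmetric] by simp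
  ultimately have "1 \<le> fact (Suc m) * t ^ Suc m * exp (1 / t)" by (simp only: ac_simps)
  then have "exp (- 1 / t) * 1 \<le> exp (- 1 / t) * (fact (Suc m) * t ^ Suc m * exp (1 / t))"
    by (intro mult_left_mono) auto
  also have "\<dots> = fact (Suc m) * t ^ Suc m" by (simp add: exp_minus)
  finally have "exp (- 1 / t) / t ^ m \<le> fact (Suc m) * t" using True by (simp add: field_simps)
  then show ?thesis using True by (simp add: flat_def)
qed (auto simp: flat_def not_less mult_nonneg_nonpos simp del: fact_Suc)

text \<open>The delicate point is t = 0: the difference quotient of \<open>flat m\<close> there is
  \<open>flat (Suc m)\<close>, which is of order |h| by \<open>flat_bound\<close>.\<close>

lemma flat_deriv: "(flat m has_real_derivative (flat (m + 2) t - real m * flat (m + 1) t)) (at t)"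
proof -
  consider "t < 0" | "t = 0" | "0 < t" by linarith
  then show ?thesis
  proof cases
    case 1
    have "((\<lambda>_. 0) has_real_derivative 0) (at t)" by simp
    then have "(flat m has_real_derivative 0) (at t)"
      by (rule has_field_derivative_transform_within_open[where S="{..<0}"]) (use 1 in \<open>auto simp: flat_def\<close>)
    then show ?thesis using 1 by (simp add: flat_def)
  next
    case 2
    have "(\<lambda>h. (flat m (0 + h) - flat m 0) / h) \<midarrow>0\<rightarrow> 0"
    proof (rule Lim_null_comparison)
      have "\<bar>flat m h / h\<bar> \<le> fact (Suc (Suc m)) * \<bar>h\<bar>" for h
      proof (cases "h = 0")
        case False
        have "flat m h / h = flat (Suc m) h" by (simp add: flat_def)
        then show ?thesis using flat_bound[of "Suc m" h] by simp
      qed simp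
      then show "\<forall>\<^sub>F h in at 0. norm ((flat m (0 + h) - flat m 0) / h) \<le> fact (Suc (Suc m)) * \<bar>h\<bar>"
        by (simp add: flat_def[of m 0] eventually_mono[OF eventually_True])
      have "((\<lambda>h::real. fact (Suc (Suc m)) * \<bar>h\<bar>) \<longlongrightarrow> fact (Suc (Suc m)) * \<bar>0\<bar>) (at 0)"
        by (intro tendsto_intros)
      then show "((\<lambda>h::real. fact (Suc (Suc m)) * \<bar>h\<bar>) \<longlongrightarrow> 0) (at 0)" by simp
    qed
    then show ?thesis using 2 by (simp add: DERIV_def flat_def)
  next
    case 3
    have "((\<lambda>t. exp (- 1 / t) / t ^ m) has_real_derivative (flat (m + 2) t - real m * flat (m + 1) t)) (at t)"
      using 3 by (auto intro!: derivative_eq_intros simp: flat_def field_simps power2_eq_square simp flip: power_Suc)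
        (cases m; simp add: field_simps)
    then show ?thesis
      by (rule has_field_derivative_transform_within_open[where S="{0<..}"]) (use 3 in \<open>auto simp: flat_def\<close>)
  qed
qed

definition flatball :: "nat \<Rightarrow> plane \<Rightarrow> complex" where
  "flatball m x = complex_of_real (flat m (1 - (norm x)\<^sup>2))"

lemma flatball_deriv:
  "(flatball m has_derivative (\<lambda>h. of_real (- 2 * (x \<bullet> h)) * (flatball (m + 2) x - of_nat m * flatball (m + 1) x))) (at x)"
proof -
  have 1: "((\<lambda>x. 1 - (norm x)\<^sup>2) has_derivative (\<lambda>h. - 2 * (x \<bullet> h))) (at x)"
    unfolding power2_norm_eq_inner
    by (rule has_derivative_eq_rhs, (rule derivative_eq_intros refl)+) (auto simp: inner_commute)
  have 2: "(flat m has_derivative (\<lambda>h. (flat (m + 2) t - real m * flat (m + 1) t) * h)) (at t)" for t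
    using flat_deriv[of m t] by (simp add: has_field_derivative_def)
  have "((\<lambda>x. flat m (1 - (norm x)\<^sup>2)) has_derivative
      (\<lambda>h. (flat (m + 2) (1 - (norm x)\<^sup>2) - real m * flat (m + 1) (1 - (norm x)\<^sup>2)) * (- 2 * (x \<bullet> h)))) (at x)"
    by (rule has_derivative_compose[OF 1 2])
  then have "((\<lambda>x. complex_of_real (flat m (1 - (norm x)\<^sup>2))) has_derivative
      (\<lambda>h. complex_of_real ((flat (m + 2) (1 - (norm x)\<^sup>2) - real m * flat (m + 1) (1 - (norm x)\<^sup>2)) * (- 2 * (x \<bullet> h))))) (at x)"
    by (rule has_derivative_of_real)
  then show ?thesis unfolding flatball_def[abs_def] by (simp add: algebra_simps)
qed

text \<open>Each partial derivative is a linear function times a combination of members of the same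
  family, so the induction on n runs over all m at once.\<close>

lemma Ck_flatball: "Ck n (flatball m)"
proof (induction n arbitrary: m)
  case 0
  show ?case using flatball_deriv
    by (auto intro!: differentiable_imp_continuous_on differentiable_at_imp_differentiable_on differentiableI)
next
  case (Suc n)
  have e: "pderiv1 (flatball m) = (\<lambda>x. of_real (- 2 * fst x) * (flatball (m + 2) x + (- of_nat m) * flatball (m + 1) x))"
    "pderiv2 (flatball m) = (\<lambda>x. of_real (- 2 * snd x) * (flatball (m + 2) x + (- of_nat m) * flatball (m + 1) x))"
    by (rule ext, simp add: pderiv_eqI[OF flatball_deriv] inner_prod_def)+
  have l: "bounded_linear (\<lambda>x :: plane. complex_of_real (- 2 * fst x))" "bounded_linear (\<lambda>x :: plane. complex_of_real (- 2 * snd x))"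
    by (intro bounded_linear_compose[OF bounded_linear_of_real] bounded_linear_const_mult bounded_linear_fst bounded_linear_snd)+
  have "flatball m differentiable_on UNIV"
    using flatball_deriv by (meson differentiable_at_imp_differentiable_on differentiableI)
  moreover have g: "Ck n (\<lambda>x. flatball (m + 2) x + (- of_nat m) * flatball (m + 1) x)"
    by (rule Ck_add[OF Suc Ck_mult[OF Ck_const Suc]])
  ultimately show ?case unfolding Ck.simps e using Ck_mult[OF Ck_linear[OF l(1)] g] Ck_mult[OF Ck_linear[OF l(2)] g] by (intro conjI)
qed

lemma bump_eq: "bump x = flat 0 (1 - (norm x)\<^sup>2)"
proof -
  have "(norm x)\<^sup>2 < 1 \<longleftrightarrow> norm x < 1" using abs_square_less_1[of "norm x"] by simp
  then show ?thesis by (simp add: bump_def flat_def)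
qed

lemma bump_continuous: "continuous_on UNIV bump"
proof -
  have "continuous_on UNIV (\<lambda>x. Re (flatball 0 x))"
    using Ck_flatball[of 0 0] by (intro continuous_intros) simp
  then show ?thesis by (simp add: flatball_def bump_eq[abs_def])
qed

lemma bump_nonneg: "0 \<le> bump x" and bump_supp: "supp_le 1 bump"
  by (auto simp: bump_def supp_le_def)

lemma bump_integral_pos: "0 < (LINT y|lborel. bump y)"
proof -
  have i: "integrable lborel bump" by (rule integrable_supp_le[OF bump_continuous bump_supp])
  have "(LINT y|lborel. bump y) \<noteq> 0"
  proof
    assume "(LINT y|lborel. bump y) = 0"
    then have "AE x in lborel. bump x = 0"
      using integral_nonneg_eq_0_iff_AE[OF i] bump_nonneg by simp
    then have "AE x in lborel. x \<notin> ball (0::plane) 1"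
      by eventually_elim (auto simp: bump_def split: if_splits)
    then have "emeasure lborel (ball (0::plane) 1) = 0"
      by (subst (asm) AE_iff_measurable[where N="ball 0 1"]) auto
    then have "measure lborel (ball (0::plane) 1) = 0" by (simp add: measure_def)
    then show False using content_ball_pos[of 1 "0::plane"] by simp
  qed
  moreover have "0 \<le> (LINT y|lborel. bump y)" by (rule integral_nonneg_AE) (simp add: bump_nonneg)
  ultimately show ?thesis by simp
qed

section \<open>The standard mollifier as a Fourier multiplier\<close>

lemma moll_nonneg: "0 \<le> std_mollifier x"
  using bump_nonneg bump_integral_pos by (simp add: std_mollifier_def)

lemma moll_continuous: "continuous_on UNIV std_mollifier"
  unfolding std_mollifier_def[abs_def] using bump_integral_pos
  by (intro continuous_intros bump_continuous) auto

lemma moll_supp: "supp_le 1 std_mollifier"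
  using bump_supp by (simp add: supp_le_def std_mollifier_def)

lemma moll_integrable: "integrable lborel std_mollifier"
  by (rule integrable_supp_le[OF moll_continuous moll_supp])

lemma moll_integral: "(LINT x|lborel. std_mollifier x) = 1"
  using bump_integral_pos by (simp add: std_mollifier_def)

text \<open>The factor by which convolution with the mollifier at scale \<epsilon> acts on frequency
  k, with the scale moved from the mollifier into the exponential by substitution.\<close>

definition mollcoef :: "real \<Rightarrow> coeffs" where
  "mollcoef \<epsilon> k = (LINT z|lborel. complex_of_real (std_mollifier z) * fexp k (- \<epsilon> *\<^sub>R z))"

lemma moll_times_integrable:
  fixes G :: "plane \<Rightarrow> complex"
  assumes "continuous_on UNIV G"
  shows "integrable lborel (\<lambda>z. complex_of_real (std_mollifier z) * G z)"
proof (rule integrable_supp_le)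
  show "continuous_on UNIV (\<lambda>z. complex_of_real (std_mollifier z) * G z)"
    by (intro continuous_intros moll_continuous assms)
  show "supp_le 1 (\<lambda>z. complex_of_real (std_mollifier z) * G z)"
    unfolding supp_le_def
  proof (intro allI impI)
    fix z :: plane assume "1 < norm z"
    then have "std_mollifier z = 0" by (rule supp_leD[OF moll_supp])
    then show "complex_of_real (std_mollifier z) * G z = 0" by simp
  qed
qed

lemma moll_avg_bound:
  fixes G :: "plane \<Rightarrow> complex"
  assumes G: "continuous_on UNIV G" and B: "\<And>z. norm z \<le> 1 \<Longrightarrow> cmod (G z) \<le> B"
  shows "cmod (LINT z|lborel. complex_of_real (std_mollifier z) * G z) \<le> B"
proof -
  have "cmod (LINT z|lborel. complex_of_real (std_mollifier z) * G z) \<le> (LINT z|lborel. cmod (complex_of_real (std_mollifier z) * G z))"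
    by (rule integral_norm_bound)
  also have "\<dots> \<le> (LINT z|lborel. std_mollifier z * B)"
  proof (rule integral_mono)
    show "integrable lborel (\<lambda>z. cmod (complex_of_real (std_mollifier z) * G z))"
      by (intro integrable_norm moll_times_integrable G)
    show "integrable lborel (\<lambda>z. std_mollifier z * B)" using moll_integrable by simp
    fix z
    show "cmod (complex_of_real (std_mollifier z) * G z) \<le> std_mollifier z * B"
    proof (cases "norm z \<le> 1")
      case True
      then show ?thesis using B[of z] moll_nonneg[of z] by (simp add: norm_mult mult_left_mono)
    next
      case False
      then have "std_mollifier z = 0" using supp_leD[OF moll_supp, of z] by simp
      then show ?thesis by simp
    qed
  qed
  also have "\<dots> = B" by (simp add: moll_integral)
  finally show ?thesis .
qed

lemma continuous_on_fexp_comp [continuous_intros]: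
  "continuous_on S g \<Longrightarrow> continuous_on S (\<lambda>x. fexp k (g x))"
  by (rule continuous_on_compose2[OF continuous_on_fexp[of UNIV]]) auto

text \<open>On trigonometric polynomials the multiplier is an average of translates, so supremum
  bounds survive mollification with constant 1.\<close>

lemma mollcoef_avg:
  "(\<Sum>k\<in>F. f k * mollcoef \<epsilon> k * fexp k x) = (LINT z|lborel. complex_of_real (std_mollifier z) * (\<Sum>k\<in>F. f k * fexp k (x + (- \<epsilon>) *\<^sub>R z)))"
proof -
  have i: "integrable lborel (\<lambda>z. complex_of_real (std_mollifier z) * (f k * fexp k (x + (- \<epsilon>) *\<^sub>R z)))" for k
    by (intro moll_times_integrable continuous_intros)
  have "(LINT z|lborel. complex_of_real (std_mollifier z) * (\<Sum>k\<in>F. f k * fexp k (x + (- \<epsilon>) *\<^sub>R z)))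
    = (\<Sum>k\<in>F. LINT z|lborel. complex_of_real (std_mollifier z) * (f k * fexp k (x + (- \<epsilon>) *\<^sub>R z)))"
    unfolding sum_distrib_left by (rule Bochner_Integration.integral_sum) (rule i)
  also have "\<dots> = (\<Sum>k\<in>F. f k * mollcoef \<epsilon> k * fexp k x)"
  proof (intro sum.cong refl)
    fix k
    have "(LINT z|lborel. complex_of_real (std_mollifier z) * (f k * fexp k (x + (- \<epsilon>) *\<^sub>R z)))
      = (LINT z|lborel. (f k * fexp k x) * (complex_of_real (std_mollifier z) * fexp k (- \<epsilon> *\<^sub>R z)))"
      unfolding fexp_plus by (simp only: ac_simps)
    also have "\<dots> = f k * mollcoef \<epsilon> k * fexp k x"
      unfolding mollcoef_def by (subst integral_mult_right_zero) (simp add: ac_simps)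
    finally show "(LINT z|lborel. complex_of_real (std_mollifier z) * (f k * fexp k (x + (- \<epsilon>) *\<^sub>R z))) = f k * mollcoef \<epsilon> k * fexp k x" .
  qed
  finally show ?thesis ..
qed

lemma mollcoef_uminus: "mollcoef \<epsilon> (- k) = cnj (mollcoef \<epsilon> k)"
proof -
  have "integrable lborel (\<lambda>z. complex_of_real (std_mollifier z) * fexp k (- \<epsilon> *\<^sub>R z))"
    by (intro moll_times_integrable continuous_intros)
  from integral_bounded_linear[OF bounded_linear_cnj this]
  show ?thesis by (simp add: mollcoef_def fexp_uminus)
qed

definition molltest :: "real \<Rightarrow> plane \<Rightarrow> plane \<Rightarrow> complex" where
  "molltest \<epsilon> x y = complex_of_real (std_mollifier ((1 / \<epsilon>) *\<^sub>R (x - y)) / \<epsilon>\<^sup>2)"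

lemma molltest_smooth: "smooth (molltest \<epsilon> x)"
proof -
  have "molltest \<epsilon> x = (\<lambda>y. complex_of_real (1 / (\<epsilon>\<^sup>2 * (LINT y|lborel. bump y))) * flatball 0 ((1 / \<epsilon>) *\<^sub>R x + (- 1 / \<epsilon>) *\<^sub>R y))"
    by (auto simp: molltest_def std_mollifier_def bump_eq flatball_def scaleR_diff_right)
  then show ?thesis unfolding smooth_def
    by (simp only:) (intro allI Ck_mult Ck_const Ck_affine Ck_flatball)
qed

lemma molltest_supp:
  assumes "0 < \<epsilon>"
  shows "supp_le (norm x + \<epsilon>) (molltest \<epsilon> x)"
  unfolding supp_le_def
proof (intro allI impI)
  fix y :: plane assume "norm x + \<epsilon> < norm y"
  moreover have "norm y \<le> norm (x - y) + norm x"
    using norm_triangle_sub[of y x] by (simp add: norm_minus_commute add.commute)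
  ultimately have "\<epsilon> < norm (x - y)" by simp
  then have "1 < norm ((1 / \<epsilon>) *\<^sub>R (x - y))" unfolding norm_scaleR using assms by (simp add: field_simps)
  then have "std_mollifier ((1 / \<epsilon>) *\<^sub>R (x - y)) = 0" by (rule supp_leD[OF moll_supp])
  then show "molltest \<epsilon> x y = 0" by (simp add: molltest_def)
qed

lemma molltest_torus: "0 < \<epsilon> \<Longrightarrow> periodize (molltest \<epsilon> x) \<in> smooth_torus"
  by (rule periodize_smooth_torus[OF molltest_smooth molltest_supp])

lemma molltest_continuous: "continuous_on UNIV (molltest \<epsilon> x)"
  using molltest_smooth[of \<epsilon> x] Ck_continuous unfolding smooth_def by blast

lemma molltest_fexp:
  assumes e: "0 < \<epsilon>"
  shows "(LINT y:cell|lborel. fexp k y * periodize (molltest \<epsilon> x) y) = fexp k x * mollcoef \<epsilon> k"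
proof -
  have c: "continuous_on UNIV (\<lambda>y. fexp k y * molltest \<epsilon> x y)"
    by (intro continuous_intros molltest_continuous)
  have s: "supp_le (norm x + \<epsilon>) (\<lambda>y. fexp k y * molltest \<epsilon> x y)"
    unfolding supp_le_def using supp_leD[OF molltest_supp[OF e, of x]] by (intro allI impI) simp
  have "(LINT y:cell|lborel. fexp k y * periodize (molltest \<epsilon> x) y) = (LINT y|lborel. fexp k y * molltest \<epsilon> x y)"
    unfolding periodize_mult[OF periodic_fexp] by (rule cell_integral_periodize[OF c s])
  also have "\<dots> = \<bar>- \<epsilon>\<bar> ^ DIM(plane) *\<^sub>R (LINT z|lborel. fexp k (x + (- \<epsilon>) *\<^sub>R z) * molltest \<epsilon> x (x + (- \<epsilon>) *\<^sub>R z))"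
    by (rule lborel_integral_affine) (use e c in \<open>auto intro: borel_measurable_continuous_onI\<close>)
  also have "\<dots> = \<epsilon>\<^sup>2 * (LINT z|lborel. (fexp k x / \<epsilon>\<^sup>2) * (complex_of_real (std_mollifier z) * fexp k (- \<epsilon> *\<^sub>R z)))"
  proof -
    have "molltest \<epsilon> x (x + (- \<epsilon>) *\<^sub>R z) = complex_of_real (std_mollifier z) / \<epsilon>\<^sup>2" for z
    proof -
      have "(1 / \<epsilon>) *\<^sub>R (x - (x + (- \<epsilon>) *\<^sub>R z)) = z" using e by simp
      then show ?thesis unfolding molltest_def by simp
    qed
    then have "fexp k (x + (- \<epsilon>) *\<^sub>R z) * molltest \<epsilon> x (x + (- \<epsilon>) *\<^sub>R z)
       = (fexp k x / \<epsilon>\<^sup>2) * (complex_of_real (std_mollifier z) * fexp k (- \<epsilon> *\<^sub>R z))" for z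
      unfolding fexp_plus by (simp add: ac_simps)
    then show ?thesis using e by (simp add: scaleR_conv_of_real power2_eq_square)
  qed
  also have "\<dots> = fexp k x * mollcoef \<epsilon> k"
    unfolding mollcoef_def integral_mult_right_zero using e by simp
  finally show ?thesis .
qed

lemma mollcoef_0: "mollcoef \<epsilon> 0 = 1"
  unfolding mollcoef_def using moll_integral by simp

text \<open>Each integration by parts trades a factor kx or ky for a derivative of g, and
  derivatives of g are again smooth and periodic.\<close>

lemma torus_coeff_decay:
  assumes g: "g \<in> smooth_torus"
  shows "\<exists>C. \<forall>k. \<bar>kx k\<bar> ^ n * cmod (LINT y:cell|lborel. fexp k y * g y) \<le> C"
    and "\<exists>C. \<forall>k. \<bar>ky k\<bar> ^ n * cmod (LINT y:cell|lborel. fexp k y * g y) \<le> C"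
proof -
  have Ckg: "Ck n g" "periodic g" for n using g by (auto simp: smooth_torus_def smooth_def)
  have per: "periodic (pderiv1 g)" "periodic (pderiv2 g)" if "g \<in> smooth_torus" for g :: "plane \<Rightarrow> complex"
  proof -
    have d: "(g has_derivative (\<lambda>h. fst h *\<^sub>R pderiv1 g x + snd h *\<^sub>R pderiv2 g x)) (at x)" for x
      using that by (intro pderiv_has_derivative differentiable_on_UNIV_at) (auto simp: smooth_torus_def smooth_def dest: spec[of _ "Suc 0"])
    have "pderiv1 g (x + (2 * pi) *\<^sub>R lattice_pt m) = pderiv1 g x \<and> pderiv2 g (x + (2 * pi) *\<^sub>R lattice_pt m) = pderiv2 g x" for x m
    proof -
      let ?t = "(2 * pi) *\<^sub>R lattice_pt m"
      have "((\<lambda>y. y + ?t) has_derivative (\<lambda>h. h)) (at x)" by (auto intro!: derivative_eq_intros)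
      from has_derivative_compose[OF this d]
      have "((\<lambda>y. g (y + ?t)) has_derivative (\<lambda>h. fst h *\<^sub>R pderiv1 g (x + ?t) + snd h *\<^sub>R pderiv2 g (x + ?t))) (at x)" .
      moreover have "(\<lambda>y. g (y + ?t)) = g"
        using that by (intro ext periodicD) (simp add: smooth_torus_def)
      ultimately have "(g has_derivative (\<lambda>h. fst h *\<^sub>R pderiv1 g (x + ?t) + snd h *\<^sub>R pderiv2 g (x + ?t))) (at x)" by simp
      from pderiv_eqI[OF this] show ?thesis by simp
    qed
    then show "periodic (pderiv1 g)" "periodic (pderiv2 g)" unfolding periodic_def by blast+
  qed
  have st: "pderiv1 g \<in> smooth_torus" "pderiv2 g \<in> smooth_torus" if "g \<in> smooth_torus" for g :: "plane \<Rightarrow> complex"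
  proof -
    have "Ck (Suc n) g" for n using that by (auto simp: smooth_torus_def smooth_def)
    then have "Ck n (pderiv1 g)" "Ck n (pderiv2 g)" for n by auto
    with per[OF that] show "pderiv1 g \<in> smooth_torus" "pderiv2 g \<in> smooth_torus"
      by (simp_all add: smooth_torus_def smooth_def)
  qed
  have fC: "Ck (Suc 0) (fexp k)" for k
  proof -
    have "pderiv1 (fexp k) = (\<lambda>x. \<i> * of_real (kx k) * fexp k x)" "pderiv2 (fexp k) = (\<lambda>x. \<i> * of_real (ky k) * fexp k x)"
      by (intro ext pderiv_fexp)+
    then show ?thesis
      by (auto intro!: continuous_intros differentiable_at_imp_differentiable_on fexp_differentiable)
  qed
  have base: "\<exists>C. \<forall>k. cmod (LINT y:cell|lborel. fexp k y * g y) \<le> C" if "g \<in> smooth_torus" for g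
  proof -
    have c: "continuous_on UNIV g" using that Ck_continuous unfolding smooth_torus_def smooth_def by blast
    have "cmod (LINT y:cell|lborel. fexp k y * g y) \<le> 1 * (LINT y:cell|lborel. cmod (g y))" for k
      by (intro cell_integral_bound continuous_intros c) simp
    then show ?thesis by blast
  qed
  have 1: "\<exists>C. \<forall>k. \<bar>kx k\<bar> ^ n * cmod (LINT y:cell|lborel. fexp k y * g y) \<le> C" if "g \<in> smooth_torus" for g n
    using that
  proof (induction n arbitrary: g)
    case 0 then show ?case using base by simp
  next
    case (Suc n)
    have Ckg: "Ck (Suc 0) g" "periodic g" using Suc.prems by (auto simp: smooth_torus_def smooth_def)
    have e: "\<bar>kx k\<bar> * cmod (LINT y:cell|lborel. fexp k y * g y) = cmod (LINT y:cell|lborel. fexp k y * pderiv1 g y)" for k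
    proof -
      have "(LINT y:cell|lborel. pderiv1 (fexp k) y * g y) = - (LINT y:cell|lborel. fexp k y * pderiv1 g y)"
        by (rule cell_integral_by_parts(1)[OF fC periodic_fexp Ckg])
      then have "\<i> * of_real (kx k) * (LINT y:cell|lborel. fexp k y * g y) = - (LINT y:cell|lborel. fexp k y * pderiv1 g y)"
        unfolding pderiv_fexp mult.assoc by (simp only: set_integral_mult_right)
      from arg_cong[OF this, of cmod] show ?thesis by (simp add: norm_mult)
    qed
    obtain C where "\<forall>k. \<bar>kx k\<bar> ^ n * cmod (LINT y:cell|lborel. fexp k y * pderiv1 g y) \<le> C"
      using Suc.IH[OF st(1)[OF Suc.prems]] ..
    then have "\<bar>kx k\<bar> ^ Suc n * cmod (LINT y:cell|lborel. fexp k y * g y) \<le> C" for k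
      unfolding power_Suc2 mult.assoc e by blast
    then show ?case by blast
  qed
  have 2: "\<exists>C. \<forall>k. \<bar>ky k\<bar> ^ n * cmod (LINT y:cell|lborel. fexp k y * g y) \<le> C" if "g \<in> smooth_torus" for g n
    using that
  proof (induction n arbitrary: g)
    case 0 then show ?case using base by simp
  next
    case (Suc n)
    have Ckg: "Ck (Suc 0) g" "periodic g" using Suc.prems by (auto simp: smooth_torus_def smooth_def)
    have e: "\<bar>ky k\<bar> * cmod (LINT y:cell|lborel. fexp k y * g y) = cmod (LINT y:cell|lborel. fexp k y * pderiv2 g y)" for k
    proof -
      have "(LINT y:cell|lborel. pderiv2 (fexp k) y * g y) = - (LINT y:cell|lborel. fexp k y * pderiv2 g y)"
        by (rule cell_integral_by_parts(2)[OF fC periodic_fexp Ckg])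
      then have "\<i> * of_real (ky k) * (LINT y:cell|lborel. fexp k y * g y) = - (LINT y:cell|lborel. fexp k y * pderiv2 g y)"
        unfolding pderiv_fexp mult.assoc by (simp only: set_integral_mult_right)
      from arg_cong[OF this, of cmod] show ?thesis by (simp add: norm_mult)
    qed
    obtain C where "\<forall>k. \<bar>ky k\<bar> ^ n * cmod (LINT y:cell|lborel. fexp k y * pderiv2 g y) \<le> C"
      using Suc.IH[OF st(2)[OF Suc.prems]] ..
    then have "\<bar>ky k\<bar> ^ Suc n * cmod (LINT y:cell|lborel. fexp k y * g y) \<le> C" for k
      unfolding power_Suc2 mult.assoc e by blast
    then show ?case by blast
  qed
  show "\<exists>C. \<forall>k. \<bar>kx k\<bar> ^ n * cmod (LINT y:cell|lborel. fexp k y * g y) \<le> C"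
    "\<exists>C. \<forall>k. \<bar>ky k\<bar> ^ n * cmod (LINT y:cell|lborel. fexp k y * g y) \<le> C"
    using 1[OF g] 2[OF g] by blast+
qed

text \<open>The multiplier is a Fourier coefficient of the smooth periodized mollifier centred at 0.
  The constant depends on \<epsilon>: this yields smoothness of each approximation but no uniform
  bound.\<close>

lemma mollcoef_decay:
  assumes e: "0 < \<epsilon>"
  shows "\<exists>C\<ge>0. \<forall>k. sz k ^ n * cmod (mollcoef \<epsilon> k) \<le> C"
proof -
  let ?g = "periodize (molltest \<epsilon> 0)"
  have s: "mollcoef \<epsilon> k = (LINT y:cell|lborel. fexp k y * ?g y)" for k
    unfolding molltest_fexp[OF e] by (simp add: fexp_def)
  obtain C1 C2 where C: "\<bar>kx k\<bar> ^ n * cmod (mollcoef \<epsilon> k) \<le> C1" "\<bar>ky k\<bar> ^ n * cmod (mollcoef \<epsilon> k) \<le> C2" for k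
    using torus_coeff_decay[OF molltest_torus[OF e, of 0], of n] unfolding s by metis
  have C0: "0 \<le> C1" "0 \<le> C2" using order_trans[OF _ C(1)[of 0]] order_trans[OF _ C(2)[of 0]] by auto
  have "sz k ^ n * cmod (mollcoef \<epsilon> k) \<le> 1 + C1 + C2" for k
  proof (cases "k = 0")
    case True then show ?thesis using C0 by (simp add: mollcoef_0 sz_def)
  next
    case False
    have "sz k = \<bar>kx k\<bar> \<or> sz k = \<bar>ky k\<bar>"
      unfolding sz_of_int[OF False] kx_def ky_def of_int_max of_int_abs by linarith
    then show ?thesis
    proof
      assume e: "sz k = \<bar>kx k\<bar>"
      show ?thesis unfolding e using C(1)[of k] C0 by linarith
    next
      assume e: "sz k = \<bar>ky k\<bar>"
      show ?thesis unfolding e using C(2)[of k] C0 by linarith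
    qed
  qed
  then show ?thesis using C0 by (intro exI[of _ "1 + C1 + C2"]) auto
qed

lemma rapid_mollcoef:
  assumes e: "0 < \<epsilon>" and f: "\<And>k. cmod (f k) \<le> B * sz k ^ p"
  shows "rapid (\<lambda>k. f k * mollcoef \<epsilon> k)"
  unfolding rapid_def
proof
  fix t
  \<comment> \<open>Two spare powers leave \<open>sz k powr (- 2)\<close>, which is square summable
    over the lattice.\<close>
  obtain n :: nat where n: "t + real p + 2 \<le> real n" using real_arch_simple by blast
  obtain C where C: "0 \<le> C" "\<And>k. sz k ^ n * cmod (mollcoef \<epsilon> k) \<le> C" using mollcoef_decay[OF e, of n] by blast
  have B: "0 \<le> B" using order_trans[OF norm_ge_zero f[of 0]] by (simp add: sz_def)
  have pt: "sz k powr t * cmod (f k * mollcoef \<epsilon> k) \<le> (B * C) * sz k powr (- 2)" for k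
  proof -
    have "sz k powr t * cmod (f k * mollcoef \<epsilon> k) \<le> sz k powr t * ((B * sz k ^ p) * cmod (mollcoef \<epsilon> k))"
      unfolding norm_mult by (intro mult_left_mono mult_right_mono f) auto
    also have "\<dots> = B * (sz k powr (t + real p) * cmod (mollcoef \<epsilon> k))"
      using sz_pos[of k] by (simp add: powr_add powr_realpow)
    also have "sz k powr (t + real p) \<le> sz k powr (real n - 2)"
      using n by (intro powr_mono sz_ge1) auto
    also have "\<dots> = sz k powr (- 2) * sz k ^ n"
      using sz_pos[of k] by (simp add: powr_add[symmetric] powr_realpow[symmetric])
    finally have "sz k powr t * cmod (f k * mollcoef \<epsilon> k) \<le> B * (sz k powr (- 2) * sz k ^ n * cmod (mollcoef \<epsilon> k))"
      using B by (simp add: mult_left_mono mult_right_mono)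
    also have "\<dots> \<le> B * (sz k powr (- 2) * C)"
      using B C(2)[of k] unfolding mult.assoc by (intro mult_left_mono) auto
    finally show ?thesis by (simp add: ac_simps)
  qed
  have "sobolev t (\<lambda>k. f k * mollcoef \<epsilon> k) ((B * C) * sqrt (szsum 4))"
    unfolding sobolev_def
  proof (intro allI impI)
    fix F :: "(int \<times> int) set" assume F: "finite F"
    have "L2_set (\<lambda>k. sz k powr t * cmod (f k * mollcoef \<epsilon> k)) F \<le> L2_set (\<lambda>k. (B * C) * sz k powr (- 2)) F"
      by (rule L2_set_mono) (use pt in auto)
    also have "\<dots> = (B * C) * L2_set (\<lambda>k. sz k powr (- 2)) F"
      using B C by (simp add: L2_set_right_distrib)
    also have "L2_set (\<lambda>k. sz k powr (- 2)) F \<le> sqrt (szsum 4)"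
    proof -
      have "(\<Sum>k\<in>F. (sz k powr (- 2))\<^sup>2) = (\<Sum>k\<in>F. sz k powr (- 4))"
        by (intro sum.cong refl) (simp add: power2_eq_square powr_add[symmetric])
      also have "\<dots> \<le> szsum 4" unfolding szsum_def using F by (intro sum_sz_bound) auto
      finally show ?thesis unfolding L2_set_def by (rule real_sqrt_le_mono)
    qed
    finally show "L2_set (\<lambda>k. sz k powr t * cmod (f k * mollcoef \<epsilon> k)) F \<le> (B * C) * sqrt (szsum 4)"
      using B C by (simp add: mult_left_mono)
  qed
  then show "\<exists>R. sobolev t (\<lambda>k. f k * mollcoef \<epsilon> k) R" by blast
qed

text \<open>\<open>besov\<close> with one derivative more: comparing a first derivative of a block
  with its mollification takes one further derivative. The zero frequency is left free here.\<close>

definition besov2 :: "real \<Rightarrow> real \<Rightarrow> coeffs \<Rightarrow> bool" where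
  "besov2 a K f \<longleftrightarrow> (\<forall>n x p q. p + q \<le> 2 \<longrightarrow>
     cmod (\<Sum>k\<in>shell n. of_real (kx k ^ p * ky k ^ q) * f k * fexp k x) \<le> K * (2 ^ n) powr (a + real (p + q) - 1))"

lemma moll_block:
  assumes F: "finite F" and B0: "\<And>x. cmod (\<Sum>k\<in>F. g k * fexp k x) \<le> B0"
  shows "cmod (\<Sum>k\<in>F. g k * mollcoef \<epsilon> k * fexp k x) \<le> B0"
  unfolding mollcoef_avg by (intro moll_avg_bound continuous_intros B0)

lemma trig_lipschitz:
  assumes F: "finite F" and B1: "\<And>x. cmod (\<Sum>k\<in>F. of_real (kx k) * g k * fexp k x) \<le> B1"
    "\<And>x. cmod (\<Sum>k\<in>F. of_real (ky k) * g k * fexp k x) \<le> B1"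
  shows "cmod ((\<Sum>k\<in>F. g k * fexp k y) - (\<Sum>k\<in>F. g k * fexp k x)) \<le> 2 * B1 * norm (y - x)"
proof (rule differentiable_bound[where S=UNIV and f="\<lambda>x. \<Sum>k\<in>F. g k * fexp k x"])
  let ?D = "\<lambda>x h. \<Sum>k\<in>F. g k * (\<i> * of_real (kx k * fst h + ky k * snd h) * fexp k x)"
  show "((\<lambda>x. \<Sum>k\<in>F. g k * fexp k x) has_derivative ?D x) (at x within UNIV)" for x
    by (intro has_derivative_sum has_derivative_mult_right fexp_has_derivative)
  show "onorm (?D x) \<le> 2 * B1" for x
  proof (rule onorm_le)
    fix h
    have "?D x h = \<i> * (of_real (fst h) * (\<Sum>k\<in>F. of_real (kx k) * g k * fexp k x) + of_real (snd h) * (\<Sum>k\<in>F. of_real (ky k) * g k * fexp k x))"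
      unfolding sum_distrib_left sum.distrib[symmetric] by (intro sum.cong refl) (simp add: algebra_simps)
    then have "cmod (?D x h) = cmod (of_real (fst h) * (\<Sum>k\<in>F. of_real (kx k) * g k * fexp k x) + of_real (snd h) * (\<Sum>k\<in>F. of_real (ky k) * g k * fexp k x))"
      by (simp add: norm_mult)
    also have "\<dots> \<le> \<bar>fst h\<bar> * cmod (\<Sum>k\<in>F. of_real (kx k) * g k * fexp k x) + \<bar>snd h\<bar> * cmod (\<Sum>k\<in>F. of_real (ky k) * g k * fexp k x)"
      by (rule order_trans[OF norm_triangle_ineq]) (simp add: norm_mult)
    also have "\<dots> \<le> norm h * B1 + norm h * B1"
      using norm_fst_le[of "fst h" "snd h"] norm_snd_le[of "snd h" "fst h"] B1
      by (intro add_mono mult_mono) auto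
    finally show "cmod (?D x h) \<le> 2 * B1 * norm h" by (simp add: algebra_simps)
  qed
qed auto

text \<open>Multiplying by \<open>mollcoef \<epsilon> k - 1\<close> averages the differences between
  translates by at most \<epsilon> and the function itself, and these are controlled by the
  Lipschitz bound.\<close>

lemma moll_block_diff:
  assumes F: "finite F" and e: "0 < \<epsilon>" and B1: "\<And>x. cmod (\<Sum>k\<in>F. of_real (kx k) * g k * fexp k x) \<le> B1"
    "\<And>x. cmod (\<Sum>k\<in>F. of_real (ky k) * g k * fexp k x) \<le> B1"
  shows "cmod (\<Sum>k\<in>F. g k * (mollcoef \<epsilon> k - 1) * fexp k x) \<le> 2 * B1 * \<epsilon>"
proof -
  let ?G = "\<lambda>x. \<Sum>k\<in>F. g k * fexp k x"
  have B10: "0 \<le> B1" using B1(1) norm_ge_zero order_trans by blast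
  have "(\<Sum>k\<in>F. g k * (mollcoef \<epsilon> k - 1) * fexp k x) = (\<Sum>k\<in>F. g k * mollcoef \<epsilon> k * fexp k x) - ?G x"
    by (simp add: algebra_simps sum_subtractf)
  also have "\<dots> = (LINT z|lborel. complex_of_real (std_mollifier z) * ?G (x + (- \<epsilon>) *\<^sub>R z)) - (LINT z|lborel. complex_of_real (std_mollifier z) * ?G x)"
    unfolding mollcoef_avg integral_mult_left_zero integral_complex_of_real moll_integral by simp
  also have "\<dots> = (LINT z|lborel. complex_of_real (std_mollifier z) * (?G (x + (- \<epsilon>) *\<^sub>R z) - ?G x))"
    unfolding right_diff_distrib
    by (rule Bochner_Integration.integral_diff[symmetric]) (intro moll_times_integrable continuous_intros)+
  also have "cmod \<dots> \<le> 2 * B1 * \<epsilon>"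
  proof (intro moll_avg_bound continuous_intros)
    fix z :: plane assume z: "norm z \<le> 1"
    have "cmod (?G (x + (- \<epsilon>) *\<^sub>R z) - ?G x) \<le> 2 * B1 * norm (x + (- \<epsilon>) *\<^sub>R z - x)"
      by (rule trig_lipschitz[OF F B1])
    also have "\<dots> \<le> 2 * B1 * \<epsilon>"
    proof (rule mult_left_mono)
      show "norm (x + (- \<epsilon>) *\<^sub>R z - x) \<le> \<epsilon>" using z e by (simp add: mult_left_le)
    qed (use B10 in simp)
    finally show "cmod (?G (x + (- \<epsilon>) *\<^sub>R z) - ?G x) \<le> 2 * B1 * \<epsilon>" .
  qed
  finally show ?thesis .
qed

lemma besov2D:
  assumes "besov2 a K f" "p + q \<le> 2"
  shows "cmod (\<Sum>k\<in>shell n. of_real (kx k ^ p * ky k ^ q) * f k * fexp k x) \<le> K * (2 ^ n) powr (a + real (p + q) - 1)"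
  using assms unfolding besov2_def by blast

lemma besov_mollcoef:
  assumes f: "besov2 a K f" "f 0 = 0"
  shows "besov a K (\<lambda>k. f k * mollcoef \<epsilon> k)"
  unfolding besov_def
proof (intro conjI allI)
  fix n x
  have b: "cmod (\<Sum>k\<in>shell n. (of_real (kx k ^ p * ky k ^ q) * f k) * mollcoef \<epsilon> k * fexp k x) \<le> K * (2 ^ n) powr (a + real (p + q) - 1)"
    if "p + q \<le> 2" for p q
    by (rule moll_block[OF finite_shell]) (rule besov2D[OF f(1) that])
  show "cmod (\<Sum>k\<in>shell n. f k * mollcoef \<epsilon> k * fexp k x) \<le> K * (2 ^ n) powr (a - 1)"
    using b[of 0 0] by simp
  show "cmod (\<Sum>k\<in>shell n. of_real (kx k) * (f k * mollcoef \<epsilon> k) * fexp k x) \<le> K * (2 ^ n) powr a"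
    using b[of 1 0] by (simp add: mult.assoc)
  show "cmod (\<Sum>k\<in>shell n. of_real (ky k) * (f k * mollcoef \<epsilon> k) * fexp k x) \<le> K * (2 ^ n) powr a"
    using b[of 0 1] by (simp add: mult.assoc)
qed (simp add: f)

text \<open>The minimum of 1 and u is at most \<open>u powr \<theta>\<close>.\<close>

lemma min_interp:
  fixes u \<theta> X M :: real
  assumes "0 < u" "0 \<le> \<theta>" "\<theta> \<le> 1" "X \<le> 2 * M" "X \<le> 2 * (M * u)" "0 \<le> M"
  shows "X \<le> 2 * (M * u powr \<theta>)"
proof (cases "u \<le> 1")
  case True
  have "u powr 1 \<le> u powr \<theta>" using True assms powr_mono'[of \<theta> 1 u] by simp
  then have "M * u \<le> M * u powr \<theta>" using assms by (intro mult_left_mono) auto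
  then show ?thesis using assms by simp
next
  case False
  have "M * 1 \<le> M * u powr \<theta>" using False assms ge_one_powr_ge_zero[of u \<theta>] by (intro mult_left_mono) auto
  then show ?thesis using assms by simp
qed

text \<open>Two bounds for each block are interpolated, the trivial one and the one with the factor
  \<open>2 ^ n * \<epsilon>\<close> supplied by the extra derivative: the rate
  \<open>\<epsilon> powr \<theta>\<close> is paid for with \<theta> derivatives.\<close>

lemma besov_mollcoef_diff:
  assumes f: "besov2 a K f" "f 0 = 0" and e: "0 < \<epsilon>" and t: "0 \<le> \<theta>" "\<theta> \<le> 1" and K: "0 \<le> K"
  shows "besov (a + \<theta>) (2 * K * \<epsilon> powr \<theta>) (\<lambda>k. f k * (mollcoef \<epsilon> k - 1))"
  unfolding besov_def
proof (intro conjI allI)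
  fix n x
  have b: "cmod (\<Sum>k\<in>shell n. (of_real (kx k ^ p * ky k ^ q) * f k) * (mollcoef \<epsilon> k - 1) * fexp k x)
      \<le> 2 * K * \<epsilon> powr \<theta> * (2 ^ n) powr (a + \<theta> + real (p + q) - 1)"
    if pq: "p + q \<le> 1" for p q
  proof -
    let ?g = "\<lambda>k. of_real (kx k ^ p * ky k ^ q) * f k"
    let ?M = "K * (2 ^ n) powr (a + real (p + q) - 1)"
    have "cmod (\<Sum>k\<in>shell n. ?g k * (mollcoef \<epsilon> k - 1) * fexp k x)
      = cmod ((\<Sum>k\<in>shell n. ?g k * mollcoef \<epsilon> k * fexp k x) - (\<Sum>k\<in>shell n. ?g k * fexp k x))"
      by (simp add: algebra_simps sum_subtractf)
    also have "\<dots> \<le> ?M + ?M"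
      using pq by (intro norm_triangle_le_diff add_mono moll_block[OF finite_shell] besov2D[OF f(1)]) auto
    finally have 1: "cmod (\<Sum>k\<in>shell n. ?g k * (mollcoef \<epsilon> k - 1) * fexp k x) \<le> 2 * ?M" by simp
    have Mu: "K * (2 ^ n) powr (a + real (p + q)) = ?M * 2 ^ n"
    proof -
      have "(2 ^ n) powr (a + real (p + q)) = (2 ^ n) powr (a + real (p + q) - 1) * (2 ^ n) powr 1"
        unfolding powr_add[symmetric] by simp
      then show ?thesis by simp
    qed
    have "cmod (\<Sum>k\<in>shell n. ?g k * (mollcoef \<epsilon> k - 1) * fexp k x) \<le> 2 * (K * (2 ^ n) powr (a + real (p + q))) * \<epsilon>"
    proof (rule moll_block_diff[OF finite_shell e])
      show "cmod (\<Sum>k\<in>shell n. of_real (kx k) * ?g k * fexp k x) \<le> K * (2 ^ n) powr (a + real (p + q))" for x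
        using besov2D[OF f(1), where p="Suc p" and q=q and n=n and x=x] pq by (simp add: mult.assoc)
      show "cmod (\<Sum>k\<in>shell n. of_real (ky k) * ?g k * fexp k x) \<le> K * (2 ^ n) powr (a + real (p + q))" for x
        using besov2D[OF f(1), where p=p and q="Suc q" and n=n and x=x] pq by (simp add: ac_simps)
    qed
    then have 2: "cmod (\<Sum>k\<in>shell n. ?g k * (mollcoef \<epsilon> k - 1) * fexp k x) \<le> 2 * (?M * (2 ^ n * \<epsilon>))"
      unfolding Mu by (simp add: mult.assoc)
    have "cmod (\<Sum>k\<in>shell n. ?g k * (mollcoef \<epsilon> k - 1) * fexp k x) \<le> 2 * (?M * (2 ^ n * \<epsilon>) powr \<theta>)"
      by (rule min_interp[OF _ t 1 2]) (use e K in auto)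
    also have "\<dots> = 2 * K * \<epsilon> powr \<theta> * ((2 ^ n) powr (a + real (p + q) - 1) * (2 ^ n) powr \<theta>)"
      using e by (simp add: powr_mult)
    also have "\<dots> = 2 * K * \<epsilon> powr \<theta> * (2 ^ n) powr (a + \<theta> + real (p + q) - 1)"
      unfolding powr_add[symmetric] by (simp add: algebra_simps)
    finally show ?thesis .
  qed
  show "cmod (\<Sum>k\<in>shell n. f k * (mollcoef \<epsilon> k - 1) * fexp k x) \<le> 2 * K * \<epsilon> powr \<theta> * (2 ^ n) powr (a + \<theta> - 1)"
    using b[of 0 0] by simp
  show "cmod (\<Sum>k\<in>shell n. of_real (kx k) * (f k * (mollcoef \<epsilon> k - 1)) * fexp k x) \<le> 2 * K * \<epsilon> powr \<theta> * (2 ^ n) powr (a + \<theta>)"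
    using b[of 1 0] by (simp add: mult.assoc)
  show "cmod (\<Sum>k\<in>shell n. of_real (ky k) * (f k * (mollcoef \<epsilon> k - 1)) * fexp k x) \<le> 2 * K * \<epsilon> powr \<theta> * (2 ^ n) powr (a + \<theta>)"
    using b[of 0 1] by (simp add: mult.assoc)
qed (simp add: f)

section \<open>Almost sure bounds for the noise\<close>

text \<open>Completing the square turns the integrand into a multiple of the normal density centred
  at \<open>\<sigma>\<^sup>2 * t\<close>.\<close>

lemma nn_integral_normal_exp:
  assumes s: "0 < \<sigma>"
  shows "(\<integral>\<^sup>+x. ennreal (normal_density 0 \<sigma> x) * ennreal (exp (t * x)) \<partial>lborel) = ennreal (exp (\<sigma>\<^sup>2 * t\<^sup>2 / 2))"
proof -
  have "normal_density 0 \<sigma> x * exp (t * x) = exp (\<sigma>\<^sup>2 * t\<^sup>2 / 2) * normal_density (\<sigma>\<^sup>2 * t) \<sigma> x" for x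
  proof -
    have "- (x\<^sup>2 / (2 * \<sigma>\<^sup>2)) + t * x = \<sigma>\<^sup>2 * t\<^sup>2 / 2 + - ((x - \<sigma>\<^sup>2 * t)\<^sup>2 / (2 * \<sigma>\<^sup>2))"
      using s by (simp add: field_simps power2_eq_square)
    then have "exp (- (x\<^sup>2 / (2 * \<sigma>\<^sup>2))) * exp (t * x) = exp (\<sigma>\<^sup>2 * t\<^sup>2 / 2) * exp (- ((x - \<sigma>\<^sup>2 * t)\<^sup>2 / (2 * \<sigma>\<^sup>2)))"
      unfolding exp_add[symmetric] by simp
    then show ?thesis by (simp add: normal_density_def)
  qed
  then have "(\<integral>\<^sup>+x. ennreal (normal_density 0 \<sigma> x) * ennreal (exp (t * x)) \<partial>lborel)
    = (\<integral>\<^sup>+x. ennreal (exp (\<sigma>\<^sup>2 * t\<^sup>2 / 2)) * ennreal (normal_density (\<sigma>\<^sup>2 * t) \<sigma> x) \<partial>lborel)"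
    by (intro nn_integral_cong) (simp add: ennreal_mult[symmetric])
  also have "\<dots> = ennreal (exp (\<sigma>\<^sup>2 * t\<^sup>2 / 2)) * (\<integral>\<^sup>+x. ennreal (normal_density (\<sigma>\<^sup>2 * t) \<sigma> x) \<partial>lborel)"
    by (rule nn_integral_cmult) simp
  also have "(\<integral>\<^sup>+x. ennreal (normal_density (\<sigma>\<^sup>2 * t) \<sigma> x) \<partial>lborel) = 1"
    using s by (subst nn_integral_eq_integral) auto
  finally show ?thesis by simp
qed

context prob_space
begin

lemma nn_integral_exp_gaussian:
  assumes X: "distributed M lborel X (normal_density 0 (sqrt (1 / 2)))"
  shows "(\<integral>\<^sup>+\<omega>. ennreal (exp (t * X \<omega>)) \<partial>M) = ennreal (exp (t\<^sup>2 / 4))"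
proof -
  have "(\<integral>\<^sup>+\<omega>. ennreal (exp (t * X \<omega>)) \<partial>M) = (\<integral>\<^sup>+x. ennreal (normal_density 0 (sqrt (1 / 2)) x) * ennreal (exp (t * x)) \<partial>lborel)"
    by (rule distributed_nn_integral[OF X, symmetric]) simp
  then show ?thesis by (simp add: nn_integral_normal_exp)
qed

lemma complex_gaussian_measurable:
  assumes "std_complex_gaussian M X"
  shows "X \<in> borel_measurable M"
proof -
  have "(\<lambda>\<omega>. Re (X \<omega>)) \<in> borel_measurable M" "(\<lambda>\<omega>. Im (X \<omega>)) \<in> borel_measurable M"
    using assms by (auto simp: std_complex_gaussian_def dest!: distributed_measurable)
  then show ?thesis by (simp add: borel_measurable_complex_iff)
qed

text \<open>Real and imaginary part are independent with variance 1/2 each, and Re (\<zeta> * X)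
  combines them with coefficients Re \<zeta> and - Im \<zeta>.\<close>

lemma nn_integral_exp_complex_gaussian:
  assumes X: "std_complex_gaussian M X"
  shows "(\<integral>\<^sup>+\<omega>. ennreal (exp (Re (\<zeta> * X \<omega>))) \<partial>M) = ennreal (exp ((cmod \<zeta>)\<^sup>2 / 4))"
proof -
  let ?Y = "\<lambda>b. case_bool (\<lambda>\<omega>. ennreal (exp (Re \<zeta> * Re (X \<omega>)))) (\<lambda>\<omega>. ennreal (exp (- Im \<zeta> * Im (X \<omega>)))) b"
  have "indep_var borel ((\<lambda>x. ennreal (exp (Re \<zeta> * x))) \<circ> (\<lambda>\<omega>. Re (X \<omega>))) borel ((\<lambda>x. ennreal (exp (- Im \<zeta> * x))) \<circ> (\<lambda>\<omega>. Im (X \<omega>)))"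
    using X unfolding std_complex_gaussian_def by (intro indep_var_compose[of borel _ borel]) auto
  then have "indep_vars (case_bool borel borel) ?Y UNIV"
    unfolding indep_var_def comp_def .
  moreover have "case_bool borel borel = (\<lambda>_ :: bool. borel :: ennreal measure)" by (auto split: bool.split)
  ultimately have ind: "indep_vars (\<lambda>_. borel) ?Y UNIV" by simp
  have "(\<integral>\<^sup>+\<omega>. (\<Prod>b\<in>UNIV. ?Y b \<omega>) \<partial>M) = (\<Prod>b\<in>UNIV. \<integral>\<^sup>+\<omega>. ?Y b \<omega> \<partial>M)"
    by (rule indep_vars_nn_integral[OF _ ind]) (auto split: bool.split)
  then have "(\<integral>\<^sup>+\<omega>. ennreal (exp (Re \<zeta> * Re (X \<omega>)) * exp (- Im \<zeta> * Im (X \<omega>))) \<partial>M)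
     = (\<integral>\<^sup>+\<omega>. ennreal (exp (Re \<zeta> * Re (X \<omega>))) \<partial>M) * (\<integral>\<^sup>+\<omega>. ennreal (exp (- Im \<zeta> * Im (X \<omega>))) \<partial>M)"
    by (simp add: UNIV_bool ennreal_mult mult.commute)
  also have "\<dots> = ennreal (exp ((Re \<zeta>)\<^sup>2 / 4)) * ennreal (exp ((- Im \<zeta>)\<^sup>2 / 4))"
    using X unfolding std_complex_gaussian_def by (simp only: nn_integral_exp_gaussian)
  also have "\<dots> = ennreal (exp ((cmod \<zeta>)\<^sup>2 / 4))"
    by (simp add: ennreal_mult[symmetric] exp_add[symmetric] cmod_power2 add_divide_distrib)
  finally show ?thesis by (simp add: exp_add[symmetric])
qed

lemma nn_integral_exp_sum:
  assumes F: "finite F" and ind: "indep_vars (\<lambda>_. borel) X F" and g: "\<And>k. k \<in> F \<Longrightarrow> std_complex_gaussian M (X k)"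
  shows "(\<integral>\<^sup>+\<omega>. ennreal (exp (Re (\<Sum>k\<in>F. \<zeta> k * X k \<omega>))) \<partial>M) = ennreal (exp ((\<Sum>k\<in>F. (cmod (\<zeta> k))\<^sup>2) / 4))"
proof -
  have "indep_vars (\<lambda>_. borel) (\<lambda>k \<omega>. ennreal (exp (Re (\<zeta> k * X k \<omega>)))) F"
    by (rule indep_vars_compose2[OF ind]) measurable
  then have "(\<integral>\<^sup>+\<omega>. (\<Prod>k\<in>F. ennreal (exp (Re (\<zeta> k * X k \<omega>)))) \<partial>M) = (\<Prod>k\<in>F. \<integral>\<^sup>+\<omega>. ennreal (exp (Re (\<zeta> k * X k \<omega>))) \<partial>M)"
    by (intro indep_vars_nn_integral F) auto
  also have "\<dots> = (\<Prod>k\<in>F. ennreal (exp ((cmod (\<zeta> k))\<^sup>2 / 4)))"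
    by (intro prod.cong refl nn_integral_exp_complex_gaussian g)
  also have "\<dots> = ennreal (exp ((\<Sum>k\<in>F. (cmod (\<zeta> k))\<^sup>2) / 4))"
    by (simp add: prod_ennreal exp_sum[OF F] sum_divide_distrib)
  also have "(\<integral>\<^sup>+\<omega>. (\<Prod>k\<in>F. ennreal (exp (Re (\<zeta> k * X k \<omega>)))) \<partial>M) = (\<integral>\<^sup>+\<omega>. ennreal (exp (Re (\<Sum>k\<in>F. \<zeta> k * X k \<omega>))) \<partial>M)"
    by (simp add: Re_sum exp_sum[OF F] prod_ennreal)
  finally show ?thesis .
qed

text \<open>A weighted sum of the exponentials has finite expectation, hence is almost surely finite.\<close>

lemma AE_exp_bound:
  fixes X :: "nat \<Rightarrow> 'i \<Rightarrow> 'a \<Rightarrow> real"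
  assumes X[measurable]: "\<And>n i. i \<in> I n \<Longrightarrow> X n i \<in> borel_measurable M"
    and fin: "\<And>n. finite (I n)" and E: "\<And>n i. i \<in> I n \<Longrightarrow> (\<integral>\<^sup>+\<omega>. ennreal (exp (X n i \<omega>)) \<partial>M) \<le> ennreal A"
    and card: "\<And>n. real (card (I n)) \<le> B * R ^ n" and R: "1 \<le> R" and A: "0 \<le> A" and B: "0 \<le> B"
  shows "AE \<omega> in M. \<exists>C\<ge>0. \<forall>n. \<forall>i\<in>I n. X n i \<omega> \<le> C * (1 + real n)"
proof -
  \<comment> \<open>The weight \<open>1 / (2 * R) ^ n\<close> beats the number of indices, of order
    \<open>R ^ n\<close>, and leaves the summable factor \<open>(1 / 2) ^ n\<close>.\<close>
  define T where "T \<omega> = (\<Sum>n. \<Sum>i\<in>I n. ennreal (1 / (2 * R) ^ n) * ennreal (exp (X n i \<omega>)))" for \<omega>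
  have T[measurable]: "T \<in> borel_measurable M" unfolding T_def by measurable
  have "(\<integral>\<^sup>+\<omega>. T \<omega> \<partial>M) = (\<Sum>n. \<Sum>i\<in>I n. ennreal (1 / (2 * R) ^ n) * (\<integral>\<^sup>+\<omega>. ennreal (exp (X n i \<omega>)) \<partial>M))"
    unfolding T_def by (subst nn_integral_suminf, measurable) (intro suminf_cong, subst nn_integral_sum, auto simp: nn_integral_cmult)
  also have "\<dots> \<le> (\<Sum>n. ennreal (A * B * (1 / 2) ^ n))"
  proof (rule suminf_le)
    fix n
    have "(\<Sum>i\<in>I n. ennreal (1 / (2 * R) ^ n) * (\<integral>\<^sup>+\<omega>. ennreal (exp (X n i \<omega>)) \<partial>M)) \<le> (\<Sum>i\<in>I n. ennreal (1 / (2 * R) ^ n) * ennreal A)"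
      by (intro sum_mono mult_left_mono E) auto
    also have "\<dots> = ennreal (real (card (I n)) * (1 / (2 * R) ^ n * A))"
      using R A by (simp add: ennreal_mult[symmetric] ennreal_of_nat_eq_real_of_nat)
    also have "\<dots> \<le> ennreal (A * B * (1 / 2) ^ n)"
    proof (rule ennreal_leI)
      have "real (card (I n)) * (1 / (2 * R) ^ n * A) \<le> (B * R ^ n) * (1 / (2 * R) ^ n * A)"
        using R A by (intro mult_right_mono card) auto
      also have "\<dots> = A * B * (1 / 2) ^ n" using R by (simp add: power_mult_distrib power_divide)
      finally show "real (card (I n)) * (1 / (2 * R) ^ n * A) \<le> A * B * (1 / 2) ^ n" .
    qed
    finally show "(\<Sum>i\<in>I n. ennreal (1 / (2 * R) ^ n) * (\<integral>\<^sup>+\<omega>. ennreal (exp (X n i \<omega>)) \<partial>M)) \<le> ennreal (A * B * (1 / 2) ^ n)" .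
  qed auto
  also have "\<dots> = ennreal (\<Sum>n. A * B * (1 / 2) ^ n)"
    using A B by (intro suminf_ennreal2 summable_mult summable_geometric) auto
  also have "\<dots> < \<infinity>" by simp
  finally have "(\<integral>\<^sup>+\<omega>. T \<omega> \<partial>M) \<noteq> \<infinity>" by simp
  then have "AE \<omega> in M. T \<omega> \<noteq> \<infinity>" by (intro nn_integral_noteq_infinite T)
  then show ?thesis
  proof eventually_elim
    case (elim \<omega>)
    then obtain t where t: "T \<omega> = ennreal t" "0 \<le> t" by (cases "T \<omega>") auto
    \<comment> \<open>Comes from taking logarithms in
      \<open>exp (X n i \<omega>) \<le> (t + 1) * (2 * R) ^ n\<close>; t + 1 instead of t keeps the
      logarithm meaningful for t = 0.\<close>
    define C where "C = max 0 (ln (t + 1)) + ln (2 * R)"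
    have C: "0 \<le> C" using R by (simp add: C_def)
    have "X n i \<omega> \<le> C * (1 + real n)" if i: "i \<in> I n" for n i
    proof -
      have "ennreal (1 / (2 * R) ^ n) * ennreal (exp (X n i \<omega>)) \<le> (\<Sum>i\<in>I n. ennreal (1 / (2 * R) ^ n) * ennreal (exp (X n i \<omega>)))"
        using fin i by (intro member_le_sum) auto
      also have "\<dots> \<le> T \<omega>"
        unfolding T_def using sum_le_suminf[of "\<lambda>n. \<Sum>i\<in>I n. ennreal (1 / (2 * R) ^ n) * ennreal (exp (X n i \<omega>))" "{n}"] by simp
      also have "ennreal (1 / (2 * R) ^ n) * ennreal (exp (X n i \<omega>)) = ennreal (1 / (2 * R) ^ n * exp (X n i \<omega>))"
        using R by (intro ennreal_mult[symmetric]) auto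
      finally have "ennreal (1 / (2 * R) ^ n * exp (X n i \<omega>)) \<le> ennreal t"
        unfolding t .
      then have "1 / (2 * R) ^ n * exp (X n i \<omega>) \<le> t" using t by simp
      then have "exp (X n i \<omega>) \<le> t * (2 * R) ^ n" using R by (simp add: field_simps)
      also have "\<dots> \<le> (t + 1) * (2 * R) ^ n" using R by (intro mult_right_mono) auto
      also have "\<dots> = exp (ln (t + 1) + real n * ln (2 * R))"
        using t R by (simp add: exp_add exp_of_nat_mult)
      finally have "X n i \<omega> \<le> ln (t + 1) + real n * ln (2 * R)" by simp
      also have "\<dots> \<le> C * 1 + real n * C"
      proof (intro add_mono mult_left_mono)
        have "0 \<le> ln (2 * R)" using R by simp
        then have "ln (t + 1) \<le> C" and c: "ln (2 * R) \<le> C" unfolding C_def by linarith+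
        then show "ln (t + 1) \<le> C * 1" by simp
        from c show "ln (2 * R) \<le> C" .
      qed simp
      finally show ?thesis by (simp add: algebra_simps)
    qed
    with C show ?case by blast
  qed
qed

end

text \<open>Exponential moments leave a linear growth in n, which any power a > 0 of
  \<open>2 ^ n\<close> absorbs; the bound is 1 + y \<le> exp y.\<close>

lemma linear_le_pow2:
  fixes a :: real
  assumes "0 < a"
  shows "1 + real n \<le> (1 + 1 / (a * ln 2)) * (2 ^ n) powr a"
proof -
  have "1 + a * ln 2 * real n \<le> exp (a * ln 2 * real n)" by (rule exp_ge_add_one_self)
  also have "\<dots> = (2 ^ n) powr a" by (simp add: powr_def ln_realpow ac_simps)
  finally have 1: "1 + a * ln 2 * real n \<le> (2 ^ n) powr a" .
  have al: "0 < a * ln 2" using assms by simp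
  have "real n = (a * ln 2 * real n) / (a * ln 2)" using al assms by simp
  also have "\<dots> \<le> (2 ^ n) powr a / (a * ln 2)" using 1 al by (intro divide_right_mono) auto
  finally have 2: "real n \<le> (2 ^ n) powr a / (a * ln 2)" .
  have 0: "0 \<le> a * ln 2 * real n" using assms by simp
  with 1 2 show ?thesis by (simp add: algebra_simps)
qed

text \<open>Exponential moments control real parts from above only; the four quarter turns recover
  the modulus up to a factor 2.\<close>

definition phases :: "complex set" where "phases = {1, - 1, \<i>, - \<i>}"

lemma norm_le_phases:
  assumes "\<And>\<sigma>. \<sigma> \<in> phases \<Longrightarrow> Re (\<sigma> * z) \<le> B"
  shows "cmod z \<le> 2 * B"
proof -
  have "Re z \<le> B" "- Re z \<le> B" "- Im z \<le> B" "Im z \<le> B"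
    using assms[of 1] assms[of "- 1"] assms[of \<i>] assms[of "- \<i>"] by (auto simp: phases_def)
  then show ?thesis using cmod_le[of z] by linarith
qed

lemma phases_norm: "\<sigma> \<in> phases \<Longrightarrow> cmod \<sigma> = 1"
  by (auto simp: phases_def)

text \<open>The mesh is 1 / 4 ^ n rather than 1 / 2 ^ n because the Lipschitz bound used for a
  block, a crude sum over all its coefficients, is of order (1 + n) * 4 ^ n. The 7 exceeds 2 *
  pi.\<close>

definition grid :: "nat \<Rightarrow> plane set" where
  "grid n = (\<lambda>(i, j). (real i / 4 ^ n - pi, real j / 4 ^ n - pi)) ` ({..<7 * 4 ^ n} \<times> {..<7 * 4 ^ n})"

lemma finite_grid [simp]: "finite (grid n)"
  by (simp add: grid_def)

lemma card_grid: "real (card (grid n)) \<le> 49 * 16 ^ n"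
proof -
  have "card (grid n) \<le> card ({..<7 * 4 ^ n :: nat} \<times> {..<7 * 4 ^ n :: nat})"
    unfolding grid_def by (rule card_image_le) simp
  also have "\<dots> = 49 * 16 ^ n" by (simp add: card_cartesian_product power_mult_distrib[symmetric])
  finally show ?thesis by (metis of_nat_le_iff of_nat_mult of_nat_numeral of_nat_power)
qed

lemma grid_near: 
  assumes "x \<in> hcell"
  obtains y where "y \<in> grid n" "norm (x - y) \<le> 2 / 4 ^ n"
proof -
  have near: "\<exists>i. i < 7 * 4 ^ n \<and> \<bar>t - (real i / 4 ^ n - pi)\<bar> \<le> 1 / 4 ^ n" if t: "- pi \<le> t" "t < pi" for t
  proof (intro exI conjI)
    define i where "i = nat \<lfloor>(t + pi) * 4 ^ n\<rfloor>"
    have i: "real i \<le> (t + pi) * 4 ^ n" "(t + pi) * 4 ^ n < real i + 1"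
      using t by (auto simp: i_def of_nat_nat)
    have "(t + pi) * 4 ^ n < 7 * 4 ^ n" using t pi_less_4 pi_approx by (intro mult_strict_right_mono) auto
    then have "real i < 7 * 4 ^ n" using i by linarith
    then have "real i < real (7 * 4 ^ n)" by simp
    then show "i < 7 * 4 ^ n" by (simp only: of_nat_less_iff)
    have "real i / 4 ^ n \<le> t + pi" "t + pi < real i / 4 ^ n + 1 / 4 ^ n"
      using i by (simp_all add: field_simps)
    then show "\<bar>t - (real i / 4 ^ n - pi)\<bar> \<le> 1 / 4 ^ n" by (simp add: abs_le_iff)
  qed
  obtain i where i: "i < 7 * 4 ^ n" "\<bar>fst x - (real i / 4 ^ n - pi)\<bar> \<le> 1 / 4 ^ n"
    using near[of "fst x"] assms by (auto simp: hcell_def)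
  obtain j where j: "j < 7 * 4 ^ n" "\<bar>snd x - (real j / 4 ^ n - pi)\<bar> \<le> 1 / 4 ^ n"
    using near[of "snd x"] assms by (auto simp: hcell_def)
  let ?y = "(real i / 4 ^ n - pi, real j / 4 ^ n - pi)"
  have "?y \<in> grid n" unfolding grid_def using i j by force
  moreover have "norm (x - ?y) \<le> \<bar>fst (x - ?y)\<bar> + \<bar>snd (x - ?y)\<bar>"
    using norm_Pair_le[of "fst (x - ?y)" "snd (x - ?y)"] unfolding prod.collapse real_norm_def .
  then have "norm (x - ?y) \<le> 2 / 4 ^ n" using i j by simp
  ultimately show ?thesis using that by blast
qed

lemma trig_periodic: "periodic (\<lambda>x. \<Sum>k\<in>F. c k * fexp k x)"
  unfolding periodic_def by (intro allI sum.cong refl) (simp only: periodicD[OF periodic_fexp])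

text \<open>Some grid point is at distance at most 2 / 4 ^ n, and \<open>trig_lipschitz\<close>
  contributes the factor 2 * L.\<close>

lemma trig_grid_bound:
  assumes G: "\<And>y. y \<in> grid n \<Longrightarrow> cmod (\<Sum>k\<in>F. c k * fexp k y) \<le> B" and F: "finite F"
    and L: "\<And>x. cmod (\<Sum>k\<in>F. of_real (kx k) * c k * fexp k x) \<le> L" "\<And>x. cmod (\<Sum>k\<in>F. of_real (ky k) * c k * fexp k x) \<le> L"
  shows "cmod (\<Sum>k\<in>F. c k * fexp k x) \<le> B + 4 * L / 4 ^ n"
proof -
  obtain m where m: "x - (2 * pi) *\<^sub>R lattice_pt m \<in> hcell" using hcell_unique[of x] by (elim ex1E)
  define x' where "x' = x - (2 * pi) *\<^sub>R lattice_pt m"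
  have "x = x' + (2 * pi) *\<^sub>R lattice_pt m" by (simp add: x'_def)
  then have e: "(\<Sum>k\<in>F. c k * fexp k x) = (\<Sum>k\<in>F. c k * fexp k x')"
    using periodicD[OF trig_periodic[of c F], of x' m] by simp
  obtain y where y: "y \<in> grid n" "norm (x' - y) \<le> 2 / 4 ^ n"
    using grid_near[OF m[folded x'_def]] by blast
  have L0: "0 \<le> L" using order_trans[OF norm_ge_zero L(1)] .
  have "cmod ((\<Sum>k\<in>F. c k * fexp k x') - (\<Sum>k\<in>F. c k * fexp k y)) \<le> 2 * L * norm (x' - y)"
    by (rule trig_lipschitz[OF F L])
  also have "\<dots> \<le> 2 * L * (2 / 4 ^ n)" using L0 y by (intro mult_left_mono) auto
  finally have "cmod ((\<Sum>k\<in>F. c k * fexp k x') - (\<Sum>k\<in>F. c k * fexp k y)) \<le> 4 * L / 4 ^ n" by simp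
  then show ?thesis unfolding e using G[OF y(1)] norm_triangle_sub[of "\<Sum>k\<in>F. c k * fexp k x'" "\<Sum>k\<in>F. c k * fexp k y"] by linarith
qed

text \<open>The multiplier \<open>kx k ^ p * ky k ^ q / nsq k\<close> is of order at most
  \<open>(2 ^ n) ^ (p + q) / 4 ^ n\<close> on shell n. It is rescaled to order 1 / 2 ^ n for all p
  and q, so that its squares sum to a bounded quantity over the shell.\<close>

definition bcoef :: "nat \<Rightarrow> nat \<Rightarrow> nat \<Rightarrow> int \<times> int \<Rightarrow> real" where
  "bcoef n p q k = kx k ^ p * ky k ^ q / nsq k * (2 ^ n / (2 ^ n) ^ (p + q))"

lemma bcoef_le:
  assumes k: "k \<in> shell n" and pq: "p + q \<le> 2"
  shows "\<bar>bcoef n p q k\<bar> \<le> 4 / 2 ^ n"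
proof -
  have k0: "k \<noteq> 0" using k by auto
  have "\<bar>kx k ^ p * ky k ^ q\<bar> \<le> (2 * 2 ^ n) ^ p * (2 * 2 ^ n) ^ q"
    unfolding abs_mult power_abs
    using order_trans[OF kx_le_sz sz_shell(2)[OF k]] order_trans[OF ky_le_sz sz_shell(2)[OF k]]
    by (intro mult_mono power_mono) auto
  also have "\<dots> = 2 ^ (p + q) * (2 ^ n) ^ (p + q)" by (simp add: power_add power_mult_distrib)
  also have "\<dots> \<le> 2 ^ 2 * (2 ^ n) ^ (p + q)" using pq by (intro mult_right_mono power_increasing) auto
  finally have 1: "\<bar>kx k ^ p * ky k ^ q\<bar> \<le> 4 * (2 ^ n) ^ (p + q)" by simp
  have 2: "(2 ^ n)\<^sup>2 \<le> nsq k"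
    using order_trans[OF power_mono[OF sz_shell(1)[OF k]] nsq_ge[OF k0]] by simp
  have "\<bar>bcoef n p q k\<bar> = \<bar>kx k ^ p * ky k ^ q\<bar> * (2 ^ n / (2 ^ n) ^ (p + q)) / nsq k"
    using nsq_pos[OF k0] by (simp add: bcoef_def abs_mult)
  also have "\<dots> \<le> 4 * (2 ^ n) ^ (p + q) * (2 ^ n / (2 ^ n) ^ (p + q)) / (2 ^ n)\<^sup>2"
    using 1 2 by (intro frac_le mult_right_mono mult_nonneg_nonneg) auto
  also have "\<dots> = 4 / 2 ^ n" by (simp add: power2_eq_square)
  finally show ?thesis .
qed

context prob_space
begin

text \<open>Exponential moments are used twice: for the blocks at grid points, where independence
  keeps the variance bounded in n, and crudely for single coefficients, which supplies the Lipschitz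
  constant between grid points. Both quantities are at most of order 1 + n, up to the
  normalisations, and this is absorbed into \<open>(2 ^ n) powr a\<close>.\<close>

lemma AE_besov2:
  assumes g: "\<And>k. k \<noteq> 0 \<Longrightarrow> std_complex_gaussian M (\<eta> k)" and ind: "indep_vars (\<lambda>_. borel) \<eta> (- {0})" and a: "0 < a"
  shows "AE \<omega> in M. \<exists>K\<ge>0. besov2 a K (\<lambda>k. \<eta> k \<omega> / nsq k)"
proof -
  have m[measurable]: "k \<noteq> 0 \<Longrightarrow> \<eta> k \<in> borel_measurable M" for k by (rule complex_gaussian_measurable[OF g])
  have blk0: "k \<noteq> 0" if "k \<in> shell n" for k n using that by auto
  define I where "I n = {(y, p, q, \<sigma>). y \<in> grid n \<and> p + q \<le> (2::nat) \<and> \<sigma> \<in> phases}" for n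
  have Isub: "I n \<subseteq> grid n \<times> {..2} \<times> {..2} \<times> phases" for n by (auto simp: I_def)
  have finI: "finite (I n)" for n by (rule finite_subset[OF Isub]) (auto simp: phases_def)
  \<comment> \<open>1764 = 49 * 9 * 4 counts grid points, pairs (p, q) with entries at most 2, and
    phases.\<close>
  have cardI: "real (card (I n)) \<le> 1764 * 16 ^ n" for n
  proof -
    have "card phases \<le> 4" by (simp add: phases_def card_insert_if)
    have "card (I n) \<le> card (grid n \<times> {..2::nat} \<times> {..2::nat} \<times> phases)"
      by (rule card_mono[OF _ Isub]) (auto simp: phases_def)
    also have "\<dots> = card (grid n) * (9 * card phases)" by (simp add: card_cartesian_product)
    also have "\<dots> \<le> card (grid n) * (9 * 4)" using \<open>card phases \<le> 4\<close> by (intro mult_left_mono) auto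
    finally have "real (card (I n)) \<le> real (card (grid n)) * 36" by (simp flip: of_nat_mult)
    then show ?thesis using card_grid[of n] by simp
  qed
  define X where "X n = (\<lambda>(y, p, q, \<sigma>) \<omega>. Re (\<Sum>k\<in>shell n. (\<sigma> * of_real (bcoef n p q k) * fexp k y) * \<eta> k \<omega>))" for n
  have X: "AE \<omega> in M. \<exists>C\<ge>0. \<forall>n. \<forall>i\<in>I n. X n i \<omega> \<le> C * (1 + real n)"
  proof (rule AE_exp_bound[where B=1764 and R=16 and A="exp 64"])
    fix n i assume "i \<in> I n"
    then obtain y p q \<sigma> where i: "i = (y, p, q, \<sigma>)" "p + q \<le> 2" "\<sigma> \<in> phases" by (auto simp: I_def)
    show "X n i \<in> borel_measurable M" unfolding i X_def using blk0[of _ n] by simp measurable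
    have "(\<integral>\<^sup>+\<omega>. ennreal (exp (X n i \<omega>)) \<partial>M) = ennreal (exp ((\<Sum>k\<in>shell n. (cmod (\<sigma> * of_real (bcoef n p q k) * fexp k y))\<^sup>2) / 4))"
      unfolding i X_def prod.case
      by (rule nn_integral_exp_sum[OF finite_shell indep_vars_subset[OF ind] g]) (use blk0 in auto)
    also have "\<dots> \<le> ennreal (exp 64)"
    proof -
      \<comment> \<open>At most 16 * 4 ^ n terms, each at most the square of 4 / 2 ^ n, give 256,
        hence the exponential moment exp (256 / 4).\<close>
      have "(\<Sum>k\<in>shell n. (cmod (\<sigma> * of_real (bcoef n p q k) * fexp k y))\<^sup>2) \<le> (\<Sum>k\<in>shell n. (4 / 2 ^ n)\<^sup>2)"
        using bcoef_le[OF _ i(2)] phases_norm[OF i(3)]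
        by (intro sum_mono power_mono) (auto simp: norm_mult)
      also have "\<dots> \<le> (16 * 4 ^ n) * (4 / 2 ^ n)\<^sup>2"
        using card_shell[of n] by (simp add: mult_right_mono)
      also have "\<dots> = 256" by (simp add: power2_eq_square power_mult_distrib[symmetric])
      finally show ?thesis by (intro ennreal_leI) simp
    qed
    finally show "(\<integral>\<^sup>+\<omega>. ennreal (exp (X n i \<omega>)) \<partial>M) \<le> ennreal (exp 64)" .
  qed (use finI cardI in auto)
  have finP: "finite (shell n \<times> phases)" for n by (simp add: phases_def)
  have Y: "AE \<omega> in M. \<exists>C\<ge>0. \<forall>n. \<forall>i\<in>shell n \<times> phases. (case i of (k, \<sigma>) \<Rightarrow> Re (\<sigma> * \<eta> k \<omega>)) \<le> C * (1 + real n)"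
  proof (rule AE_exp_bound[where B=64 and R=4 and A="exp (1 / 4)"])
    fix n and i :: "(int \<times> int) \<times> complex" assume "i \<in> shell n \<times> phases"
    then obtain k \<sigma> where i: "i = (k, \<sigma>)" "k \<in> shell n" "\<sigma> \<in> phases" by auto
    have k: "k \<noteq> 0" using i by auto
    show "(\<lambda>\<omega>. case i of (k, \<sigma>) \<Rightarrow> Re (\<sigma> * \<eta> k \<omega>)) \<in> borel_measurable M"
      unfolding i prod.case using m[OF k] by measurable
    show "(\<integral>\<^sup>+\<omega>. ennreal (exp (case i of (k, \<sigma>) \<Rightarrow> Re (\<sigma> * \<eta> k \<omega>))) \<partial>M) \<le> ennreal (exp (1 / 4))"
      unfolding i prod.case nn_integral_exp_complex_gaussian[OF g[OF k]] using phases_norm[OF i(3)] by simp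
  next
    fix n
    have "card phases \<le> 4" by (simp add: phases_def card_insert_if)
    then have "real (card (shell n)) * real (card phases) \<le> (16 * 4 ^ n) * 4" using card_shell[of n] by (intro mult_mono) auto
    then show "real (card (shell n \<times> phases)) \<le> 64 * 4 ^ n" by (simp add: card_cartesian_product)
  qed (use finP in auto)
  from X Y show ?thesis
  proof eventually_elim
    case (elim \<omega>)
    obtain C where C: "0 \<le> C" "\<And>n y p q \<sigma>. y \<in> grid n \<Longrightarrow> p + q \<le> 2 \<Longrightarrow> \<sigma> \<in> phases \<Longrightarrow> X n (y, p, q, \<sigma>) \<omega> \<le> C * (1 + real n)"
      using elim(1) by (auto simp: I_def)
    obtain D where D: "0 \<le> D" "\<And>n k \<sigma>. k \<in> shell n \<Longrightarrow> \<sigma> \<in> phases \<Longrightarrow> Re (\<sigma> * \<eta> k \<omega>) \<le> D * (1 + real n)"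
      using elim(2) by auto
    \<comment> \<open>The 2 comes from passing from phases to the modulus, 1024 D from the
      oscillation between grid points.\<close>
    define E where "E = 2 * C + 1024 * D"
    define K where "K = E * (1 + 1 / (a * ln 2))"
    have E0: "0 \<le> E" using C D by (simp add: E_def)
    have F: "cmod (\<Sum>k\<in>shell n. (of_real (bcoef n p q k) * \<eta> k \<omega>) * fexp k x) \<le> E * (1 + real n)" if pq: "p + q \<le> 2" for n p q x
    proof -
      have e: "cmod (\<eta> k \<omega>) \<le> 2 * (D * (1 + real n))" if "k \<in> shell n" for k
        by (rule norm_le_phases) (rule D(2)[OF that])
      have L: "cmod (\<Sum>k\<in>shell n. of_real (c k) * (of_real (bcoef n p q k) * \<eta> k \<omega>) * fexp k x) \<le> 256 * D * (1 + real n) * 4 ^ n"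
        if c: "\<And>k. k \<in> shell n \<Longrightarrow> \<bar>c k\<bar> \<le> 2 * 2 ^ n" for c x
      proof -
        have "cmod (\<Sum>k\<in>shell n. of_real (c k) * (of_real (bcoef n p q k) * \<eta> k \<omega>) * fexp k x)
          \<le> (\<Sum>k\<in>shell n. (2 * 2 ^ n) * ((4 / 2 ^ n) * (2 * (D * (1 + real n)))))"
        proof (rule sum_norm_le)
          fix k assume k: "k \<in> shell n"
          have "\<bar>c k\<bar> * (\<bar>bcoef n p q k\<bar> * cmod (\<eta> k \<omega>)) \<le> (2 * 2 ^ n) * ((4 / 2 ^ n) * (2 * (D * (1 + real n))))"
            by (intro mult_mono c k bcoef_le pq e) auto
          then show "cmod (of_real (c k) * (of_real (bcoef n p q k) * \<eta> k \<omega>) * fexp k x) \<le> (2 * 2 ^ n) * ((4 / 2 ^ n) * (2 * (D * (1 + real n))))"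
            by (simp add: norm_mult)
        qed
        also have "\<dots> = real (card (shell n)) * (16 * (D * (1 + real n)))" by simp
        also have "\<dots> \<le> (16 * 4 ^ n) * (16 * (D * (1 + real n)))"
          using D by (intro mult_right_mono card_shell) auto
        finally show ?thesis by (simp add: algebra_simps)
      qed
      have "cmod (\<Sum>k\<in>shell n. (of_real (bcoef n p q k) * \<eta> k \<omega>) * fexp k x) \<le> 2 * (C * (1 + real n)) + 4 * (256 * D * (1 + real n) * 4 ^ n) / 4 ^ n"
      proof (rule trig_grid_bound[OF _ finite_shell])
        fix y assume y: "y \<in> grid n"
        show "cmod (\<Sum>k\<in>shell n. (of_real (bcoef n p q k) * \<eta> k \<omega>) * fexp k y) \<le> 2 * (C * (1 + real n))"
        proof (rule norm_le_phases)
          fix \<sigma> assume s: "\<sigma> \<in> phases"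
          have "Re (\<sigma> * (\<Sum>k\<in>shell n. (of_real (bcoef n p q k) * \<eta> k \<omega>) * fexp k y)) = X n (y, p, q, \<sigma>) \<omega>"
            unfolding X_def prod.case sum_distrib_left by (intro arg_cong[where f=Re] sum.cong refl) (simp add: ac_simps)
          then show "Re (\<sigma> * (\<Sum>k\<in>shell n. (of_real (bcoef n p q k) * \<eta> k \<omega>) * fexp k y)) \<le> C * (1 + real n)"
            using C(2)[OF y pq s] by simp
        qed
      next
        fix x
        show "cmod (\<Sum>k\<in>shell n. of_real (kx k) * (of_real (bcoef n p q k) * \<eta> k \<omega>) * fexp k x) \<le> 256 * D * (1 + real n) * 4 ^ n"
          using order_trans[OF kx_le_sz sz_shell(2)] by (intro L)
        show "cmod (\<Sum>k\<in>shell n. of_real (ky k) * (of_real (bcoef n p q k) * \<eta> k \<omega>) * fexp k x) \<le> 256 * D * (1 + real n) * 4 ^ n"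
          using order_trans[OF ky_le_sz sz_shell(2)] by (intro L)
      qed
      also have "4 * (256 * D * (1 + real n) * 4 ^ n) / 4 ^ n = 1024 * D * (1 + real n)" by simp
      finally show ?thesis by (simp add: E_def algebra_simps)
    qed
    have "besov2 a K (\<lambda>k. \<eta> k \<omega> / nsq k)"
      unfolding besov2_def
    proof (intro allI impI)
      fix n x and p q :: nat assume pq: "p + q \<le> 2"
      \<comment> \<open>The normalisation contained in \<open>bcoef\<close>, to be divided out
        again.\<close>
      define s :: real where "s = 2 ^ n / (2 ^ n) ^ (p + q)"
      have s: "0 < s" by (simp add: s_def)
      have "(\<Sum>k\<in>shell n. (of_real (bcoef n p q k) * \<eta> k \<omega>) * fexp k x) = of_real s * (\<Sum>k\<in>shell n. of_real (kx k ^ p * ky k ^ q) * (\<eta> k \<omega> / nsq k) * fexp k x)"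
        unfolding sum_distrib_left by (intro sum.cong refl) (simp add: bcoef_def s_def ac_simps)
      then have "s * cmod (\<Sum>k\<in>shell n. of_real (kx k ^ p * ky k ^ q) * (\<eta> k \<omega> / nsq k) * fexp k x) \<le> E * (1 + real n)"
        using F[OF pq, of n x] s by (simp add: norm_mult)
      also have "\<dots> \<le> E * ((1 + 1 / (a * ln 2)) * (2 ^ n) powr a)"
        by (intro mult_left_mono linear_le_pow2 a E0)
      also have "\<dots> = K * (2 ^ n) powr a" by (simp add: K_def)
      finally have "cmod (\<Sum>k\<in>shell n. of_real (kx k ^ p * ky k ^ q) * (\<eta> k \<omega> / nsq k) * fexp k x) \<le> K * (2 ^ n) powr a / s"
        using s by (simp add: pos_le_divide_eq mult.commute)
      also have "K * (2 ^ n) powr a / s = K * (2 ^ n) powr (a + real (p + q) - 1)"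
      proof -
        have "(2 ^ n) powr (a + real (p + q) - 1) = (2 ^ n) powr a * (2 ^ n) powr (real (p + q)) / (2 ^ n) powr 1"
          unfolding powr_add[symmetric] powr_diff[symmetric] by simp
        moreover have "(2 ^ n) powr (real (p + q)) = ((2::real) ^ n) ^ (p + q)" by (rule powr_realpow) simp
        ultimately show ?thesis by (simp add: s_def)
      qed
      finally show "cmod (\<Sum>k\<in>shell n. of_real (kx k ^ p * ky k ^ q) * (\<eta> k \<omega> / nsq k) * fexp k x) \<le> K * (2 ^ n) powr (a + real (p + q) - 1)" .
    qed
    moreover have "0 \<le> K" using E0 a by (simp add: K_def)
    ultimately show ?case by blast
  qed
qed

end

section \<open>The mollified noise as a Fourier series\<close>

lemma besov2_add: "besov2 a K f \<Longrightarrow> besov2 a K' g \<Longrightarrow> besov2 a (K + K') (\<lambda>k. f k + g k)"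
  unfolding besov2_def
proof (intro allI impI)
  fix n x and p q :: nat
  assume f: "\<forall>n x p q. p + q \<le> 2 \<longrightarrow> cmod (\<Sum>k\<in>shell n. of_real (kx k ^ p * ky k ^ q) * f k * fexp k x) \<le> K * (2 ^ n) powr (a + real (p + q) - 1)"
    and g: "\<forall>n x p q. p + q \<le> 2 \<longrightarrow> cmod (\<Sum>k\<in>shell n. of_real (kx k ^ p * ky k ^ q) * g k * fexp k x) \<le> K' * (2 ^ n) powr (a + real (p + q) - 1)"
    and pq: "p + q \<le> 2"
  have "cmod (\<Sum>k\<in>shell n. of_real (kx k ^ p * ky k ^ q) * f k * fexp k x) \<le> K * (2 ^ n) powr (a + real (p + q) - 1)"
    "cmod (\<Sum>k\<in>shell n. of_real (kx k ^ p * ky k ^ q) * g k * fexp k x) \<le> K' * (2 ^ n) powr (a + real (p + q) - 1)"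
    using f g pq by blast+
  then have "cmod ((\<Sum>k\<in>shell n. of_real (kx k ^ p * ky k ^ q) * f k * fexp k x) + (\<Sum>k\<in>shell n. of_real (kx k ^ p * ky k ^ q) * g k * fexp k x))
     \<le> K * (2 ^ n) powr (a + real (p + q) - 1) + K' * (2 ^ n) powr (a + real (p + q) - 1)"
    by (rule norm_triangle_mono)
  then show "cmod (\<Sum>k\<in>shell n. of_real (kx k ^ p * ky k ^ q) * (f k + g k) * fexp k x) \<le> (K + K') * (2 ^ n) powr (a + real (p + q) - 1)"
    by (simp add: distrib_left distrib_right sum.distrib)
qed

text \<open>Substituting -k for k changes the multiplier only by the sign
  \<open>(- 1) ^ (p + q)\<close>. The real part in the noise symmetrises its coefficients in this
  way.\<close>

lemma besov2_refl: "besov2 a K f \<Longrightarrow> besov2 a K (\<lambda>k. cnj (f (- k)))"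
  unfolding besov2_def
proof (intro allI impI)
  fix n x and p q :: nat
  assume f: "\<forall>n x p q. p + q \<le> 2 \<longrightarrow> cmod (\<Sum>k\<in>shell n. of_real (kx k ^ p * ky k ^ q) * f k * fexp k x) \<le> K * (2 ^ n) powr (a + real (p + q) - 1)"
    and pq: "p + q \<le> 2"
  have "(\<Sum>k\<in>shell n. of_real (kx k ^ p * ky k ^ q) * cnj (f (- k)) * fexp k x)
     = (\<Sum>k\<in>shell n. of_real (kx (- k) ^ p * ky (- k) ^ q) * cnj (f k) * fexp (- k) x)"
    by (rule sum.reindex_bij_witness[of _ uminus uminus]) auto
  also have "\<dots> = (- 1) ^ (p + q) * cnj (\<Sum>k\<in>shell n. of_real (kx k ^ p * ky k ^ q) * f k * fexp k x)"
    unfolding cnj_sum sum_distrib_left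
    by (intro sum.cong refl) (simp add: fexp_uminus power_add power_minus[of "kx _"] power_minus[of "ky _"])
  also have "cmod \<dots> = cmod (\<Sum>k\<in>shell n. of_real (kx k ^ p * ky k ^ q) * f k * fexp k x)"
    by (simp only: norm_mult norm_power norm_minus_cancel norm_one power_one mult_1 complex_mod_cnj)
  also have "\<dots> \<le> K * (2 ^ n) powr (a + real (p + q) - 1)" using f pq by blast
  finally show "cmod (\<Sum>k\<in>shell n. of_real (kx k ^ p * ky k ^ q) * cnj (f (- k)) * fexp k x) \<le> K * (2 ^ n) powr (a + real (p + q) - 1)" .
qed

text \<open>A single coefficient is at most the supremum of its block, and a \<le> 1 keeps these
  suprema bounded in n.\<close>

lemma besov2_coeff:
  assumes f: "besov2 a K f" "f 0 = 0" and a: "a \<le> 1"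
  shows "cmod (f k) \<le> K"
proof (cases "k = 0")
  case True
  have "0 \<le> K * (2 ^ 0) powr (a + real (0 + 0) - 1)" by (rule order_trans[OF norm_ge_zero besov2D[OF f(1)]]) simp
  then show ?thesis using True f by simp
next
  case False
  obtain n where "k \<in> square n" using eventually_in_square[of "{k}"] by (auto simp: eventually_sequentially)
  then have "\<exists>i<n. k \<in> shell i"
  proof (induction n)
    case 0 then show ?case using False by (simp add: square_0)
  next
    case (Suc n)
    then show ?case by (auto simp: square_Suc less_Suc_eq)
  qed
  then obtain i where i: "k \<in> shell i" by blast
  have K: "0 \<le> K"
  proof -
    have "0 \<le> K * (2 ^ 0) powr (a + real (0 + 0) - 1)" by (rule order_trans[OF norm_ge_zero besov2D[OF f(1)]]) simp
    then show ?thesis by simp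
  qed
  have "sobolev 0 (\<lambda>k. if k \<in> shell i then f k else 0) (K * (2 ^ i) powr (a - 1))"
    using besov2D[OF f(1), of 0 0] by (intro sobolev_trig_coeff) auto
  from sobolev_coord[OF this, of k] have "cmod (f k) \<le> K * (2 ^ i) powr (a - 1)" using i sz_pos[of k] by simp
  also have "\<dots> \<le> K * 1" using K a powr_mono[of "a - 1" 0 "2 ^ i"] by (intro mult_left_mono) auto
  finally show ?thesis by simp
qed

lemma nsq_nonneg: "0 \<le> nsq k"
  by (simp add: nsq_def)

lemma nsq_le: "nsq k \<le> 2 * sz k ^ 2"
proof -
  have "(kx k)\<^sup>2 \<le> (sz k)\<^sup>2" "(ky k)\<^sup>2 \<le> (sz k)\<^sup>2"
    using kx_le_sz[of k] ky_le_sz[of k] sz_nonneg[of k] by (simp_all add: abs_le_square_iff[symmetric])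
  then show ?thesis by (simp add: nsq_def)
qed

text \<open>The series clause of \<open>white_noise\<close> for a single sample; it separates the
  deterministic analysis from probability.\<close>

definition noise_series :: "coeffs \<Rightarrow> real \<Rightarrow> functional \<Rightarrow> bool" where
  "noise_series \<eta> c u \<longleftrightarrow> (\<forall>\<phi>\<in>smooth_torus. ((\<lambda>k. of_fun (\<lambda>x. complex_of_real (Re (\<eta> k * exp (\<i> * (lattice_pt k \<bullet> x))))) \<phi>)
     has_sum (u \<phi> - of_fun (\<lambda>x. complex_of_real c) \<phi>)) (UNIV - {0}))"

text \<open>The sequence \<open>\<eta> k / nsq k\<close> vanishes at \<open>0\<close> since \<open>x / 0 = 0\<close>.\<close>

lemma mollify_white_noise:
  fixes \<eta> :: "coeffs"
  assumes e: "0 < \<epsilon>" and f: "besov2 a K (\<lambda>k. \<eta> k / nsq k)" and a: "a \<le> 1" and u: "noise_series \<eta> c u"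
  shows "mollify \<epsilon> u x = complex_of_real c
    + fourier (\<lambda>k. nsq k * ((\<eta> k / nsq k + cnj (\<eta> (- k) / nsq (- k))) / 2) * mollcoef \<epsilon> k) x"
    and "rapid (\<lambda>k. nsq k * ((\<eta> k / nsq k + cnj (\<eta> (- k) / nsq (- k))) / 2) * mollcoef \<epsilon> k)"
proof -
  let ?\<phi> = "periodize (molltest \<epsilon> x)"
  define h where "h k = nsq k * (\<eta> k / nsq k)" for k
  have h: "h k = (if k = 0 then 0 else \<eta> k)" for k using nsq_pos[of k] by (auto simp: h_def)
  have phi: "?\<phi> \<in> smooth_torus" by (rule molltest_torus[OF e])
  have phic: "continuous_on UNIV ?\<phi>" using phi Ck_continuous unfolding smooth_torus_def smooth_def by blast
  have mol: "mollify \<epsilon> u x = u ?\<phi>"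
    unfolding mollify_def molltest_def[abs_def] by (simp add: power2_eq_square)
  have const: "of_fun (\<lambda>x. complex_of_real c) ?\<phi> = complex_of_real c"
    using molltest_fexp[OF e, of 0 x] by (simp add: of_fun_def mollcoef_0)
  \<comment> \<open>Taking the real part of mode k puts half of \<open>\<eta> k\<close> at k and
    half of its conjugate at -k. \<open>A\<close> and \<open>B\<close> are these two contributions,
    before halving and each indexed by its own frequency.\<close>
  define A where "A k = h k * mollcoef \<epsilon> k" for k
  define B where "B k = cnj (h (- k)) * mollcoef \<epsilon> k" for k
  have f1: "cmod (\<eta> k / nsq k) \<le> K" for k by (rule besov2_coeff[OF f _ a]) simp
  have hb: "cmod (h k) \<le> (2 * K) * sz k ^ 2" for k
  proof -
    have "cmod (h k) = nsq k * cmod (\<eta> k / nsq k)" using nsq_nonneg[of k] unfolding h_def by (simp only: norm_mult norm_of_real abs_of_nonneg)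
    also have "\<dots> \<le> (2 * sz k ^ 2) * K" by (intro mult_mono nsq_le f1) (auto simp: nsq_def)
    finally show ?thesis by (simp add: ac_simps)
  qed
  have hb': "cmod (cnj (h (- k))) \<le> (2 * K) * sz k ^ 2" for k using hb[of "- k"] by simp
  have A: "rapid A" unfolding A_def by (rule rapid_mollcoef[OF e hb])
  have B: "rapid B" unfolding B_def by (rule rapid_mollcoef[OF e hb'])
  have AB: "(\<lambda>k. nsq k * ((\<eta> k / nsq k + cnj (\<eta> (- k) / nsq (- k))) / 2) * mollcoef \<epsilon> k) = (\<lambda>k. (1 / 2) * A k + (1 / 2) * B k)"
    by (rule ext) (simp add: A_def B_def h_def algebra_simps)
  show "rapid (\<lambda>k. nsq k * ((\<eta> k / nsq k + cnj (\<eta> (- k) / nsq (- k))) / 2) * mollcoef \<epsilon> k)"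
    unfolding AB by (intro rapid_add rapid_cmult A B)
  have trm: "of_fun (\<lambda>x. complex_of_real (Re (\<eta> k * exp (\<i> * (lattice_pt k \<bullet> x))))) ?\<phi>
     = (1 / 2) * (A k * fexp k x) + (1 / 2) * (B (- k) * fexp (- k) x)" if k: "k \<noteq> 0" for k
  proof -
    have "complex_of_real (Re (\<eta> k * fexp k y)) * ?\<phi> y = (\<eta> k / 2) * (fexp k y * ?\<phi> y) + (cnj (\<eta> k) / 2) * (fexp (- k) y * ?\<phi> y)" for y
    proof -
      have "complex_of_real (Re (\<eta> k * fexp k y)) = (\<eta> k * fexp k y + cnj (\<eta> k * fexp k y)) / 2"
        by (simp only: complex_add_cnj) simp
      then have e: "complex_of_real (Re (\<eta> k * fexp k y)) = (\<eta> k * fexp k y + cnj (\<eta> k) * cnj (fexp k y)) / 2"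
        unfolding complex_cnj_mult .
      show ?thesis unfolding e fexp_uminus by (simp add: field_simps)
    qed
    then have "of_fun (\<lambda>y. complex_of_real (Re (\<eta> k * fexp k y))) ?\<phi>
      = (LINT y:cell|lborel. (\<eta> k / 2) * (fexp k y * ?\<phi> y) + (cnj (\<eta> k) / 2) * (fexp (- k) y * ?\<phi> y))"
      unfolding of_fun_def by simp
    also have "\<dots> = (\<eta> k / 2) * (LINT y:cell|lborel. fexp k y * ?\<phi> y) + (cnj (\<eta> k) / 2) * (LINT y:cell|lborel. fexp (- k) y * ?\<phi> y)"
      by (subst set_integral_add) (auto intro!: set_integrable_cell continuous_intros phic)
    also have "\<dots> = (1 / 2) * (A k * fexp k x) + (1 / 2) * (B (- k) * fexp (- k) x)"
      unfolding molltest_fexp[OF e] A_def B_def h using k by (simp add: ac_simps)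
    finally show ?thesis unfolding fexp_def .
  qed
  have sA: "((\<lambda>k. A k * fexp k x) has_sum fourier A x) (UNIV - {0})"
  proof -
    have "((\<lambda>k. A k * fexp k x) has_sum fourier A x) UNIV" unfolding fourier_def by (intro has_sum_infsum rapid_fourier_summable A)
    moreover have "((\<lambda>k. A k * fexp k x) has_sum fourier A x) (UNIV - {0}) \<longleftrightarrow> ((\<lambda>k. A k * fexp k x) has_sum fourier A x) UNIV"
      by (rule has_sum_cong_neutral) (auto simp: A_def h)
    ultimately show ?thesis by simp
  qed
  have sB: "((\<lambda>k. B (- k) * fexp (- k) x) has_sum fourier B x) (UNIV - {0})"
  proof -
    have "((\<lambda>k. B k * fexp k x) has_sum fourier B x) UNIV" unfolding fourier_def by (intro has_sum_infsum rapid_fourier_summable B)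
    moreover have "((\<lambda>k. B k * fexp k x) has_sum fourier B x) (UNIV - {0}) \<longleftrightarrow> ((\<lambda>k. B k * fexp k x) has_sum fourier B x) UNIV"
      by (rule has_sum_cong_neutral) (auto simp: B_def h)
    ultimately have "((\<lambda>k. B k * fexp k x) has_sum fourier B x) (UNIV - {0})" by simp
    then show ?thesis by (subst has_sum_reindex_bij_witness[of _ uminus uminus]) auto
  qed
  have "((\<lambda>k. (1 / 2) * (A k * fexp k x) + (1 / 2) * (B (- k) * fexp (- k) x))
      has_sum ((1 / 2) * fourier A x + (1 / 2) * fourier B x)) (UNIV - {0})"
    by (intro has_sum_add has_sum_cmult_right sA sB)
  moreover have "((\<lambda>k. of_fun (\<lambda>x. complex_of_real (Re (\<eta> k * exp (\<i> * (lattice_pt k \<bullet> x))))) ?\<phi>)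
      has_sum ((1 / 2) * fourier A x + (1 / 2) * fourier B x)) (UNIV - {0}) \<longleftrightarrow>
     ((\<lambda>k. (1 / 2) * (A k * fexp k x) + (1 / 2) * (B (- k) * fexp (- k) x))
      has_sum ((1 / 2) * fourier A x + (1 / 2) * fourier B x)) (UNIV - {0})"
    by (rule has_sum_cong) (rule trm, simp)
  ultimately have "((\<lambda>k. of_fun (\<lambda>x. complex_of_real (Re (\<eta> k * exp (\<i> * (lattice_pt k \<bullet> x))))) ?\<phi>)
      has_sum ((1 / 2) * fourier A x + (1 / 2) * fourier B x)) (UNIV - {0})" by blast
  from has_sum_unique[OF this u[unfolded noise_series_def, rule_format, OF phi]]
  have "u ?\<phi> = complex_of_real c + ((1 / 2) * fourier A x + (1 / 2) * fourier B x)" unfolding const by simp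
  then show "mollify \<epsilon> u x = complex_of_real c
    + fourier (\<lambda>k. nsq k * ((\<eta> k / nsq k + cnj (\<eta> (- k) / nsq (- k))) / 2) * mollcoef \<epsilon> k) x"
    unfolding mol AB fourier_add[OF rapid_cmult[OF A] rapid_cmult[OF B]] fourier_cmult .
qed

section \<open>Solutions driven by a good noise\<close>

definition rsol :: "(3 \<Rightarrow> real) \<Rightarrow> (3 \<Rightarrow> real) \<Rightarrow> (3 \<Rightarrow> coeffs) \<Rightarrow> plane \<Rightarrow> complex ^ 3" where
  "rsol A B \<psi> x = (\<chi> j. Complex (A j) (B j) + (pderiv2 (fourier (\<psi> j)) x + \<i> * pderiv1 (fourier (\<psi> j)) x))"

definition rcoef :: "complex \<Rightarrow> coeffs \<Rightarrow> coeffs" where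
  "rcoef c f k = (if k = 0 then c else 0) + (\<i> * of_real (ky k) * f k + \<i> * (\<i> * of_real (kx k) * f k))"

lemma rcoef_rapid: "rapid f \<Longrightarrow> rapid (rcoef c f)"
  unfolding rcoef_def[abs_def] by (intro rapid_add rapid_single rapid_cmult[of _ \<i>] rapid_deriv)

lemma rsol_fourier: "rapid (\<psi> j) \<Longrightarrow> rsol A B \<psi> x $ j = fourier (rcoef (Complex (A j) (B j)) (\<psi> j)) x"
proof -
  assume r: "rapid (\<psi> j)"
  have "fourier (rcoef (Complex (A j) (B j)) (\<psi> j)) x = fourier (\<lambda>k. if k = 0 then Complex (A j) (B j) else 0) x
     + (fourier (\<lambda>k. \<i> * of_real (ky k) * \<psi> j k) x + fourier (\<lambda>k. \<i> * (\<i> * of_real (kx k) * \<psi> j k)) x)"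
    unfolding rcoef_def[abs_def]
    by (subst fourier_add, rule rapid_single, intro rapid_add rapid_cmult[of _ \<i>] rapid_deriv r,
        subst fourier_add, intro rapid_deriv r, intro rapid_cmult[of _ \<i>] rapid_deriv r, rule refl)
  then show ?thesis unfolding fourier_single fourier_cmult[of \<i>] by (simp add: rsol_def pderiv_fourier r)
qed

lemma rsol_smooth:
  assumes r: "\<And>j. rapid (\<psi> j)"
  shows "rsol A B \<psi> \<in> smooth_torus"
proof -
  have "Ck n (\<lambda>x. \<chi> j. fourier (c j) x)" if "\<And>j. rapid (c j)" for n and c :: "3 \<Rightarrow> coeffs"
    using that
  proof (induction n arbitrary: c)
    case 0
    have "continuous_on UNIV (\<lambda>x. fourier (c j) x)" for j by (rule fourier_continuous[OF 0])
    then show ?case unfolding Ck.simps by (rule continuous_on_vec_lambda)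
  next
    case (Suc n)
    let ?D = "\<lambda>x h. \<chi> j. fst h *\<^sub>R fourier (\<lambda>k. \<i> * of_real (kx k) * c j k) x + snd h *\<^sub>R fourier (\<lambda>k. \<i> * of_real (ky k) * c j k) x"
    have d: "((\<lambda>x. \<chi> j. fourier (c j) x) has_derivative ?D x) (at x)" for x
    proof (rule has_derivative_componentwise_within[THEN iffD2], rule ballI)
      fix i :: "complex ^ 3" assume "i \<in> Basis"
      then obtain j u where i: "i = axis j u" unfolding Basis_vec_def by blast
      show "((\<lambda>x. (\<chi> j. fourier (c j) x) \<bullet> i) has_derivative (\<lambda>h. ?D x h \<bullet> i)) (at x)"
        unfolding i inner_axis vec_lambda_beta
        by (rule has_derivative_inner_left) (rule fourier_has_derivative[OF Suc.prems])
    qed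
    have e: "pderiv1 (\<lambda>x. \<chi> j. fourier (c j) x) = (\<lambda>x. \<chi> j. fourier (\<lambda>k. \<i> * of_real (kx k) * c j k) x)"
      "pderiv2 (\<lambda>x. \<chi> j. fourier (c j) x) = (\<lambda>x. \<chi> j. fourier (\<lambda>k. \<i> * of_real (ky k) * c j k) x)"
      by (rule ext, simp add: pderiv_eqI[OF d])+
    have "(\<lambda>x. \<chi> j. fourier (c j) x) differentiable_on UNIV"
      using d by (meson differentiable_at_imp_differentiable_on differentiableI)
    then show ?case unfolding Ck.simps e
      by (intro conjI Suc.IH[OF rapid_deriv(1)[OF Suc.prems]] Suc.IH[OF rapid_deriv(2)[OF Suc.prems]])
  qed
  moreover have e: "rsol A B \<psi> = (\<lambda>x. \<chi> j. fourier (rcoef (Complex (A j) (B j)) (\<psi> j)) x)"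
    by (rule ext) (simp add: vec_eq_iff rsol_fourier r)
  moreover have "periodic (rsol A B \<psi>)"
    unfolding e periodic_def
  proof (intro allI)
    fix m x
    show "(\<chi> j. fourier (rcoef (Complex (A j) (B j)) (\<psi> j)) (x + (2 * pi) *\<^sub>R lattice_pt m)) = (\<chi> j. fourier (rcoef (Complex (A j) (B j)) (\<psi> j)) x)"
      by (simp only: periodicD[OF fourier_periodic])
  qed
  ultimately show ?thesis using rcoef_rapid[OF r] unfolding smooth_torus_def smooth_def by simp
qed

lemma jac_at_0: "jac f g 0 = 0"
  by (simp add: jac_def wedge_def)

lemma fourier_nonlin0:
  assumes r: "\<And>j. rapid (\<psi> j)"
  shows "((\<lambda>k. nonlin0 A B \<psi> j k * fexp k x) has_sum
     (pderiv2 (fourier (\<psi> (j + 1))) x * pderiv1 (fourier (\<psi> (j + 2))) x - pderiv1 (fourier (\<psi> (j + 1))) x * pderiv2 (fourier (\<psi> (j + 2))) x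
      + ((A (j + 1) * pderiv1 (fourier (\<psi> (j + 2))) x - A (j + 2) * pderiv1 (fourier (\<psi> (j + 1))) x)
       - (B (j + 1) * pderiv2 (fourier (\<psi> (j + 2))) x - B (j + 2) * pderiv2 (fourier (\<psi> (j + 1))) x)))) UNIV"
proof -
  have 1: "((\<lambda>k. jac (\<psi> (j + 1)) (\<psi> (j + 2)) k * fexp k x) has_sum
     (pderiv2 (fourier (\<psi> (j + 1))) x * pderiv1 (fourier (\<psi> (j + 2))) x - pderiv1 (fourier (\<psi> (j + 1))) x * pderiv2 (fourier (\<psi> (j + 2))) x)) UNIV"
    using fourier_jac[OF r[of "j + 1"] r[of "j + 2"], of x] by (simp add: has_sum_iff fourier_def[of "jac _ _"])
  have x: "((\<lambda>k. (\<i> * of_real (kx k) * \<psi> i k) * fexp k x) has_sum pderiv1 (fourier (\<psi> i)) x) UNIV"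
    and y: "((\<lambda>k. (\<i> * of_real (ky k) * \<psi> i k) * fexp k x) has_sum pderiv2 (fourier (\<psi> i)) x) UNIV" for i
    unfolding pderiv_fourier[OF r] unfolding fourier_def by (intro has_sum_infsum rapid_fourier_summable rapid_deriv r)+
  have e: "nonlin0 A B \<psi> j k * fexp k x = jac (\<psi> (j + 1)) (\<psi> (j + 2)) k * fexp k x
     + ((A (j + 1) * ((\<i> * of_real (kx k) * \<psi> (j + 2) k) * fexp k x) - A (j + 2) * ((\<i> * of_real (kx k) * \<psi> (j + 1) k) * fexp k x))
      - (B (j + 1) * ((\<i> * of_real (ky k) * \<psi> (j + 2) k) * fexp k x) - B (j + 2) * ((\<i> * of_real (ky k) * \<psi> (j + 1) k) * fexp k x)))" for k
    by (simp add: nonlin0_def cross_lin_def algebra_simps)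
  show ?thesis unfolding e by (intro has_sum_add has_sum_diff has_sum_cmult_right 1 x y)
qed

lemma real_of_cnj: "cnj z = z \<Longrightarrow> z = of_real (Re z)"
  by (simp add: complex_eq_iff)

text \<open>The quadratic part of the system is -2 \<i> times the cross product of Re r and Im r.
  For real stream functions it splits into the cross product of A and B, first order terms and a
  Jacobian. By \<open>AB\<close> the first cancels the mean of the noise; the rest is
  \<open>eq\<close>, since dbar of a component is \<i> / 2 times the Laplacian of its stream
  function.\<close>

lemma rsol_solves:
  fixes \<gamma> :: "real ^ 3" and w :: "3 \<Rightarrow> coeffs"
  assumes r: "\<And>j. rapid (\<psi> j)" and re: "\<And>j k. \<psi> j (- k) = cnj (\<psi> j k)"
    and w: "\<And>j. rapid (w j)"
    and eq: "\<And>j k. of_real (nsq k) * \<psi> j k = - 2 * \<gamma> $ j * w j k + 4 * nonlin0 A B \<psi> j k"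
    and F: "\<And>j x. F j x = complex_of_real (m j) + fourier (w j) x"
    and AB: "\<And>j. A (j + 1) * B (j + 2) - A (j + 2) * B (j + 1) = \<gamma> $ j * m j / 2"
  shows "solves_system \<gamma> F (rsol A B \<psi>)"
proof -
  let ?r = "rsol A B \<psi>"
  have main: "dbar (\<lambda>y. ?r y $ j) x = ?r x $ (j + 1) * cnj (?r x $ (j + 2)) - cnj (?r x $ (j + 1)) * ?r x $ (j + 2) + \<i> * \<gamma> $ j * F j x" for j x
  proof -
    define c where "c = Complex (A j) (B j)"
    have rj: "(\<lambda>y. ?r y $ j) = fourier (rcoef c (\<psi> j))" by (rule ext) (simp add: rsol_fourier r c_def)
    note rr = rcoef_rapid[OF r[of j], of c]
    have "dbar (\<lambda>y. ?r y $ j) x = (1 / 2) * (fourier (\<lambda>k. \<i> * of_real (kx k) * rcoef c (\<psi> j) k) x + \<i> * fourier (\<lambda>k. \<i> * of_real (ky k) * rcoef c (\<psi> j) k) x)"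
      unfolding dbar_def rj pderiv_fourier[OF rr] ..
    also have "\<dots> = fourier (\<lambda>k. (1 / 2) * (\<i> * of_real (kx k) * rcoef c (\<psi> j) k + \<i> * (\<i> * of_real (ky k) * rcoef c (\<psi> j) k))) x"
      unfolding fourier_cmult by (subst fourier_add) (auto intro!: rapid_cmult[of _ \<i>] rapid_deriv rr simp: fourier_cmult)
    also have "(\<lambda>k. (1 / 2) * (\<i> * of_real (kx k) * rcoef c (\<psi> j) k + \<i> * (\<i> * of_real (ky k) * rcoef c (\<psi> j) k)))
       = (\<lambda>k. \<i> * \<gamma> $ j * w j k + (- 2 * \<i>) * nonlin0 A B \<psi> j k)"
    proof
      fix k
      have "(1 / 2) * (\<i> * of_real (kx k) * rcoef c (\<psi> j) k + \<i> * (\<i> * of_real (ky k) * rcoef c (\<psi> j) k)) = - (\<i> / 2) * (of_real (nsq k) * \<psi> j k)"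
        by (cases "k = 0") (simp_all add: rcoef_def nsq_def algebra_simps power2_eq_square)
      also have "\<dots> = \<i> * \<gamma> $ j * w j k + (- 2 * \<i>) * nonlin0 A B \<psi> j k"
        unfolding eq by (simp add: algebra_simps)
      finally show "(1 / 2) * (\<i> * of_real (kx k) * rcoef c (\<psi> j) k + \<i> * (\<i> * of_real (ky k) * rcoef c (\<psi> j) k)) = \<i> * \<gamma> $ j * w j k + (- 2 * \<i>) * nonlin0 A B \<psi> j k" .
    qed
    finally have d: "dbar (\<lambda>y. ?r y $ j) x = fourier (\<lambda>k. \<i> * \<gamma> $ j * w j k + (- 2 * \<i>) * nonlin0 A B \<psi> j k) x" .
    define X where "X i = Re (pderiv1 (fourier (\<psi> i)) x)" for i
    define Y where "Y i = Re (pderiv2 (fourier (\<psi> i)) x)" for i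
    have X: "pderiv1 (fourier (\<psi> i)) x = of_real (X i)" for i
      unfolding X_def by (rule real_of_cnj) (simp add: pderiv_fourier r fourier_real re)
    have Y: "pderiv2 (fourier (\<psi> i)) x = of_real (Y i)" for i
      unfolding Y_def by (rule real_of_cnj) (simp add: pderiv_fourier r fourier_real re)
    define i1 i2 where "i1 = j + 1" and "i2 = j + 2"
    let ?N = "Y i1 * X i2 - X i1 * Y i2 + ((A i1 * X i2 - A i2 * X i1) - (B i1 * Y i2 - B i2 * Y i1))"
    have n: "((\<lambda>k. nonlin0 A B \<psi> j k * fexp k x) has_sum complex_of_real ?N) UNIV"
      using fourier_nonlin0[OF r, where A=A and B=B and j=j and x=x] unfolding X Y i1_def[symmetric] i2_def[symmetric] by simp
    have ww: "((\<lambda>k. w j k * fexp k x) has_sum fourier (w j) x) UNIV"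
      unfolding fourier_def by (intro has_sum_infsum rapid_fourier_summable w)
    have "((\<lambda>k. (\<i> * \<gamma> $ j) * (w j k * fexp k x) + (- 2 * \<i>) * (nonlin0 A B \<psi> j k * fexp k x)) has_sum
       (\<i> * \<gamma> $ j) * fourier (w j) x + (- 2 * \<i>) * complex_of_real ?N) UNIV"
      by (intro has_sum_add has_sum_cmult_right n ww)
    then have "dbar (\<lambda>y. ?r y $ j) x = (\<i> * \<gamma> $ j) * fourier (w j) x + (- 2 * \<i>) * complex_of_real ?N"
      unfolding d by (simp add: fourier_def has_sum_iff algebra_simps)
    moreover have "?r x $ i = Complex (A i + Y i) (B i + X i)" for i
      unfolding rsol_def vec_lambda_beta X Y by (simp add: complex_eq_iff)
    moreover have "\<gamma> $ j * m j = 2 * (A i1 * B i2 - A i2 * B i1)"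
      using AB[of j] unfolding i1_def i2_def by simp
    then have "complex_of_real (\<gamma> $ j) * complex_of_real (m j) = complex_of_real (2 * (A i1 * B i2 - A i2 * B i1))"
      unfolding of_real_mult[symmetric] by (rule arg_cong)
    ultimately show ?thesis unfolding F i1_def[symmetric] i2_def[symmetric] distrib_left
      by (simp add: complex_eq_iff algebra_simps)
  qed
  have 3: "(1::3) + 1 = 2" "(1::3) + 2 = 3" "(2::3) + 1 = 3" "(2::3) + 2 = 1" "(3::3) + 1 = 1" "(3::3) + 2 = 2"
    by simp_all
  show ?thesis
    unfolding solves_system_def
    using main[of 1] main[of 2] main[of 3] unfolding 3 by (simp add: algebra_simps)
qed

text \<open>B points along the third axis and A is orthogonal to it, so their cross product can have
  any first two components while the third vanishes. Dividing by \<open>sqrt (norm \<gamma>)\<close>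
  shares the size evenly between them; for \<gamma> = 0 both vectors are zero.\<close>

definition cB :: "real ^ 3 \<Rightarrow> 3 \<Rightarrow> real" where
  "cB \<gamma> j = (if j = 3 then sqrt (norm \<gamma>) else 0)"

definition cA :: "real ^ 3 \<Rightarrow> (3 \<Rightarrow> real) \<Rightarrow> 3 \<Rightarrow> real" where
  "cA \<gamma> m j = (if j = 1 then - (\<gamma> $ 2 * m 2) / (2 * sqrt (norm \<gamma>))
     else if j = 2 then \<gamma> $ 1 * m 1 / (2 * sqrt (norm \<gamma>)) else 0)"

text \<open>The mean of the noise is absorbed by the cross product of two constant vectors, each of
  size of order \<open>sqrt |\<gamma>|\<close>.\<close>

lemma cA_cB_cross:
  assumes "m 3 = 0"
  shows "cA \<gamma> m (j + 1) * cB \<gamma> (j + 2) - cA \<gamma> m (j + 2) * cB \<gamma> (j + 1) = \<gamma> $ j * m j / 2"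
proof -
  have 3: "(1::3) + 1 = 2" "(1::3) + 2 = 3" "(2::3) + 1 = 3" "(2::3) + 2 = 1" "(3::3) + 1 = 1" "(3::3) + 2 = 2"
    "(1::3) \<noteq> 2" "(1::3) \<noteq> 3" "(2::3) \<noteq> 3"
    by simp_all
  have "\<gamma> $ 1 = 0 \<and> \<gamma> $ 2 = 0" if "norm \<gamma> = 0" using that by simp
  moreover have "norm \<gamma> \<noteq> 0 \<Longrightarrow> sqrt (norm \<gamma>) \<noteq> 0" by simp
  moreover have "j = 1 \<or> j = 2 \<or> j = 3" by (rule exhaust_3)
  ultimately show ?thesis
    using assms by (cases "norm \<gamma> = 0"; elim disjE) (simp_all add: cA_def cB_def)
qed

lemma cA_bound:
  assumes m: "\<And>j. \<bar>m j\<bar> \<le> K"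
  shows "\<bar>cA \<gamma> m j\<bar> \<le> sqrt (norm \<gamma>) * (1 + K)" "\<bar>cB \<gamma> j\<bar> \<le> sqrt (norm \<gamma>) * (1 + K)"
proof -
  have K: "0 \<le> K" using order_trans[OF abs_ge_zero m] .
  have *: "\<bar>\<gamma> $ i * m i / (2 * sqrt (norm \<gamma>))\<bar> \<le> sqrt (norm \<gamma>) * (1 + K)" for i
  proof (cases "norm \<gamma> = 0")
    case False
    then have s: "0 < sqrt (norm \<gamma>)" by simp
    define t where "t = sqrt (norm \<gamma>)"
    have t: "0 < t" "norm \<gamma> = t * t" using s by (simp_all add: t_def)
    have "\<bar>\<gamma> $ i * m i\<bar> \<le> norm \<gamma> * K"
      unfolding abs_mult by (intro mult_mono component_le_norm_cart m) auto
    then have "\<bar>\<gamma> $ i * m i\<bar> / (2 * t) \<le> t * t * K / (2 * t)"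
      unfolding t(2) using t(1) by (intro divide_right_mono) auto
    also have "\<dots> = t * (K / 2)" using t(1) by simp
    also have "\<dots> \<le> t * (1 + K)" using K t(1) by (intro mult_left_mono) auto
    finally show ?thesis using t(1) unfolding t_def[symmetric] by (simp add: abs_mult)
  qed simp
  show "\<bar>cA \<gamma> m j\<bar> \<le> sqrt (norm \<gamma>) * (1 + K)"
    using *[of 1] *[of 2] K by (auto simp: cA_def)
  show "\<bar>cB \<gamma> j\<bar> \<le> sqrt (norm \<gamma>) * (1 + K)"
    using K by (auto simp: cB_def mult_le_cancel_left1)
qed

section \<open>Uniform bounds for the approximate solutions\<close>

definition psiN :: "real ^ 3 \<Rightarrow> (3 \<Rightarrow> coeffs) \<Rightarrow> real \<Rightarrow> 3 \<Rightarrow> coeffs" where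
  "psiN \<gamma> \<Upsilon> \<epsilon> j k = of_real (\<gamma> $ j) * (\<Upsilon> j k * mollcoef \<epsilon> k)"

definition good_noise :: "real \<Rightarrow> real \<Rightarrow> (3 \<Rightarrow> coeffs) \<Rightarrow> (3 \<Rightarrow> real) \<Rightarrow> bool" where
  "good_noise a K \<Upsilon> m \<longleftrightarrow> (\<forall>j. besov2 a K (\<Upsilon> j) \<and> \<Upsilon> j 0 = 0 \<and> (\<forall>k. \<Upsilon> j (- k) = cnj (\<Upsilon> j k)) \<and> \<bar>m j\<bar> \<le> K) \<and> m 3 = 0"

text \<open>The choice is made separately for each sample, \<gamma> and \<epsilon>. Any choice will
  do, since \<open>solves_fp_diff\<close> compares arbitrary solutions in the ball.\<close>

definition sol_psi :: "real \<Rightarrow> real \<Rightarrow> real ^ 3 \<Rightarrow> (3 \<Rightarrow> coeffs) \<Rightarrow> (3 \<Rightarrow> real) \<Rightarrow> real \<Rightarrow> 3 \<Rightarrow> coeffs" where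
  "sol_psi s K \<gamma> \<Upsilon> m \<epsilon> j k = psiN \<gamma> \<Upsilon> \<epsilon> j k
     + (SOME \<theta>. solves_fp s (cA \<gamma> m) (cB \<gamma>) (norm \<gamma> * K) (psiN \<gamma> \<Upsilon> \<epsilon>) \<theta>) j k"

lemma besov_diff: "besov b K f \<Longrightarrow> besov b K' g \<Longrightarrow> besov b (K + K') (\<lambda>k. f k - g k)"
  using besov_add[of b K f K' "\<lambda>k. - 1 * g k"] besov_cmult[of b K' g "- 1"] by simp

lemma max_bound3:
  assumes "\<And>j :: 3. \<exists>D. P j D" "\<And>j D D'. P j D \<Longrightarrow> D \<le> D' \<Longrightarrow> P j (D' :: real)"
  shows "\<exists>D. \<forall>j. P j D"
proof -
  obtain d where d: "\<And>j. P j (d j)" using assms(1) by metis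
  have "P j (Max (range d))" for j
    by (rule assms(2)[OF d]) simp
  then show ?thesis by blast
qed

context
  fixes a b s K \<theta> :: real and \<gamma> :: "real ^ 3" and \<Upsilon> :: "3 \<Rightarrow> coeffs" and m :: "3 \<Rightarrow> real"
  assumes par: "0 < a" "a \<le> b" "b = a + \<theta>" "2 * b < s" "s < 1 / 2" "0 \<le> \<theta>" "\<theta> \<le> 1"
    and good: "good_noise a K \<Upsilon> m"
    and small: "nconst b s * (2 * (norm \<gamma> * K) + sqrt (norm \<gamma>) * (1 + K)) \<le> 1 / 2"
begin

lemma noise_facts: "besov2 a K (\<Upsilon> j)" "\<Upsilon> j 0 = 0" "\<Upsilon> j (- k) = cnj (\<Upsilon> j k)" "\<bar>m j\<bar> \<le> K" "m 3 = 0"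
  using good unfolding good_noise_def by blast+

lemma K_nonneg: "0 \<le> K"
  using order_trans[OF abs_ge_zero noise_facts(4)] .

lemma b_pos: "0 < b"
  using par by simp

lemma psiN_rapid:
  assumes "0 < \<epsilon>"
  shows "rapid (psiN \<gamma> \<Upsilon> \<epsilon> j)"
proof -
  have "cmod (\<Upsilon> j k) \<le> K * sz k ^ 0" for k
    using besov2_coeff[OF noise_facts(1,2), of j k] par by simp
  from rapid_mollcoef[OF assms this] show ?thesis
    unfolding psiN_def[abs_def] by (rule rapid_cmult)
qed

lemma psiN_sobolev1: "0 < \<epsilon> \<Longrightarrow> \<exists>D. \<forall>j. sobolev 1 (psiN \<gamma> \<Upsilon> \<epsilon> j) D"
  by (rule max_bound3) (auto intro: rapidD[OF psiN_rapid] sobolev_mono)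

lemma psiN_besov: "besov b (norm \<gamma> * K) (psiN \<gamma> \<Upsilon> \<epsilon> j)"
proof -
  have "besov b K (\<lambda>k. \<Upsilon> j k * mollcoef \<epsilon> k)"
    by (rule besov_exp_mono[OF besov_mollcoef[OF noise_facts(1,2)]]) (use par in simp)
  from besov_cmult[OF this, of "of_real (\<gamma> $ j)"]
  have "besov b (cmod (of_real (\<gamma> $ j)) * K) (psiN \<gamma> \<Upsilon> \<epsilon> j)" unfolding psiN_def[abs_def] .
  then show ?thesis
    by (rule besov_mono) (simp add: mult_right_mono K_nonneg component_le_norm_cart)
qed

text \<open>Both mollifications are compared with the unmollified sequence, through
  \<open>mollcoef \<epsilon> k - 1\<close>, which is why the two rates add up.\<close>

lemma psiN_diff:
  assumes e: "0 < \<epsilon>" "0 < \<epsilon>'"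
  shows "besov b (norm \<gamma> * K * 2 * (\<epsilon> powr \<theta> + \<epsilon>' powr \<theta>)) (\<lambda>k. psiN \<gamma> \<Upsilon> \<epsilon> j k - psiN \<gamma> \<Upsilon> \<epsilon>' j k)"
proof -
  have "besov b (2 * K * \<epsilon> powr \<theta>) (\<lambda>k. \<Upsilon> j k * (mollcoef \<epsilon> k - 1))" if "0 < \<epsilon>" for \<epsilon>
    unfolding par(3) by (rule besov_mollcoef_diff[OF noise_facts(1,2) that par(6,7) K_nonneg])
  from besov_cmult[OF besov_diff[OF this[OF e(1)] this[OF e(2)]], of "of_real (\<gamma> $ j)"]
  have "besov b (cmod (of_real (\<gamma> $ j)) * (2 * K * \<epsilon> powr \<theta> + 2 * K * \<epsilon>' powr \<theta>)) (\<lambda>k. psiN \<gamma> \<Upsilon> \<epsilon> j k - psiN \<gamma> \<Upsilon> \<epsilon>' j k)"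
    by (simp add: psiN_def algebra_simps)
  then show ?thesis
  proof (rule besov_mono)
    have "cmod (of_real (\<gamma> $ j)) * (2 * K * \<epsilon> powr \<theta> + 2 * K * \<epsilon>' powr \<theta>) \<le> norm \<gamma> * (2 * K * \<epsilon> powr \<theta> + 2 * K * \<epsilon>' powr \<theta>)"
      using K_nonneg by (intro mult_right_mono) (auto simp: component_le_norm_cart)
    then show "cmod (of_real (\<gamma> $ j)) * (2 * K * \<epsilon> powr \<theta> + 2 * K * \<epsilon>' powr \<theta>) \<le> norm \<gamma> * K * 2 * (\<epsilon> powr \<theta> + \<epsilon>' powr \<theta>)"
      by (simp add: algebra_simps)
  qed
qed

lemma ex_theta:
  assumes e: "0 < \<epsilon>"
  shows "\<exists>th. solves_fp s (cA \<gamma> m) (cB \<gamma>) (norm \<gamma> * K) (psiN \<gamma> \<Upsilon> \<epsilon>) th \<and>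
    (\<forall>j k. sol_psi s K \<gamma> \<Upsilon> m \<epsilon> j k = psiN \<gamma> \<Upsilon> \<epsilon> j k + th j k)"
proof -
  obtain D where D: "\<And>j. sobolev 1 (psiN \<gamma> \<Upsilon> \<epsilon> j) D" using psiN_sobolev1[OF e] by blast
  have ex: "\<exists>th. solves_fp s (cA \<gamma> m) (cB \<gamma>) (norm \<gamma> * K) (psiN \<gamma> \<Upsilon> \<epsilon>) th"
    by (rule ex_solves_fp[OF b_pos par(4,5) cA_bound[OF noise_facts(4)] small psiN_besov D])
  show ?thesis unfolding sol_psi_def
    by (rule exI, rule conjI, rule someI_ex[OF ex]) simp
qed

lemma theta_0: "solves_fp s A B R \<Psi> th \<Longrightarrow> th j 0 = 0"
proof -
  assume "solves_fp s A B R \<Psi> th"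
  then have "th j 0 = nonlin A B (\<lambda>j k. \<Psi> j k + th j k) j 0" unfolding solves_fp_def by metis
  then show ?thesis by (simp add: nonlin_def)
qed

text \<open>9 = 1 + 8, with 1 for the rough part and 8 from the Sobolev embedding of the
  remainder.\<close>

lemma besov_combine:
  assumes p: "besov b e p" and t: "sobolev (2 - s) t e" "t 0 = 0"
  shows "besov s (9 * e) (\<lambda>k. p k + t k)"
proof -
  have "besov s (e + 8 * e) (\<lambda>k. p k + t k)"
    by (intro besov_add besov_exp_mono[OF p] sobolev_imp_besov t) (use par in auto)
  then show ?thesis by simp
qed

lemma sol_psi_besov:
  assumes e: "0 < \<epsilon>"
  shows "besov s (9 * (norm \<gamma> * K)) (sol_psi s K \<gamma> \<Upsilon> m \<epsilon> j)"
proof -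
  obtain th where th0: "solves_fp s (cA \<gamma> m) (cB \<gamma>) (norm \<gamma> * K) (psiN \<gamma> \<Upsilon> \<epsilon>) th \<and> (\<forall>j k. sol_psi s K \<gamma> \<Upsilon> m \<epsilon> j k = psiN \<gamma> \<Upsilon> \<epsilon> j k + th j k)"
    using ex_theta[OF e] ..
  note th = conjunct1[OF th0] conjunct2[OF th0, rule_format]
  have "sobolev (2 - s) (th j) (norm \<gamma> * K)" using th(1) unfolding solves_fp_def by blast
  from besov_combine[OF psiN_besov this theta_0[OF th(1)], of \<epsilon> j]
  show ?thesis unfolding th(2)[abs_def] .
qed

text \<open>By \<open>solves_fp_diff\<close> the remainders differ by no more than the bound for the
  linear parts, so the rate of mollification carries over to the solution.\<close>

lemma sol_psi_diff:
  assumes e: "0 < \<epsilon>" "0 < \<epsilon>'"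
  shows "besov s (9 * (norm \<gamma> * K * 2 * (\<epsilon> powr \<theta> + \<epsilon>' powr \<theta>))) (\<lambda>k. sol_psi s K \<gamma> \<Upsilon> m \<epsilon> j k - sol_psi s K \<gamma> \<Upsilon> m \<epsilon>' j k)"
proof -
  obtain th where th0: "solves_fp s (cA \<gamma> m) (cB \<gamma>) (norm \<gamma> * K) (psiN \<gamma> \<Upsilon> \<epsilon>) th \<and> (\<forall>j k. sol_psi s K \<gamma> \<Upsilon> m \<epsilon> j k = psiN \<gamma> \<Upsilon> \<epsilon> j k + th j k)"
    using ex_theta[OF e(1)] ..
  note th = conjunct1[OF th0] conjunct2[OF th0, rule_format]
  obtain th' where th'0: "solves_fp s (cA \<gamma> m) (cB \<gamma>) (norm \<gamma> * K) (psiN \<gamma> \<Upsilon> \<epsilon>') th' \<and> (\<forall>j k. sol_psi s K \<gamma> \<Upsilon> m \<epsilon>' j k = psiN \<gamma> \<Upsilon> \<epsilon>' j k + th' j k)"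
    using ex_theta[OF e(2)] ..
  note th' = conjunct1[OF th'0] conjunct2[OF th'0, rule_format]
  obtain D where D: "\<And>j. sobolev 1 (psiN \<gamma> \<Upsilon> \<epsilon> j) D" using psiN_sobolev1[OF e(1)] by blast
  obtain D' where D': "\<And>j. sobolev 1 (psiN \<gamma> \<Upsilon> \<epsilon>' j) D'" using psiN_sobolev1[OF e(2)] by blast
  have w: "sobolev (2 - s) (\<lambda>k. th j k - th' j k) (norm \<gamma> * K * 2 * (\<epsilon> powr \<theta> + \<epsilon>' powr \<theta>))"
    by (rule solves_fp_diff[OF b_pos par(4,5) cA_bound[OF noise_facts(4)] small psiN_besov D psiN_besov D' psiN_diff[OF e] th(1) th'(1)])
  have z: "th j 0 - th' j 0 = 0" using theta_0[OF th(1)] theta_0[OF th'(1)] by simp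
  have "besov s (9 * (norm \<gamma> * K * 2 * (\<epsilon> powr \<theta> + \<epsilon>' powr \<theta>))) (\<lambda>k. (psiN \<gamma> \<Upsilon> \<epsilon> j k - psiN \<gamma> \<Upsilon> \<epsilon>' j k) + (th j k - th' j k))"
    by (rule besov_combine[OF psiN_diff[OF e] w z])
  then show ?thesis unfolding th(2) th'(2) by (simp add: algebra_simps)
qed

lemma sol_psi_eq:
  assumes e: "0 < \<epsilon>"
  shows "sol_psi s K \<gamma> \<Upsilon> m \<epsilon> j k = psiN \<gamma> \<Upsilon> \<epsilon> j k + nonlin (cA \<gamma> m) (cB \<gamma>) (sol_psi s K \<gamma> \<Upsilon> m \<epsilon>) j k"
proof -
  obtain th where th0: "solves_fp s (cA \<gamma> m) (cB \<gamma>) (norm \<gamma> * K) (psiN \<gamma> \<Upsilon> \<epsilon>) th \<and> (\<forall>j k. sol_psi s K \<gamma> \<Upsilon> m \<epsilon> j k = psiN \<gamma> \<Upsilon> \<epsilon> j k + th j k)"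
    using ex_theta[OF e] ..
  note th = conjunct1[OF th0] conjunct2[OF th0, rule_format]
  have e1: "(\<lambda>j k. psiN \<gamma> \<Upsilon> \<epsilon> j k + th j k) = sol_psi s K \<gamma> \<Upsilon> m \<epsilon>" unfolding th(2)[abs_def] ..
  have "th = nonlin (cA \<gamma> m) (cB \<gamma>) (\<lambda>j k. psiN \<gamma> \<Upsilon> \<epsilon> j k + th j k)" using th(1) unfolding solves_fp_def by blast
  then have "th = nonlin (cA \<gamma> m) (cB \<gamma>) (sol_psi s K \<gamma> \<Upsilon> m \<epsilon>)" unfolding e1 .
  then show ?thesis using th(2) by metis
qed

lemma sol_psi_rapid:
  assumes e: "0 < \<epsilon>"
  shows "rapid (sol_psi s K \<gamma> \<Upsilon> m \<epsilon> j)"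
proof (rule rapid_of_fixpoint[where s=s and f="sol_psi s K \<gamma> \<Upsilon> m \<epsilon>", OF _ par(5) psiN_rapid[OF e] _ sol_psi_eq[OF e]])
  show "0 < s" using par b_pos by simp
  obtain th where th0: "solves_fp s (cA \<gamma> m) (cB \<gamma>) (norm \<gamma> * K) (psiN \<gamma> \<Upsilon> \<epsilon>) th \<and> (\<forall>j k. sol_psi s K \<gamma> \<Upsilon> m \<epsilon> j k = psiN \<gamma> \<Upsilon> \<epsilon> j k + th j k)"
    using ex_theta[OF e] ..
  note th = conjunct1[OF th0] conjunct2[OF th0, rule_format]
  fix j
  have "sobolev (2 - s) (th j) (norm \<gamma> * K)" using th(1) unfolding solves_fp_def by blast
  moreover obtain R where "sobolev (2 - s) (psiN \<gamma> \<Upsilon> \<epsilon> j) R" using rapidD[OF psiN_rapid[OF e]] by blast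
  ultimately show "\<exists>R. sobolev (2 - s) (sol_psi s K \<gamma> \<Upsilon> m \<epsilon> j) R" unfolding th(2)[abs_def] using sobolev_add by blast
qed

lemma sol_psi_real:
  assumes e: "0 < \<epsilon>"
  shows "sol_psi s K \<gamma> \<Upsilon> m \<epsilon> j (- k) = cnj (sol_psi s K \<gamma> \<Upsilon> m \<epsilon> j k)"
proof -
  obtain th where th0: "solves_fp s (cA \<gamma> m) (cB \<gamma>) (norm \<gamma> * K) (psiN \<gamma> \<Upsilon> \<epsilon>) th \<and> (\<forall>j k. sol_psi s K \<gamma> \<Upsilon> m \<epsilon> j k = psiN \<gamma> \<Upsilon> \<epsilon> j k + th j k)"
    using ex_theta[OF e] ..
  note th = conjunct1[OF th0] conjunct2[OF th0, rule_format]
  obtain D where D: "\<And>j. sobolev 1 (psiN \<gamma> \<Upsilon> \<epsilon> j) D" using psiN_sobolev1[OF e] by blast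
  have p: "psiN \<gamma> \<Upsilon> \<epsilon> j (- k) = cnj (psiN \<gamma> \<Upsilon> \<epsilon> j k)" for j k
    by (simp add: psiN_def noise_facts(3) mollcoef_uminus)
  have "th j (- k) = cnj (th j k)"
    by (rule solves_fp_real[OF b_pos par(4,5) cA_bound[OF noise_facts(4)] small psiN_besov D p th(1)])
  then show ?thesis unfolding th(2) by (simp add: p)
qed

lemma rsol_solution:
  fixes w :: "3 \<Rightarrow> coeffs"
  assumes e: "0 < \<epsilon>" and w: "\<And>j. rapid (w j)" "\<And>j k. of_real (nsq k) * (\<Upsilon> j k * mollcoef \<epsilon> k) = - 2 * w j k"
    and F: "\<And>j x. F j x = complex_of_real (m j) + fourier (w j) x"
  shows "rsol (cA \<gamma> m) (cB \<gamma>) (sol_psi s K \<gamma> \<Upsilon> m \<epsilon>) \<in> smooth_torus"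
    and "solves_system \<gamma> F (rsol (cA \<gamma> m) (cB \<gamma>) (sol_psi s K \<gamma> \<Upsilon> m \<epsilon>))"
proof -
  show "rsol (cA \<gamma> m) (cB \<gamma>) (sol_psi s K \<gamma> \<Upsilon> m \<epsilon>) \<in> smooth_torus"
    by (rule rsol_smooth[OF sol_psi_rapid[OF e]])
  show "solves_system \<gamma> F (rsol (cA \<gamma> m) (cB \<gamma>) (sol_psi s K \<gamma> \<Upsilon> m \<epsilon>))"
  proof (rule rsol_solves[OF sol_psi_rapid[OF e] sol_psi_real[OF e] w(1) _ F cA_cB_cross[of m, OF noise_facts(5)]])
    fix j k
    let ?n = "nonlin0 (cA \<gamma> m) (cB \<gamma>) (sol_psi s K \<gamma> \<Upsilon> m \<epsilon>) j k"
    have "of_real (nsq k) * sol_psi s K \<gamma> \<Upsilon> m \<epsilon> j k = of_real (nsq k) * psiN \<gamma> \<Upsilon> \<epsilon> j k + of_real (nsq k) * nonlin (cA \<gamma> m) (cB \<gamma>) (sol_psi s K \<gamma> \<Upsilon> m \<epsilon>) j k"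
      by (subst sol_psi_eq[OF e]) (simp only: distrib_left)
    also have "of_real (nsq k) * psiN \<gamma> \<Upsilon> \<epsilon> j k = \<gamma> $ j * (of_real (nsq k) * (\<Upsilon> j k * mollcoef \<epsilon> k))"
      by (simp add: psiN_def)
    also have "\<dots> = - 2 * \<gamma> $ j * w j k" unfolding w(2) by simp
    \<comment> \<open>At k = 0 both sides vanish: the left one through its factor
      \<open>nsq k\<close>, the right one because the Jacobian and the first order terms are total
      derivatives.\<close>
    also have "of_real (nsq k) * nonlin (cA \<gamma> m) (cB \<gamma>) (sol_psi s K \<gamma> \<Upsilon> m \<epsilon>) j k = 4 * ?n"
    proof (cases "k = 0")
      case True
      then have "?n = 0" by (simp add: nonlin0_def jac_at_0)
      then show ?thesis using True by simp
    next
      case False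
      then show ?thesis using nsq_pos[OF False] by (simp add: nonlin_def)
    qed
    finally show "of_real (nsq k) * sol_psi s K \<gamma> \<Upsilon> m \<epsilon> j k = - 2 * \<gamma> $ j * w j k + 4 * ?n" .
  qed
qed

end

section \<open>The limit in the negative Hoelder space\<close>

lemma smooth_torusD: "\<phi> \<in> smooth_torus \<Longrightarrow> Ck n \<phi>" "\<phi> \<in> smooth_torus \<Longrightarrow> periodic \<phi>"
  by (auto simp: smooth_torus_def smooth_def)

lemma integral_rescaled_le:
  fixes f :: "plane \<Rightarrow> complex"
  assumes f: "continuous_on UNIV f" "supp_le 1 f" "\<And>x. cmod (f x) \<le> 1" and l: "0 < l"
  shows "(LINT y|lborel. cmod (f (t + (1 / l) *\<^sub>R y))) \<le> 4 * l\<^sup>2"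
proof -
  let ?Q = "cbox (- 1, - 1) (1, 1) :: plane set"
  have fm: "(\<lambda>x. cmod (f x)) \<in> borel_measurable borel"
    by (intro borel_measurable_continuous_onI continuous_intros f)
  have Q: "x \<in> ?Q" if "norm x \<le> 1" for x :: plane
    using that norm_fst_le[of "fst x" "snd x"] norm_snd_le[of "snd x" "fst x"] by (cases x) (auto simp: mem_box Basis_prod_def inner_prod_def)
  have "(LINT x|lborel. cmod (f x)) \<le> (LINT x|lborel. indicator ?Q x)"
  proof (rule integral_mono)
    show "integrable lborel (\<lambda>x. cmod (f x))" by (intro integrable_norm integrable_supp_le[OF f(1,2)])
    show "integrable lborel (indicator ?Q :: plane \<Rightarrow> real)"
      by (rule integrable_real_indicator) (auto simp: emeasure_lborel_cbox_eq)
    show "cmod (f x) \<le> indicator ?Q x" for x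
      using f(3)[of x] Q[of x] supp_leD[OF f(2), of x] by (cases "norm x \<le> 1") auto
  qed
  also have "\<dots> = 4"
    by (simp add: measure_lborel_cbox_eq Basis_prod_def inner_prod_def)
  finally have I: "(LINT x|lborel. cmod (f x)) \<le> 4" .
  have "(LINT x|lborel. cmod (f x)) = \<bar>1 / l\<bar> ^ DIM(plane) *\<^sub>R (LINT y|lborel. cmod (f (t + (1 / l) *\<^sub>R y)))"
    using l by (intro lborel_integral_affine[OF fm]) auto
  then have "(LINT y|lborel. cmod (f (t + (1 / l) *\<^sub>R y))) = l\<^sup>2 * (LINT x|lborel. cmod (f x))"
    using l by (simp add: power2_eq_square)
  also have "\<dots> \<le> l\<^sup>2 * 4" using I by (intro mult_left_mono) auto
  finally show ?thesis by simp
qed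

text \<open>Rescaled test functions have L1 norm bounded independently of l, and each derivative
  costs 1 / l; the 4 is the area of the square containing the unit ball.\<close>

lemma rescaled_test:
  fixes x :: plane
  assumes \<phi>: "\<phi> \<in> unit_tests" and l: "0 < l"
  defines "g \<equiv> periodize (rescale l x \<phi>)"
  shows "g \<in> smooth_torus" "(LINT y:cell|lborel. cmod (g y)) \<le> 4"
    "(LINT y:cell|lborel. cmod (pderiv1 g y)) \<le> 4 / l" "(LINT y:cell|lborel. cmod (pderiv2 g y)) \<le> 4 / l"
proof -
  define t where "t = (- 1 / l) *\<^sub>R x"
  have arg: "(1 / l) *\<^sub>R (y - x) = t + (1 / l) *\<^sub>R y" for y
    by (simp add: t_def scaleR_diff_right)
  have h: "rescale l x \<phi> = (\<lambda>y. complex_of_real (1 / l\<^sup>2) * \<phi> (t + (1 / l) *\<^sub>R y))"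
    by (rule ext) (simp add: rescale_def arg)
  have sm: "Ck n \<phi>" for n using \<phi> by (simp add: unit_tests_def smooth_def)
  have C: "Ck n (rescale l x \<phi>)" for n
    unfolding h by (intro Ck_mult Ck_const Ck_affine sm)
  have supp: "supp_le 1 \<phi>"
    unfolding supp_le_def
  proof (intro allI impI)
    fix y :: plane assume "1 < norm y"
    then have "y \<notin> ball 0 1" by simp
    then have "y \<notin> {x. \<phi> x \<noteq> 0}" using \<phi> closure_subset[of "{x. \<phi> x \<noteq> 0}"] unfolding unit_tests_def by blast
    then show "\<phi> y = 0" by simp
  qed
  have suppR: "supp_le (norm x + l) (rescale l x \<phi>)"
    unfolding supp_le_def
  proof (intro allI impI)
    fix y :: plane assume y: "norm x + l < norm y"
    have "norm y \<le> norm (y - x) + norm x" using norm_triangle_sub[of y x] by simp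
    then have "l < norm (y - x)" using y by simp
    then have "1 < norm ((1 / l) *\<^sub>R (y - x))" using l by simp
    from supp_leD[OF supp this] show "rescale l x \<phi> y = 0" by (simp add: rescale_def)
  qed
  have d: "(\<phi> has_derivative (\<lambda>h. fst h *\<^sub>R pderiv1 \<phi> y + snd h *\<^sub>R pderiv2 \<phi> y)) (at y)" for y
    using sm[of "Suc 0"] by (intro pderiv_has_derivative Ck_Suc_continuous)
  have hd: "(rescale l x \<phi> has_derivative (\<lambda>k. complex_of_real (1 / l\<^sup>2) *
     (fst ((1 / l) *\<^sub>R k) *\<^sub>R pderiv1 \<phi> (t + (1 / l) *\<^sub>R y) + snd ((1 / l) *\<^sub>R k) *\<^sub>R pderiv2 \<phi> (t + (1 / l) *\<^sub>R y)))) (at y)" for y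
    unfolding h
  proof (rule has_derivative_mult_right)
    have "((\<lambda>y. t + (1 / l) *\<^sub>R y) has_derivative (\<lambda>k. (1 / l) *\<^sub>R k)) (at y)"
      by (auto intro!: derivative_eq_intros)
    from has_derivative_compose[OF this d]
    show "((\<lambda>y. \<phi> (t + (1 / l) *\<^sub>R y)) has_derivative (\<lambda>k. fst ((1 / l) *\<^sub>R k) *\<^sub>R pderiv1 \<phi> (t + (1 / l) *\<^sub>R y) + snd ((1 / l) *\<^sub>R k) *\<^sub>R pderiv2 \<phi> (t + (1 / l) *\<^sub>R y))) (at y)" .
  qed
  have p: "pderiv1 (rescale l x \<phi>) y = complex_of_real (1 / l ^ 3) * pderiv1 \<phi> (t + (1 / l) *\<^sub>R y)"
    "pderiv2 (rescale l x \<phi>) y = complex_of_real (1 / l ^ 3) * pderiv2 \<phi> (t + (1 / l) *\<^sub>R y)" for y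
    unfolding pderiv_eqI[OF hd] by (simp_all add: scaleR_conv_of_real power2_eq_square power3_eq_cube)
  have le: "(LINT y|lborel. cmod (complex_of_real (1 / l ^ n) * f (t + (1 / l) *\<^sub>R y))) \<le> 1 / l ^ n * (4 * l\<^sup>2)"
    if "continuous_on UNIV f" "supp_le 1 f" "\<And>x. cmod (f x) \<le> 1" for f n
  proof -
    have "(LINT y|lborel. cmod (complex_of_real (1 / l ^ n) * f (t + (1 / l) *\<^sub>R y))) = 1 / l ^ n * (LINT y|lborel. cmod (f (t + (1 / l) *\<^sub>R y)))"
      using l by (simp add: norm_mult norm_divide norm_power)
    also have "\<dots> \<le> 1 / l ^ n * (4 * l\<^sup>2)" using l by (intro mult_left_mono integral_rescaled_le that) auto
    finally show ?thesis .
  qed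
  have b: "cmod (\<phi> y) \<le> 1" "cmod (pderiv1 \<phi> y) \<le> 1" "cmod (pderiv2 \<phi> y) \<le> 1" for y
    using \<phi> unfolding unit_tests_def by blast+
  note c = Ck_Suc_continuous[OF sm] and cR = Ck_Suc_continuous[OF C]
  show "g \<in> smooth_torus" unfolding g_def
    by (rule periodize_smooth_torus[OF _ suppR]) (simp add: smooth_def C)
  have "(LINT y:cell|lborel. cmod (g y)) \<le> (LINT y|lborel. cmod (rescale l x \<phi> y))"
    unfolding g_def by (rule cell_integral_norm_periodize[OF cR(1) suppR])
  also have "\<dots> \<le> 1 / l ^ 2 * (4 * l\<^sup>2)" unfolding h by (rule le[OF c(1) supp b(1)])
  finally show "(LINT y:cell|lborel. cmod (g y)) \<le> 4" using l by simp
  have e: "1 / l ^ 3 * (4 * l\<^sup>2) = 4 / l" using l by (simp add: power2_eq_square power3_eq_cube)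
  have "(LINT y:cell|lborel. cmod (pderiv1 g y)) \<le> (LINT y|lborel. cmod (pderiv1 (rescale l x \<phi>) y))"
    unfolding g_def pderiv_periodize[OF cR(3) suppR] by (rule cell_integral_norm_periodize[OF cR(4) supp_le_pderiv(1)[OF suppR]])
  also have "\<dots> \<le> 1 / l ^ 3 * (4 * l\<^sup>2)" unfolding p by (rule le[OF c(4) supp_le_pderiv(1)[OF supp] b(2)])
  finally show "(LINT y:cell|lborel. cmod (pderiv1 g y)) \<le> 4 / l" unfolding e .
  have "(LINT y:cell|lborel. cmod (pderiv2 g y)) \<le> (LINT y|lborel. cmod (pderiv2 (rescale l x \<phi>) y))"
    unfolding g_def pderiv_periodize[OF cR(3) suppR] by (rule cell_integral_norm_periodize[OF cR(5) supp_le_pderiv(2)[OF suppR]])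
  also have "\<dots> \<le> 1 / l ^ 3 * (4 * l\<^sup>2)" unfolding p by (rule le[OF c(5) supp_le_pderiv(2)[OF supp] b(3)])
  finally show "(LINT y:cell|lborel. cmod (pderiv2 g y)) \<le> 4 / l" unfolding e .
qed

lemma neg_norm_le:
  assumes "\<And>x l \<phi>. 0 < l \<Longrightarrow> l \<le> 1 \<Longrightarrow> \<phi> \<in> unit_tests \<Longrightarrow> cmod (u (periodize (rescale l x \<phi>))) \<le> Y * l powr (- \<kappa>)"
  shows "neg_norm \<kappa> u \<le> ennreal Y"
  unfolding neg_norm_def
proof (rule Sup_least, safe)
  fix x and l :: real and \<phi> assume l: "0 < l" "l \<le> 1" and \<phi>: "\<phi> \<in> unit_tests"
  have "l powr \<kappa> * cmod (u (periodize (rescale l x \<phi>))) \<le> l powr \<kappa> * (Y * l powr (- \<kappa>))"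
    by (intro mult_left_mono assms l \<phi>) auto
  also have "\<dots> = Y" using l by (simp add: powr_minus)
  finally show "ennreal (l powr \<kappa> * cmod (u (periodize (rescale l x \<phi>)))) \<le> ennreal Y"
    by (rule ennreal_leI)
qed

text \<open>A rate for differences makes the family Cauchy; sending the second parameter to 0 along
  1 / (n + 1) leaves the rate in the first one alone.\<close>

lemma lim_rate:
  fixes v :: "real \<Rightarrow> complex"
  assumes \<theta>: "0 < \<theta>" and v: "\<And>\<epsilon> \<epsilon>'. 0 < \<epsilon> \<Longrightarrow> 0 < \<epsilon>' \<Longrightarrow> cmod (v \<epsilon> - v \<epsilon>') \<le> X * (\<epsilon> powr \<theta> + \<epsilon>' powr \<theta>)"
  shows "(\<lambda>n. v (inverse (real (Suc n)))) \<longlonglongrightarrow> lim (\<lambda>n. v (inverse (real (Suc n))))"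
    and "0 < \<epsilon> \<Longrightarrow> cmod (v \<epsilon> - lim (\<lambda>n. v (inverse (real (Suc n))))) \<le> X * \<epsilon> powr \<theta>"
proof -
  let ?e = "\<lambda>n. inverse (real (Suc n)) powr \<theta>"
  have e0: "?e \<longlonglongrightarrow> 0"
    using \<theta> by (intro tendsto_zero_powrI[OF LIMSEQ_inverse_real_of_nat tendsto_const] always_eventually allI) auto
  have X: "0 \<le> X"
  proof (rule ccontr)
    assume "\<not> 0 \<le> X"
    then have "X * (1 powr \<theta> + 1 powr \<theta>) < 0" by (simp add: mult_neg_pos)
    moreover have "cmod (v 1 - v 1) \<le> X * (1 powr \<theta> + 1 powr \<theta>)" by (rule v) auto
    ultimately show False by simp
  qed
  have "Cauchy (\<lambda>n. v (inverse (real (Suc n))))"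
  proof (rule metric_CauchyI)
    fix r :: real assume r: "0 < r"
    have "(\<lambda>n. X * ?e n) \<longlonglongrightarrow> X * 0" by (intro tendsto_intros e0)
    then have "\<forall>\<^sub>F n in sequentially. X * ?e n < r / 2" using r by (intro order_tendstoD) auto
    then obtain N where N: "\<And>n. N \<le> n \<Longrightarrow> X * ?e n < r / 2" by (auto simp: eventually_sequentially)
    show "\<exists>M. \<forall>m\<ge>M. \<forall>n\<ge>M. dist (v (inverse (real (Suc m)))) (v (inverse (real (Suc n)))) < r"
    proof (intro exI allI impI)
      fix m n assume m: "N \<le> m" and n: "N \<le> n"
      have "cmod (v (inverse (real (Suc m))) - v (inverse (real (Suc n)))) \<le> X * (?e m + ?e n)" by (rule v) auto
      then show "dist (v (inverse (real (Suc m)))) (v (inverse (real (Suc n)))) < r"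
        using N[OF m] N[OF n] unfolding dist_norm distrib_left by linarith
    qed
  qed
  then show L: "(\<lambda>n. v (inverse (real (Suc n)))) \<longlonglongrightarrow> lim (\<lambda>n. v (inverse (real (Suc n))))"
    by (simp add: Cauchy_convergent_iff convergent_LIMSEQ_iff)
  assume e: "0 < \<epsilon>"
  show "cmod (v \<epsilon> - lim (\<lambda>n. v (inverse (real (Suc n))))) \<le> X * \<epsilon> powr \<theta>"
  proof (rule LIMSEQ_le)
    show "(\<lambda>n. cmod (v \<epsilon> - v (inverse (real (Suc n))))) \<longlonglongrightarrow> cmod (v \<epsilon> - lim (\<lambda>n. v (inverse (real (Suc n)))))"
      by (intro tendsto_intros L)
    have "(\<lambda>n. X * (\<epsilon> powr \<theta> + ?e n)) \<longlonglongrightarrow> X * (\<epsilon> powr \<theta> + 0)" by (intro tendsto_intros e0)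
    then show "(\<lambda>n. X * (\<epsilon> powr \<theta> + ?e n)) \<longlonglongrightarrow> X * \<epsilon> powr \<theta>" by simp
    show "\<exists>N. \<forall>n\<ge>N. cmod (v \<epsilon> - v (inverse (real (Suc n)))) \<le> X * (\<epsilon> powr \<theta> + ?e n)"
      by (intro exI[of _ 0] allI impI v e) auto
  qed
qed

text \<open>The pairing with the non-constant part
  \<open>\<partial>\<^sub>2\<psi> + \<i> \<partial>\<^sub>1\<psi>\<close> of a component; the
  constants are the same for all \<epsilon> and cancel in differences.\<close>

definition gpair :: "coeffs \<Rightarrow> functional" where
  "gpair f \<phi> = (LINT x:cell|lborel. pderiv2 (fourier f) x * \<phi> x) + \<i> * (LINT x:cell|lborel. pderiv1 (fourier f) x * \<phi> x)"

lemma pderiv_fourier_continuous: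
  assumes "rapid f"
  shows "continuous_on UNIV (pderiv1 (fourier f))" "continuous_on UNIV (pderiv2 (fourier f))"
  using Ck_Suc_continuous(4,5)[OF fourier_Ck[OF assms]] .

lemma of_fun_rsol:
  assumes f: "rapid (\<psi> j)" and g: "continuous_on UNIV \<phi>"
  shows "of_fun (\<lambda>x. rsol A B \<psi> x $ j) \<phi> = Complex (A j) (B j) * (LINT x:cell|lborel. \<phi> x) + gpair (\<psi> j) \<phi>"
proof -
  have "of_fun (\<lambda>x. rsol A B \<psi> x $ j) \<phi> = (LINT x:cell|lborel. Complex (A j) (B j) * \<phi> x
      + (pderiv2 (fourier (\<psi> j)) x * \<phi> x + \<i> * (pderiv1 (fourier (\<psi> j)) x * \<phi> x)))"
    by (simp add: of_fun_def rsol_def algebra_simps)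
  also have "\<dots> = (LINT x:cell|lborel. Complex (A j) (B j) * \<phi> x)
      + ((LINT x:cell|lborel. pderiv2 (fourier (\<psi> j)) x * \<phi> x) + (LINT x:cell|lborel. \<i> * (pderiv1 (fourier (\<psi> j)) x * \<phi> x)))"
    by (subst set_integral_add, (intro set_integrable_cell continuous_intros g pderiv_fourier_continuous f)+)+ simp
  finally show ?thesis by (simp add: gpair_def)
qed

lemma gpair_diff:
  assumes f: "rapid f" "rapid f'" and g: "continuous_on UNIV \<phi>"
  shows "gpair f \<phi> - gpair f' \<phi> = gpair (\<lambda>k. f k - f' k) \<phi>"
proof -
  have r: "rapid (\<lambda>k. f k - f' k)"
    using rapid_diff[OF f] .
  have e: "pderiv1 (fourier (\<lambda>k. f k - f' k)) x = pderiv1 (fourier f) x - pderiv1 (fourier f') x"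
    "pderiv2 (fourier (\<lambda>k. f k - f' k)) x = pderiv2 (fourier f) x - pderiv2 (fourier f') x" for x
    unfolding pderiv_fourier[OF r] pderiv_fourier[OF f(1)] pderiv_fourier[OF f(2)] right_diff_distrib
    by (subst fourier_diff, (intro rapid_deriv f)+, rule refl)+
  show ?thesis
    unfolding gpair_def e left_diff_distrib
    by (subst set_integral_diff(2), (intro set_integrable_cell continuous_intros g pderiv_fourier_continuous f)+)+ (simp add: algebra_simps)
qed

lemma gpair_test:
  assumes f: "rapid f" "besov s L f" and s: "s < \<kappa>" "0 \<le> \<kappa>" "\<kappa> \<le> 1" and \<phi>: "\<phi> \<in> unit_tests" "0 < l"
  shows "cmod (gpair f (periodize (rescale l x \<phi>))) \<le> 8 * L * geo (\<kappa> - s) * l powr (- \<kappa>)"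
proof -
  note t = rescaled_test[OF \<phi>, of x]
  note p = fourier_pairing[OF f s smooth_torusD[OF t(1)] \<phi>(2) t(2-4)]
  have "cmod (gpair f (periodize (rescale l x \<phi>))) \<le> L * 4 * geo (\<kappa> - s) * l powr (- \<kappa>) + L * 4 * geo (\<kappa> - s) * l powr (- \<kappa>)"
    unfolding gpair_def using p by (intro norm_triangle_mono) (simp_all add: norm_mult)
  then show ?thesis by (simp add: algebra_simps)
qed

text \<open>With the derivative moved to the test function a bounded function remains; this shows
  that the limit is a distribution of order at most one.\<close>

lemma gpair_bound:
  assumes f: "rapid f" "besov s L f" and s: "s < 1" and \<phi>: "\<phi> \<in> smooth_torus"
  shows "cmod (gpair f \<phi>) \<le> L * geo (1 - s) * ((LINT x:cell|lborel. cmod (pderiv1 \<phi> x)) + (LINT x:cell|lborel. cmod (pderiv2 \<phi> x)))"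
proof -
  note bp = cell_integral_by_parts[OF fourier_Ck[OF f(1)] fourier_periodic smooth_torusD[OF \<phi>]]
  note c = Ck_Suc_continuous(4,5)[OF smooth_torusD(1)[OF \<phi>]]
  have 1: "cmod (LINT x:cell|lborel. pderiv1 (fourier f) x * \<phi> x) \<le> L * geo (1 - s) * (LINT x:cell|lborel. cmod (pderiv1 \<phi> x))"
    unfolding bp norm_minus_cancel by (intro cell_integral_bound fourier_continuous f c fourier_sup[OF f s])
  have 2: "cmod (LINT x:cell|lborel. pderiv2 (fourier f) x * \<phi> x) \<le> L * geo (1 - s) * (LINT x:cell|lborel. cmod (pderiv2 \<phi> x))"
    unfolding bp norm_minus_cancel by (intro cell_integral_bound fourier_continuous f c fourier_sup[OF f s])
  have "cmod (gpair f \<phi>) \<le> cmod (LINT x:cell|lborel. pderiv2 (fourier f) x * \<phi> x) + cmod (LINT x:cell|lborel. pderiv1 (fourier f) x * \<phi> x)"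
    unfolding gpair_def by (rule order_trans[OF norm_triangle_ineq]) (simp add: norm_mult)
  with 1 2 show ?thesis unfolding distrib_left by linarith
qed

text \<open>The limit of the pairings along 1 / (n + 1). Convergence is established for smooth
  periodic test functions, the only ones on which a functional matters.\<close>

definition rlimit :: "(3 \<Rightarrow> real) \<Rightarrow> (3 \<Rightarrow> real) \<Rightarrow> (real \<Rightarrow> 3 \<Rightarrow> coeffs) \<Rightarrow> 3 \<Rightarrow> functional" where
  "rlimit A B f j \<phi> = lim (\<lambda>n. of_fun (\<lambda>x. rsol A B (f (inverse (real (Suc n)))) x $ j) \<phi>)"

lemma cell_integral_le:
  fixes g :: "plane \<Rightarrow> complex"
  assumes g: "continuous_on UNIV g" and B: "\<And>x. cmod (g x) \<le> B"
  shows "(LINT x:cell|lborel. cmod (g x)) \<le> 4 * pi\<^sup>2 * B"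
proof -
  have "(LINT x:cell|lborel. cmod (g x)) \<le> (LINT x:cell|lborel. B)"
    by (intro set_integral_mono set_integrable_cell continuous_intros g B)
  also have "\<dots> = measure lborel cell * B"
    using emeasure_cell_finite by (simp add: set_lebesgue_integral_def less_top)
  finally show ?thesis by (simp add: measure_cell)
qed

context
  fixes f :: "real \<Rightarrow> 3 \<Rightarrow> coeffs" and s L D \<theta> \<kappa> :: real and A B :: "3 \<Rightarrow> real"
  assumes rapid: "\<And>\<epsilon> j. 0 < \<epsilon> \<Longrightarrow> rapid (f \<epsilon> j)"
    and besov: "\<And>\<epsilon> j. 0 < \<epsilon> \<Longrightarrow> besov s L (f \<epsilon> j)"
    and besov_d: "\<And>\<epsilon> \<epsilon>' j. 0 < \<epsilon> \<Longrightarrow> 0 < \<epsilon>' \<Longrightarrow> besov s (D * (\<epsilon> powr \<theta> + \<epsilon>' powr \<theta>)) (\<lambda>k. f \<epsilon> j k - f \<epsilon>' j k)"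
    and par: "0 < \<theta>" "s < \<kappa>" "0 \<le> \<kappa>" "\<kappa> \<le> 1"
begin

lemma rsol_diff:
  assumes e: "0 < \<epsilon>" "0 < \<epsilon>'" and g: "continuous_on UNIV \<phi>"
  shows "of_fun (\<lambda>x. rsol A B (f \<epsilon>) x $ j) \<phi> - of_fun (\<lambda>x. rsol A B (f \<epsilon>') x $ j) \<phi> = gpair (\<lambda>k. f \<epsilon> j k - f \<epsilon>' j k) \<phi>"
  unfolding of_fun_rsol[OF rapid[OF e(1)] g] of_fun_rsol[OF rapid[OF e(2)] g] gpair_diff[OF rapid[OF e(1)] rapid[OF e(2)] g, symmetric]
  by simp

lemma rapid_d:
  assumes e: "0 < \<epsilon>" "0 < \<epsilon>'"
  shows "rapid (\<lambda>k. f \<epsilon> j k - f \<epsilon>' j k)"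
  using rapid_diff[OF rapid[OF e(1)] rapid[OF e(2)]] .

lemma s_less: "s < 1"
  using par by simp

lemma rlimit_tendsto:
  assumes \<phi>: "\<phi> \<in> smooth_torus"
  shows "(\<lambda>n. of_fun (\<lambda>x. rsol A B (f (inverse (real (Suc n)))) x $ j) \<phi>) \<longlonglongrightarrow> rlimit A B f j \<phi>"
  unfolding rlimit_def
proof (rule lim_rate(1)[OF par(1)])
  fix \<epsilon> \<epsilon>' :: real assume e: "0 < \<epsilon>" "0 < \<epsilon>'"
  let ?I = "(LINT x:cell|lborel. cmod (pderiv1 \<phi> x)) + (LINT x:cell|lborel. cmod (pderiv2 \<phi> x))"
  show "cmod (of_fun (\<lambda>x. rsol A B (f \<epsilon>) x $ j) \<phi> - of_fun (\<lambda>x. rsol A B (f \<epsilon>') x $ j) \<phi>)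
     \<le> (D * geo (1 - s) * ?I) * (\<epsilon> powr \<theta> + \<epsilon>' powr \<theta>)"
    unfolding rsol_diff[OF e Ck_continuous[OF smooth_torusD(1)[OF \<phi>]]]
    using gpair_bound[OF rapid_d[OF e] besov_d[OF e] s_less \<phi>, of j] by (simp add: ac_simps)
qed

lemma rlimit_rate:
  assumes \<phi>: "\<phi> \<in> unit_tests" "0 < l" and e: "0 < \<epsilon>"
  shows "cmod (of_fun (\<lambda>y. rsol A B (f \<epsilon>) y $ j) (periodize (rescale l x \<phi>)) - rlimit A B f j (periodize (rescale l x \<phi>)))
     \<le> (8 * D * geo (\<kappa> - s) * \<epsilon> powr \<theta>) * l powr (- \<kappa>)"
proof -
  let ?g = "periodize (rescale l x \<phi>)"
  have "cmod (of_fun (\<lambda>y. rsol A B (f \<epsilon>) y $ j) ?g - rlimit A B f j ?g) \<le> (8 * D * geo (\<kappa> - s) * l powr (- \<kappa>)) * \<epsilon> powr \<theta>"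
    unfolding rlimit_def
  proof (rule lim_rate(2)[OF par(1) _ e])
    fix \<epsilon> \<epsilon>' :: real assume e: "0 < \<epsilon>" "0 < \<epsilon>'"
    show "cmod (of_fun (\<lambda>x. rsol A B (f \<epsilon>) x $ j) ?g - of_fun (\<lambda>x. rsol A B (f \<epsilon>') x $ j) ?g)
       \<le> (8 * D * geo (\<kappa> - s) * l powr (- \<kappa>)) * (\<epsilon> powr \<theta> + \<epsilon>' powr \<theta>)"
      unfolding rsol_diff[OF e Ck_continuous[OF smooth_torusD(1)[OF rescaled_test(1)[OF \<phi>]]]]
      using gpair_test[OF rapid_d[OF e] besov_d[OF e] par(2-4) \<phi>, of j x] by (simp add: ac_simps)
  qed
  then show ?thesis by (simp add: ac_simps)
qed

lemma rlimit_neg_norm: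
  assumes e: "0 < \<epsilon>"
  shows "neg_norm3 \<kappa> (diff3 (rsol A B (f \<epsilon>)) (rlimit A B f)) \<le> ennreal (8 * D * geo (\<kappa> - s) * \<epsilon> powr \<theta>)"
  unfolding neg_norm3_def
proof (rule SUP_least, rule neg_norm_le)
  fix j x and l :: real and \<phi> assume "0 < l" "\<phi> \<in> unit_tests"
  then show "cmod (diff3 (rsol A B (f \<epsilon>)) (rlimit A B f) j (periodize (rescale l x \<phi>))) \<le> 8 * D * geo (\<kappa> - s) * \<epsilon> powr \<theta> * l powr (- \<kappa>)"
    unfolding diff3_def by (intro rlimit_rate e)
qed

lemma rlimit_bound:
  assumes \<phi>: "\<phi> \<in> smooth_torus" and le: "\<And>\<epsilon>. 0 < \<epsilon> \<Longrightarrow> cmod (of_fun (\<lambda>x. rsol A B (f \<epsilon>) x $ j) \<phi>) \<le> Y"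
  shows "cmod (rlimit A B f j \<phi>) \<le> Y"
proof (rule tendsto_upperbound[OF tendsto_norm[OF rlimit_tendsto[OF \<phi>]]])
  show "\<forall>\<^sub>F n in sequentially. cmod (of_fun (\<lambda>x. rsol A B (f (inverse (real (Suc n)))) x $ j) \<phi>) \<le> Y"
    by (intro always_eventually allI le) simp
qed simp

lemma rsol_bound:
  assumes e: "0 < \<epsilon>" and \<phi>: "\<phi> \<in> smooth_torus"
  shows "cmod (of_fun (\<lambda>x. rsol A B (f \<epsilon>) x $ j) \<phi>)
     \<le> cmod (Complex (A j) (B j)) * (LINT x:cell|lborel. cmod (\<phi> x)) + cmod (gpair (f \<epsilon> j) \<phi>)"
proof -
  note c = Ck_continuous[OF smooth_torusD(1)[OF \<phi>]]
  have "cmod (LINT x:cell|lborel. \<phi> x) \<le> (LINT x:cell|lborel. cmod (\<phi> x))"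
    by (intro set_integral_norm_bound set_integrable_cell c)
  then have "cmod (Complex (A j) (B j) * (LINT x:cell|lborel. \<phi> x)) \<le> cmod (Complex (A j) (B j)) * (LINT x:cell|lborel. cmod (\<phi> x))"
    unfolding norm_mult by (intro mult_left_mono) auto
  then show ?thesis
    unfolding of_fun_rsol[OF rapid[OF e] c] by (intro norm_triangle_mono) auto
qed

lemma rlimit_distribution: "distribution (rlimit A B f j)"
  unfolding distribution_def
proof (intro conjI ballI allI)
  let ?e = "\<lambda>n. inverse (real (Suc n))"
  fix \<phi> :: "plane \<Rightarrow> complex" assume \<phi>: "\<phi> \<in> smooth_torus"
  note c = Ck_continuous[OF smooth_torusD(1)[OF \<phi>]]
  have sc: "continuous_on UNIV (\<lambda>x. rsol A B (f (?e n)) x $ j)" for n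
    unfolding rsol_def vec_lambda_beta by (intro continuous_intros pderiv_fourier_continuous rapid) auto
  {
    fix \<psi> :: "plane \<Rightarrow> complex" assume \<psi>: "\<psi> \<in> smooth_torus"
    note c' = Ck_continuous[OF smooth_torusD(1)[OF \<psi>]]
    have "of_fun (\<lambda>x. rsol A B (f (?e n)) x $ j) (\<lambda>x. \<phi> x + \<psi> x)
       = of_fun (\<lambda>x. rsol A B (f (?e n)) x $ j) \<phi> + of_fun (\<lambda>x. rsol A B (f (?e n)) x $ j) \<psi>" for n
      unfolding of_fun_def distrib_left
      by (intro set_integral_add set_integrable_cell continuous_intros c c' sc)
    then show "rlimit A B f j (\<lambda>x. \<phi> x + \<psi> x) = rlimit A B f j \<phi> + rlimit A B f j \<psi>"
      unfolding rlimit_def[of A B f j "\<lambda>x. \<phi> x + \<psi> x"]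
      by (simp only:) (intro limI tendsto_add rlimit_tendsto \<phi> \<psi>)
  next
    fix a :: complex
    have "of_fun (\<lambda>x. rsol A B (f (?e n)) x $ j) (\<lambda>x. a * \<phi> x) = a * of_fun (\<lambda>x. rsol A B (f (?e n)) x $ j) \<phi>" for n
      unfolding of_fun_def mult.left_commute[of _ a] by simp
    then show "rlimit A B f j (\<lambda>x. a * \<phi> x) = a * rlimit A B f j \<phi>"
      unfolding rlimit_def[of A B f j "\<lambda>x. a * \<phi> x"]
      by (simp only:) (intro limI tendsto_mult tendsto_const rlimit_tendsto \<phi>)
  }
next
  let ?c = "cmod (Complex (A j) (B j))"
  show "\<exists>C N. \<forall>\<phi>\<in>smooth_torus. \<forall>b.
        (\<forall>m n x. m + n \<le> N \<longrightarrow> cmod ((pderiv1 ^^ m) ((pderiv2 ^^ n) \<phi>) x) \<le> b)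
          \<longrightarrow> cmod (rlimit A B f j \<phi>) \<le> C * b"
  proof (intro exI[of _ "4 * pi\<^sup>2 * ?c + 8 * pi\<^sup>2 * (L * geo (1 - s))"] exI[of _ 1] ballI allI impI)
    fix \<phi> :: "plane \<Rightarrow> complex" and C assume \<phi>: "\<phi> \<in> smooth_torus"
      and C: "\<forall>m n x. m + n \<le> 1 \<longrightarrow> cmod ((pderiv1 ^^ m) ((pderiv2 ^^ n) \<phi>) x) \<le> C"
    have C0: "cmod (\<phi> x) \<le> C" for x using C[rule_format, of 0 0 x] by simp
    have C1: "cmod (pderiv1 \<phi> x) \<le> C" for x using C[rule_format, of 1 0 x] by simp
    have C2: "cmod (pderiv2 \<phi> x) \<le> C" for x using C[rule_format, of 0 1 x] by simp
    note c = Ck_Suc_continuous[OF smooth_torusD(1)[OF \<phi>]]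
    show "cmod (rlimit A B f j \<phi>) \<le> (4 * pi\<^sup>2 * ?c + 8 * pi\<^sup>2 * (L * geo (1 - s))) * C"
    proof (rule rlimit_bound[OF \<phi>])
      fix \<epsilon> :: real assume e: "0 < \<epsilon>"
      have "0 \<le> L * geo (1 - s)" using fourier_sup[OF rapid[OF e] besov[OF e] s_less] norm_ge_zero order_trans by blast
      then have "L * geo (1 - s) * ((LINT x:cell|lborel. cmod (pderiv1 \<phi> x)) + (LINT x:cell|lborel. cmod (pderiv2 \<phi> x)))
         \<le> L * geo (1 - s) * (4 * pi\<^sup>2 * C + 4 * pi\<^sup>2 * C)"
        by (intro mult_left_mono add_mono cell_integral_le c C1 C2)
      moreover have "?c * (LINT x:cell|lborel. cmod (\<phi> x)) \<le> ?c * (4 * pi\<^sup>2 * C)"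
        by (intro mult_left_mono cell_integral_le c C0) auto
      ultimately have "cmod (of_fun (\<lambda>x. rsol A B (f \<epsilon>) x $ j) \<phi>) \<le> ?c * (4 * pi\<^sup>2 * C) + L * geo (1 - s) * (4 * pi\<^sup>2 * C + 4 * pi\<^sup>2 * C)"
        using rsol_bound[OF e \<phi>, of j] gpair_bound[OF rapid[OF e] besov[OF e] s_less \<phi>, of j] by linarith
      then show "cmod (of_fun (\<lambda>x. rsol A B (f \<epsilon>) x $ j) \<phi>) \<le> (4 * pi\<^sup>2 * ?c + 8 * pi\<^sup>2 * (L * geo (1 - s))) * C"
        by (simp add: algebra_simps)
    qed
  qed
qed

lemma rlimit_neg_space: "rlimit A B f \<in> neg_space3 \<kappa>"
proof -
  let ?c = "\<lambda>j. cmod (Complex (A j) (B j))"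
  let ?Y = "4 * (\<Sum>j\<in>UNIV. ?c j) + 8 * L * geo (\<kappa> - s)"
  have "neg_norm3 \<kappa> (rlimit A B f) \<le> ennreal ?Y"
    unfolding neg_norm3_def
  proof (rule SUP_least, rule neg_norm_le)
    fix j x and l :: real and \<phi> assume l: "0 < l" "l \<le> 1" and \<phi>: "\<phi> \<in> unit_tests"
    let ?g = "periodize (rescale l x \<phi>)"
    note t = rescaled_test[OF \<phi> l(1), of x]
    show "cmod (rlimit A B f j ?g) \<le> ?Y * l powr (- \<kappa>)"
    proof (rule rlimit_bound[OF t(1)])
      fix \<epsilon> :: real assume e: "0 < \<epsilon>"
      \<comment> \<open>The constant part is bounded independently of l, and for l \<le> 1 such a
        bound is dominated by \<open>l powr (- \<kappa>)\<close>.\<close>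
      have l1: "1 \<le> l powr (- \<kappa>)" using powr_mono2'[of "- \<kappa>" l 1] l par by simp
      have "?c j * (LINT x:cell|lborel. cmod (?g x)) \<le> (\<Sum>j\<in>UNIV. ?c j) * 4"
        by (intro mult_mono member_le_sum t sum_nonneg) (auto simp: set_lebesgue_integral_def)
      also have "\<dots> \<le> (\<Sum>j\<in>UNIV. ?c j) * 4 * l powr (- \<kappa>)"
        using mult_left_mono[OF l1, of "(\<Sum>j\<in>UNIV. ?c j) * 4"] by (simp add: sum_nonneg)
      finally show "cmod (of_fun (\<lambda>x. rsol A B (f \<epsilon>) x $ j) ?g) \<le> ?Y * l powr (- \<kappa>)"
        using rsol_bound[OF e t(1), of j] gpair_test[OF rapid[OF e] besov[OF e] par(2-4) \<phi> l(1), of j x]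
        by (simp add: algebra_simps)
    qed
  qed
  also have "\<dots> < \<infinity>" by simp
  finally show ?thesis by (simp add: neg_space3_def rlimit_distribution)
qed

end

text \<open>The coefficients of the mean-zero solution of \<Delta>\<Psi> = 2 W without the mean of
  W: mode k of the real noise has coefficient
  \<open>(\<zeta> k + cnj (\<zeta> (- k))) / 2\<close>.\<close>

definition noise_coef :: "coeffs \<Rightarrow> coeffs" where
  "noise_coef \<zeta> k = - (\<zeta> k / nsq k + cnj (\<zeta> (- k) / nsq (- k)))"

lemma besov2_uminus: "besov2 a K f \<Longrightarrow> besov2 a K (\<lambda>k. - f k)"
  by (simp add: besov2_def sum_negf)

lemma besov2_mono: "besov2 a K f \<Longrightarrow> K \<le> K' \<Longrightarrow> besov2 a K' f"
  unfolding besov2_def by (meson mult_right_mono order_trans powr_ge_zero)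

lemma good_noise_coef:
  fixes \<zeta> :: "3 \<Rightarrow> coeffs"
  assumes f: "\<And>j. besov2 a K (\<lambda>k. \<zeta> j k / nsq k)" and m: "\<And>j. \<bar>m j\<bar> \<le> K" "m 3 = 0"
  shows "good_noise a (2 * K) (\<lambda>j. noise_coef (\<zeta> j)) m"
  unfolding good_noise_def
proof (intro conjI allI)
  fix j k
  show "besov2 a (2 * K) (noise_coef (\<zeta> j))"
    unfolding noise_coef_def[abs_def] using besov2_uminus[OF besov2_add[OF f besov2_refl[OF f]]] by simp
  show "noise_coef (\<zeta> j) 0 = 0" by (simp add: noise_coef_def nsq_def)
  show "noise_coef (\<zeta> j) (- k) = cnj (noise_coef (\<zeta> j) k)" by (simp add: noise_coef_def)
  show "\<bar>m j\<bar> \<le> 2 * K" using m(1)[of j] abs_ge_zero[of "m j"] by linarith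
qed (rule m)

lemma solution_of_good_noise:
  fixes \<zeta> :: "3 \<Rightarrow> coeffs" and u :: "3 \<Rightarrow> functional" and \<gamma> :: "real ^ 3"
  assumes \<kappa>: "0 < \<kappa>" "\<kappa> < 1 / 2"
    and f: "\<And>j. besov2 (\<kappa> / 8) K (\<lambda>k. \<zeta> j k / nsq k)" and m: "\<And>j. \<bar>m j\<bar> \<le> K" "m 3 = 0"
    and u: "\<And>j. noise_series (\<zeta> j) (m j) (u j)"
    and small: "nconst (\<kappa> / 4) (3 * \<kappa> / 4) * (2 * (norm \<gamma> * (2 * K)) + sqrt (norm \<gamma>) * (1 + 2 * K)) \<le> 1 / 2"
  defines "\<psi> \<equiv> sol_psi (3 * \<kappa> / 4) (2 * K) \<gamma> (\<lambda>j. noise_coef (\<zeta> j)) m"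
  shows "0 < \<epsilon> \<Longrightarrow> rsol (cA \<gamma> m) (cB \<gamma>) (\<psi> \<epsilon>) \<in> smooth_torus"
    and "0 < \<epsilon> \<Longrightarrow> solves_system \<gamma> (\<lambda>j. mollify \<epsilon> (u j)) (rsol (cA \<gamma> m) (cB \<gamma>) (\<psi> \<epsilon>))"
    and "rlimit (cA \<gamma> m) (cB \<gamma>) \<psi> \<in> neg_space3 \<kappa>"
    and "0 < \<epsilon> \<Longrightarrow> neg_norm3 \<kappa> (diff3 (rsol (cA \<gamma> m) (cB \<gamma>) (\<psi> \<epsilon>)) (rlimit (cA \<gamma> m) (cB \<gamma>) \<psi>))
        \<le> ennreal (8 * (9 * (norm \<gamma> * (2 * K) * 2)) * geo (\<kappa> / 4) * \<epsilon> powr (\<kappa> / 8))"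
proof -
  \<comment> \<open>With b = \<kappa> / 4 and s = 3 * \<kappa> / 4 the chain 2 * b < s < \<kappa>
    has room \<kappa> / 4 on both sides, and \<kappa> < 1/2 gives s < 1/2.\<close>
  have par: "0 < \<kappa> / 8" "\<kappa> / 8 \<le> \<kappa> / 4" "\<kappa> / 4 = \<kappa> / 8 + \<kappa> / 8" "2 * (\<kappa> / 4) < 3 * \<kappa> / 4" "3 * \<kappa> / 4 < 1 / 2" "0 \<le> \<kappa> / 8" "\<kappa> / 8 \<le> 1"
    using \<kappa> by auto
  note noise_facts = good_noise_coef[where \<zeta>=\<zeta> and m=m, OF f m]
  note mw = mollify_white_noise[OF _ f par(7) u]
  have wr: "rapid (\<lambda>k. nsq k * ((\<zeta> j k / nsq k + cnj (\<zeta> j (- k) / nsq (- k))) / 2) * mollcoef \<epsilon> k)" if "0 < \<epsilon>" for j \<epsilon>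
    by (rule mw(2)[OF that])
  have we: "of_real (nsq k) * (noise_coef (\<zeta> j) k * mollcoef \<epsilon> k)
      = - 2 * (nsq k * ((\<zeta> j k / nsq k + cnj (\<zeta> j (- k) / nsq (- k))) / 2) * mollcoef \<epsilon> k)" for j k \<epsilon>
    unfolding noise_coef_def by (simp only: mult_minus_left mult_minus_right mult.assoc) simp
  have wF: "mollify \<epsilon> (u j) x = complex_of_real (m j) + fourier (\<lambda>k. nsq k * ((\<zeta> j k / nsq k + cnj (\<zeta> j (- k) / nsq (- k))) / 2) * mollcoef \<epsilon> k) x"
    if "0 < \<epsilon>" for j x \<epsilon>
    by (rule mw(1)[OF that])
  show "rsol (cA \<gamma> m) (cB \<gamma>) (\<psi> \<epsilon>) \<in> smooth_torus"
    "solves_system \<gamma> (\<lambda>j. mollify \<epsilon> (u j)) (rsol (cA \<gamma> m) (cB \<gamma>) (\<psi> \<epsilon>))" if e: "0 < \<epsilon>"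
    unfolding \<psi>_def by (rule rsol_solution[OF par noise_facts small e wr[OF e] we wF[OF e]])+
  have r: "rapid (\<psi> \<epsilon> j)" "besov (3 * \<kappa> / 4) (9 * (norm \<gamma> * (2 * K))) (\<psi> \<epsilon> j)" if "0 < \<epsilon>" for \<epsilon> j
    unfolding \<psi>_def by (rule sol_psi_rapid[OF par noise_facts small that] sol_psi_besov[OF par noise_facts small that])+
  have d: "besov (3 * \<kappa> / 4) (9 * (norm \<gamma> * (2 * K) * 2) * (\<epsilon> powr (\<kappa> / 8) + \<epsilon>' powr (\<kappa> / 8))) (\<lambda>k. \<psi> \<epsilon> j k - \<psi> \<epsilon>' j k)"
    if "0 < \<epsilon>" "0 < \<epsilon>'" for \<epsilon> \<epsilon>' j
    using sol_psi_diff[OF par noise_facts small that] unfolding \<psi>_def mult.assoc .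
  have par': "3 * \<kappa> / 4 < \<kappa>" "0 \<le> \<kappa>" "\<kappa> \<le> 1" using \<kappa> by auto
  show "rlimit (cA \<gamma> m) (cB \<gamma>) \<psi> \<in> neg_space3 \<kappa>"
    by (rule rlimit_neg_space[OF r d par(1) par'])
  have k: "\<kappa> - 3 * \<kappa> / 4 = \<kappa> / 4" by simp
  show "0 < \<epsilon> \<Longrightarrow> neg_norm3 \<kappa> (diff3 (rsol (cA \<gamma> m) (cB \<gamma>) (\<psi> \<epsilon>)) (rlimit (cA \<gamma> m) (cB \<gamma>) \<psi>))
        \<le> ennreal (8 * (9 * (norm \<gamma> * (2 * K) * 2)) * geo (\<kappa> / 4) * \<epsilon> powr (\<kappa> / 8))"
    using rlimit_neg_norm[OF r d par(1) par', where A="cA \<gamma> m" and B="cB \<gamma>"] unfolding k .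
qed

section \<open>The good event\<close>

lemma countable_dense_plane: "\<exists>D. countable D \<and> closure D = (UNIV :: plane set)"
proof -
  obtain D :: "plane set" where "countable D" and D: "\<And>X. open X \<Longrightarrow> X \<noteq> {} \<Longrightarrow> \<exists>d\<in>D. d \<in> X"
    by (rule countable_dense_setE) blast
  have "x \<in> closure D" for x
    unfolding closure_iff_nhds_not_empty
  proof (intro allI impI)
    fix A V assume "V \<subseteq> A" "open V" "x \<in> V"
    with D[of V] show "D \<inter> A \<noteq> {}" by blast
  qed
  with \<open>countable D\<close> show ?thesis by blast
qed

text \<open>Blocks are continuous in x, so their bounds at countably many points suffice; this makes
  the good event measurable.\<close>

lemma besov2_dense:
  assumes D: "closure D = (UNIV :: plane set)"
  shows "besov2 a K f \<longleftrightarrow> (\<forall>n p q. p + q \<le> 2 \<longrightarrow> (\<forall>x\<in>D.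
     cmod (\<Sum>k\<in>shell n. of_real (kx k ^ p * ky k ^ q) * f k * fexp k x) \<le> K * (2 ^ n) powr (a + real (p + q) - 1)))"
    (is "_ \<longleftrightarrow> ?R")
proof
  assume R: ?R
  show "besov2 a K f"
    unfolding besov2_def
  proof (intro allI impI)
    fix n x and p q :: nat assume pq: "p + q \<le> 2"
    show "cmod (\<Sum>k\<in>shell n. of_real (kx k ^ p * ky k ^ q) * f k * fexp k x) \<le> K * (2 ^ n) powr (a + real (p + q) - 1)"
    proof (rule continuous_le_on_closure[where S=D and f="\<lambda>x. cmod (\<Sum>k\<in>shell n. of_real (kx k ^ p * ky k ^ q) * f k * fexp k x)"])
      show "continuous_on (closure D) (\<lambda>x. cmod (\<Sum>k\<in>shell n. of_real (kx k ^ p * ky k ^ q) * f k * fexp k x))"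
        unfolding D by (intro continuous_intros)
    qed (use R pq D in auto)
  qed
next
  assume "besov2 a K f" then show ?R unfolding besov2_def by blast
qed

context prob_space
begin

text \<open>White noise provides one independent family indexed by pairs (k, j), whereas the moment
  bounds use the subfamily of a fixed j, indexed by k.\<close>

lemma indep_vars_reindex:
  assumes X: "indep_vars N X (h ` I)" and h: "inj_on h I"
  shows "indep_vars (\<lambda>i. N (h i)) (\<lambda>i. X (h i)) I"
  unfolding indep_vars_def2 indep_sets_def
proof (intro conjI ballI allI impI)
  fix i assume "i \<in> I"
  then show "random_variable (N (h i)) (X (h i))" "{X (h i) -` A \<inter> space M |A. A \<in> sets (N (h i))} \<subseteq> events"
    using X unfolding indep_vars_def2 indep_sets_def by blast+
next
  fix J A assume J: "J \<subseteq> I" "J \<noteq> {}" "finite J"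
    and A: "A \<in> (\<Pi> j\<in>J. {X (h j) -` A \<inter> space M |A. A \<in> sets (N (h j))})"
  define g where "g = inv_into J h"
  have hJ: "inj_on h J" using h J(1) by (rule inj_on_subset)
  have g: "g (h j) = j" if "j \<in> J" for j unfolding g_def by (rule inv_into_f_f[OF hJ that])
  have "(\<lambda>i. A (g i)) \<in> (\<Pi> i\<in>h ` J. {X i -` A \<inter> space M |A. A \<in> sets (N i)})"
    using A by (auto simp: g Pi_iff)
  moreover have "h ` J \<subseteq> h ` I" "h ` J \<noteq> {}" "finite (h ` J)" using J by auto
  ultimately have "prob (\<Inter>i\<in>h ` J. A (g i)) = (\<Prod>i\<in>h ` J. prob (A (g i)))"
    using X unfolding indep_vars_def2 indep_sets_def by blast
  then show "prob (\<Inter>j\<in>J. A j) = (\<Prod>j\<in>J. prob (A j))"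
    by (simp add: prod.reindex[OF hJ] g cong: INF_cong_simp)
qed

text \<open>Continuity from below along the increasing events, after removing the null set on which
  the almost sure statements fail; the set produced satisfies them at every point.\<close>

lemma AE_exhaust:
  fixes P :: "nat \<Rightarrow> 'a \<Rightarrow> bool"
  assumes P: "AE \<omega> in M. \<exists>n. P n \<omega>" and Q: "AE \<omega> in M. Q \<omega>" and mono: "\<And>m n \<omega>. P m \<omega> \<Longrightarrow> m \<le> n \<Longrightarrow> P n \<omega>"
    and meas: "\<And>n. {\<omega>\<in>space M. P n \<omega>} \<in> sets M" and \<delta>: "0 < \<delta>"
  shows "\<exists>n. \<exists>A\<in>sets M. 1 - \<delta> < measure M A \<and> (\<forall>\<omega>\<in>A. P n \<omega> \<and> Q \<omega>)"
proof -
  have "AE \<omega> in M. (\<exists>n. P n \<omega>) \<and> Q \<omega>" using P Q by eventually_elim blast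
  then obtain N where N: "\<And>\<omega>. \<omega> \<in> space M - N \<Longrightarrow> (\<exists>n. P n \<omega>) \<and> Q \<omega>" "N \<in> null_sets M" by (rule AE_E3) (rule that)
  have Ns: "N \<in> sets M" using N(2) by auto
  define A where "A n = {\<omega>\<in>space M. P n \<omega>} - N" for n
  have A: "range A \<subseteq> sets M" "incseq A"
    using meas Ns mono unfolding A_def incseq_def by auto
  have "(\<Union>n. A n) = space M - N" using N(1) unfolding A_def by blast
  moreover have "prob (space M - N) = 1"
    using prob_compl[OF Ns] N(2) by (simp add: measure_eq_0_null_sets)
  ultimately have "(\<lambda>n. prob (A n)) \<longlonglongrightarrow> 1" using finite_Lim_measure_incseq[OF A] by simp
  then have "\<forall>\<^sub>F n in sequentially. 1 - \<delta> < prob (A n)" using \<delta> by (intro order_tendstoD) auto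
  then obtain n where n: "1 - \<delta> < prob (A n)" by (auto simp: eventually_sequentially)
  then show ?thesis using A(1) N(1) unfolding A_def by (intro exI[of _ n] bexI[of _ "A n"]) (auto simp: A_def)
qed

lemma besov2_event:
  fixes \<eta> :: "int \<times> int \<Rightarrow> 'a \<Rightarrow> complex"
  assumes [measurable]: "\<And>k. k \<noteq> 0 \<Longrightarrow> \<eta> k \<in> borel_measurable M"
  shows "{\<omega>\<in>space M. besov2 a K (\<lambda>k. \<eta> k \<omega> / nsq k)} \<in> sets M"
proof -
  obtain D where D: "countable D" "closure D = (UNIV :: plane set)" using countable_dense_plane by blast
  have m: "(\<lambda>\<omega>. cmod (\<Sum>k\<in>shell n. of_real (kx k ^ p * ky k ^ q) * (\<eta> k \<omega> / nsq k) * fexp k x)) \<in> borel_measurable M" for n p q x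
  proof (rule measurable_compose[OF _ borel_measurable_norm], rule borel_measurable_sum)
    fix k assume "k \<in> shell n"
    then have "k \<noteq> 0" by auto
    note [measurable] = assms[OF this]
    show "(\<lambda>\<omega>. of_real (kx k ^ p * ky k ^ q) * (\<eta> k \<omega> / nsq k) * fexp k x) \<in> borel_measurable M" by measurable
  qed
  show ?thesis
    unfolding besov2_dense[OF D(2)]
  proof (intro sets.sets_Collect_countable_All)
    fix n p q
    have "{\<omega> \<in> space M. \<forall>x\<in>D. cmod (\<Sum>k\<in>shell n. of_real (kx k ^ p * ky k ^ q) * (\<eta> k \<omega> / nsq k) * fexp k x) \<le> K * (2 ^ n) powr (a + real (p + q) - 1)} \<in> sets M"
      by (intro sets.sets_Collect_countable_All' D(1) borel_measurable_le m borel_measurable_const)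
    then show "{\<omega> \<in> space M. p + q \<le> 2 \<longrightarrow> (\<forall>x\<in>D. cmod (\<Sum>k\<in>shell n. of_real (kx k ^ p * ky k ^ q) * (\<eta> k \<omega> / nsq k) * fexp k x) \<le> K * (2 ^ n) powr (a + real (p + q) - 1))} \<in> sets M"
      by (cases "p + q \<le> 2") simp_all
  qed
qed

text \<open>One integer n bounds all components on the whole event, so a smallness threshold chosen
  from n is uniform in the sample.\<close>

lemma white_noise_event:
  assumes W: "white_noise M {3} W" and a: "0 < a" and \<delta>: "0 < \<delta>"
  shows "\<exists>(c :: 3 \<Rightarrow> 'a \<Rightarrow> real) (\<eta> :: int \<times> int \<Rightarrow> 3 \<Rightarrow> 'a \<Rightarrow> complex) (n :: nat). \<exists>A\<in>sets M. 1 - \<delta> < measure M A \<and>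
    (\<forall>\<omega>\<in>A. (\<forall>j. besov2 a (real n) (\<lambda>k. \<eta> k j \<omega> / nsq k)) \<and> (\<forall>j. \<bar>c j \<omega>\<bar> \<le> real n) \<and> c 3 \<omega> = 0 \<and>
      (\<forall>j. noise_series (\<lambda>k. \<eta> k j \<omega>) (c j \<omega>) (W j \<omega>)))"
proof -
  obtain c :: "3 \<Rightarrow> 'a \<Rightarrow> real" and \<eta> :: "int \<times> int \<Rightarrow> 3 \<Rightarrow> 'a \<Rightarrow> complex"
    where c: "\<forall>j. j \<notin> {3} \<longrightarrow> distributed M lborel (c j) std_normal_density" "\<forall>j\<in>{3}. \<forall>\<omega>. c j \<omega> = 0"
      and g: "\<forall>k j. k \<noteq> 0 \<longrightarrow> std_complex_gaussian M (\<eta> k j)"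
      and ind: "indep_vars (\<lambda>_. borel) (\<lambda>(k, j) \<omega>. if k = 0 then complex_of_real (c j \<omega>) else \<eta> k j \<omega>) {(k, j). k = 0 \<longrightarrow> j \<notin> {3}}"
      and r: "AE \<omega> in M. \<forall>j. distribution (W j \<omega>) \<and>
       noise_series (\<lambda>k. \<eta> k j \<omega>) (c j \<omega>) (W j \<omega>)"
    using W unfolding white_noise_def noise_series_def by blast
  have cm: "c j \<in> borel_measurable M" for j
  proof (cases "j = 3")
    case True
    then have "c j = (\<lambda>_. 0)" using c(2) by auto
    then show ?thesis by simp
  next
    case False
    then show ?thesis using c(1) by (auto simp: distributed_def)
  qed
  have em: "\<eta> k j \<in> borel_measurable M" if "k \<noteq> 0" for k j
    using complex_gaussian_measurable g that by blast
  have ind': "indep_vars (\<lambda>_. borel) (\<lambda>k. \<eta> k j) (- {0})" for j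
  proof -
    let ?X = "\<lambda>(k, j) \<omega>. if k = 0 then complex_of_real (c j \<omega>) else \<eta> k j \<omega>"
    have "indep_vars (\<lambda>_. borel) ?X ((\<lambda>k. (k, j)) ` (- {0}))"
      by (rule indep_vars_subset[OF ind]) auto
    then have "indep_vars (\<lambda>_. borel) (\<lambda>k. ?X (k, j)) (- {0})"
      by (rule indep_vars_reindex) (auto intro: inj_onI)
    then show ?thesis
      by (subst indep_vars_cong[OF refl _ refl, where Y="\<lambda>k. ?X (k, j)"]) auto
  qed
  define P where "P n \<omega> \<longleftrightarrow> (\<forall>j. besov2 a (real n) (\<lambda>k. \<eta> k j \<omega> / nsq k) \<and> \<bar>c j \<omega>\<bar> \<le> real n)" for n \<omega>
  have "AE \<omega> in M. \<forall>j. \<exists>K\<ge>0. besov2 a K (\<lambda>k. \<eta> k j \<omega> / nsq k)"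
    unfolding AE_all_countable using AE_besov2[OF _ ind' a] g by blast
  then have P: "AE \<omega> in M. \<exists>n. P n \<omega>"
  proof eventually_elim
    case (elim \<omega>)
    have "\<exists>K. \<forall>j. besov2 a K (\<lambda>k. \<eta> k j \<omega> / nsq k) \<and> \<bar>c j \<omega>\<bar> \<le> K"
    proof (rule max_bound3)
      fix j
      obtain K where "besov2 a K (\<lambda>k. \<eta> k j \<omega> / nsq k)" using elim by blast
      then have "besov2 a (max K \<bar>c j \<omega>\<bar>) (\<lambda>k. \<eta> k j \<omega> / nsq k)" by (rule besov2_mono) simp
      then show "\<exists>K. besov2 a K (\<lambda>k. \<eta> k j \<omega> / nsq k) \<and> \<bar>c j \<omega>\<bar> \<le> K"
        by (intro exI conjI) auto
    qed (use besov2_mono order_trans in blast)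
    then obtain K where K: "\<And>j. besov2 a K (\<lambda>k. \<eta> k j \<omega> / nsq k)" "\<And>j. \<bar>c j \<omega>\<bar> \<le> K" by blast
    obtain n :: nat where n: "K \<le> real n" using real_arch_simple by blast
    show ?case unfolding P_def
      by (intro exI[of _ n] allI conjI besov2_mono[OF K(1) n] order_trans[OF K(2) n])
  qed
  have "\<exists>n. \<exists>A\<in>sets M. 1 - \<delta> < measure M A \<and> (\<forall>\<omega>\<in>A. P n \<omega> \<and> (\<forall>j. distribution (W j \<omega>) \<and>
       noise_series (\<lambda>k. \<eta> k j \<omega>) (c j \<omega>) (W j \<omega>)))"
  proof (rule AE_exhaust[OF P r _ _ \<delta>])
    show "P m \<omega> \<Longrightarrow> m \<le> n \<Longrightarrow> P n \<omega>" for m n \<omega>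
      unfolding P_def by (meson besov2_mono of_nat_mono order_trans)
    show "{\<omega> \<in> space M. P n \<omega>} \<in> sets M" for n
      unfolding P_def
    proof (intro sets.sets_Collect_countable_All sets.sets_Collect_conj besov2_event em)
      show "{\<omega> \<in> space M. \<bar>c j \<omega>\<bar> \<le> real n} \<in> sets M" for j
        using cm[of j] by measurable
    qed
  qed
  then obtain n A where A: "A \<in> sets M" "1 - \<delta> < measure M A" "\<forall>\<omega>\<in>A. P n \<omega> \<and> (\<forall>j. distribution (W j \<omega>) \<and>
       noise_series (\<lambda>k. \<eta> k j \<omega>) (c j \<omega>) (W j \<omega>))"
    by blast
  have c3: "c 3 \<omega> = 0" for \<omega> using c(2) by simp
  show ?thesis
    by (rule exI[of _ c], rule exI[of _ \<eta>], rule exI[of _ n], rule bexI[OF _ A(1)])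
       (use A(2,3) c3 in \<open>unfold P_def, blast\<close>)
qed

end

text \<open>With t = sqrt g \<le> 1 one has g \<le> t, so both terms are bounded by t times a
  constant; the condition t \<le> R becomes g \<le> \<open>R\<^sup>2\<close>.\<close>

lemma threshold:
  assumes N: "0 < (N::real)" and K: "0 \<le> K"
  shows "\<exists>\<sigma>>0. \<forall>g. 0 \<le> g \<longrightarrow> g < \<sigma> \<longrightarrow> N * (2 * (g * K) + sqrt g * (1 + K)) \<le> 1 / 2"
proof -
  define R where "R = 1 / (2 * N * (3 * K + 1))"
  have R: "0 < R" using N K by (simp add: R_def)
  show ?thesis
  proof (intro exI[of _ "min 1 (R\<^sup>2)"] conjI allI impI)
    fix g :: real assume g: "0 \<le> g" "g < min 1 (R\<^sup>2)"
    define t where "t = sqrt g"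
    have t: "0 \<le> t" "g = t * t" using g by (simp_all add: t_def)
    have tR: "t \<le> R" unfolding t_def using g R by (intro real_le_lsqrt) auto
    have t1: "t \<le> 1" unfolding t_def using g by simp
    have "t * t \<le> t" using mult_left_mono[OF t1 t(1)] by simp
    then have "t * t * K \<le> t * K" using K by (rule mult_right_mono)
    then have "2 * (g * K) + sqrt g * (1 + K) \<le> t * (3 * K + 1)"
      unfolding t(2) t_def[symmetric, unfolded t(2)] using t by (simp add: algebra_simps)
    also have "\<dots> \<le> R * (3 * K + 1)" using tR K by (intro mult_right_mono) auto
    finally have "N * (2 * (g * K) + sqrt g * (1 + K)) \<le> N * (R * (3 * K + 1))"
      using N by (intro mult_left_mono) auto
    also have "\<dots> = 1 / 2" using N K by (simp add: R_def)
    finally show "N * (2 * (g * K) + sqrt g * (1 + K)) \<le> 1 / 2" .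
  qed (use R in simp)
qed

lemma tendsto_powr_ennreal:
  assumes b: "0 < b"
  shows "((\<lambda>\<epsilon>. ennreal (C * \<epsilon> powr b)) \<longlongrightarrow> 0) (at_right 0)"
proof -
  have "((\<lambda>\<epsilon>. C * \<epsilon> powr b) \<longlongrightarrow> C * 0 powr b) (at_right 0)"
    using b by (intro tendsto_intros tendsto_powr' tendsto_ident_at) (auto intro: eventually_mono[OF eventually_at_right_less])
  then have "((\<lambda>\<epsilon>. C * \<epsilon> powr b) \<longlongrightarrow> 0) (at_right 0)" by simp
  from tendsto_ennrealI[OF this] show ?thesis by simp
qed

theorem theorem1p3:
  fixes M :: "'a measure" and W :: "3 \<Rightarrow> 'a \<Rightarrow> functional" and \<kappa> :: real
  assumes "prob_space M"
    and "white_noise M {3} W"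
    and "0 < \<kappa>" and "\<kappa> < 1 / 2"
  shows "\<forall>\<delta>>0. \<exists>\<sigma>0>0. \<exists>A\<in>sets M. measure M A > 1 - \<delta> \<and>
    (\<forall>\<gamma> :: real ^ 3. norm \<gamma> < \<sigma>0 \<longrightarrow>
      (\<exists>(re :: real \<Rightarrow> 'a \<Rightarrow> plane \<Rightarrow> complex ^ 3) (r :: 'a \<Rightarrow> 3 \<Rightarrow> functional).
        (\<forall>\<epsilon>>0. \<forall>\<omega>\<in>A. re \<epsilon> \<omega> \<in> smooth_torus \<and>
           solves_system \<gamma> (\<lambda>j. mollify \<epsilon> (W j \<omega>)) (re \<epsilon> \<omega>)) \<and>
        (\<forall>\<omega>\<in>A. r \<omega> \<in> neg_space3 \<kappa> \<and>
           ((\<lambda>\<epsilon>. neg_norm3 \<kappa> (diff3 (re \<epsilon> \<omega>) (r \<omega>))) \<longlongrightarrow> 0) (at_right 0)) \<and>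
        (\<exists>C>0. \<forall>\<epsilon>>0. \<forall>\<omega>\<in>A.
           neg_norm3 \<kappa> (diff3 (re \<epsilon> \<omega>) (r \<omega>)) \<le> ennreal (C * \<epsilon> powr (\<kappa> / 8)))))"
proof (intro allI impI)
  fix \<delta> :: real assume \<delta>: "0 < \<delta>"
  interpret prob_space M by fact
  note \<kappa> = assms(3,4)
  have \<kappa>8: "0 < \<kappa> / 8" using \<kappa> by simp
  obtain c :: "3 \<Rightarrow> 'a \<Rightarrow> real" and \<eta> :: "int \<times> int \<Rightarrow> 3 \<Rightarrow> 'a \<Rightarrow> complex" and n :: nat and A
    where A: "A \<in> sets M" "1 - \<delta> < measure M A"
      and A': "\<forall>\<omega>\<in>A. (\<forall>j. besov2 (\<kappa> / 8) (real n) (\<lambda>k. \<eta> k j \<omega> / nsq k)) \<and> (\<forall>j. \<bar>c j \<omega>\<bar> \<le> real n) \<and> c 3 \<omega> = 0 \<and>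
      (\<forall>j. noise_series (\<lambda>k. \<eta> k j \<omega>) (c j \<omega>) (W j \<omega>))"
    using white_noise_event[OF assms(2) \<kappa>8 \<delta>] by blast
  have good: "\<And>\<omega> j. \<omega> \<in> A \<Longrightarrow> besov2 (\<kappa> / 8) (real n) (\<lambda>k. \<eta> k j \<omega> / nsq k)"
    "\<And>\<omega> j. \<omega> \<in> A \<Longrightarrow> \<bar>c j \<omega>\<bar> \<le> real n" "\<And>\<omega>. \<omega> \<in> A \<Longrightarrow> c 3 \<omega> = 0"
    "\<And>\<omega> j. \<omega> \<in> A \<Longrightarrow> noise_series (\<lambda>k. \<eta> k j \<omega>) (c j \<omega>) (W j \<omega>)"
    using A' by blast+
  have N: "0 < nconst (\<kappa> / 4) (3 * \<kappa> / 4)" using \<kappa> by (intro nconst_pos) auto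
  \<comment> \<open>n is already fixed at this point, so \<sigma> depends on \<kappa> and on the
    event but not on \<gamma> or \<epsilon>.\<close>
  obtain \<sigma> where \<sigma>: "0 < \<sigma>" "\<forall>g. 0 \<le> g \<longrightarrow> g < \<sigma> \<longrightarrow> nconst (\<kappa> / 4) (3 * \<kappa> / 4) * (2 * (g * (2 * real n)) + sqrt g * (1 + 2 * real n)) \<le> 1 / 2"
    using threshold[OF N, of "2 * real n"] by auto
  show "\<exists>\<sigma>0>0. \<exists>A\<in>sets M. measure M A > 1 - \<delta> \<and>
    (\<forall>\<gamma> :: real ^ 3. norm \<gamma> < \<sigma>0 \<longrightarrow>
      (\<exists>(re :: real \<Rightarrow> 'a \<Rightarrow> plane \<Rightarrow> complex ^ 3) (r :: 'a \<Rightarrow> 3 \<Rightarrow> functional).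
        (\<forall>\<epsilon>>0. \<forall>\<omega>\<in>A. re \<epsilon> \<omega> \<in> smooth_torus \<and>
           solves_system \<gamma> (\<lambda>j. mollify \<epsilon> (W j \<omega>)) (re \<epsilon> \<omega>)) \<and>
        (\<forall>\<omega>\<in>A. r \<omega> \<in> neg_space3 \<kappa> \<and>
           ((\<lambda>\<epsilon>. neg_norm3 \<kappa> (diff3 (re \<epsilon> \<omega>) (r \<omega>))) \<longlongrightarrow> 0) (at_right 0)) \<and>
        (\<exists>C>0. \<forall>\<epsilon>>0. \<forall>\<omega>\<in>A.
           neg_norm3 \<kappa> (diff3 (re \<epsilon> \<omega>) (r \<omega>)) \<le> ennreal (C * \<epsilon> powr (\<kappa> / 8)))))"
  proof (rule exI[of _ \<sigma>], rule conjI[OF \<sigma>(1)], rule bexI[OF _ A(1)], rule conjI[OF A(2)], intro allI impI)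
    fix \<gamma> :: "real ^ 3" assume \<gamma>: "norm \<gamma> < \<sigma>"
    have small: "nconst (\<kappa> / 4) (3 * \<kappa> / 4) * (2 * (norm \<gamma> * (2 * real n)) + sqrt (norm \<gamma>) * (1 + 2 * real n)) \<le> 1 / 2"
      using \<sigma>(2) \<gamma> by simp
    define \<psi> where "\<psi> \<omega> = sol_psi (3 * \<kappa> / 4) (2 * real n) \<gamma> (\<lambda>j. noise_coef (\<lambda>k. \<eta> k j \<omega>)) (\<lambda>j. c j \<omega>)" for \<omega>
    define re where "re \<epsilon> \<omega> = rsol (cA \<gamma> (\<lambda>j. c j \<omega>)) (cB \<gamma>) (\<psi> \<omega> \<epsilon>)" for \<epsilon> \<omega>
    define r where "r \<omega> = rlimit (cA \<gamma> (\<lambda>j. c j \<omega>)) (cB \<gamma>) (\<psi> \<omega>)" for \<omega>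
    note sol = solution_of_good_noise[where \<zeta>="\<lambda>j k. \<eta> k j \<omega>" and m="\<lambda>j. c j \<omega>" and u="\<lambda>j. W j \<omega>" and K="real n" for \<omega>,
        OF \<kappa> good small, folded \<psi>_def, folded re_def r_def]
    define C where "C = 8 * (9 * (norm \<gamma> * (2 * real n) * 2)) * geo (\<kappa> / 4)"
    have le: "neg_norm3 \<kappa> (diff3 (re \<epsilon> \<omega>) (r \<omega>)) \<le> ennreal ((\<bar>C\<bar> + 1) * \<epsilon> powr (\<kappa> / 8))" if "0 < \<epsilon>" "\<omega> \<in> A" for \<epsilon> \<omega>
    proof -
      have "neg_norm3 \<kappa> (diff3 (re \<epsilon> \<omega>) (r \<omega>)) \<le> ennreal (C * \<epsilon> powr (\<kappa> / 8))"
        unfolding C_def using sol(4) that by blast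
      \<comment> \<open>A positive constant is demanded, while C vanishes for \<gamma> = 0.\<close>
      also have "\<dots> \<le> ennreal ((\<bar>C\<bar> + 1) * \<epsilon> powr (\<kappa> / 8))"
        by (intro ennreal_leI mult_right_mono) auto
      finally show ?thesis .
    qed
    have lim: "((\<lambda>\<epsilon>. neg_norm3 \<kappa> (diff3 (re \<epsilon> \<omega>) (r \<omega>))) \<longlongrightarrow> 0) (at_right 0)" if "\<omega> \<in> A" for \<omega>
      by (rule tendsto_sandwich[OF _ _ tendsto_const tendsto_powr_ennreal[OF \<kappa>8, of "\<bar>C\<bar> + 1"]])
         (auto intro!: eventually_at_rightI[of 0 1] le that)
    show "\<exists>(re :: real \<Rightarrow> 'a \<Rightarrow> plane \<Rightarrow> complex ^ 3) (r :: 'a \<Rightarrow> 3 \<Rightarrow> functional).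
        (\<forall>\<epsilon>>0. \<forall>\<omega>\<in>A. re \<epsilon> \<omega> \<in> smooth_torus \<and>
           solves_system \<gamma> (\<lambda>j. mollify \<epsilon> (W j \<omega>)) (re \<epsilon> \<omega>)) \<and>
        (\<forall>\<omega>\<in>A. r \<omega> \<in> neg_space3 \<kappa> \<and>
           ((\<lambda>\<epsilon>. neg_norm3 \<kappa> (diff3 (re \<epsilon> \<omega>) (r \<omega>))) \<longlongrightarrow> 0) (at_right 0)) \<and>
        (\<exists>C>0. \<forall>\<epsilon>>0. \<forall>\<omega>\<in>A.
           neg_norm3 \<kappa> (diff3 (re \<epsilon> \<omega>) (r \<omega>)) \<le> ennreal (C * \<epsilon> powr (\<kappa> / 8)))"
      by (rule exI[of _ re], rule exI[of _ r])
         (intro conjI allI impI ballI exI[of _ "\<bar>C\<bar> + 1"] sol(1) sol(2) sol(3) lim le; simp)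
  qed
qed

end
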